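(* Let $n\ge2$. The automorphism group $\operatorname{Aut}(F_n)$ is naturally identified, via the action by conjugation, with the normalizer of the standard action of $F_n$ in $\operatorname{Homeo}(0,1)$ (that is, conjugation induces an isomorphism from this normalizer onto $\operatorname{Aut}(F_n)$). Equivalently, after lifting to the Cantor space, it is identified with the group of homeomorphisms $\psi:\mathcal C_n\to\mathcal C_n$ which preserve the relation $\sim_{\rho_n}$ and normalize the copy of $F_n$ acting on $\mathcal C_n$. Under this identification, $\operatorname{Aut}(F_n)$ consists precisely of those homeomorphisms $\psi:\mathcal C_n\to\mathcal C_n$ such that both $\psi$ and $\psi^{-1}$ are order-preserving or order-reversing rational homeomorphisms whose minimal transducers are semi-synchronizing.
   Context: Let $X_n=\{0,\dots,n-1\}$, $\mathcal W_n=X_n^*$ the finite words (including the empty word $\varepsilon$), $\mathcal C_n=X_n^{\mathbb N}$ with the lexicographic order, $U_u=u\mathcal C_n$ for $u\in\mathcal W_n$. Let $\rho_n:\mathcal C_n\to[0,1]$, $\rho_n(\omega_1\omega_2\cdots)=\sum_j\omega_jn^{-j}$, and write $\omega\sim_{\rho_n}\eta$ if $\rho_n(\omega)=\rho_n(\eta)$. $F_n$ is the group of increasing piecewise-linear homeomorphisms of $[0,1]$ with finitely many breakpoints, all in $\mathbb Z[1/n]$, and slopes integer powers of $n$ (standard action on $(0,1)$). Equivalently, via $\rho_n$, it is the group of order-preserving homeomorphisms $f$ of $\mathcal C_n$ given by finite prefix replacement: $f(u_i\omega)=v_i\omega$ for finite complete prefix codes $\{u_1<\dots<u_k\}$, $\{v_1<\dots<v_k\}$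 (complete: the cylinders partition $\mathcal C_n$). $\operatorname{Homeo}(0,1)$ is the group of all homeomorphisms of $(0,1)$, including orientation-reversing ones. An initial $(n,m)$-transducer is $T=(S,t,o,s_0)$ with state set $S$, transition function $t:S\times X_n\to S$, output function $o:S\times X_n\to\mathcal W_m$, and initial state $s_0$; $t,o$ extend to words by $t(s,ui)=t(t(s,u),i)$, $o(s,ui)=o(s,u)o(t(s,u),i)$, and outputs on infinite inputs are assumed infinite. Each state $s$ induces $h_s:\mathcal C_n\to\mathcal C_m$; $T$ represents $h_{s_0}$. A homeomorphism is rational if it is represented by a finite initial transducer. The minimal transducer of a homeomorphism $\psi$ is the unique (up to isomorphism) initial transducer representing $\psi$ in which all states are reachable, distinct states induce distinct maps, and $o(s,i)$ is always the greatest common prefix of $h_s(U_i)$. A word is inner if it is nonempty and is neither $0^k$ nor $(n-1)^k$. Put $\sigma_n(u_1\cdots u_r)=\sum_ju_j\bmod(n-1)$. An initial transducer $(S,t,o,s_0)$ with input alphabet $X_n$ is semi-synchronizing if (i) there are states $s_L,s_R$ with $t(s_L,0)=s_L$, $t(s_R,n-1)=s_R$, reached from $s_0$ by some words $0^r$ and $(n-1)^r$, respectively; (ii) there is $k\ge0$ such that $t(s_0,uw)=t(s_0,vw)$ for all inner words $u,v$ with $\sigma_n(u)=\sigma_n(v)$ and all $w\in X_n^k$. *)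

theory Defs
  imports
    "HOL-Analysis.Analysis"
    "HOL-Algebra.Group_Action"
    "HOL-Library.Fun_Lexorder"
    "HOL-Library.Omega_Words_Fun"
begin

section \<open>Homeomorphism groups and conjugation\<close>

text \<open>As in \<^const>\<open>BijGroup\<close>, maps are extensional, so that group elements are determined by
  their values on the space.\<close>

definition homeo_group :: "'a::topological_space set \<Rightarrow> ('a \<Rightarrow> 'a) monoid" where
  "homeo_group S = BijGroup S \<lparr>carrier := {f \<in> Bij S. \<exists>g. homeomorphism S S f g}\<rparr>"

text \<open>For an injective homomorphism \<open>\<phi>\<close> from \<open>G\<close> to \<open>H\<close> (a faithful action) and an element
  \<open>a\<close> of \<open>H\<close> normalizing the image of \<open>\<phi>\<close>, this is the automorphism of \<open>G\<close> induced by
  conjugation with \<open>a\<close>.\<close>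

definition conj_aut ::
  "('a, 'c) monoid_scheme \<Rightarrow> ('b, 'd) monoid_scheme \<Rightarrow> ('a \<Rightarrow> 'b) \<Rightarrow> 'b \<Rightarrow> 'a \<Rightarrow> 'a" where
  "conj_aut G H \<phi> a =
     (\<lambda>g\<in>carrier G. inv_into (carrier G) \<phi> (a \<otimes>\<^bsub>H\<^esub> \<phi> g \<otimes>\<^bsub>H\<^esub> inv\<^bsub>H\<^esub> a))"

section \<open>The groups \<open>F\<^sub>n\<close> on the interval\<close>

definition n_adic :: "nat \<Rightarrow> real set" where
  "n_adic n = {of_int a / of_nat n ^ k | a k. True}"

text \<open>The finite set \<open>B\<close> contains the breakpoints and the two endpoints; \<open>f\<close> is affine with
  slope a power of \<open>n\<close> on every closed interval whose interior avoids \<open>B\<close>.\<close>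

definition n_adic_PL :: "nat \<Rightarrow> (real \<Rightarrow> real) \<Rightarrow> bool" where
  "n_adic_PL n f \<longleftrightarrow>
     (\<exists>B. finite B \<and> B \<subseteq> n_adic n \<inter> {0..1} \<and> {0, 1} \<subseteq> B \<and>
        (\<forall>a b. 0 \<le> a \<and> a < b \<and> b \<le> 1 \<and> {a<..<b} \<inter> B = {} \<longrightarrow>
           (\<exists>(k::int) c. \<forall>x\<in>{a..b}. f x = of_nat n powi k * x + c)))"

definition thompson_F :: "nat \<Rightarrow> (real \<Rightarrow> real) monoid" where
  "thompson_F n = homeo_group {0..1}
     \<lparr>carrier := {f \<in> carrier (homeo_group {0..1}). strict_mono_on {0..1} f \<and> n_adic_PL n f}\<rparr>"

abbreviation Homeo01 :: "(real \<Rightarrow> real) monoid" where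
  "Homeo01 \<equiv> homeo_group {0<..<1}"

definition interval_action :: "(real \<Rightarrow> real) \<Rightarrow> real \<Rightarrow> real" where
  "interval_action f = restrict f {0<..<1}"

definition interval_normalizer :: "nat \<Rightarrow> (real \<Rightarrow> real) monoid" where
  "interval_normalizer n =
     Homeo01 \<lparr>carrier := normalizer Homeo01 (interval_action ` carrier (thompson_F n))\<rparr>"

section \<open>The Cantor space\<close>

definition cantor :: "nat \<Rightarrow> nat word set" where
  "cantor n = {\<omega>. \<forall>j. \<omega> j < n}"

abbreviation words :: "nat \<Rightarrow> nat list set" where
  "words n \<equiv> lists {..<n}"

definition cylinder :: "nat \<Rightarrow> nat list \<Rightarrow> nat word set" where
  "cylinder n u = (\<lambda>\<omega>. u \<frown> \<omega>) ` cantor n"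

text \<open>Letters are indexed from 0, hence the shifted exponent.\<close>

definition rho :: "nat \<Rightarrow> nat word \<Rightarrow> real" where
  "rho n \<omega> = suminf (\<lambda>j. of_nat (\<omega> j) / of_nat n ^ Suc j)"

abbreviation HomeoC :: "nat \<Rightarrow> (nat word \<Rightarrow> nat word) monoid" where
  "HomeoC n \<equiv> homeo_group (cantor n)"

definition order_preserving :: "nat \<Rightarrow> (nat word \<Rightarrow> nat word) \<Rightarrow> bool" where
  "order_preserving n \<psi> \<longleftrightarrow> monotone_on (cantor n) less_fun less_fun \<psi>"

definition order_reversing :: "nat \<Rightarrow> (nat word \<Rightarrow> nat word) \<Rightarrow> bool" where
  "order_reversing n \<psi> \<longleftrightarrow> monotone_on (cantor n) less_fun (\<lambda>\<omega> \<eta>. less_fun \<eta> \<omega>) \<psi>"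

definition complete_prefix_code :: "nat \<Rightarrow> nat list list \<Rightarrow> bool" where
  "complete_prefix_code n us \<longleftrightarrow>
     set us \<subseteq> words n \<and> sorted_wrt (\<lambda>u v. (u, v) \<in> lexord less_than) us \<and>
     (\<forall>\<omega>\<in>cantor n. \<exists>!i. i < length us \<and> \<omega> \<in> cylinder n (us ! i))"

definition prefix_replacement :: "nat \<Rightarrow> (nat word \<Rightarrow> nat word) \<Rightarrow> bool" where
  "prefix_replacement n f \<longleftrightarrow>
     (\<exists>us vs. complete_prefix_code n us \<and> complete_prefix_code n vs \<and> length us = length vs \<and>
        (\<forall>i<length us. \<forall>\<omega>\<in>cantor n. f (us ! i \<frown> \<omega>) = vs ! i \<frown> \<omega>))"

definition F_cantor :: "nat \<Rightarrow> (nat word \<Rightarrow> nat word) monoid" where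
  "F_cantor n = HomeoC n
     \<lparr>carrier := {f \<in> carrier (HomeoC n). order_preserving n f \<and> prefix_replacement n f}\<rparr>"

definition preserves_rho_relation :: "nat \<Rightarrow> (nat word \<Rightarrow> nat word) \<Rightarrow> bool" where
  "preserves_rho_relation n \<psi> \<longleftrightarrow>
     (\<forall>\<omega>\<in>cantor n. \<forall>\<eta>\<in>cantor n. rho n \<omega> = rho n \<eta> \<longleftrightarrow> rho n (\<psi> \<omega>) = rho n (\<psi> \<eta>))"

definition cantor_normalizer :: "nat \<Rightarrow> (nat word \<Rightarrow> nat word) monoid" where
  "cantor_normalizer n = HomeoC n
     \<lparr>carrier := {\<psi> \<in> normalizer (HomeoC n) (carrier (F_cantor n)). preserves_rho_relation n \<psi>}\<rparr>"

text \<open>The lift through \<^const>\<open>rho\<close> of a homeomorphism \<open>f\<close> of the open unit interval. There is at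
  most one; it exists if and only if \<open>f\<close> maps the \<open>n\<close>-adic points of the interval onto
  themselves.\<close>

definition cantor_lift :: "nat \<Rightarrow> (real \<Rightarrow> real) \<Rightarrow> nat word \<Rightarrow> nat word" where
  "cantor_lift n f = (THE \<psi>. \<psi> \<in> carrier (HomeoC n) \<and>
     (\<forall>\<omega>\<in>cantor n. rho n \<omega> \<in> {0<..<1} \<longrightarrow> rho n (\<psi> \<omega>) = f (rho n \<omega>)))"

definition cantor_action :: "nat \<Rightarrow> (real \<Rightarrow> real) \<Rightarrow> nat word \<Rightarrow> nat word" where
  "cantor_action n f = cantor_lift n (interval_action f)"

section \<open>Transducers\<close>

record 's transducer =
  states :: "'s set"
  step :: "'s \<Rightarrow> nat \<Rightarrow> 's"
  emit :: "'s \<Rightarrow> nat \<Rightarrow> nat list"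
  start :: 's

definition trans_word :: "'s transducer \<Rightarrow> 's \<Rightarrow> nat list \<Rightarrow> 's" where
  "trans_word T = foldl (step T)"

primrec out_word :: "'s transducer \<Rightarrow> 's \<Rightarrow> nat list \<Rightarrow> nat list" where
  "out_word T s [] = []"
| "out_word T s (i # u) = emit T s i @ out_word T (step T s i) u"

definition is_transducer :: "nat \<Rightarrow> nat \<Rightarrow> 's transducer \<Rightarrow> bool" where
  "is_transducer n m T \<longleftrightarrow>
     start T \<in> states T \<and>
     (\<forall>s\<in>states T. \<forall>i<n. step T s i \<in> states T \<and> emit T s i \<in> words m) \<and>
     (\<forall>s\<in>states T. \<forall>\<omega>\<in>cantor n. \<forall>j. \<exists>k. j < length (out_word T s (map \<omega> [0..<k])))"

text \<open>The \<open>j\<close>-th output letter is read off from any input prefix that is long enough.\<close>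

definition induced :: "'s transducer \<Rightarrow> 's \<Rightarrow> nat word \<Rightarrow> nat word" where
  "induced T s \<omega> = (\<lambda>j.
     out_word T s (map \<omega> [0..<LEAST k. j < length (out_word T s (map \<omega> [0..<k]))]) ! j)"

definition represents ::
  "nat \<Rightarrow> nat \<Rightarrow> 's transducer \<Rightarrow> (nat word \<Rightarrow> nat word) \<Rightarrow> bool" where
  "represents n m T \<psi> \<longleftrightarrow>
     is_transducer n m T \<and> (\<forall>\<omega>\<in>cantor n. induced T (start T) \<omega> = \<psi> \<omega>)"

text \<open>The states of a finite transducer may be taken to be natural numbers.\<close>

definition rational :: "nat \<Rightarrow> nat \<Rightarrow> (nat word \<Rightarrow> nat word) \<Rightarrow> bool" where
  "rational n m \<psi> \<longleftrightarrow> (\<exists>T :: nat transducer. finite (states T) \<and> represents n m T \<psi>)"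

definition word_prefix :: "nat list \<Rightarrow> nat word \<Rightarrow> bool" where
  "word_prefix w \<omega> \<longleftrightarrow> map \<omega> [0..<length w] = w"

definition is_greatest_common_prefix :: "nat list \<Rightarrow> nat word set \<Rightarrow> bool" where
  "is_greatest_common_prefix w A \<longleftrightarrow>
     (\<forall>\<omega>\<in>A. word_prefix w \<omega>) \<and>
     (\<forall>v. (\<forall>\<omega>\<in>A. word_prefix v \<omega>) \<longrightarrow> length v \<le> length w)"

definition minimal_transducer ::
  "nat \<Rightarrow> nat \<Rightarrow> (nat word \<Rightarrow> nat word) \<Rightarrow> 's transducer \<Rightarrow> bool" where
  "minimal_transducer n m \<psi> T \<longleftrightarrow>
     represents n m T \<psi> \<and>
     (\<forall>s\<in>states T. \<exists>u\<in>words n. trans_word T (start T) u = s) \<and>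
     (\<forall>s\<in>states T. \<forall>s'\<in>states T.
        (\<forall>\<omega>\<in>cantor n. induced T s \<omega> = induced T s' \<omega>) \<longrightarrow> s = s') \<and>
     (\<forall>s\<in>states T. \<forall>i<n.
        is_greatest_common_prefix (emit T s i) (induced T s ` cylinder n [i]))"

definition inner_word :: "nat \<Rightarrow> nat list \<Rightarrow> bool" where
  "inner_word n u \<longleftrightarrow> u \<in> words n \<and> u \<noteq> [] \<and>
     (\<nexists>k. u = replicate k 0) \<and> (\<nexists>k. u = replicate k (n - 1))"

definition sigma :: "nat \<Rightarrow> nat list \<Rightarrow> nat" where
  "sigma n u = sum_list u mod (n - 1)"

definition semi_synchronizing :: "nat \<Rightarrow> 's transducer \<Rightarrow> bool" where
  "semi_synchronizing n T \<longleftrightarrow>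
     (\<exists>s\<^sub>L\<in>states T. step T s\<^sub>L 0 = s\<^sub>L \<and> (\<exists>r. trans_word T (start T) (replicate r 0) = s\<^sub>L)) \<and>
     (\<exists>s\<^sub>R\<in>states T. step T s\<^sub>R (n - 1) = s\<^sub>R \<and>
        (\<exists>r. trans_word T (start T) (replicate r (n - 1)) = s\<^sub>R)) \<and>
     (\<exists>k. \<forall>u v. inner_word n u \<and> inner_word n v \<and> sigma n u = sigma n v \<longrightarrow>
        (\<forall>w\<in>words n. length w = k \<longrightarrow>
           trans_word T (start T) (u @ w) = trans_word T (start T) (v @ w)))"

text \<open>Minimal transducers are unique up to isomorphism and \<^const>\<open>semi_synchronizing\<close> is invariant
  under isomorphism. All states being reachable, there are at most countably many of them, so
  natural numbers suffice as states.\<close>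

definition minimal_semi_synchronizing :: "nat \<Rightarrow> (nat word \<Rightarrow> nat word) \<Rightarrow> bool" where
  "minimal_semi_synchronizing n \<psi> \<longleftrightarrow>
     (\<exists>T :: nat transducer. minimal_transducer n n \<psi> T \<and> semi_synchronizing n T)"

definition monotone_rational_semi_synchronizing ::
  "nat \<Rightarrow> (nat word \<Rightarrow> nat word) \<Rightarrow> bool" where
  "monotone_rational_semi_synchronizing n \<psi> \<longleftrightarrow>
     (order_preserving n \<psi> \<or> order_reversing n \<psi>) \<and> rational n n \<psi> \<and>
     minimal_semi_synchronizing n \<psi>"

end

theory Submission
  imports Defs
begin

text \<open>The proof has two independent parts.

  \<^emph>\<open>Automorphisms are conjugations.\<close> In \<open>F\<^sub>n\<close>, disjointness of the supports of two elements can be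
  expressed by a first-order formula of the group. So an automorphism preserves the inclusions
  between the sets \<open>Z f\<close>, where \<open>Z f\<close> is the interior of the set of fixed points of \<open>f\<close>. The elements
  \<open>f\<close> such that \<open>Z f\<close> is a ray \<open>(0,x)\<close> or \<open>(x,1)\<close> are exactly those for which \<open>Z f\<close> is nontrivial and
  comparable with all its translates, and the endpoints \<open>x\<close> of these rays are exactly the \<open>n\<close>-adic
  points. Therefore an automorphism acts monotonically on the \<open>n\<close>-adic points, and the homeomorphism
  of \<open>(0,1)\<close> that extends this action induces it. Since it preserves the \<open>n\<close>-adic points, it lifts to
  the Cantor space.

  \<^emph>\<open>Normalizing means synchronizing.\<close> Write \<open>\<psi>(u\<omega>) = x \<psi>\<^sub>u(\<omega>)\<close> with \<open>x\<close> the greatest common prefix of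
  \<open>\<psi>(U\<^sub>u)\<close>; the residuals \<open>\<psi>\<^sub>u\<close> are the states of the minimal transducer. Two inner words \<open>u\<close>, \<open>v\<close> of
  the same digit sum modulo \<open>n - 1\<close> are exchanged by a prefix replacement \<open>f\<close> in \<open>F\<^sub>n\<close>. If \<open>\<psi>\<close>
  normalizes \<open>F\<^sub>n\<close>, then \<open>\<psi>f\<psi>\<^sup>-\<^sup>1\<close> is a prefix replacement as well, so that \<open>\<psi>\<^sub>u\<^sub>w = \<psi>\<^sub>v\<^sub>w\<close> for all long \<open>w\<close>.
  Conversely, an element of \<open>F\<^sub>n\<close> replaces prefixes by prefixes of the same digit sum, and where the
  residuals agree its conjugate by \<open>\<psi>\<close> is a prefix replacement.\<close>

section \<open>Infinite words and the map \<open>\<rho>\<close>\<close>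

text \<open>Commuting does not detect disjoint supports, since an element commutes with its own
  powers; hence the double commutators in \<open>separated\<close>. The set Z f may have many
  components; comparability with all translates excludes this because F_n acts independently on the
  two sides of an n-adic point.

  The modulus n - 1 enters twice. A base n numeral is congruent to its digit sum since n is 1 modulo
  n - 1, so equal digit sums are necessary for moving a cylinder. Splitting a word of a prefix code
  adds n - 1 words, so for inner words they also suffice.

  Constant words stand apart because F_n fixes both ends of the Cantor space; the ends get the
  states s_L and s_R. The condition on \<psi> gives one inclusion, that conjugation by \<psi> maps
  F_n into itself; the condition on the inverse gives the other.

  The pairs identified by \<open>rho\<close> are the adjacent pairs of the lexicographic order, so
  monotone bijections preserve the relation. A homeomorphism of (0,1), however, lifts only if it
  preserves the n-adic points, and for elements of the normalizer this is known only after the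
  reconstruction.\<close>

lemma cantor_conc [simp]: "u \<frown> \<omega> \<in> cantor n \<longleftrightarrow> u \<in> words n \<and> \<omega> \<in> cantor n"
proof (intro iffI conjI)
  assume h: "u \<frown> \<omega> \<in> cantor n"
  have hj: "(u \<frown> \<omega>) j < n" for j using h unfolding cantor_def by blast
  have "u ! i < n" if "i < length u" for i using hj[of i] that by simp
  then show "u \<in> words n" by (auto simp: in_set_conv_nth)
  have "\<omega> j < n" for j using hj[of "length u + j"] by simp
  then show "\<omega> \<in> cantor n" by (simp add: cantor_def)
next
  assume "u \<in> words n \<and> \<omega> \<in> cantor n"
  then show "u \<frown> \<omega> \<in> cantor n" by (auto simp: cantor_def conc_def)
qed

lemma cantor_build [simp]: "i ## \<omega> \<in> cantor n \<longleftrightarrow> i < n \<and> \<omega> \<in> cantor n"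
  using cantor_conc[of "[i]" \<omega> n] by simp

lemma prefix_in_words [simp]: "\<omega> \<in> cantor n \<Longrightarrow> subsequence \<omega> i k \<in> words n"
  by (auto simp: cantor_def)

lemma suffix_in_cantor [simp]: "\<omega> \<in> cantor n \<Longrightarrow> suffix k \<omega> \<in> cantor n"
  by (auto simp: cantor_def)

lemma cantorD: "\<omega> \<in> cantor n \<Longrightarrow> \<omega> j < n"
  by (auto simp: cantor_def)

lemma in_cylinder_iff: "\<omega> \<in> cylinder n u \<longleftrightarrow> \<omega> \<in> cantor n \<and> u \<in> words n \<and> prefix (length u) \<omega> = u" if "u \<in> words n"
proof -
  have "prefix (length u) \<omega> = u \<Longrightarrow> u \<frown> suffix (length u) \<omega> = \<omega>"
    by (metis prefix_suffix)
  with that show ?thesis unfolding cylinder_def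
    by (auto simp: image_iff intro!: bexI[of _ "suffix (length u) \<omega>"])
qed

section \<open>Lexicographic order on infinite words\<close>

lemma less_fun_total: "\<omega> \<noteq> \<eta> \<Longrightarrow> less_fun \<omega> \<eta> \<or> less_fun \<eta> \<omega>" for \<omega> \<eta> :: "nat word"
proof -
  assume "\<omega> \<noteq> \<eta>"
  then obtain j where "\<omega> j \<noteq> \<eta> j" by blast
  define k where "k = (LEAST k. \<omega> k \<noteq> \<eta> k)"
  have "\<omega> k \<noteq> \<eta> k" unfolding k_def by (rule LeastI) fact
  moreover have "\<forall>i<k. \<omega> i = \<eta> i" unfolding k_def using not_less_Least by blast
  ultimately show ?thesis unfolding less_fun_def by (metis linorder_neqE_nat)
qed

lemma less_fun_split:
  assumes "less_fun \<omega> (\<eta>::nat word)"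
  obtains u i j \<omega>' \<eta>' where "\<omega> = (u @ [i]) \<frown> \<omega>'" "\<eta> = (u @ [j]) \<frown> \<eta>'" "i < j"
proof -
  from assms obtain k where k: "\<omega> k < \<eta> k" "\<And>i. i < k \<Longrightarrow> \<omega> i = \<eta> i" by (auto elim: less_funE)
  have *: "prefix k \<omega> = prefix k \<eta>" using k by (auto simp: subsequence_def)
  have "\<omega> = (prefix k \<omega> @ [\<omega> k]) \<frown> suffix (Suc k) \<omega>" "\<eta> = (prefix k \<omega> @ [\<eta> k]) \<frown> suffix (Suc k) \<eta>"
     using prefix_suffix[of \<omega> "Suc k"] prefix_suffix[of \<eta> "Suc k"] * by auto
  with k that show thesis by blast
qed

lemma less_fun_conc [simp]: "less_fun (u \<frown> \<omega>) (u \<frown> \<eta>) \<longleftrightarrow> less_fun \<omega> \<eta>" for \<omega> \<eta> :: "nat word"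
proof
  assume "less_fun (u \<frown> \<omega>) (u \<frown> \<eta>)"
  then obtain k where k: "(u \<frown> \<omega>) k < (u \<frown> \<eta>) k" "\<And>i. i < k \<Longrightarrow> (u \<frown> \<omega>) i = (u \<frown> \<eta>) i"
    by (auto elim: less_funE)
  have "length u \<le> k" using k(1) by (rule_tac ccontr) simp
  show "less_fun \<omega> \<eta>" unfolding less_fun_def
  proof (intro exI[of _ "k - length u"] conjI allI impI)
    show "\<omega> (k - length u) < \<eta> (k - length u)" using k(1) \<open>length u \<le> k\<close> by simp
    fix i assume "i < k - length u"
    then show "\<omega> i = \<eta> i" using k(2)[of "length u + i"] by simp
  qed
next
  assume "less_fun \<omega> \<eta>"
  then obtain k where k: "\<omega> k < \<eta> k" "\<And>i. i < k \<Longrightarrow> \<omega> i = \<eta> i" by (auto elim: less_funE)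
  show "less_fun (u \<frown> \<omega>) (u \<frown> \<eta>)" unfolding less_fun_def
    by (rule exI[of _ "length u + k"]) (auto simp: k conc_def)
qed

lemma less_fun_diff: "i < j \<Longrightarrow> less_fun ((u @ [i]) \<frown> \<omega>) ((u @ [j]) \<frown> (\<eta>::nat word))"
  unfolding less_fun_def by (rule exI[of _ "length u"]) (auto simp: nth_append)

text \<open>Compactness of the Cantor space in combinatorial form: it turns pointwise statements
  about prefixes into statements about all words of some length. A word with arbitrarily long bad
  extensions has a one-letter extension of the same kind, because the alphabet is finite; iterating
  produces an infinite word without a good prefix.\<close>

lemma koenig:
  assumes "\<forall>\<omega>\<in>cantor n. \<exists>k. P (prefix k \<omega>)" and mono: "\<And>u w. P u \<Longrightarrow> w \<in> words n \<Longrightarrow> P (u @ w)"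
  shows "\<exists>N. \<forall>u\<in>words n. N \<le> length u \<longrightarrow> P u"
proof (rule ccontr)
  define bad where "bad u \<longleftrightarrow> u \<in> words n \<and> (\<forall>N. \<exists>w\<in>words n. N \<le> length w \<and> \<not> P (u @ w))" for u
  assume "\<not> ?thesis"
  then have b0: "bad []" unfolding bad_def by auto
  have step: "\<exists>i. bad (u @ [i])" if "bad u" for u
  proof (rule ccontr)
    assume "\<nexists>i. bad (u @ [i])"
    then have "\<forall>i<n. \<exists>N. \<forall>w\<in>words n. N \<le> length w \<longrightarrow> P ((u @ [i]) @ w)"
      using that unfolding bad_def by auto
    then obtain N where N: "\<And>i w. i < n \<Longrightarrow> w \<in> words n \<Longrightarrow> N i \<le> length w \<Longrightarrow> P ((u @ [i]) @ w)"
      by metis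
    \<comment> \<open>\<open>Suc\<close> makes \<open>w\<close> nonempty, and after its first letter
      \<open>i\<close> is removed it still has at least \<open>N i\<close> letters.\<close>
    from that obtain w where w: "w \<in> words n" "Suc (Max (insert 0 (N ` {..<n}))) \<le> length w" "\<not> P (u @ w)"
      unfolding bad_def by blast
    then obtain i w' where iw: "w = i # w'" by (cases w) auto
    have "N i \<le> Max (insert 0 (N ` {..<n}))" using w iw by (intro Max_ge) auto
    then show False using N[of i w'] w iw by auto
  qed
  define f where "f = rec_nat [] (\<lambda>_ u. u @ [SOME i. bad (u @ [i])])"
  have f0: "f 0 = []" and fS: "f (Suc k) = f k @ [SOME i. bad (f k @ [i])]" for k
    by (simp_all add: f_def)
  have badf: "bad (f k)" for k
  proof (induction k)
    case (Suc k)
    then show ?case unfolding fS using someI_ex[OF step[OF Suc]] by simp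
  qed (simp add: f0 b0)
  define \<omega> where "\<omega> k = (SOME i. bad (f k @ [i]))" for k
  have pre: "prefix k \<omega> = f k" for k
    by (induction k) (auto simp: f0 fS \<omega>_def)
  have "\<omega> \<in> cantor n" unfolding cantor_def
  proof safe
    fix j have "bad (f j @ [\<omega> j])" using badf[of "Suc j"] unfolding fS \<omega>_def .
    then show "\<omega> j < n" by (auto simp: bad_def)
  qed
  then obtain k where "P (f k)" using assms(1) pre by auto
  then show False using badf[of k] mono unfolding bad_def by blast
qed

text \<open>Each coordinate is a discrete space, so continuity means that every output letter is
  determined near a given input by a finite prefix of it.\<close>

lemma continuous_on_discrete_word:
  fixes \<psi> :: "nat word \<Rightarrow> nat word"
  shows "continuous_on S \<psi> \<longleftrightarrow>
    (\<forall>\<omega>\<in>S. \<forall>j. \<exists>k. \<forall>\<eta>\<in>S. prefix k \<eta> = prefix k \<omega> \<longrightarrow> \<psi> \<eta> j = \<psi> \<omega> j)"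
proof
  assume c: "continuous_on S \<psi>"
  show "\<forall>\<omega>\<in>S. \<forall>j. \<exists>k. \<forall>\<eta>\<in>S. prefix k \<eta> = prefix k \<omega> \<longrightarrow> \<psi> \<eta> j = \<psi> \<omega> j"
  proof safe
    fix \<omega> j assume "\<omega> \<in> S"
    have "continuous_on S (\<lambda>\<eta>. \<psi> \<eta> j)" by (rule continuous_on_product_then_coordinatewise[OF c])
    then have "\<exists>A. open A \<and> \<omega> \<in> A \<and> (\<forall>\<eta>\<in>S. \<eta> \<in> A \<longrightarrow> \<psi> \<eta> j \<in> {\<psi> \<omega> j})"
      using \<open>\<omega> \<in> S\<close> unfolding continuous_on_topological
      by (metis open_discrete insertI1)
    then obtain A where A: "open A" "\<omega> \<in> A" "\<forall>\<eta>\<in>S. \<eta> \<in> A \<longrightarrow> \<psi> \<eta> j = \<psi> \<omega> j" by auto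
    obtain X where X: "\<omega> \<in> (\<Pi>\<^sub>E i\<in>UNIV. X i)" "finite {i. X i \<noteq> UNIV}" "(\<Pi>\<^sub>E i\<in>UNIV. X i) \<subseteq> A"
      using product_topology_open_contains_basis[of "\<lambda>i. euclidean" UNIV A \<omega>] A(1,2)
      by (auto simp: open_fun_def)
    obtain k where k: "\<forall>i\<in>{i. X i \<noteq> UNIV}. i < k" using X(2)
      by (meson finite_nat_set_iff_bounded)
    show "\<exists>k. \<forall>\<eta>\<in>S. prefix k \<eta> = prefix k \<omega> \<longrightarrow> \<psi> \<eta> j = \<psi> \<omega> j"
    proof (intro exI[of _ k] ballI impI)
      fix \<eta> assume "\<eta> \<in> S" and p: "prefix k \<eta> = prefix k \<omega>"
      have "\<eta> i \<in> X i" for i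
      proof (cases "i < k")
        case True
        then have "\<eta> i = \<omega> i" using arg_cong[OF p, of "\<lambda>l. l ! i"] by simp
        then show ?thesis using X(1) by auto
      next
        case False then show ?thesis using k by auto
      qed
      then have "\<eta> \<in> A" using X(3) by auto
      then show "\<psi> \<eta> j = \<psi> \<omega> j" using A(3) \<open>\<eta> \<in> S\<close> by blast
    qed
  qed
next
  assume *: "\<forall>\<omega>\<in>S. \<forall>j. \<exists>k. \<forall>\<eta>\<in>S. prefix k \<eta> = prefix k \<omega> \<longrightarrow> \<psi> \<eta> j = \<psi> \<omega> j"
  show "continuous_on S \<psi>"
  proof (rule continuous_on_coordinatewise_then_product)
    fix j
    show "continuous_on S (\<lambda>\<omega>. \<psi> \<omega> j)"
      unfolding continuous_on_topological
    proof safe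
      fix \<omega> B assume "\<omega> \<in> S" "open B" "\<psi> \<omega> j \<in> B"
      obtain k where k: "\<forall>\<eta>\<in>S. prefix k \<eta> = prefix k \<omega> \<longrightarrow> \<psi> \<eta> j = \<psi> \<omega> j" using * \<open>\<omega> \<in> S\<close> by blast
      have op: "open {\<eta> :: nat word. \<forall>i\<in>{..<k}. \<eta> i \<in> {\<omega> i}}"
        by (rule product_topology_basis'[of "{..<k}" "\<lambda>i. {\<omega> i}" "\<lambda>i. i"]) (auto simp: open_discrete)
      show "\<exists>A. open A \<and> \<omega> \<in> A \<and> (\<forall>\<eta>\<in>S. \<eta> \<in> A \<longrightarrow> \<psi> \<eta> j \<in> B)"
      proof (intro exI[of _ "{\<eta> :: nat word. \<forall>i\<in>{..<k}. \<eta> i \<in> {\<omega> i}}"] conjI ballI impI op)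
        fix \<eta> assume "\<eta> \<in> S" "\<eta> \<in> {\<eta>. \<forall>i\<in>{..<k}. \<eta> i \<in> {\<omega> i}}"
        then have "prefix k \<eta> = prefix k \<omega>" by (auto simp: subsequence_def)
        then show "\<psi> \<eta> j \<in> B" using k \<open>\<eta> \<in> S\<close> \<open>\<psi> \<omega> j \<in> B\<close> by auto
      qed simp
    qed
  qed
qed

lemma compact_cantor: "compact (cantor n)"
proof -
  have "cantor n = (\<Pi>\<^sub>E i\<in>UNIV. {..<n})" by (auto simp: cantor_def PiE_def)
  moreover have "compactin (product_topology (\<lambda>i::nat. euclidean :: nat topology) UNIV) (\<Pi>\<^sub>E i\<in>UNIV. {..<n})"
    by (subst compactin_PiE) (auto simp: finite_imp_compact)
  ultimately show ?thesis by (simp add: euclidean_product_topology)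
qed


section \<open>Eventually constant words and base n numerals\<close>

definition evconst :: "nat \<Rightarrow> nat word \<Rightarrow> bool" where
  "evconst c \<omega> \<longleftrightarrow> (\<exists>k. suffix k \<omega> = (\<lambda>_. c))"

lemma evconst_conc [simp]: "evconst c (u \<frown> \<omega>) \<longleftrightarrow> evconst c \<omega>"
proof
  assume "evconst c (u \<frown> \<omega>)"
  then obtain k where "suffix k (u \<frown> \<omega>) = (\<lambda>_. c)" by (auto simp: evconst_def)
  then have *: "(u \<frown> \<omega>) (k + j) = c" for j by (metis suffix_nth)
  have "suffix k \<omega> = (\<lambda>_. c)"
  proof
    fix j show "suffix k \<omega> j = c" using *[of "length u + j"] by simp
  qed
  then show "evconst c \<omega>" by (auto simp: evconst_def)
next
  assume "evconst c \<omega>"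
  then obtain k where "suffix k \<omega> = (\<lambda>_. c)" by (auto simp: evconst_def)
  then have "suffix (length u + k) (u \<frown> \<omega>) = (\<lambda>_. c)" by simp
  then show "evconst c (u \<frown> \<omega>)" unfolding evconst_def by blast
qed

lemma evconst_build [simp]: "evconst c (i ## \<omega>) \<longleftrightarrow> evconst c \<omega>"
  using evconst_conc[of c "[i]" \<omega>] by simp

lemma evconst_const [simp]: "evconst c (\<lambda>_. d) \<longleftrightarrow> c = d"
  by (auto simp: evconst_def fun_eq_iff)

lemma evconst_unique: "evconst c \<omega> \<Longrightarrow> evconst d \<omega> \<Longrightarrow> c = d"
proof -
  assume "evconst c \<omega>" "evconst d \<omega>"
  then obtain k l where "suffix k \<omega> = (\<lambda>_. c)" "suffix l \<omega> = (\<lambda>_. d)" by (auto simp: evconst_def)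
  then have "suffix k \<omega> l = c" "suffix l \<omega> k = d" by simp_all
  then show "c = d" by (simp add: add.commute)
qed

primrec word_num :: "nat \<Rightarrow> nat list \<Rightarrow> nat" where
  "word_num n [] = 0"
| "word_num n (i # u) = i * n ^ length u + word_num n u"

lemma word_num_append: "word_num n (u @ v) = word_num n u * n ^ length v + word_num n v"
  by (induction u) (auto simp: algebra_simps power_add)

lemma word_num_less: "u \<in> words n \<Longrightarrow> word_num n u < n ^ length u"
proof (induction u)
  case (Cons i u)
  then have "i * n ^ length u + word_num n u < i * n ^ length u + n ^ length u" by auto
  also have "\<dots> = Suc i * n ^ length u" by simp
  also have "\<dots> \<le> n * n ^ length u" using Cons.prems by (intro mult_right_mono) auto
  finally show ?case by simp
qed auto

lemma word_num_surj: "J < n ^ L \<Longrightarrow> \<exists>u\<in>words n. length u = L \<and> word_num n u = J"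
proof (induction L arbitrary: J)
  case 0 then show ?case by (intro bexI[of _ "[]"]) auto
next
  case (Suc L)
  then have "0 < n" by (cases n) auto
  have "J div n < n ^ L" using Suc.prems by (simp add: less_mult_imp_div_less mult.commute)
  then obtain u where u: "u \<in> words n" "length u = L" "word_num n u = J div n" using Suc.IH by blast
  then show ?case using \<open>0 < n\<close>
    by (intro bexI[of _ "u @ [J mod n]"]) (auto simp: word_num_append)
qed

text \<open>Casting out: n is congruent to 1 modulo n - 1, so each power of n in the numeral may be
  replaced by 1.\<close>

lemma word_num_cong_sum_list: 
  assumes "n \<ge> 1" shows "(int (n - 1)) dvd (int (word_num n u) - int (sum_list u))"
proof (induction u)
  case (Cons i u)
  have "int (n - 1) dvd int n ^ length u - 1 ^ length u"
    using assms by (metis of_nat_1 of_nat_diff dvd_trans power_diff_1_eq dvd_triv_left power_one)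
  then have "int (n - 1) dvd int i * (int n ^ length u - 1) + (int (word_num n u) - int (sum_list u))"
    using Cons by (intro dvd_add dvd_mult) auto
  then show ?case by (simp add: algebra_simps)
qed simp

section \<open>The map rho, its fibres and the order\<close>

locale base_n = fixes n :: nat assumes n2: "2 \<le> n"
begin

lemma zeros_cantor [simp]: "(\<lambda>_. 0) \<in> cantor n" using n2 by (auto simp: cantor_def)
lemma tops_cantor [simp]: "(\<lambda>_. n - Suc 0) \<in> cantor n" using n2 by (auto simp: cantor_def)

lemma n_pos [simp]: "0 < n" "n \<noteq> 0" "real n > 0" "Suc 0 < n" using n2 by auto

lemma top_digits_sums: "(\<lambda>j. real (n - 1) / real n ^ Suc j) sums 1"
proof -
  have "(\<lambda>j. (1 / real n) ^ j) sums (1 / (1 - 1 / real n))" by (rule geometric_sums) (use n2 in auto)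
  from sums_mult[OF this, of "real (n - 1) / real n"]
  show ?thesis using n2 by (simp add: field_simps power_divide of_nat_diff)
qed

lemma summable_rho:
  assumes "\<omega> \<in> cantor n" shows "summable (\<lambda>j. real (\<omega> j) / real n ^ Suc j)"
proof (rule summable_comparison_test'[OF sums_summable[OF top_digits_sums], of 0])
  fix j
  have "\<omega> j \<le> n - 1" using cantorD[OF assms, of j] by auto
  then have "real (\<omega> j) \<le> real (n - 1)" by linarith
  then show "norm (real (\<omega> j) / real n ^ Suc j) \<le> real (n - 1) / real n ^ Suc j"
    by (simp add: divide_right_mono del: power_Suc)
qed

lemma rho_nonneg: "\<omega> \<in> cantor n \<Longrightarrow> 0 \<le> rho n \<omega>"
  unfolding rho_def by (intro suminf_nonneg summable_rho) auto

text \<open>Lies over x -> 1 - x and reverses the order. It reduces statements about top letters,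
  left expansions and order-reversing maps to their mirror images.\<close>

definition flip :: "nat word \<Rightarrow> nat word" where "flip \<omega> = (\<lambda>j. n - 1 - \<omega> j)"

lemma flip_cantor [simp]: "flip \<omega> \<in> cantor n"
  using n2 by (auto simp: flip_def cantor_def)

lemma flip_flip [simp]: "\<omega> \<in> cantor n \<Longrightarrow> flip (flip \<omega>) = \<omega>"
proof
  fix j assume "\<omega> \<in> cantor n"
  from cantorD[OF this, of j] show "flip (flip \<omega>) j = \<omega> j" by (simp add: flip_def)
qed

lemma rho_flip:
  assumes "\<omega> \<in> cantor n" shows "rho n (flip \<omega>) = 1 - rho n \<omega>"
proof -
  have *: "real (flip \<omega> j) / real n ^ Suc j = real (n - 1) / real n ^ Suc j - real (\<omega> j) / real n ^ Suc j" for j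
  proof -
    have "\<omega> j \<le> n - 1" using cantorD[OF assms, of j] by auto
    then show ?thesis by (simp add: flip_def diff_divide_distrib[symmetric] of_nat_diff del: power_Suc)
  qed
  show ?thesis unfolding rho_def *
    by (subst suminf_diff[OF sums_summable[OF top_digits_sums] summable_rho[OF assms], symmetric]) (simp only: sums_unique[OF top_digits_sums, symmetric])
qed

lemma rho_le_1: "\<omega> \<in> cantor n \<Longrightarrow> rho n \<omega> \<le> 1"
  using rho_flip rho_nonneg[of "flip \<omega>"] by simp

lemma rho_eq_0_iff: "\<omega> \<in> cantor n \<Longrightarrow> rho n \<omega> = 0 \<longleftrightarrow> \<omega> = (\<lambda>_. 0)"
  unfolding rho_def by (subst suminf_eq_zero_iff[OF summable_rho]) (auto simp: fun_eq_iff)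

lemma rho_eq_1_iff: 
  assumes "\<omega> \<in> cantor n" shows "rho n \<omega> = 1 \<longleftrightarrow> \<omega> = (\<lambda>_. n - 1)"
proof -
  have "rho n \<omega> = 1 \<longleftrightarrow> flip \<omega> = (\<lambda>_. 0)" using rho_eq_0_iff[of "flip \<omega>"] rho_flip[OF assms] by auto
  also have "\<dots> \<longleftrightarrow> \<omega> = (\<lambda>_. n - 1)"
  proof
    assume h: "flip \<omega> = (\<lambda>_. 0)"
    show "\<omega> = (\<lambda>_. n - 1)"
    proof
      fix j show "\<omega> j = n - 1" using fun_cong[OF h, of j] cantorD[OF assms, of j] by (simp add: flip_def)
    qed
  qed (simp add: flip_def)
  finally show ?thesis .
qed

lemma rho_zeros [simp]: "rho n (\<lambda>_. 0) = 0" by (simp add: rho_def)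
lemma rho_tops [simp]: "rho n (\<lambda>_. n - Suc 0) = 1" using rho_eq_1_iff[OF tops_cantor] by simp

lemma rho_Cons: 
  assumes "i < n" "\<omega> \<in> cantor n" shows "rho n ([i] \<frown> \<omega>) = (real i + rho n \<omega>) / real n"
proof -
  let ?f = "\<lambda>j. real (([i] \<frown> \<omega>) j) / real n ^ Suc j"
  have s: "summable ?f" by (rule summable_rho) (use assms in auto)
  have "rho n ([i] \<frown> \<omega>) = ?f 0 + (\<Sum>j. ?f (Suc j))"
    unfolding rho_def by (subst suminf_split_head[OF s]) simp
  also have "(\<Sum>j. ?f (Suc j)) = (\<Sum>j. real (\<omega> j) / real n ^ Suc j / real n)"
    by (intro suminf_cong) (simp add: conc_def)
  also have "\<dots> = rho n \<omega> / real n" unfolding rho_def by (rule suminf_divide[OF summable_rho[OF assms(2)]])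
  finally show ?thesis by (simp add: add_divide_distrib)
qed

lemma rho_build [simp]: "i < n \<Longrightarrow> \<omega> \<in> cantor n \<Longrightarrow> rho n (i ## \<omega>) = (real i + rho n \<omega>) / real n"
  using rho_Cons[of i \<omega>] by simp

lemma rho_conc: "u \<in> words n \<Longrightarrow> \<omega> \<in> cantor n \<Longrightarrow> rho n (u \<frown> \<omega>) = (real (word_num n u) + rho n \<omega>) / real n ^ length u"
proof (induction u)
  case (Cons i u)
  have "rho n ((i # u) \<frown> \<omega>) = rho n ([i] \<frown> (u \<frown> \<omega>))" by simp
  also have "\<dots> = (real i + rho n (u \<frown> \<omega>)) / real n" using Cons.prems by (intro rho_Cons) auto
  finally show ?case using Cons by (simp add: add_divide_distrib mult.commute)
qed simp

text \<open>The two values differ by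
  \<open>(j - i + rho n \<eta> - rho n \<omega>) / n ^ Suc (length u)\<close>. Here j - i is at
  least 1 and the difference of the tails at least -1, so equality is the usual carry between the
  tails (n-1)(n-1)... and 00...\<close>

lemma rho_less_diff:
  assumes "i < j" "(u @ [i]) \<frown> \<omega> \<in> cantor n" "(u @ [j]) \<frown> \<eta> \<in> cantor n"
  shows "rho n ((u @ [i]) \<frown> \<omega>) \<le> rho n ((u @ [j]) \<frown> \<eta>)"
    "rho n ((u @ [i]) \<frown> \<omega>) = rho n ((u @ [j]) \<frown> \<eta>) \<longleftrightarrow> \<omega> = (\<lambda>_. n - 1) \<and> \<eta> = (\<lambda>_. 0) \<and> j = Suc i"
proof -
  have c: "u \<in> words n" "i < n" "j < n" "\<omega> \<in> cantor n" "\<eta> \<in> cantor n" using assms by auto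
  have e: "rho n ((u @ [j]) \<frown> \<eta>) - rho n ((u @ [i]) \<frown> \<omega>) = (real j - real i + rho n \<eta> - rho n \<omega>) / real n ^ Suc (length u)"
    using c by (simp add: rho_conc word_num_append diff_divide_distrib add_divide_distrib mult.commute)
  have b: "0 \<le> rho n \<eta>" "rho n \<omega> \<le> 1" "real j - real i \<ge> 1"
    using c assms(1) by (auto simp: rho_nonneg rho_le_1)
  then have "(real j - real i + rho n \<eta> - rho n \<omega>) / real n ^ Suc (length u) \<ge> 0"
    by (intro divide_nonneg_pos) auto
  with e show "rho n ((u @ [i]) \<frown> \<omega>) \<le> rho n ((u @ [j]) \<frown> \<eta>)" by linarith
  have "rho n ((u @ [i]) \<frown> \<omega>) = rho n ((u @ [j]) \<frown> \<eta>) \<longleftrightarrow> real j - real i + rho n \<eta> - rho n \<omega> = 0"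
    using e by auto
  also have "\<dots> \<longleftrightarrow> rho n \<omega> = 1 \<and> rho n \<eta> = 0 \<and> real j - real i = 1" using b by auto
  finally show "rho n ((u @ [i]) \<frown> \<omega>) = rho n ((u @ [j]) \<frown> \<eta>) \<longleftrightarrow> \<omega> = (\<lambda>_. n - 1) \<and> \<eta> = (\<lambda>_. 0) \<and> j = Suc i"
    using c by (auto simp: rho_eq_0_iff rho_eq_1_iff)
qed

lemma rho_mono: "\<omega> \<in> cantor n \<Longrightarrow> \<eta> \<in> cantor n \<Longrightarrow> less_fun \<omega> \<eta> \<Longrightarrow> rho n \<omega> \<le> rho n \<eta>"
  by (metis less_fun_split rho_less_diff(1))

lemma rho_less_imp: "\<omega> \<in> cantor n \<Longrightarrow> \<eta> \<in> cantor n \<Longrightarrow> rho n \<omega> < rho n \<eta> \<Longrightarrow> less_fun \<omega> \<eta>"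
  using rho_mono[of \<eta> \<omega>] less_fun_total[of \<omega> \<eta>] by (metis leD less_irrefl)

lemma rho_eq_less:
  assumes "\<omega> \<in> cantor n" "\<eta> \<in> cantor n" "less_fun \<omega> \<eta>" "rho n \<omega> = rho n \<eta>"
  shows "evconst (n - 1) \<omega> \<and> evconst 0 \<eta>"
proof -
  from assms(3) obtain u i j \<omega>' \<eta>' where "\<omega> = (u @ [i]) \<frown> \<omega>'" "\<eta> = (u @ [j]) \<frown> \<eta>'" "i < j"
    by (rule less_fun_split)
  with assms rho_less_diff(2)[of i j u \<omega>' \<eta>'] show ?thesis by auto
qed

lemma evconst_excl: "evconst (n - 1) \<omega> \<Longrightarrow> \<not> evconst 0 \<omega>"
  using evconst_unique[of "n - 1" \<omega> 0] n2 by auto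

text \<open>Of two distinct words with equal value the smaller ends in n - 1 and the larger in 0, so
  one additional bit tells them apart.\<close>

lemma rho_inj:
  assumes "\<omega> \<in> cantor n" "\<eta> \<in> cantor n" "rho n \<omega> = rho n \<eta>" "evconst (n - 1) \<omega> \<longleftrightarrow> evconst (n - 1) \<eta>"
  shows "\<omega> = \<eta>"
proof (rule ccontr)
  assume "\<omega> \<noteq> \<eta>"
  then consider "less_fun \<omega> \<eta>" | "less_fun \<eta> \<omega>" using less_fun_total by blast
  then show False
  proof cases
    case 1
    with rho_eq_less[of \<omega> \<eta>] evconst_excl assms show False by auto
  next
    case 2
    with rho_eq_less[of \<eta> \<omega>] evconst_excl assms show False by auto
  qed
qed

lemma evconst_top_n_adic:
  assumes "\<omega> \<in> cantor n" "evconst (n - 1) \<omega> \<or> evconst 0 \<omega>" shows "rho n \<omega> \<in> n_adic n"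
proof -
  obtain k where k: "suffix k \<omega> = (\<lambda>_. n - 1) \<or> suffix k \<omega> = (\<lambda>_. 0)"
    using assms unfolding evconst_def by blast
  have "rho n (suffix k \<omega>) \<in> {0,1}" using k by auto
  have "rho n \<omega> = (real (word_num n (prefix k \<omega>)) + rho n (suffix k \<omega>)) / real n ^ k"
    using rho_conc[of "prefix k \<omega>" "suffix k \<omega>"] assms(1) by simp
  moreover obtain a :: int where "real (word_num n (prefix k \<omega>)) + rho n (suffix k \<omega>) = of_int a"
    using \<open>rho n (suffix k \<omega>) \<in> {0,1}\<close>
    by (metis (no_types, opaque_lifting) add.right_neutral insertE of_int_1 of_int_add of_int_of_nat_eq singletonD)
  ultimately show ?thesis unfolding n_adic_def by auto
qed

text \<open>After a shift by as many letters as the denominator has factors n, the remaining value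
  is an integer in [0,1], and only the two constant words have the values 0 and 1.\<close>

lemma n_adic_evconst:
  assumes "\<omega> \<in> cantor n" "rho n \<omega> \<in> n_adic n" shows "evconst (n - 1) \<omega> \<or> evconst 0 \<omega>"
proof -
  obtain a :: int and k where a: "rho n \<omega> = of_int a / real n ^ k" using assms(2) by (auto simp: n_adic_def)
  have "rho n \<omega> = (real (word_num n (prefix k \<omega>)) + rho n (suffix k \<omega>)) / real n ^ k"
    using rho_conc[of "prefix k \<omega>" "suffix k \<omega>"] assms(1) by simp
  then have "rho n (suffix k \<omega>) = of_int (a - int (word_num n (prefix k \<omega>)))"
    using a by (simp add: field_simps)
  then obtain z :: int where "rho n (suffix k \<omega>) = of_int z" by blast
  moreover have "0 \<le> rho n (suffix k \<omega>)" "rho n (suffix k \<omega>) \<le> 1" using assms(1) by (auto intro: rho_nonneg rho_le_1)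
  ultimately have "rho n (suffix k \<omega>) = 0 \<or> rho n (suffix k \<omega>) = 1"
    by (metis int_one_le_iff_zero_less of_int_0 of_int_0_le_iff of_int_1 of_int_le_1_iff order_antisym order_le_less)
  then have "suffix k \<omega> = (\<lambda>_. 0) \<or> suffix k \<omega> = (\<lambda>_. n - 1)"
    using assms(1) by (simp add: rho_eq_0_iff rho_eq_1_iff)
  then show ?thesis unfolding evconst_def by blast
qed

lemma rho_inj_non_adic: "\<omega> \<in> cantor n \<Longrightarrow> \<eta> \<in> cantor n \<Longrightarrow> rho n \<omega> = rho n \<eta> \<Longrightarrow> rho n \<omega> \<notin> n_adic n \<Longrightarrow> \<omega> = \<eta>"
  by (rule rho_inj) (auto dest: evconst_top_n_adic)

text \<open>The greedy expansion; over an n-adic point it is the larger of the two expansions. The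
  remainders \<open>r k\<close> stay below 1, whereas a tail of letters n - 1 would force a
  remainder equal to 1.\<close>

lemma rho_surj_right:
  assumes "0 \<le> x" "x < 1" shows "\<exists>\<omega>\<in>cantor n. rho n \<omega> = x \<and> \<not> evconst (n - 1) \<omega>"
proof -
  define r where "r k = rec_nat x (\<lambda>_ y. real n * y - of_int \<lfloor>real n * y\<rfloor>) k" for k
  have r0: "r 0 = x" and rS: "r (Suc k) = real n * r k - of_int \<lfloor>real n * r k\<rfloor>" for k by (simp_all add: r_def)
  define \<omega> where "\<omega> k = nat \<lfloor>real n * r k\<rfloor>" for k
  have rb: "0 \<le> r k \<and> r k < 1" for k
  proof (cases k)
    case (Suc j) then show ?thesis unfolding Suc rS by linarith
  qed (use assms r0 in auto)
  have \<omega>: "real (\<omega> k) = of_int \<lfloor>real n * r k\<rfloor>" for k unfolding \<omega>_def using rb[of k] by simp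
  have "\<omega> \<in> cantor n" unfolding cantor_def
  proof safe
    fix k have "real n * r k < real n * 1" using rb[of k] n_pos(3) by (intro mult_strict_left_mono) auto
    then have "real (\<omega> k) < real n" unfolding \<omega> using of_int_floor_le[of "real n * r k"] by linarith
    then show "\<omega> k < n" by simp
  qed
  have part: "(\<Sum>j<k. real (\<omega> j) / real n ^ Suc j) = x - r k / real n ^ k" for k
  proof (induction k)
    case (Suc k)
    have rr: "r (Suc k) = real n * r k - real (\<omega> k)" by (simp add: rS \<omega>)
    have "(\<Sum>j<Suc k. real (\<omega> j) / real n ^ Suc j) = x - (real n * r k - real (\<omega> k)) / real n ^ Suc k"
      unfolding sum.lessThan_Suc Suc by (simp add: diff_divide_distrib)
    then show ?case using rr by simp
  qed (simp add: r0)
  \<comment> \<open>The partial sums miss x by \<open>r k / n ^ k\<close>, which tends to 0 since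
    the remainders are bounded.\<close>
  have rho_r: "rho n \<omega> = x" if "\<omega> \<in> cantor n" "\<And>k. 0 \<le> r k \<and> r k < 1" 
      "\<And>k. (\<Sum>j<k. real (\<omega> j) / real n ^ Suc j) = x - r k / real n ^ k" for \<omega> x and r :: "nat \<Rightarrow> real"
  proof -
    have "(\<lambda>k. (1 / real n) ^ k) \<longlonglongrightarrow> 0" by (rule LIMSEQ_power_zero) (use n2 in auto)
    then have "(\<lambda>k. r k / real n ^ k) \<longlonglongrightarrow> 0"
      by (rule tendsto_0_le[where K=1]) (auto simp: that(2) less_imp_le power_divide divide_right_mono)
    then have "(\<lambda>k. \<Sum>j<k. real (\<omega> j) / real n ^ Suc j) \<longlonglongrightarrow> x - 0" unfolding that(3) by (intro tendsto_intros)
    then have "(\<lambda>j. real (\<omega> j) / real n ^ Suc j) sums x" by (simp add: sums_def)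
    then show ?thesis unfolding rho_def by (rule sums_unique[symmetric])
  qed
  have "rho n \<omega> = x" by (rule rho_r[OF \<open>\<omega> \<in> cantor n\<close> rb part])
  moreover have "\<not> evconst (n - 1) \<omega>"
  proof
    assume "evconst (n - 1) \<omega>"
    then obtain k where k: "suffix k \<omega> = (\<lambda>_. n - 1)" by (auto simp: evconst_def)
    have "rho n \<omega> = (real (word_num n (prefix k \<omega>)) + rho n (suffix k \<omega>)) / real n ^ k"
      using rho_conc[of "prefix k \<omega>" "suffix k \<omega>"] \<open>\<omega> \<in> cantor n\<close> by simp
    then have "rho n \<omega> = (real (word_num n (prefix k \<omega>)) + 1) / real n ^ k"
      using k by simp
    moreover have "rho n (prefix k \<omega> \<frown> (\<lambda>_. 0)) = (real (word_num n (prefix k \<omega>)) + 0) / real n ^ k"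
      using \<open>\<omega> \<in> cantor n\<close> by (subst rho_conc) auto
    moreover have "rho n (prefix k \<omega> \<frown> (\<lambda>_. 0)) = (\<Sum>j<k. real (\<omega> j) / real n ^ Suc j)"
    proof -
      have "rho n (prefix k \<omega> \<frown> (\<lambda>_. 0)) = (\<Sum>j<k. real ((prefix k \<omega> \<frown> (\<lambda>_. 0)) j) / real n ^ Suc j)"
        unfolding rho_def by (rule suminf_finite) (auto simp: conc_def)
      also have "\<dots> = (\<Sum>j<k. real (\<omega> j) / real n ^ Suc j)" by (rule sum.cong) auto
      finally show ?thesis .
    qed
    ultimately have "x = x - r k / real n ^ k + 1 / real n ^ k" using part[of k] \<open>rho n \<omega> = x\<close>
      by (simp add: add_divide_distrib)
    then have "r k = 1" by (simp add: field_simps)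
    then show False using rb[of k] by simp
  qed
  ultimately show ?thesis using \<open>\<omega> \<in> cantor n\<close> by blast
qed

lemma evconst_flip: "\<omega> \<in> cantor n \<Longrightarrow> evconst 0 (flip \<omega>) \<longleftrightarrow> evconst (n - 1) \<omega>"
  "\<omega> \<in> cantor n \<Longrightarrow> evconst (n - 1) (flip \<omega>) \<longleftrightarrow> evconst 0 \<omega>"
proof -
  have *: "suffix k (flip \<omega>) = flip (suffix k \<omega>)" for k \<omega> by (simp add: flip_def suffix_def)
  have f: "flip (\<lambda>_. 0) = (\<lambda>_. n - 1)" "flip (\<lambda>_. n - 1) = (\<lambda>_. 0)" by (simp_all add: flip_def)
  have 1: "evconst 0 (flip \<omega>)" if "evconst (n - 1) \<omega>" for \<omega>
    using that unfolding evconst_def * using f by metis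
  have 2: "evconst (n - 1) (flip \<omega>)" if "evconst 0 \<omega>" for \<omega>
    using that unfolding evconst_def * using f by metis
  show "\<omega> \<in> cantor n \<Longrightarrow> evconst 0 (flip \<omega>) \<longleftrightarrow> evconst (n - 1) \<omega>"
    "\<omega> \<in> cantor n \<Longrightarrow> evconst (n - 1) (flip \<omega>) \<longleftrightarrow> evconst 0 \<omega>"
    using 1[of \<omega>] 2[of \<omega>] 1[of "flip \<omega>"] 2[of "flip \<omega>"] by auto
qed

lemma rho_surj_left:
  assumes "0 < x" "x \<le> 1" shows "\<exists>\<omega>\<in>cantor n. rho n \<omega> = x \<and> \<not> evconst 0 \<omega>"
proof -
  obtain \<omega> where "\<omega> \<in> cantor n" "rho n \<omega> = 1 - x" "\<not> evconst (n - 1) \<omega>" using rho_surj_right[of "1 - x"] assms by auto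
  then show ?thesis by (intro bexI[of _ "flip \<omega>"]) (auto simp: rho_flip evconst_flip)
qed

lemma rho_surj: "0 \<le> x \<Longrightarrow> x \<le> 1 \<Longrightarrow> \<exists>\<omega>\<in>cantor n. rho n \<omega> = x"
  using rho_surj_right[of x] rho_surj_left[of x] by (cases "x < 1") auto

lemma n_adic_two_preimages:
  assumes "0 < x" "x < 1"
  shows "x \<in> n_adic n \<longleftrightarrow> (\<exists>\<omega>\<in>cantor n. \<exists>\<eta>\<in>cantor n. \<omega> \<noteq> \<eta> \<and> rho n \<omega> = x \<and> rho n \<eta> = x)"
proof
  assume x: "x \<in> n_adic n"
  obtain \<omega> where w: "\<omega> \<in> cantor n" "rho n \<omega> = x" "\<not> evconst (n - 1) \<omega>" using rho_surj_right[of x] assms by auto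
  obtain \<eta> where e: "\<eta> \<in> cantor n" "rho n \<eta> = x" "\<not> evconst 0 \<eta>" using rho_surj_left[of x] assms by auto
  have "evconst 0 \<omega>" using n_adic_evconst[of \<omega>] w x by auto
  then have "\<omega> \<noteq> \<eta>" using e by auto
  then show "\<exists>\<omega>\<in>cantor n. \<exists>\<eta>\<in>cantor n. \<omega> \<noteq> \<eta> \<and> rho n \<omega> = x \<and> rho n \<eta> = x" using w e by blast
next
  assume "\<exists>\<omega>\<in>cantor n. \<exists>\<eta>\<in>cantor n. \<omega> \<noteq> \<eta> \<and> rho n \<omega> = x \<and> rho n \<eta> = x"
  then show "x \<in> n_adic n" using rho_inj_non_adic by metis
qed

text \<open>Between two distinct values there are further values, and a fibre of \<open>rho\<close>
  has at most two points. This expresses the relation by the order alone.\<close>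

lemma rho_between:
  assumes "\<omega> \<in> cantor n" "\<eta> \<in> cantor n" "less_fun \<omega> \<eta>"
  shows "rho n \<omega> = rho n \<eta> \<longleftrightarrow> \<not> (\<exists>\<xi>\<in>cantor n. less_fun \<omega> \<xi> \<and> less_fun \<xi> \<eta>)"
proof
  assume e: "rho n \<omega> = rho n \<eta>"
  show "\<not> (\<exists>\<xi>\<in>cantor n. less_fun \<omega> \<xi> \<and> less_fun \<xi> \<eta>)"
  proof
    assume "\<exists>\<xi>\<in>cantor n. less_fun \<omega> \<xi> \<and> less_fun \<xi> \<eta>"
    then obtain \<xi> where x: "\<xi> \<in> cantor n" "less_fun \<omega> \<xi>" "less_fun \<xi> \<eta>" by blast
    then have "rho n \<omega> = rho n \<xi>" "rho n \<xi> = rho n \<eta>" using rho_mono[of \<omega> \<xi>] rho_mono[of \<xi> \<eta>] assms e by auto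
    then show False using rho_eq_less[of \<omega> \<xi>] rho_eq_less[of \<xi> \<eta>] x assms evconst_excl by auto
  qed
next
  assume h: "\<not> (\<exists>\<xi>\<in>cantor n. less_fun \<omega> \<xi> \<and> less_fun \<xi> \<eta>)"
  show "rho n \<omega> = rho n \<eta>"
  proof (rule ccontr)
    assume "rho n \<omega> \<noteq> rho n \<eta>"
    then have "rho n \<omega> < rho n \<eta>" using rho_mono[OF assms] by simp
    then obtain y where y: "rho n \<omega> < y" "y < rho n \<eta>" using dense by blast
    then obtain \<xi> where "\<xi> \<in> cantor n" "rho n \<xi> = y"
      using rho_surj[of y] rho_nonneg[OF assms(1)] rho_le_1[OF assms(2)] by auto
    then show False using h y rho_less_imp[of \<omega> \<xi>] rho_less_imp[of \<xi> \<eta>] assms by auto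
  qed
qed

end

section \<open>Monotone homeomorphisms of the Cantor space\<close>

lemma homeo_group_carrier_iff:
  "f \<in> carrier (homeo_group S) \<longleftrightarrow>
     f \<in> extensional S \<and> bij_betw f S S \<and> continuous_on S f \<and> continuous_on S (inv_into S f)"
proof
  assume "f \<in> carrier (homeo_group S)"
  then obtain g where f: "f \<in> Bij S" and g: "homeomorphism S S f g" by (auto simp: homeo_group_def)
  have b: "bij_betw f S S" using f by (simp add: Bij_def)
  have "inv_into S f y = g y" if "y \<in> S" for y
  proof -
    have "f (g y) = y" "g y \<in> S" using g that by (auto simp: homeomorphism_def)
    then show ?thesis using b by (metis bij_betw_def inv_into_f_f)
  qed
  then have "continuous_on S (inv_into S f)" using g by (auto simp: homeomorphism_def cong: continuous_on_cong)
  then show "f \<in> extensional S \<and> bij_betw f S S \<and> continuous_on S f \<and> continuous_on S (inv_into S f)"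
    using f g by (auto simp: Bij_def homeomorphism_def)
next
  assume h: "f \<in> extensional S \<and> bij_betw f S S \<and> continuous_on S f \<and> continuous_on S (inv_into S f)"
  then have "homeomorphism S S f (inv_into S f)"
    using bij_betw_inv_into[of f S S]
    by (auto simp: homeomorphism_def bij_betw_def f_inv_into_f)
  then show "f \<in> carrier (homeo_group S)" using h by (auto simp: homeo_group_def Bij_def)
qed

lemma homeo_group_ext:
  "f \<in> carrier (homeo_group S) \<Longrightarrow> g \<in> carrier (homeo_group S) \<Longrightarrow> (\<And>x. x \<in> S \<Longrightarrow> f x = g x) \<Longrightarrow> f = g"
  by (auto simp: homeo_group_carrier_iff intro: extensionalityI)

lemma homeo_group_subset: "carrier (homeo_group S) \<subseteq> Bij S" by (auto simp: homeo_group_def)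

lemma subgroup_homeo: "subgroup (carrier (homeo_group S)) (BijGroup S)"
proof (rule group.subgroupI[OF group_BijGroup])
  show "carrier (homeo_group S) \<subseteq> carrier (BijGroup S)" by (auto simp: homeo_group_def BijGroup_def)
  have "(\<lambda>x\<in>S. x) \<in> carrier (homeo_group S)"
    unfolding homeo_group_carrier_iff
  proof (intro conjI)
    show b: "bij_betw (\<lambda>x\<in>S. x) S S" by (auto simp: bij_betw_def inj_on_def)
    have "inv_into S (\<lambda>x\<in>S. x) y = y" if "y \<in> S" for y
      using b that by (metis bij_betw_def inv_into_f_f restrict_apply')
    then show "continuous_on S (inv_into S (\<lambda>x\<in>S. x))"
      using continuous_on_cong[of S S "inv_into S (\<lambda>x\<in>S. x)" "\<lambda>x. x"] by auto
    show "continuous_on S (\<lambda>x\<in>S. x)" using continuous_on_cong[of S S "\<lambda>x\<in>S. x" "\<lambda>x. x"] by auto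
  qed auto
  then show "carrier (homeo_group S) \<noteq> {}" by blast
next
  fix f assume f: "f \<in> carrier (homeo_group S)"
  then have fB: "f \<in> Bij S" using homeo_group_subset by blast
  have b: "bij_betw f S S" using f by (simp add: homeo_group_carrier_iff)
  show "inv\<^bsub>BijGroup S\<^esub> f \<in> carrier (homeo_group S)"
    unfolding inv_BijGroup[OF fB] homeo_group_carrier_iff
  proof (intro conjI)
    have "(\<lambda>x\<in>S. inv_into S f x) \<in> Bij S" using fB by (rule restrict_inv_into_Bij)
    then show b': "bij_betw (\<lambda>x\<in>S. inv_into S f x) S S" by (simp add: Bij_def)
    show "continuous_on S (\<lambda>x\<in>S. inv_into S f x)"
      using f continuous_on_cong[of S S "\<lambda>x\<in>S. inv_into S f x" "inv_into S f"] by (auto simp: homeo_group_carrier_iff)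
    have "inv_into S (\<lambda>x\<in>S. inv_into S f x) y = f y" if "y \<in> S" for y
    proof -
      have "f y \<in> S" using b that by (auto simp: bij_betw_def)
      moreover have "(\<lambda>x\<in>S. inv_into S f x) (f y) = y" using b that calculation by (auto simp: bij_betw_def)
      ultimately show ?thesis using b' by (metis bij_betw_def inv_into_f_f)
    qed
    then show "continuous_on S (inv_into S (\<lambda>x\<in>S. inv_into S f x))"
      using f continuous_on_cong[of S S "inv_into S (\<lambda>x\<in>S. inv_into S f x)" f] by (auto simp: homeo_group_carrier_iff)
  qed auto
next
  fix f g assume f: "f \<in> carrier (homeo_group S)" and g: "g \<in> carrier (homeo_group S)"
  then have fB: "f \<in> Bij S" "g \<in> Bij S" using homeo_group_subset by blast+
  have b: "bij_betw f S S" "bij_betw g S S" using f g by (auto simp: homeo_group_carrier_iff)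
  have e: "f \<otimes>\<^bsub>BijGroup S\<^esub> g = compose S f g" using fB by (simp add: BijGroup_def)
  show "f \<otimes>\<^bsub>BijGroup S\<^esub> g \<in> carrier (homeo_group S)"
    unfolding e homeo_group_carrier_iff
  proof (intro conjI)
    show bc: "bij_betw (compose S f g) S S" using b by (rule_tac bij_betw_compose)
    have im: "f ` S = S" "g ` S = S" "inv_into S f ` S = S" "inv_into S g ` S = S"
      using b bij_betw_inv_into[OF b(1)] bij_betw_inv_into[OF b(2)] unfolding bij_betw_def by blast+
    have "continuous_on S (f \<circ> g)" using f g im by (intro continuous_on_compose) (auto simp: homeo_group_carrier_iff)
    then show "continuous_on S (compose S f g)"
      using continuous_on_cong[of S S "compose S f g" "f \<circ> g"] by (auto simp: compose_def)
    have "continuous_on S (inv_into S g \<circ> inv_into S f)" using f g im by (intro continuous_on_compose) (auto simp: homeo_group_carrier_iff)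
    moreover have "inv_into S (compose S f g) y = (inv_into S g \<circ> inv_into S f) y" if "y \<in> S" for y
    proof -
      have "(inv_into S g \<circ> inv_into S f) y \<in> S" using im that by (metis comp_apply imageI)
      moreover have "compose S f g ((inv_into S g \<circ> inv_into S f) y) = y"
        using im that b calculation by (simp add: compose_def f_inv_into_f inv_into_into)
      ultimately show ?thesis using bc by (metis bij_betw_def inv_into_f_f)
    qed
    ultimately show "continuous_on S (inv_into S (compose S f g))"
      using continuous_on_cong[of S S "inv_into S (compose S f g)" "inv_into S g \<circ> inv_into S f"] by auto
  qed (auto simp: compose_def)
qed

lemma group_homeo_group: "group (homeo_group S)"
proof -
  have "homeo_group S = BijGroup S \<lparr>carrier := carrier (homeo_group S)\<rparr>" by (simp add: homeo_group_def)
  then show ?thesis using subgroup.subgroup_is_group[OF subgroup_homeo group_BijGroup] by metis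
qed

lemma homeo_mult: "f \<in> carrier (homeo_group S) \<Longrightarrow> g \<in> carrier (homeo_group S) \<Longrightarrow> f \<otimes>\<^bsub>homeo_group S\<^esub> g = compose S f g"
  using homeo_group_subset[of S] by (auto simp: homeo_group_def BijGroup_def)

lemma homeo_mult_closed:
  "f \<in> carrier (homeo_group S) \<Longrightarrow> g \<in> carrier (homeo_group S) \<Longrightarrow> f \<otimes>\<^bsub>homeo_group S\<^esub> g \<in> carrier (homeo_group S)"
  using group.is_monoid[OF group_homeo_group] by (rule monoid.m_closed)

lemma homeo_mult_apply: "f \<in> carrier (homeo_group S) \<Longrightarrow> g \<in> carrier (homeo_group S) \<Longrightarrow> x \<in> S \<Longrightarrow>
    (f \<otimes>\<^bsub>homeo_group S\<^esub> g) x = f (g x)"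
  by (simp add: homeo_mult compose_def)

lemma homeo_one: "\<one>\<^bsub>homeo_group S\<^esub> = (\<lambda>x\<in>S. x)"
  by (simp add: homeo_group_def BijGroup_def)

lemma homeo_inv: "f \<in> carrier (homeo_group S) \<Longrightarrow> inv\<^bsub>homeo_group S\<^esub> f = restrict (inv_into S f) S"
proof -
  assume f: "f \<in> carrier (homeo_group S)"
  have "homeo_group S = BijGroup S \<lparr>carrier := carrier (homeo_group S)\<rparr>" by (simp add: homeo_group_def)
  then have "inv\<^bsub>homeo_group S\<^esub> f = inv\<^bsub>BijGroup S\<^esub> f"
    using group.m_inv_consistent[OF group_BijGroup subgroup_homeo f] by metis
  then show ?thesis using inv_BijGroup[of f S] f homeo_group_subset by auto
qed

lemma homeo_closed: "f \<in> carrier (homeo_group S) \<Longrightarrow> x \<in> S \<Longrightarrow> f x \<in> S"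
  by (auto simp: homeo_group_carrier_iff bij_betw_def)

lemma homeo_inv_closed: "f \<in> carrier (homeo_group S) \<Longrightarrow> inv\<^bsub>homeo_group S\<^esub> f \<in> carrier (homeo_group S)"
  by (rule group.inv_closed[OF group_homeo_group])

lemma homeo_inv_apply:
  assumes "f \<in> carrier (homeo_group S)" "x \<in> S"
  shows "f ((inv\<^bsub>homeo_group S\<^esub> f) x) = x" "(inv\<^bsub>homeo_group S\<^esub> f) (f x) = x"
proof -
  have b: "bij_betw f S S" using assms by (simp add: homeo_group_carrier_iff)
  show "f ((inv\<^bsub>homeo_group S\<^esub> f) x) = x" "(inv\<^bsub>homeo_group S\<^esub> f) (f x) = x"
    using assms b by (auto simp: homeo_inv bij_betw_def f_inv_into_f)
qed

lemma continuous_on_wordI: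
  fixes f :: "nat word \<Rightarrow> 'b::metric_space"
  assumes "\<And>\<omega> e. \<omega> \<in> S \<Longrightarrow> e > 0 \<Longrightarrow> \<exists>k. \<forall>\<eta>\<in>S. prefix k \<eta> = prefix k \<omega> \<longrightarrow> dist (f \<eta>) (f \<omega>) < e"
  shows "continuous_on S f"
  unfolding continuous_on_topological
proof safe
  fix \<omega> B assume "\<omega> \<in> S" "open B" "f \<omega> \<in> B"
  then obtain e where e: "e > 0" "ball (f \<omega>) e \<subseteq> B" by (meson openE)
  then obtain k where k: "\<forall>\<eta>\<in>S. prefix k \<eta> = prefix k \<omega> \<longrightarrow> dist (f \<eta>) (f \<omega>) < e" using assms \<open>\<omega> \<in> S\<close> by blast
  have op: "open {\<eta> :: nat word. \<forall>i\<in>{..<k}. \<eta> i \<in> {\<omega> i}}"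
    by (rule product_topology_basis'[of "{..<k}" "\<lambda>i. {\<omega> i}" "\<lambda>i. i"]) (auto simp: open_discrete)
  show "\<exists>A. open A \<and> \<omega> \<in> A \<and> (\<forall>\<eta>\<in>S. \<eta> \<in> A \<longrightarrow> f \<eta> \<in> B)"
  proof (intro exI[of _ "{\<eta> :: nat word. \<forall>i\<in>{..<k}. \<eta> i \<in> {\<omega> i}}"] conjI ballI impI op)
    fix \<eta> assume "\<eta> \<in> S" "\<eta> \<in> {\<eta>. \<forall>i\<in>{..<k}. \<eta> i \<in> {\<omega> i}}"
    then have "prefix k \<eta> = prefix k \<omega>" by (auto simp: subsequence_def)
    then show "f \<eta> \<in> B" using k \<open>\<eta> \<in> S\<close> e by (auto simp: dist_commute)
  qed simp
qed

section \<open>Order and topology of the Cantor space\<close>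

lemma less_fun_conc_diff:
  assumes "length u = length v" "u \<noteq> v" "less_fun (u \<frown> \<omega>) (v \<frown> (\<eta> :: nat word))"
  shows "less_fun (u \<frown> \<omega>') (v \<frown> \<eta>')"
proof -
  obtain k where k: "(u \<frown> \<omega>) k < (v \<frown> \<eta>) k" "\<And>i. i < k \<Longrightarrow> (u \<frown> \<omega>) i = (v \<frown> \<eta>) i"
    using assms(3) by (auto elim: less_funE)
  have "k < length u"
  proof (rule ccontr)
    assume "\<not> k < length u"
    then have "u ! i = v ! i" if "i < length u" for i using k(2)[of i] that assms(1) by simp
    then show False using assms by (metis nth_equalityI)
  qed
  then show ?thesis using k assms(1) unfolding less_fun_def by (intro exI[of _ k]) auto
qed

lemma less_fun_nbhd:
  assumes "less_fun \<omega> (\<tau> :: nat word)"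
  shows "\<exists>k. \<forall>\<eta>. prefix k \<eta> = prefix k \<omega> \<longrightarrow> less_fun \<eta> \<tau>" "\<exists>k. \<forall>\<eta>. prefix k \<eta> = prefix k \<tau> \<longrightarrow> less_fun \<omega> \<eta>"
proof -
  obtain k where k: "\<omega> k < \<tau> k" "\<And>i. i < k \<Longrightarrow> \<omega> i = \<tau> i" using assms by (auto elim: less_funE)
  have p: "\<eta> i = \<xi> i" if "prefix (Suc k) \<eta> = prefix (Suc k) \<xi>" "i < Suc k" for \<eta> \<xi> :: "nat word" and i
    using arg_cong[OF that(1), of "\<lambda>l. l ! i"] that(2) by (simp del: subseq_to_Suc)
  show "\<exists>k. \<forall>\<eta>. prefix k \<eta> = prefix k \<omega> \<longrightarrow> less_fun \<eta> \<tau>"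
  proof (intro exI allI impI)
    fix \<eta> assume h: "prefix (Suc k) \<eta> = prefix (Suc k) \<omega>"
    have "\<eta> k = \<omega> k" "\<And>i. i < k \<Longrightarrow> \<eta> i = \<omega> i" using p[OF h] by simp_all
    then show "less_fun \<eta> \<tau>" unfolding less_fun_def using k by (intro exI[of _ k]) simp
  qed
  show "\<exists>k. \<forall>\<eta>. prefix k \<eta> = prefix k \<tau> \<longrightarrow> less_fun \<omega> \<eta>"
  proof (intro exI allI impI)
    fix \<eta> assume h: "prefix (Suc k) \<eta> = prefix (Suc k) \<tau>"
    have "\<eta> k = \<tau> k" "\<And>i. i < k \<Longrightarrow> \<eta> i = \<tau> i" using p[OF h] by simp_all
    then show "less_fun \<omega> \<eta>" unfolding less_fun_def using k by (intro exI[of _ k]) simp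
  qed
qed

context base_n begin

lemma not_less_zeros: "\<omega> \<in> cantor n \<Longrightarrow> \<not> less_fun \<omega> (\<lambda>_. 0)" by (auto simp: less_fun_def)
lemma not_less_tops: "\<omega> \<in> cantor n \<Longrightarrow> \<not> less_fun (\<lambda>_. n - Suc 0) \<omega>"
  by (auto simp: less_fun_def not_less dest: cantorD) (metis One_nat_def Suc_pred cantorD less_Suc_eq_le n_pos(1))

text \<open>A point whose prefix differs from u lies on the same side of all points of the cylinder,
  so a cylinder is the order interval between its first and its last point.\<close>

lemma in_cylinder_between:
  assumes "\<xi> \<in> cantor n" "u \<in> words n" "\<not> less_fun \<xi> (u \<frown> (\<lambda>_. 0))" "\<not> less_fun (u \<frown> (\<lambda>_. n - 1)) \<xi>"
  shows "prefix (length u) \<xi> = u"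
proof (rule ccontr)
  assume ne: "prefix (length u) \<xi> \<noteq> u"
  let ?v = "prefix (length u) \<xi>" let ?s = "suffix (length u) \<xi>"
  have "?v \<frown> (\<lambda>_. 0) \<noteq> u \<frown> (\<lambda>_. 0)" using ne by (subst concat_eq) auto
  then consider "less_fun (?v \<frown> (\<lambda>_. 0)) (u \<frown> (\<lambda>_. 0))" | "less_fun (u \<frown> (\<lambda>_. 0)) (?v \<frown> (\<lambda>_. 0))"
    using less_fun_total by blast
  then show False
  proof cases
    case 1
    then have "less_fun (?v \<frown> ?s) (u \<frown> (\<lambda>_. 0))" using ne by (intro less_fun_conc_diff[OF _ _ 1]) auto
    then show False using assms by simp
  next
    case 2
    then have "less_fun (u \<frown> (\<lambda>_. n - 1)) (?v \<frown> ?s)" using ne by (intro less_fun_conc_diff[OF _ _ 2]) auto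
    then show False using assms by simp
  qed
qed

text \<open>The successor is the other expansion of the same real number, which exists because the
  value is below 1.\<close>

lemma successor_top:
  assumes "u \<in> words n" "u \<frown> (\<lambda>_. n - 1) \<noteq> (\<lambda>_. n - 1)"
  shows "\<exists>\<sigma>\<in>cantor n. less_fun (u \<frown> (\<lambda>_. n - 1)) \<sigma> \<and> \<not> (\<exists>\<xi>\<in>cantor n. less_fun (u \<frown> (\<lambda>_. n - 1)) \<xi> \<and> less_fun \<xi> \<sigma>)"
proof -
  let ?t = "u \<frown> (\<lambda>_. n - 1)"
  have t: "?t \<in> cantor n" using assms by simp
  have "rho n ?t < 1" using rho_eq_1_iff[OF t] rho_le_1[OF t] assms(2) by simp
  then obtain \<sigma> where s: "\<sigma> \<in> cantor n" "rho n \<sigma> = rho n ?t" "\<not> evconst (n - 1) \<sigma>"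
    using rho_surj_right[of "rho n ?t"] rho_nonneg[OF t] by auto
  have "\<sigma> \<noteq> ?t" using s(3) by auto
  then have "less_fun ?t \<sigma>" using less_fun_total rho_eq_less[of \<sigma> ?t] s t by metis
  then show ?thesis using rho_between[OF t s(1)] s by metis
qed

lemma predecessor_zero:
  assumes "u \<in> words n" "u \<frown> (\<lambda>_. 0) \<noteq> (\<lambda>_. 0)"
  shows "\<exists>\<sigma>\<in>cantor n. less_fun \<sigma> (u \<frown> (\<lambda>_. 0)) \<and> \<not> (\<exists>\<xi>\<in>cantor n. less_fun \<sigma> \<xi> \<and> less_fun \<xi> (u \<frown> (\<lambda>_. 0)))"
proof -
  let ?t = "u \<frown> (\<lambda>_. 0)"
  have t: "?t \<in> cantor n" using assms by simp
  have "rho n ?t > 0" using rho_eq_0_iff[OF t] rho_nonneg[OF t] assms(2) by simp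
  then obtain \<sigma> where s: "\<sigma> \<in> cantor n" "rho n \<sigma> = rho n ?t" "\<not> evconst 0 \<sigma>"
    using rho_surj_left[of "rho n ?t"] rho_le_1[OF t] by auto
  have "\<sigma> \<noteq> ?t" using s(3) by auto
  then have "less_fun \<sigma> ?t" using less_fun_total rho_eq_less[of ?t \<sigma>] s t by metis
  then show ?thesis using rho_between[OF s(1) t] s by metis
qed

lemma order_preserving_iff:
  assumes "inj_on \<psi> (cantor n)" "order_preserving n \<psi>" "\<omega> \<in> cantor n" "\<eta> \<in> cantor n"
  shows "less_fun (\<psi> \<omega>) (\<psi> \<eta>) \<longleftrightarrow> less_fun \<omega> \<eta>"
  using assms less_fun_total[of \<omega> \<eta>] less_fun_asym less_fun_irrefl
  unfolding order_preserving_def monotone_on_def by metis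

lemma order_reversing_iff:
  assumes "inj_on \<psi> (cantor n)" "order_reversing n \<psi>" "\<omega> \<in> cantor n" "\<eta> \<in> cantor n"
  shows "less_fun (\<psi> \<omega>) (\<psi> \<eta>) \<longleftrightarrow> less_fun \<eta> \<omega>"
  using assms less_fun_total[of \<omega> \<eta>] less_fun_asym less_fun_irrefl
  unfolding order_reversing_def monotone_on_def by metis

text \<open>Cylinders are order-open, because the first and the last point of a cylinder have an immediate
  predecessor and an immediate successor (unless they are extremal).\<close>

lemma order_preserving_continuous:
  assumes b: "bij_betw \<psi> (cantor n) (cantor n)" and o: "order_preserving n \<psi>"
  shows "continuous_on (cantor n) \<psi>"
  unfolding continuous_on_discrete_word
proof safe
  fix \<omega> j assume w: "\<omega> \<in> cantor n"
  have inj: "inj_on \<psi> (cantor n)" and im: "\<psi> ` cantor n = cantor n" using b by (auto simp: bij_betw_def)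
  note oi = order_preserving_iff[OF inj o]
  have pw: "\<psi> \<omega> \<in> cantor n" using w im by blast
  define u where "u = prefix (Suc j) (\<psi> \<omega>)"
  have u: "u \<in> words n" unfolding u_def using pw by (rule prefix_in_words)
  have uw: "u \<frown> suffix (Suc j) (\<psi> \<omega>) = \<psi> \<omega>" unfolding u_def by simp
  have lo: "\<not> less_fun (\<psi> \<omega>) (u \<frown> (\<lambda>_. 0))"
    using less_fun_conc[of u "suffix (Suc j) (\<psi> \<omega>)" "\<lambda>_. 0"] uw pw not_less_zeros by simp
  have hi: "\<not> less_fun (u \<frown> (\<lambda>_. n - 1)) (\<psi> \<omega>)"
    using less_fun_conc[of u "\<lambda>_. n - 1" "suffix (Suc j) (\<psi> \<omega>)"] uw pw not_less_tops by simp
  have "\<exists>k. \<forall>\<eta>\<in>cantor n. prefix k \<eta> = prefix k \<omega> \<longrightarrow> \<not> less_fun (u \<frown> (\<lambda>_. n - 1)) (\<psi> \<eta>)"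
  proof (cases "u \<frown> (\<lambda>_. n - 1) = (\<lambda>_. n - 1)")
    case True
    have "\<not> less_fun (u \<frown> (\<lambda>_. n - 1)) (\<psi> \<eta>)" if "\<eta> \<in> cantor n" for \<eta>
      unfolding True using that im not_less_tops[of "\<psi> \<eta>"] by auto
    then show ?thesis by blast
  next
    case False
    then obtain \<sigma> where s: "\<sigma> \<in> cantor n" "less_fun (u \<frown> (\<lambda>_. n - 1)) \<sigma>"
      "\<not> (\<exists>\<xi>\<in>cantor n. less_fun (u \<frown> (\<lambda>_. n - 1)) \<xi> \<and> less_fun \<xi> \<sigma>)" using successor_top[OF u] by blast
    obtain \<tau> where t: "\<tau> \<in> cantor n" "\<psi> \<tau> = \<sigma>" using s(1) im by (metis imageE)
    \<comment> \<open>Being at most the last point of the cylinder is the same as being below its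
      successor \<sigma>. This strict inequality is pulled back to \<tau>, where it persists near
      \<omega>.\<close>
    have "less_fun (\<psi> \<omega>) \<sigma>" using hi s less_fun_total less_fun_trans by metis
    then have "less_fun \<omega> \<tau>" using oi w t by metis
    then obtain k where k: "\<forall>\<eta>. prefix k \<eta> = prefix k \<omega> \<longrightarrow> less_fun \<eta> \<tau>" using less_fun_nbhd(1) by blast
    show ?thesis
    proof (intro exI[of _ k] ballI impI notI)
      fix \<eta> assume e: "\<eta> \<in> cantor n" "prefix k \<eta> = prefix k \<omega>" "less_fun (u \<frown> (\<lambda>_. n - 1)) (\<psi> \<eta>)"
      then have "less_fun (\<psi> \<eta>) \<sigma>" using k oi t by metis
      then show False using s(3) e im by blast
    qed
  qed
  then obtain k1 where k1: "\<And>\<eta>. \<eta>\<in>cantor n \<Longrightarrow> prefix k1 \<eta> = prefix k1 \<omega> \<Longrightarrow> \<not> less_fun (u \<frown> (\<lambda>_. n - 1)) (\<psi> \<eta>)" by blast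
  have "\<exists>k. \<forall>\<eta>\<in>cantor n. prefix k \<eta> = prefix k \<omega> \<longrightarrow> \<not> less_fun (\<psi> \<eta>) (u \<frown> (\<lambda>_. 0))"
  proof (cases "u \<frown> (\<lambda>_. 0) = (\<lambda>_. 0)")
    case True
    have "\<not> less_fun (\<psi> \<eta>) (u \<frown> (\<lambda>_. 0))" if "\<eta> \<in> cantor n" for \<eta>
      unfolding True using that im not_less_zeros[of "\<psi> \<eta>"] by auto
    then show ?thesis by blast
  next
    case False
    then obtain \<sigma> where s: "\<sigma> \<in> cantor n" "less_fun \<sigma> (u \<frown> (\<lambda>_. 0))"
      "\<not> (\<exists>\<xi>\<in>cantor n. less_fun \<sigma> \<xi> \<and> less_fun \<xi> (u \<frown> (\<lambda>_. 0)))" using predecessor_zero[OF u] by blast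
    obtain \<tau> where t: "\<tau> \<in> cantor n" "\<psi> \<tau> = \<sigma>" using s(1) im by (metis imageE)
    have "less_fun \<sigma> (\<psi> \<omega>)" using lo s less_fun_total less_fun_trans by metis
    then have "less_fun \<tau> \<omega>" using oi w t by metis
    then obtain k where k: "\<forall>\<eta>. prefix k \<eta> = prefix k \<omega> \<longrightarrow> less_fun \<tau> \<eta>" using less_fun_nbhd(2) by blast
    show ?thesis
    proof (intro exI[of _ k] ballI impI notI)
      fix \<eta> assume e: "\<eta> \<in> cantor n" "prefix k \<eta> = prefix k \<omega>" "less_fun (\<psi> \<eta>) (u \<frown> (\<lambda>_. 0))"
      then have "less_fun \<sigma> (\<psi> \<eta>)" using k oi t by metis
      then show False using s(3) e im by blast
    qed
  qed
  then obtain k2 where k2: "\<And>\<eta>. \<eta>\<in>cantor n \<Longrightarrow> prefix k2 \<eta> = prefix k2 \<omega> \<Longrightarrow> \<not> less_fun (\<psi> \<eta>) (u \<frown> (\<lambda>_. 0))" by blast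
  show "\<exists>k. \<forall>\<eta>\<in>cantor n. prefix k \<eta> = prefix k \<omega> \<longrightarrow> \<psi> \<eta> j = \<psi> \<omega> j"
  proof (intro exI[of _ "max k1 k2"] ballI impI)
    fix \<eta> assume e: "\<eta> \<in> cantor n" "prefix (max k1 k2) \<eta> = prefix (max k1 k2) \<omega>"
    have "prefix k1 \<eta> = prefix k1 \<omega>" "prefix k2 \<eta> = prefix k2 \<omega>"
      using arg_cong[OF e(2), of "take k1"] arg_cong[OF e(2), of "take k2"] by (auto simp: min_def max_def split: if_splits)
    then have "prefix (length u) (\<psi> \<eta>) = u"
      using in_cylinder_between[of "\<psi> \<eta>" u] k1[OF e(1)] k2[OF e(1)] u im e(1) by auto
    then have "prefix (Suc j) (\<psi> \<eta>) = prefix (Suc j) (\<psi> \<omega>)" unfolding u_def by simp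
    from arg_cong[OF this, of "\<lambda>l. l ! j"] show "\<psi> \<eta> j = \<psi> \<omega> j" by (simp del: subseq_to_Suc)
  qed
qed

lemma flip_less: "\<omega> \<in> cantor n \<Longrightarrow> \<eta> \<in> cantor n \<Longrightarrow> less_fun (flip \<omega>) (flip \<eta>) \<longleftrightarrow> less_fun \<eta> \<omega>"
proof -
  have 1: "less_fun (flip \<eta>) (flip \<omega>)" if "less_fun \<omega> \<eta>" "\<omega> \<in> cantor n" "\<eta> \<in> cantor n" for \<omega> \<eta>
  proof -
    from that(1) obtain k where k: "\<omega> k < \<eta> k" "\<And>i. i < k \<Longrightarrow> \<omega> i = \<eta> i" by (auto elim: less_funE)
    show ?thesis unfolding less_fun_def 
      using k cantorD[OF that(2), of k] cantorD[OF that(3), of k] by (intro exI[of _ k]) (auto simp: flip_def)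
  qed
  show "\<omega> \<in> cantor n \<Longrightarrow> \<eta> \<in> cantor n \<Longrightarrow> less_fun (flip \<omega>) (flip \<eta>) \<longleftrightarrow> less_fun \<eta> \<omega>"
    using 1[of \<eta> \<omega>] 1[of "flip \<omega>" "flip \<eta>"] by auto
qed

lemma flip_bij: "bij_betw flip (cantor n) (cantor n)"
  by (rule bij_betwI[of _ _ _ flip]) auto

lemma flip_continuous: "continuous_on (cantor n) flip"
  unfolding continuous_on_discrete_word
proof safe
  fix \<omega> j
  show "\<exists>k. \<forall>\<eta>\<in>cantor n. prefix k \<eta> = prefix k \<omega> \<longrightarrow> flip \<eta> j = flip \<omega> j"
  proof (intro exI[of _ "Suc j"] ballI impI)
    fix \<eta> assume "prefix (Suc j) \<eta> = prefix (Suc j) \<omega>"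
    from arg_cong[OF this, of "\<lambda>l. l ! j"] show "flip \<eta> j = flip \<omega> j" by (simp add: flip_def del: subseq_to_Suc)
  qed
qed

lemma order_reversing_flip:
  assumes "bij_betw \<psi> (cantor n) (cantor n)"
  shows "order_reversing n \<psi> \<longleftrightarrow> order_preserving n (flip \<circ> \<psi>)"
proof -
  have "\<psi> \<omega> \<in> cantor n" if "\<omega> \<in> cantor n" for \<omega> using assms that by (auto simp: bij_betw_def)
  then show ?thesis unfolding order_reversing_def order_preserving_def monotone_on_def by (auto simp: flip_less)
qed

lemma monotone_continuous:
  assumes b: "bij_betw \<psi> (cantor n) (cantor n)" and o: "order_preserving n \<psi> \<or> order_reversing n \<psi>"
  shows "continuous_on (cantor n) \<psi>"
  using o
proof
  assume r: "order_reversing n \<psi>"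
  have b': "bij_betw (flip \<circ> \<psi>) (cantor n) (cantor n)" using b flip_bij by (rule bij_betw_trans)
  have "continuous_on (cantor n) (flip \<circ> \<psi>)"
    using order_preserving_continuous[OF b'] r order_reversing_flip[OF b] by blast
  then have "continuous_on (cantor n) (flip \<circ> (flip \<circ> \<psi>))"
    using b' flip_continuous by (intro continuous_on_compose[of _ "flip \<circ> \<psi>" flip]) (auto simp: bij_betw_def)
  moreover have "(flip \<circ> (flip \<circ> \<psi>)) \<omega> = \<psi> \<omega>" if "\<omega> \<in> cantor n" for \<omega>
    using that flip_flip[of "\<psi> \<omega>"] bij_betwE[OF b] by simp
  ultimately show ?thesis using continuous_on_cong[of "cantor n" "cantor n" "flip \<circ> (flip \<circ> \<psi>)" \<psi>] by auto
qed (use order_preserving_continuous[OF b] in blast)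

lemma monotone_inv:
  assumes b: "bij_betw \<psi> (cantor n) (cantor n)"
  shows "order_preserving n \<psi> \<Longrightarrow> order_preserving n (inv_into (cantor n) \<psi>)"
    "order_reversing n \<psi> \<Longrightarrow> order_reversing n (inv_into (cantor n) \<psi>)"
proof -
  have inj: "inj_on \<psi> (cantor n)" using b by (simp add: bij_betw_def)
  have *: "inv_into (cantor n) \<psi> \<omega> \<in> cantor n" "\<psi> (inv_into (cantor n) \<psi> \<omega>) = \<omega>" if "\<omega> \<in> cantor n" for \<omega>
    using b that by (auto simp: bij_betw_def inv_into_into f_inv_into_f)
  show "order_preserving n \<psi> \<Longrightarrow> order_preserving n (inv_into (cantor n) \<psi>)"
    unfolding order_preserving_def[of n "inv_into (cantor n) \<psi>"] monotone_on_def using order_preserving_iff[OF inj] * by metis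
  show "order_reversing n \<psi> \<Longrightarrow> order_reversing n (inv_into (cantor n) \<psi>)"
    unfolding order_reversing_def[of n "inv_into (cantor n) \<psi>"] monotone_on_def using order_reversing_iff[OF inj] * by metis
qed

text \<open>Continuity comes for free for the map and for its inverse, as both are monotone
  bijections.\<close>

lemma monotone_HomeoC:
  assumes b: "bij_betw \<psi> (cantor n) (cantor n)" and o: "order_preserving n \<psi> \<or> order_reversing n \<psi>"
    and e: "\<psi> \<in> extensional (cantor n)"
  shows "\<psi> \<in> carrier (HomeoC n)"
  unfolding homeo_group_carrier_iff
  using b e monotone_continuous[OF b o] monotone_continuous[OF bij_betw_inv_into[OF b]] monotone_inv[OF b] o by blast

text \<open>By \<open>rho_between\<close> the identified pairs are the adjacent ones, and a monotone
  bijection carries adjacent points to adjacent points.\<close>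

lemma monotone_preserves_rho:
  assumes b: "bij_betw \<psi> (cantor n) (cantor n)" and o: "order_preserving n \<psi> \<or> order_reversing n \<psi>"
  shows "preserves_rho_relation n \<psi>"
proof -
  have inj: "inj_on \<psi> (cantor n)" and im: "\<psi> ` cantor n = cantor n" using b by (auto simp: bij_betw_def)
  have main: "rho n \<omega> = rho n \<eta> \<longleftrightarrow> rho n (\<psi> \<omega>) = rho n (\<psi> \<eta>)" if "\<omega> \<in> cantor n" "\<eta> \<in> cantor n" "less_fun \<omega> \<eta>" for \<omega> \<eta>
  proof -
    have m: "\<psi> \<omega> \<in> cantor n" "\<psi> \<eta> \<in> cantor n" using im that by auto
    show ?thesis using o
    proof
      assume o: "order_preserving n \<psi>"
      note oi = order_preserving_iff[OF inj o]
      have "(\<exists>\<xi>\<in>cantor n. less_fun \<omega> \<xi> \<and> less_fun \<xi> \<eta>) \<longleftrightarrow> (\<exists>\<xi>\<in>cantor n. less_fun (\<psi> \<omega>) \<xi> \<and> less_fun \<xi> (\<psi> \<eta>))"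
      proof -
        have "(\<exists>\<xi>\<in>cantor n. less_fun (\<psi> \<omega>) \<xi> \<and> less_fun \<xi> (\<psi> \<eta>)) \<longleftrightarrow> (\<exists>\<xi>\<in>\<psi> ` cantor n. less_fun (\<psi> \<omega>) \<xi> \<and> less_fun \<xi> (\<psi> \<eta>))" unfolding im ..
        also have "\<dots> \<longleftrightarrow> (\<exists>\<xi>\<in>cantor n. less_fun \<omega> \<xi> \<and> less_fun \<xi> \<eta>)" using oi that by auto
        finally show ?thesis by blast
      qed
      moreover have "less_fun (\<psi> \<omega>) (\<psi> \<eta>)" using oi that by blast
      ultimately show ?thesis using rho_between[OF that] rho_between[OF m] by simp
    next
      assume o: "order_reversing n \<psi>"
      note oi = order_reversing_iff[OF inj o]
      have "(\<exists>\<xi>\<in>cantor n. less_fun \<omega> \<xi> \<and> less_fun \<xi> \<eta>) \<longleftrightarrow> (\<exists>\<xi>\<in>cantor n. less_fun (\<psi> \<eta>) \<xi> \<and> less_fun \<xi> (\<psi> \<omega>))"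
      proof -
        have "(\<exists>\<xi>\<in>cantor n. less_fun (\<psi> \<eta>) \<xi> \<and> less_fun \<xi> (\<psi> \<omega>)) \<longleftrightarrow> (\<exists>\<xi>\<in>\<psi> ` cantor n. less_fun (\<psi> \<eta>) \<xi> \<and> less_fun \<xi> (\<psi> \<omega>))" unfolding im ..
        also have "\<dots> \<longleftrightarrow> (\<exists>\<xi>\<in>cantor n. less_fun \<omega> \<xi> \<and> less_fun \<xi> \<eta>)" using oi that by auto
        finally show ?thesis by blast
      qed
      moreover have "less_fun (\<psi> \<eta>) (\<psi> \<omega>)" using oi that by blast
      ultimately show ?thesis using rho_between[OF that] rho_between[OF m(2,1)] by (simp add: eq_commute)
    qed
  qed
  show ?thesis unfolding preserves_rho_relation_def
  proof safe
    fix \<omega> \<eta> assume c: "\<omega> \<in> cantor n" "\<eta> \<in> cantor n"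
    show "rho n (\<psi> \<omega>) = rho n (\<psi> \<eta>)" if "rho n \<omega> = rho n \<eta>"
      using main[of \<omega> \<eta>] main[of \<eta> \<omega>] less_fun_total[of \<omega> \<eta>] c that by (cases "\<omega> = \<eta>") auto
    show "rho n \<omega> = rho n \<eta>" if "rho n (\<psi> \<omega>) = rho n (\<psi> \<eta>)"
      using main[of \<omega> \<eta>] main[of \<eta> \<omega>] less_fun_total[of \<omega> \<eta>] c that by (cases "\<omega> = \<eta>") auto
  qed
qed

end

section \<open>Lifting from the interval to the Cantor space\<close>

lemma Homeo01_monotone:
  assumes "a \<in> carrier Homeo01"
  shows "strict_mono_on {0<..<1} a \<or> strict_antimono_on {0<..<1} a"
  using assms injective_eq_monotone_map[of "{0<..<1}" a]
  by (auto simp: homeo_group_carrier_iff bij_betw_def is_interval_oo)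

lemma strict_mono_on_bij_continuous:
  fixes a :: "real \<Rightarrow> real"
  assumes "bij_betw a {0<..<1} {0<..<1}" "strict_mono_on {0<..<1} a"
  shows "continuous_on {0<..<1} a"
proof (rule continuous_onI_mono)
  show "open (a ` {0<..<1})" using assms(1) by (simp add: bij_betw_def)
  show "a x \<le> a y" if "x \<in> {0<..<1}" "y \<in> {0<..<1}" "x \<le> y" for x y
    using strict_mono_on_leD[OF assms(2)] that by blast
qed

lemma strict_mono_on_inv_into:
  fixes a :: "'a::linorder \<Rightarrow> 'b::linorder"
  assumes "bij_betw a S T" "strict_mono_on S a"
  shows "strict_mono_on T (inv_into S a)"
proof (rule strict_mono_onI)
  fix x y assume xy: "x \<in> T" "y \<in> T" "x < y"
  have i: "inv_into S a x \<in> S" "inv_into S a y \<in> S" "a (inv_into S a x) = x" "a (inv_into S a y) = y"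
    using assms(1) xy by (auto simp: bij_betw_def inv_into_into f_inv_into_f)
  show "inv_into S a x < inv_into S a y"
    using strict_mono_on_less[OF assms(2) i(1,2)] i xy by simp
qed

lemma strict_mono_on_bij_Homeo01:
  assumes "bij_betw a {0<..<1} {0<..<1}" "strict_mono_on {0<..<1} a" "a \<in> extensional {0<..<1}"
  shows "a \<in> carrier Homeo01"
  unfolding homeo_group_carrier_iff
  using assms strict_mono_on_bij_continuous[OF assms(1,2)]
    strict_mono_on_bij_continuous[OF bij_betw_inv_into[OF assms(1)] strict_mono_on_inv_into[OF assms(1,2)]]
  by blast

text \<open>A continuous injection on an interval is monotone, so a homeomorphism of [0,1] permutes
  the endpoints and restricts to the open interval.\<close>

lemma homeo_Icc_interval:
  assumes "f \<in> carrier (homeo_group {0..1::real})"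
  shows "strict_mono_on {0..1} f \<or> strict_antimono_on {0..1} f"
    and "bij_betw f {0<..<1} {0<..<1}" and "interval_action f \<in> carrier Homeo01"
    and "f ` {0, 1} = {0, 1}"
proof -
  have b: "bij_betw f {0..1} {0..1}" and c: "continuous_on {0..1} f" and ci: "continuous_on {0..1} (inv_into {0..1} f)"
    using assms by (auto simp: homeo_group_carrier_iff)
  show m: "strict_mono_on {0..1} f \<or> strict_antimono_on {0..1} f"
    using injective_eq_monotone_map[of "{0..1}" f] b c by (auto simp: bij_betw_def is_interval_cc)
  have r: "f x \<in> {0..1}" if "x \<in> {0..1}" for x using b that by (auto simp: bij_betw_def)
  have s: "\<exists>x\<in>{0..1}. f x = y" if "y \<in> {0..1}" for y using b that unfolding bij_betw_def by (metis imageE)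
  show e: "f ` {0, 1} = {0, 1}"
    using m
  proof
    assume m: "strict_mono_on {0..1} f"
    have le: "f x \<le> f y" if "x \<in> {0..1}" "y \<in> {0..1}" "x \<le> y" for x y using strict_mono_on_leD[OF m] that by blast
    obtain x0 x1 where "x0 \<in> {0..1}" "f x0 = 0" "x1 \<in> {0..1}" "f x1 = 1" using s[of 0] s[of 1] by auto
    then have "f 0 = 0" "f 1 = 1" using le[of 0 x0] le[of x1 1] r[of 0] r[of 1] by auto
    then show ?thesis by auto
  next
    assume m: "strict_antimono_on {0..1} f"
    have le: "f y \<le> f x" if "x \<in> {0..1}" "y \<in> {0..1}" "x \<le> y" for x y
      using m that unfolding monotone_on_def by (cases "x = y") (auto simp: less_le)
    obtain x0 x1 where "x0 \<in> {0..1}" "f x0 = 0" "x1 \<in> {0..1}" "f x1 = 1" using s[of 0] s[of 1] by auto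
    then have "f 0 = 1" "f 1 = 0" using le[of x0 1] le[of 0 x1] r[of 0] r[of 1] by auto
    then show ?thesis by auto
  qed
  have d: "{0<..<1} = {0..1} - {0, 1::real}" by auto
  have inj: "inj_on f {0..1}" using b by (simp add: bij_betw_def)
  have "f ` {0<..<1} = f ` {0..1} - f ` {0, 1}" unfolding d by (rule inj_on_image_set_diff[OF inj]) auto
  also have "\<dots> = {0<..<1}" using b e d by (simp add: bij_betw_def)
  finally have im: "f ` {0<..<1} = {0<..<1}" .
  show b': "bij_betw f {0<..<1} {0<..<1}" using im inj by (auto simp: bij_betw_def inj_on_def)
  have b'': "bij_betw (interval_action f) {0<..<1} {0<..<1}" using b' unfolding interval_action_def by (simp add: bij_betw_cong[of "{0<..<1}" "restrict f {0<..<1}" f])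
  show "interval_action f \<in> carrier Homeo01"
    unfolding homeo_group_carrier_iff
  proof (intro conjI b'')
    show "interval_action f \<in> extensional {0<..<1}" by (simp add: interval_action_def)
    show "continuous_on {0<..<1} (interval_action f)"
      using continuous_on_subset[OF c, of "{0<..<1}"] continuous_on_cong[of "{0<..<1}" "{0<..<1}" "interval_action f" f]
      unfolding d by (auto simp: interval_action_def d)
    have "inv_into {0<..<1} (interval_action f) y = inv_into {0..1} f y" if "y \<in> {0<..<1}" for y
    proof -
      obtain x where x: "x \<in> {0<..<1}" "f x = y" using im \<open>y \<in> _\<close> by (metis imageE)
      then have "inv_into {0..1} f y = x" using inj inv_into_f_f[of f "{0..1}" x] by auto
      moreover have "inv_into {0<..<1} (interval_action f) (interval_action f x) = x"
        using x b'' by (intro inv_into_f_f) (auto simp: bij_betw_def)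
      ultimately show ?thesis using x by (simp add: interval_action_def)
    qed
    then show "continuous_on {0<..<1} (inv_into {0<..<1} (interval_action f))"
      using continuous_on_subset[OF ci, of "{0<..<1}"] 
        continuous_on_cong[of "{0<..<1}" "{0<..<1}" "inv_into {0<..<1} (interval_action f)" "inv_into {0..1} f"]
        greaterThanLessThan_subseteq_atLeastAtMost_iff[of 0 1 0 "1::real"] by simp
  qed
qed

section \<open>Lifts of homeomorphisms of (0,1)\<close>

context base_n begin

definition adic_stable :: "(real \<Rightarrow> real) \<Rightarrow> bool" where
  "adic_stable a \<longleftrightarrow> (\<forall>x\<in>{0<..<1}. a x \<in> n_adic n \<longleftrightarrow> x \<in> n_adic n)"

lemma n_adic_of_int [simp]: "of_int a \<in> n_adic n"
  unfolding n_adic_def by (auto intro!: exI[of _ a] exI[of _ "0::nat"])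

lemma n_adic_0 [simp]: "0 \<in> n_adic n" using n_adic_of_int[of 0] by simp
lemma n_adic_1 [simp]: "1 \<in> n_adic n" using n_adic_of_int[of 1] by simp

lemma n_adic_add: "x \<in> n_adic n \<Longrightarrow> y \<in> n_adic n \<Longrightarrow> x + y \<in> n_adic n"
proof -
  assume "x \<in> n_adic n" "y \<in> n_adic n"
  then obtain a b :: int and k l where "x = of_int a / real n ^ k" "y = of_int b / real n ^ l" by (auto simp: n_adic_def)
  then have "x + y = of_int (a * int n ^ l + b * int n ^ k) / real n ^ (k + l)"
    by (simp add: power_add add_divide_distrib)
  then show ?thesis unfolding n_adic_def by blast
qed

lemma n_adic_uminus: "x \<in> n_adic n \<Longrightarrow> - x \<in> n_adic n"
  unfolding n_adic_def by clarsimp (metis minus_divide_left of_int_minus)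

lemma n_adic_diff: "x \<in> n_adic n \<Longrightarrow> y \<in> n_adic n \<Longrightarrow> x - y \<in> n_adic n"
  using n_adic_add[of x "- y"] n_adic_uminus by simp

text \<open>\<open>b\<close> selects the expansion: one ending in n - 1 exists only over n-adic
  points other than 0, one not ending in n - 1 only below 1.\<close>

lemma n_adic_pick:
  assumes "0 \<le> x" "x \<le> 1" "b \<Longrightarrow> x \<in> n_adic n \<and> 0 < x" "\<not> b \<Longrightarrow> x < 1"
  shows "\<exists>\<omega>\<in>cantor n. rho n \<omega> = x \<and> (evconst (n - 1) \<omega> \<longleftrightarrow> b)"
proof (cases b)
  case True
  then obtain \<omega> where "\<omega> \<in> cantor n" "rho n \<omega> = x" "\<not> evconst 0 \<omega>" using rho_surj_left[of x] assms by auto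
  then show ?thesis using n_adic_evconst[of \<omega>] assms True by auto
next
  case False
  then show ?thesis using rho_surj_right[of x] assms by auto
qed

text \<open>A point of the Cantor space is determined by its image under \<open>\<rho>\<close> and by whether it ends in
  \<open>(n-1)\<^sup>\<omega>\<close>; the lift keeps the latter.\<close>

lemma lift_exists_mono:
  assumes b: "bij_betw a {0<..<1} {0<..<1}" and m: "strict_mono_on {0<..<1} a" and d: "adic_stable a"
  shows "\<exists>\<psi>\<in>carrier (HomeoC n). order_preserving n \<psi> \<and> (\<forall>\<omega>\<in>cantor n. rho n \<omega> \<in> {0<..<1} \<longrightarrow> rho n (\<psi> \<omega>) = a (rho n \<omega>))"
proof -
  \<comment> \<open>Extends \<open>a\<close> by the identity to the endpoints, so that all words can
    be treated alike.\<close>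
  define f where "f x = (if x \<in> {0<..<1} then a x else x)" for x
  have ar: "a x \<in> {0<..<1}" if "x \<in> {0<..<1}" for x using b that by (auto simp: bij_betw_def)
  have fr: "f x \<in> {0..1}" if "x \<in> {0..1}" for x using that ar[of x] by (auto simp: f_def)
  have fm: "f x < f y" if "x \<in> {0..1}" "y \<in> {0..1}" "x < y" for x y
    using that ar[of x] ar[of y] strict_mono_onD[OF m, of x y] by (auto simp: f_def)
  have fs: "\<exists>x\<in>{0..1}. f x = y" if "y \<in> {0..1}" for y
  proof (cases "y \<in> {0<..<1}")
    case True
    then obtain x where "x \<in> {0<..<1}" "a x = y" using b unfolding bij_betw_def by (metis imageE)
    then show ?thesis by (intro bexI[of _ x]) (auto simp: f_def)
  next
    case False
    then show ?thesis using that by (intro bexI[of _ y]) (auto simp: f_def)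
  qed
  have fd: "f x \<in> n_adic n \<longleftrightarrow> x \<in> n_adic n" if "x \<in> {0..1}" for x
    using that d by (auto simp: f_def adic_stable_def)
  have f0: "0 < f x \<longleftrightarrow> 0 < x" "f x < 1 \<longleftrightarrow> x < 1" if "x \<in> {0..1}" for x
    using that ar[of x] by (auto simp: f_def)
  have cond: "rho n \<omega> \<in> {0..1}" "evconst (n - 1) \<omega> \<Longrightarrow> rho n \<omega> \<in> n_adic n \<and> 0 < rho n \<omega>"
    "\<not> evconst (n - 1) \<omega> \<Longrightarrow> rho n \<omega> < 1" if w: "\<omega> \<in> cantor n" for \<omega>
  proof -
    show *: "rho n \<omega> \<in> {0..1}" using w by (simp add: rho_nonneg rho_le_1)
    show "evconst (n - 1) \<omega> \<Longrightarrow> rho n \<omega> \<in> n_adic n \<and> 0 < rho n \<omega>"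
      using * evconst_top_n_adic[OF w] rho_eq_0_iff[OF w] evconst_excl[of \<omega>] by fastforce
    show "\<not> evconst (n - 1) \<omega> \<Longrightarrow> rho n \<omega> < 1" using * rho_eq_1_iff[OF w] by fastforce
  qed
  have "\<exists>\<eta>\<in>cantor n. rho n \<eta> = f (rho n \<omega>) \<and> (evconst (n - 1) \<eta> \<longleftrightarrow> evconst (n - 1) \<omega>)" if w: "\<omega> \<in> cantor n" for \<omega>
    using cond[OF w] fr[of "rho n \<omega>"] fd[of "rho n \<omega>"] f0[of "rho n \<omega>"] by (intro n_adic_pick) auto
  then obtain h where h: "\<And>\<omega>. \<omega> \<in> cantor n \<Longrightarrow> h \<omega> \<in> cantor n \<and> rho n (h \<omega>) = f (rho n \<omega>) \<and> (evconst (n - 1) (h \<omega>) \<longleftrightarrow> evconst (n - 1) \<omega>)"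
    by metis
  define \<psi> where "\<psi> = restrict h (cantor n)"
  have p: "\<psi> \<omega> \<in> cantor n" "rho n (\<psi> \<omega>) = f (rho n \<omega>)" "evconst (n - 1) (\<psi> \<omega>) \<longleftrightarrow> evconst (n - 1) \<omega>" if "\<omega> \<in> cantor n" for \<omega>
    using h that by (auto simp: \<psi>_def)
  have op: "less_fun (\<psi> \<omega>) (\<psi> \<eta>)" if w: "\<omega> \<in> cantor n" "\<eta> \<in> cantor n" "less_fun \<omega> \<eta>" for \<omega> \<eta>
  proof (cases "rho n \<omega> = rho n \<eta>")
    case True
    \<comment> \<open>On a two-point fibre the value decides nothing. The tail does: the smaller
      point is the one ending in n - 1, and the lift keeps this property.\<close>
    have ee: "evconst (n - 1) \<omega> \<and> evconst 0 \<eta>" using rho_eq_less[OF w True] .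
    then have "\<psi> \<omega> \<noteq> \<psi> \<eta>" using p(3)[OF w(1)] p(3)[OF w(2)] evconst_excl by metis
    moreover have "\<not> less_fun (\<psi> \<eta>) (\<psi> \<omega>)"
      using rho_eq_less[OF p(1)[OF w(2)] p(1)[OF w(1)]] p w True ee evconst_excl by metis
    ultimately show ?thesis using less_fun_total by blast
  next
    case False
    then have "rho n \<omega> < rho n \<eta>" using rho_mono[OF w] by simp
    then have "rho n (\<psi> \<omega>) < rho n (\<psi> \<eta>)" using fm[of "rho n \<omega>" "rho n \<eta>"] cond(1) p w by auto
    then show ?thesis using rho_less_imp p w by blast
  qed
  have "\<exists>\<omega>\<in>cantor n. \<psi> \<omega> = \<eta>" if e: "\<eta> \<in> cantor n" for \<eta>
  proof -
    obtain y where y: "y \<in> {0..1}" "f y = rho n \<eta>" using fs cond(1)[OF e] by blast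
    obtain \<omega> where "\<omega> \<in> cantor n" "rho n \<omega> = y" "evconst (n - 1) \<omega> \<longleftrightarrow> evconst (n - 1) \<eta>"
      using n_adic_pick[of y "evconst (n - 1) \<eta>"] y cond[OF e] fd[OF y(1)] f0[OF y(1)] by auto
    then show ?thesis using rho_inj[OF p(1) e] p y by (intro bexI[of _ \<omega>]) auto
  qed
  moreover have "inj_on \<psi> (cantor n)"
    by (rule inj_onI) (metis op less_fun_total less_fun_irrefl)
  ultimately have bij: "bij_betw \<psi> (cantor n) (cantor n)" using p(1) by (fastforce simp: bij_betw_def image_iff)
  have o: "order_preserving n \<psi>" using op by (auto simp: order_preserving_def monotone_on_def)
  have "\<psi> \<in> carrier (HomeoC n)" using monotone_HomeoC[OF bij] o by (simp add: \<psi>_def)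
  then show ?thesis using o p by (auto simp: f_def)
qed

lemma flip_HomeoC: "restrict flip (cantor n) \<in> carrier (HomeoC n)"
proof (rule monotone_HomeoC)
  show "bij_betw (restrict flip (cantor n)) (cantor n) (cantor n)"
    using flip_bij by (simp add: bij_betw_cong[of "cantor n" "restrict flip (cantor n)" flip])
  show "order_preserving n (restrict flip (cantor n)) \<or> order_reversing n (restrict flip (cantor n))"
    by (rule disjI2) (auto simp: order_reversing_def monotone_on_def flip_less)
qed auto

text \<open>A decreasing map becomes increasing after composition with x -> 1 - x; its lift is then
  corrected by \<open>flip\<close>.\<close>

lemma lift_exists:
  assumes a: "a \<in> carrier Homeo01" and d: "adic_stable a"
  shows "\<exists>\<psi>\<in>carrier (HomeoC n). (strict_mono_on {0<..<1} a \<longrightarrow> order_preserving n \<psi>) \<and>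
    (order_preserving n \<psi> \<or> order_reversing n \<psi>) \<and>
    (\<forall>\<omega>\<in>cantor n. rho n \<omega> \<in> {0<..<1} \<longrightarrow> rho n (\<psi> \<omega>) = a (rho n \<omega>))"
proof (cases "strict_mono_on {0<..<1} a")
  case True
  then show ?thesis using lift_exists_mono[of a] a d by (auto simp: homeo_group_carrier_iff)
next
  case False
  then have anti: "strict_antimono_on {0<..<1} a" using Homeo01_monotone[OF a] by blast
  have b: "bij_betw a {0<..<1} {0<..<1}" using a by (simp add: homeo_group_carrier_iff)
  have "bij_betw (\<lambda>x. 1 - x) {0<..<1} {0<..<1::real}" by (rule bij_betwI[of _ _ _ "\<lambda>x. 1 - x"]) auto
  with b have b': "bij_betw ((\<lambda>x. 1 - x) \<circ> a) {0<..<1} {0<..<1}" by (rule bij_betw_trans)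
  have m': "strict_mono_on {0<..<1} ((\<lambda>x. 1 - x) \<circ> a)"
    using anti by (auto simp: monotone_on_def)
  have "1 - y \<in> n_adic n \<longleftrightarrow> y \<in> n_adic n" for y
    using n_adic_diff[of 1 y] n_adic_diff[of 1 "1 - y"] by auto
  then have d': "adic_stable ((\<lambda>x. 1 - x) \<circ> a)" using d by (simp add: adic_stable_def)
  obtain \<psi> where p: "\<psi> \<in> carrier (HomeoC n)" "order_preserving n \<psi>"
    "\<And>\<omega>. \<omega>\<in>cantor n \<Longrightarrow> rho n \<omega> \<in> {0<..<1} \<Longrightarrow> rho n (\<psi> \<omega>) = 1 - a (rho n \<omega>)"
    using lift_exists_mono[OF b' m' d'] by auto
  let ?F = "restrict flip (cantor n)"
  let ?P = "?F \<otimes>\<^bsub>HomeoC n\<^esub> \<psi>"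
  have P: "?P \<in> carrier (HomeoC n)" by (rule homeo_mult_closed[OF flip_HomeoC p(1)])
  have Pa: "?P \<omega> = flip (\<psi> \<omega>)" if "\<omega> \<in> cantor n" for \<omega>
    using that homeo_mult_apply[OF flip_HomeoC p(1) that] homeo_closed[OF p(1) that] by simp
  have bp: "bij_betw \<psi> (cantor n) (cantor n)" using p by (simp add: homeo_group_carrier_iff)
  have "order_reversing n ?P"
    using p(2) homeo_closed[OF p(1)] by (auto simp: order_reversing_def order_preserving_def monotone_on_def Pa flip_less)
  moreover have "rho n (?P \<omega>) = a (rho n \<omega>)" if "\<omega>\<in>cantor n" "rho n \<omega> \<in> {0<..<1}" for \<omega>
    using p(3)[OF that] rho_flip[OF homeo_closed[OF p(1) that(1)]] by (simp add: Pa that)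
  ultimately show ?thesis using P False by blast
qed

text \<open>A tail that is not eventually constant, over the letters 0 and 1, which are available
  since n is at least 2. Appended to finite words it gives a dense set of words whose values are not
  n-adic.\<close>

definition alternating :: "nat word" where "alternating = (\<lambda>j. j mod 2)"

lemma alternating_cantor [simp]: "alternating \<in> cantor n"
proof -
  have "j mod 2 < n" for j :: nat using n2 by (meson less_le_trans mod_less_divisor zero_less_numeral)
  then show ?thesis by (auto simp: alternating_def cantor_def)
qed

lemma alternating_not_evconst: "\<not> evconst c alternating"
proof
  assume "evconst c alternating"
  then obtain k where k: "suffix k alternating = (\<lambda>_. c)" by (auto simp: evconst_def)
  from fun_cong[OF k, of 0] fun_cong[OF k, of 1] have "k mod 2 = Suc k mod 2"
    by (simp add: alternating_def)
  then show False by presburger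
qed

lemma rho_alternating: "u \<in> words n \<Longrightarrow> rho n (u \<frown> alternating) \<notin> n_adic n"
  using n_adic_evconst[of "u \<frown> alternating"] alternating_not_evconst by auto

text \<open>Every cylinder contains a word ending in \<open>alternating\<close>, so the words over
  points that are not n-adic are dense. On these words \<open>rho\<close> is injective, which makes
  equalities checkable on values.\<close>

lemma continuous_eq_off_n_adic:
  fixes \<psi> \<phi> :: "nat word \<Rightarrow> nat word"
  assumes "continuous_on (cantor n) \<psi>" "continuous_on (cantor n) \<phi>"
    and e: "\<And>\<omega>. \<omega> \<in> cantor n \<Longrightarrow> rho n \<omega> \<notin> n_adic n \<Longrightarrow> \<psi> \<omega> = \<phi> \<omega>" and w: "\<omega> \<in> cantor n"
  shows "\<psi> \<omega> = \<phi> \<omega>"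
proof
  fix j
  obtain k where k: "\<forall>\<eta>\<in>cantor n. prefix k \<eta> = prefix k \<omega> \<longrightarrow> \<psi> \<eta> j = \<psi> \<omega> j"
    using assms(1) w unfolding continuous_on_discrete_word by blast
  obtain l where l: "\<forall>\<eta>\<in>cantor n. prefix l \<eta> = prefix l \<omega> \<longrightarrow> \<phi> \<eta> j = \<phi> \<omega> j"
    using assms(2) w unfolding continuous_on_discrete_word by blast
  define \<eta> where "\<eta> = prefix (max k l) \<omega> \<frown> alternating"
  have c: "\<eta> \<in> cantor n" "rho n \<eta> \<notin> n_adic n" using w rho_alternating[of "prefix (max k l) \<omega>"] by (auto simp: \<eta>_def)
  have "prefix k \<eta> = prefix k \<omega>" "prefix l \<eta> = prefix l \<omega>" by (auto simp: \<eta>_def min_def)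
  then show "\<psi> \<omega> j = \<phi> \<omega> j" using k l c e[OF c] by metis
qed

lemma lift_unique:
  assumes d: "adic_stable a" and p: "\<psi> \<in> carrier (HomeoC n)" "\<phi> \<in> carrier (HomeoC n)"
    and 1: "\<forall>\<omega>\<in>cantor n. rho n \<omega> \<in> {0<..<1} \<longrightarrow> rho n (\<psi> \<omega>) = a (rho n \<omega>)"
    and 2: "\<forall>\<omega>\<in>cantor n. rho n \<omega> \<in> {0<..<1} \<longrightarrow> rho n (\<phi> \<omega>) = a (rho n \<omega>)"
  shows "\<psi> = \<phi>"
proof (rule homeo_group_ext[OF p])
  fix \<omega> assume "\<omega> \<in> cantor n"
  then show "\<psi> \<omega> = \<phi> \<omega>"
  proof (rule continuous_eq_off_n_adic[rotated -1])
    fix \<omega> assume w: "\<omega> \<in> cantor n" "rho n \<omega> \<notin> n_adic n"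
    have "rho n \<omega> \<noteq> 0" "rho n \<omega> \<noteq> 1" using w(2) by auto
    then have r: "rho n \<omega> \<in> {0<..<1}" using rho_nonneg[OF w(1)] rho_le_1[OF w(1)] by auto
    then have "a (rho n \<omega>) \<notin> n_adic n" using d w(2) by (simp add: adic_stable_def)
    then show "\<psi> \<omega> = \<phi> \<omega>" using rho_inj_non_adic[of "\<psi> \<omega>" "\<phi> \<omega>"] 1 2 r w p homeo_closed by metis
  qed (use p in \<open>auto simp: homeo_group_carrier_iff\<close>)
qed

text \<open>The subgroup on which lifts exist and lifting is multiplicative. That the normalizer of
  F_n lies inside it is a consequence of the reconstruction, see
  \<open>interval_normalizer_adic\<close>.\<close>

definition adic_homeos :: "(real \<Rightarrow> real) set" where
  "adic_homeos = {a \<in> carrier Homeo01. adic_stable a}"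

lemma cantor_lift:
  assumes "a \<in> adic_homeos"
  shows "cantor_lift n a \<in> carrier (HomeoC n)"
    "\<omega> \<in> cantor n \<Longrightarrow> rho n \<omega> \<in> {0<..<1} \<Longrightarrow> rho n (cantor_lift n a \<omega>) = a (rho n \<omega>)"
    "strict_mono_on {0<..<1} a \<Longrightarrow> order_preserving n (cantor_lift n a)"
    "order_preserving n (cantor_lift n a) \<or> order_reversing n (cantor_lift n a)"
proof -
  have a: "a \<in> carrier Homeo01" "adic_stable a" using assms by (auto simp: adic_homeos_def)
  obtain \<psi> where p: "\<psi>\<in>carrier (HomeoC n)" "strict_mono_on {0<..<1} a \<longrightarrow> order_preserving n \<psi>"
    "order_preserving n \<psi> \<or> order_reversing n \<psi>"
    "\<forall>\<omega>\<in>cantor n. rho n \<omega> \<in> {0<..<1} \<longrightarrow> rho n (\<psi> \<omega>) = a (rho n \<omega>)" using lift_exists[OF a] by blast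
  have "cantor_lift n a = \<psi>" unfolding cantor_lift_def
    by (rule the_equality) (use p lift_unique[OF a(2)] in blast)+
  then show "cantor_lift n a \<in> carrier (HomeoC n)"
    "\<omega> \<in> cantor n \<Longrightarrow> rho n \<omega> \<in> {0<..<1} \<Longrightarrow> rho n (cantor_lift n a \<omega>) = a (rho n \<omega>)"
    "strict_mono_on {0<..<1} a \<Longrightarrow> order_preserving n (cantor_lift n a)"
    "order_preserving n (cantor_lift n a) \<or> order_reversing n (cantor_lift n a)" using p by auto
qed

lemma cantor_lift_eqI:
  assumes "a \<in> adic_homeos" "\<psi> \<in> carrier (HomeoC n)"
    "\<And>\<omega>. \<omega> \<in> cantor n \<Longrightarrow> rho n \<omega> \<in> {0<..<1} \<Longrightarrow> rho n (\<psi> \<omega>) = a (rho n \<omega>)"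
  shows "cantor_lift n a = \<psi>"
  using assms cantor_lift[of a] by (intro lift_unique[of a]) (auto simp: adic_homeos_def)

lemma subgroup_adic_homeos: "subgroup adic_homeos Homeo01"
proof (rule group.subgroupI[OF group_homeo_group])
  show "adic_homeos \<subseteq> carrier Homeo01" by (auto simp: adic_homeos_def)
  have "\<one>\<^bsub>Homeo01\<^esub> \<in> adic_homeos"
    using group.is_monoid[OF group_homeo_group, THEN monoid.one_closed] unfolding adic_homeos_def adic_stable_def
    by (auto simp: homeo_one)
  then show "adic_homeos \<noteq> {}" by blast
next
  fix f assume f: "f \<in> adic_homeos"
  then have f': "f \<in> carrier Homeo01" by (simp add: adic_homeos_def)
  have "(inv\<^bsub>Homeo01\<^esub> f) x \<in> n_adic n \<longleftrightarrow> x \<in> n_adic n" if "x \<in> {0<..<1}" for x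
  proof -
    have "f ((inv\<^bsub>Homeo01\<^esub> f) x) \<in> n_adic n \<longleftrightarrow> (inv\<^bsub>Homeo01\<^esub> f) x \<in> n_adic n"
      using f homeo_closed[OF homeo_inv_closed[OF f'] that] by (simp add: adic_homeos_def adic_stable_def)
    then show ?thesis unfolding homeo_inv_apply(1)[OF f' that] ..
  qed
  then show "inv\<^bsub>Homeo01\<^esub> f \<in> adic_homeos" using homeo_inv_closed[OF f'] by (auto simp: adic_homeos_def adic_stable_def)
next
  fix f g assume "f \<in> adic_homeos" "g \<in> adic_homeos"
  then show "f \<otimes>\<^bsub>Homeo01\<^esub> g \<in> adic_homeos"
    using homeo_mult_closed[of f "{0<..<1}" g] homeo_closed[of g "{0<..<1}"]
    by (auto simp: adic_homeos_def adic_stable_def homeo_mult_apply)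
qed

lemma rho_open_iff: "\<omega> \<in> cantor n \<Longrightarrow> rho n \<omega> \<in> {0<..<1} \<longleftrightarrow> rho n \<omega> \<noteq> 0 \<and> rho n \<omega> \<noteq> 1"
  using rho_nonneg[of \<omega>] rho_le_1[of \<omega>] by auto

lemma cantor_lift_mult:
  assumes a: "a \<in> adic_homeos" "b \<in> adic_homeos"
  shows "cantor_lift n (a \<otimes>\<^bsub>Homeo01\<^esub> b) = cantor_lift n a \<otimes>\<^bsub>HomeoC n\<^esub> cantor_lift n b"
proof (rule cantor_lift_eqI)
  have c: "a \<in> carrier Homeo01" "b \<in> carrier Homeo01" using a by (auto simp: adic_homeos_def)
  show "a \<otimes>\<^bsub>Homeo01\<^esub> b \<in> adic_homeos" using subgroup.m_closed[OF subgroup_adic_homeos a] .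
  show "cantor_lift n a \<otimes>\<^bsub>HomeoC n\<^esub> cantor_lift n b \<in> carrier (HomeoC n)"
    by (rule homeo_mult_closed) (use a cantor_lift in auto)
  fix \<omega> assume w: "\<omega> \<in> cantor n" "rho n \<omega> \<in> {0<..<1}"
  have "rho n (cantor_lift n b \<omega>) \<in> {0<..<1}" using cantor_lift(2)[OF a(2) w] homeo_closed[OF c(2) w(2)] by simp
  then show "rho n ((cantor_lift n a \<otimes>\<^bsub>HomeoC n\<^esub> cantor_lift n b) \<omega>) = (a \<otimes>\<^bsub>Homeo01\<^esub> b) (rho n \<omega>)"
    using w a c cantor_lift homeo_closed[OF cantor_lift(1)[OF a(2)] w(1)] 
    by (simp add: homeo_mult_apply[OF cantor_lift(1)[OF a(1)] cantor_lift(1)[OF a(2)]] homeo_mult_apply[OF c])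
qed

lemma cantor_lift_inj: "inj_on (cantor_lift n) adic_homeos"
proof (rule inj_onI)
  fix a b assume a: "a \<in> adic_homeos" "b \<in> adic_homeos" and e: "cantor_lift n a = cantor_lift n b"
  then have c: "a \<in> carrier Homeo01" "b \<in> carrier Homeo01" by (auto simp: adic_homeos_def)
  show "a = b"
  proof (rule homeo_group_ext[OF c])
    fix x :: real assume x: "x \<in> {0<..<1}"
    then obtain \<omega> where "\<omega> \<in> cantor n" "rho n \<omega> = x" using rho_surj[of x] by auto
    then show "a x = b x" using cantor_lift(2)[OF a(1), of \<omega>] cantor_lift(2)[OF a(2), of \<omega>] e x by simp
  qed
qed

section \<open>Descending from the Cantor space to the interval\<close>

lemma rho_split:
  "\<omega> \<in> cantor n \<Longrightarrow> rho n \<omega> = (real (word_num n (prefix k \<omega>)) + rho n (suffix k \<omega>)) / real n ^ k"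
  using rho_conc[of "prefix k \<omega>" "suffix k \<omega>"] by simp

lemma rho_continuous: "continuous_on (cantor n) (rho n)"
proof (rule continuous_on_wordI)
  fix \<omega> and e :: real assume w: "\<omega> \<in> cantor n" and e: "e > 0"
  obtain k where k: "(1 / real n) ^ k < e" using real_arch_pow_inv[OF e, of "1 / real n"] n2 by auto
  show "\<exists>k. \<forall>\<eta>\<in>cantor n. prefix k \<eta> = prefix k \<omega> \<longrightarrow> dist (rho n \<eta>) (rho n \<omega>) < e"
  proof (intro exI[of _ k] ballI impI)
    fix \<eta> assume h: "\<eta> \<in> cantor n" "prefix k \<eta> = prefix k \<omega>"
    have 1: "rho n \<eta> = (real (word_num n (prefix k \<omega>)) + rho n (suffix k \<eta>)) / real n ^ k"
      using rho_split[OF h(1), of k] unfolding h(2) .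
    have 2: "rho n \<omega> = (real (word_num n (prefix k \<omega>)) + rho n (suffix k \<omega>)) / real n ^ k"
      using rho_split[OF w] .
    have "rho n \<eta> - rho n \<omega> = (rho n (suffix k \<eta>) - rho n (suffix k \<omega>)) * (1 / real n) ^ k"
      unfolding 1 2 by (simp add: field_simps)
    moreover have "\<bar>rho n (suffix k \<eta>) - rho n (suffix k \<omega>)\<bar> \<le> 1"
      using rho_nonneg[of "suffix k \<eta>"] rho_le_1[of "suffix k \<eta>"] rho_nonneg[of "suffix k \<omega>"] rho_le_1[of "suffix k \<omega>"] h w by auto
    ultimately have "\<bar>rho n \<eta> - rho n \<omega>\<bar> \<le> 1 * (1 / real n) ^ k"
      by (simp add: abs_mult mult_left_le_one_le)
    then show "dist (rho n \<eta>) (rho n \<omega>) < e" using k by (simp add: dist_real_def)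
  qed
qed

lemma rho_image: "rho n ` cantor n = {0..1}"
  using rho_surj by (auto simp: rho_nonneg rho_le_1 image_iff) (metis)

text \<open>The interval is the quotient of the compact Cantor space by the fibres of
  \<open>rho\<close>, so a map compatible with the fibres passes to the quotient. Preservation in
  both directions makes the result injective, and compactness gives continuity of it and of its
  inverse.\<close>

lemma descend:
  assumes p: "\<psi> \<in> carrier (HomeoC n)" and r: "preserves_rho_relation n \<psi>"
  shows "\<exists>f\<in>carrier (homeo_group {0..1}). \<forall>\<omega>\<in>cantor n. rho n (\<psi> \<omega>) = f (rho n \<omega>)"
proof -
  have bp: "bij_betw \<psi> (cantor n) (cantor n)" and cp: "continuous_on (cantor n) \<psi>" using p by (auto simp: homeo_group_carrier_iff)
  have pc: "\<psi> \<omega> \<in> cantor n" if "\<omega> \<in> cantor n" for \<omega> using homeo_closed[OF p that] .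
  define s where "s x = (SOME \<omega>. \<omega> \<in> cantor n \<and> rho n \<omega> = x)" for x
  have s: "s x \<in> cantor n \<and> rho n (s x) = x" if "x \<in> {0..1}" for x
  proof -
    from that have "\<exists>\<omega>\<in>cantor n. rho n \<omega> = x" using rho_surj[of x] by simp
    then obtain \<omega> where "\<omega> \<in> cantor n \<and> rho n \<omega> = x" by blast
    then show ?thesis unfolding s_def by (rule someI[of "\<lambda>\<omega>. \<omega> \<in> cantor n \<and> rho n \<omega> = x"])
  qed
  define f where "f = (\<lambda>x\<in>{0..1}. rho n (\<psi> (s x)))"
  have f: "f (rho n \<omega>) = rho n (\<psi> \<omega>)" if "\<omega> \<in> cantor n" for \<omega>
  proof -
    have i: "rho n \<omega> \<in> {0..1}" using rho_image that by blast
    have "rho n (s (rho n \<omega>)) = rho n \<omega>" using s[OF i] by simp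
    then show ?thesis using r s[OF i] that i unfolding preserves_rho_relation_def f_def by auto
  qed
  have im: "f ` {0..1} = {0..1}"
  proof -
    have "f ` {0..1} = f ` (rho n ` cantor n)" by (simp add: rho_image)
    also have "\<dots> = rho n ` (\<psi> ` cantor n)" by (auto simp: image_image f intro!: image_cong)
    also have "\<psi> ` cantor n = cantor n" using bp by (simp add: bij_betw_def)
    finally show ?thesis by (simp add: rho_image)
  qed
  have inj: "inj_on f {0..1}"
  proof (rule inj_onI)
    fix x y assume xy: "x \<in> {0..1}" "y \<in> {0..1}" "f x = f y"
    then have "rho n (\<psi> (s x)) = rho n (\<psi> (s y))" by (simp add: f_def)
    then have "rho n (s x) = rho n (s y)" using r s[OF xy(1)] s[OF xy(2)] unfolding preserves_rho_relation_def by blast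
    then show "x = y" using s[OF xy(1)] s[OF xy(2)] by simp
  qed
  have cont: "continuous_on {0..1} f"
  proof (subst continuous_on_closed_vimage)
    show "\<forall>B. closed B \<longrightarrow> closed (f -` B \<inter> {0..1})"
    proof safe
      fix B :: "real set" assume B: "closed B"
      have "continuous_on (cantor n) (rho n \<circ> \<psi>)"
        using bp by (intro continuous_on_compose cp) (simp add: bij_betw_def rho_continuous)
      then have "closedin (top_of_set (cantor n)) (cantor n \<inter> (rho n \<circ> \<psi>) -` B)"
        using B by (rule continuous_closedin_preimage)
      \<comment> \<open>By compactness \<open>rho\<close> is a closed map, so the preimage of
        \<open>B\<close> under \<open>f\<close> is closed, being the image of a closed set of
        words.\<close>
      then have "compact ((rho n \<circ> \<psi>) -` B \<inter> cantor n)"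
        using closedin_compact[OF compact_cantor] by (simp add: Int_commute)
      then have "compact (rho n ` ((rho n \<circ> \<psi>) -` B \<inter> cantor n))"
        by (rule compact_continuous_image[rotated]) (rule continuous_on_subset[OF rho_continuous], auto)
      moreover have "rho n ` ((rho n \<circ> \<psi>) -` B \<inter> cantor n) = f -` B \<inter> {0..1}"
      proof safe
        fix x assume x: "f x \<in> B" "x \<in> {0..1}"
        then show "x \<in> rho n ` ((rho n \<circ> \<psi>) -` B \<inter> cantor n)"
          using s[OF x(2)] f[of "s x"] by (intro image_eqI[of _ _ "s x"]) auto
      qed (use f rho_image in auto)
      ultimately show "closed (f -` B \<inter> {0..1})" using compact_imp_closed by metis
    qed
  qed auto
  obtain g where "homeomorphism {0..1} {0..1} f g" using homeomorphism_compact[OF _ cont im inj] by auto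
  then have "f \<in> carrier (homeo_group {0..1})"
    using inj im by (auto simp: homeo_group_def Bij_def bij_betw_def f_def)
  then show ?thesis using f[symmetric] by (intro bexI[of _ f]) simp_all
qed

text \<open>Inside (0,1) the n-adic points are those with two preimages under \<open>rho\<close>, a
  property that survives any bijection compatible with the fibres.\<close>

lemma descend_adic_stable:
  assumes p: "\<psi> \<in> carrier (HomeoC n)" and r: "preserves_rho_relation n \<psi>"
    and f: "f \<in> carrier (homeo_group {0..1})" "\<forall>\<omega>\<in>cantor n. rho n (\<psi> \<omega>) = f (rho n \<omega>)"
  shows "interval_action f \<in> adic_homeos" "cantor_lift n (interval_action f) = \<psi>"
proof -
  have bp: "bij_betw \<psi> (cantor n) (cantor n)" using p by (auto simp: homeo_group_carrier_iff)
  note H = homeo_Icc_interval(2,3)[OF f(1)]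
  have ia: "interval_action f x = f x" if "x \<in> {0<..<1}" for x using that by (simp add: interval_action_def)
  have injf: "inj_on f {0..1}" using f(1) by (simp add: homeo_group_carrier_iff bij_betw_def)
  have "interval_action f x \<in> n_adic n \<longleftrightarrow> x \<in> n_adic n" if x: "x \<in> {0<..<1}" for x
  proof -
    have fx: "f x \<in> {0<..<1}" using H(1) x by (auto simp: bij_betw_def)
    have "x \<in> n_adic n \<longleftrightarrow> (\<exists>\<omega>\<in>cantor n. \<exists>\<eta>\<in>cantor n. \<omega> \<noteq> \<eta> \<and> rho n \<omega> = x \<and> rho n \<eta> = x)"
      using n_adic_two_preimages x by simp
    also have "\<dots> \<longleftrightarrow> (\<exists>\<omega>\<in>cantor n. \<exists>\<eta>\<in>cantor n. \<psi> \<omega> \<noteq> \<psi> \<eta> \<and> rho n (\<psi> \<omega>) = f x \<and> rho n (\<psi> \<eta>) = f x)"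
    proof -
      have "rho n \<omega> = x \<longleftrightarrow> rho n (\<psi> \<omega>) = f x" if "\<omega> \<in> cantor n" for \<omega>
        using that f(2) injf x rho_nonneg[OF that] rho_le_1[OF that] by (auto simp: inj_on_def)
      moreover have "\<omega> \<noteq> \<eta> \<longleftrightarrow> \<psi> \<omega> \<noteq> \<psi> \<eta>" if "\<omega> \<in> cantor n" "\<eta> \<in> cantor n" for \<omega> \<eta>
        using that bp by (auto simp: bij_betw_def inj_on_def)
      ultimately show ?thesis by blast
    qed
    also have "\<dots> \<longleftrightarrow> (\<exists>\<omega>\<in>\<psi> ` cantor n. \<exists>\<eta>\<in>\<psi> ` cantor n. \<omega> \<noteq> \<eta> \<and> rho n \<omega> = f x \<and> rho n \<eta> = f x)" by auto
    also have "\<dots> \<longleftrightarrow> f x \<in> n_adic n" using n_adic_two_preimages[of "f x"] fx bp by (simp add: bij_betw_def)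
    finally show ?thesis using ia[OF x] by simp
  qed
  then show A: "interval_action f \<in> adic_homeos" using H(2) by (simp add: adic_homeos_def adic_stable_def)
  show "cantor_lift n (interval_action f) = \<psi>"
    by (rule cantor_lift_eqI[OF A p]) (simp add: f(2) ia)
qed

lemma cantor_lift_preserves_rho: "a \<in> adic_homeos \<Longrightarrow> preserves_rho_relation n (cantor_lift n a)"
  using cantor_lift[of a] monotone_preserves_rho[of "cantor_lift n a"] by (auto simp: homeo_group_carrier_iff)

lemma cantor_lift_image: "cantor_lift n ` adic_homeos = {\<psi> \<in> carrier (HomeoC n). preserves_rho_relation n \<psi>}"
proof safe
  fix \<psi> assume p: "\<psi> \<in> carrier (HomeoC n)" "preserves_rho_relation n \<psi>"
  then obtain f where "f\<in>carrier (homeo_group {0..1})" "\<forall>\<omega>\<in>cantor n. rho n (\<psi> \<omega>) = f (rho n \<omega>)" using descend by blast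
  from descend_adic_stable[OF p this] show "\<psi> \<in> cantor_lift n ` adic_homeos" by blast
qed (use cantor_lift cantor_lift_preserves_rho in auto)

end

section \<open>Piecewise linear maps and prefix replacements\<close>

primrec all_words :: "nat \<Rightarrow> nat \<Rightarrow> nat list list" where
  "all_words n 0 = [[]]"
| "all_words n (Suc N) = concat (map (\<lambda>i. map ((#) i) (all_words n N)) [0..<n])"

lemma set_all_words: "set (all_words n N) = {u \<in> words n. length u = N}"
proof (induction N)
  case (Suc N)
  have "u \<in> set (all_words n (Suc N)) \<longleftrightarrow> u \<in> {u \<in> words n. length u = Suc N}" for u
    by (cases u) (auto simp: Suc)
  then show ?case by blast
qed auto

lemma sorted_wrt_concat_upt:
  assumes "\<And>i. i < m \<Longrightarrow> sorted_wrt P (f i)" "\<And>i j x y. i < j \<Longrightarrow> j < m \<Longrightarrow> x \<in> set (f i) \<Longrightarrow> y \<in> set (f j) \<Longrightarrow> P x y"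
  shows "sorted_wrt P (concat (map f [0..<m]))"
  using assms
proof (induction m)
  case (Suc m)
  have "sorted_wrt P (concat (map f [0..<m]))" by (rule Suc.IH) (use Suc.prems in auto)
  then show ?case using Suc.prems by (auto simp: sorted_wrt_append)
qed simp

text \<open>Order of whole cylinders. Under \<open>lexord\<close> a proper prefix is smaller than
  its extensions; here only words with disjoint cylinders are related, so a sorted list already has
  pairwise disjoint cylinders.\<close>

definition word_less :: "nat list \<Rightarrow> nat list \<Rightarrow> bool" where
  "word_less u v \<longleftrightarrow> (\<forall>\<omega> \<eta>. less_fun (u \<frown> \<omega>) (v \<frown> \<eta>))"

lemma word_less_Cons: "word_less u v \<Longrightarrow> word_less (i # u) (i # v)"
proof -
  assume h: "word_less u v"
  have "less_fun ([i] \<frown> (u \<frown> \<omega>)) ([i] \<frown> (v \<frown> \<eta>))" for \<omega> \<eta>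
    unfolding less_fun_conc using h by (simp add: word_less_def)
  then show ?thesis by (simp add: word_less_def)
qed

lemma word_less_first: "i < j \<Longrightarrow> word_less (i # u) (j # v)"
  using less_fun_diff[of i j "[]"] by (auto simp: word_less_def)

lemma sorted_all_words: "sorted_wrt word_less (all_words n N)"
proof (induction N)
  case (Suc N)
  have "sorted_wrt word_less (map ((#) i) (all_words n N))" for i
    unfolding sorted_wrt_map by (rule sorted_wrt_mono_rel[OF _ Suc]) (rule word_less_Cons)
  then show ?case unfolding all_words.simps
    by (intro sorted_wrt_concat_upt) (auto intro: word_less_first)
qed simp

lemma word_less_append: "word_less u v \<Longrightarrow> word_less (u @ a) (v @ b)"
  unfolding word_less_def by (metis conc_conc)

lemma not_word_less_prefix: "\<not> word_less u (u @ w)" "\<not> word_less (u @ w) u"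
proof -
  have "u \<frown> (w \<frown> (\<lambda>_. 0)) = (u @ w) \<frown> (\<lambda>_. 0)" by simp
  then show "\<not> word_less u (u @ w)" "\<not> word_less (u @ w) u"
    unfolding word_less_def using less_fun_irrefl by metis+
qed

lemma lexord_word_less:
  assumes "(v, u) \<in> lexord less_than" shows "(\<exists>w. u = v @ w) \<or> word_less v u"
proof -
  from assms consider a x where "u = v @ a # x" | p a b x y where "a < b" "v = p @ a # x" "u = p @ b # y"
    by (auto simp: lexord_def)
  then show ?thesis
  proof cases
    case (2 p a b x y)
    then have "word_less v u" using less_fun_diff[of a b p] by (auto simp: word_less_def)
    then show ?thesis ..
  qed blast
qed

lemma word_lexord_linear: "(u, v) \<in> lexord less_than \<or> u = v \<or> (v, u) \<in> lexord less_than" for u v :: "nat list"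
proof -
  have "\<forall>a b. (a, b) \<in> less_than \<or> a = b \<or> (b, a) \<in> less_than" by auto
  from lexord_linear[OF this] show ?thesis by blast
qed

lemma word_less_lexord:
  assumes "word_less u v" shows "(u, v) \<in> lexord less_than"
proof (rule ccontr)
  assume n: "(u, v) \<notin> lexord less_than"
  have "(v, u) \<in> lexord less_than \<or> u = v"
    using word_lexord_linear[of u v] n by blast
  then show False
  proof
    assume "(v, u) \<in> lexord less_than"
    then consider w where "u = v @ w" | "word_less v u" using lexord_word_less by blast
    then show False
    proof cases
      case 1 then show False using assms not_word_less_prefix by metis
    next
      case 2 then show False using assms less_fun_asym unfolding word_less_def by blast
    qed
  qed (use assms not_word_less_prefix(1)[of u "[]"] in simp)
qed

lemma complete_prefix_codeI:
  assumes "set us \<subseteq> words n" "sorted_wrt word_less us" "\<And>\<omega>. \<omega> \<in> cantor n \<Longrightarrow> \<exists>u\<in>set us. \<omega> \<in> cylinder n u"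
  shows "complete_prefix_code n us"
  unfolding complete_prefix_code_def
proof (intro conjI ballI)
  show "sorted_wrt (\<lambda>u v. (u, v) \<in> lexord less_than) us"
    by (rule sorted_wrt_mono_rel[OF _ assms(2)]) (rule word_less_lexord)
  fix \<omega> assume "\<omega> \<in> cantor n"
  then obtain i where i: "i < length us" "\<omega> \<in> cylinder n (us ! i)" using assms(3) by (metis in_set_conv_nth)
  show "\<exists>!i. i < length us \<and> \<omega> \<in> cylinder n (us ! i)"
  proof (rule ex1I[of _ i])
    fix j assume j: "j < length us \<and> \<omega> \<in> cylinder n (us ! j)"
    obtain a where a: "\<omega> = us ! i \<frown> a" using i by (auto simp: cylinder_def)
    obtain b where "\<omega> = us ! j \<frown> b" using j by (auto simp: cylinder_def)
    note ab = a this
    show "j = i"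
    proof (rule ccontr)
      assume "j \<noteq> i"
      then have "word_less (us ! i) (us ! j) \<or> word_less (us ! j) (us ! i)"
        using assms(2) i j by (metis linorder_neqE_nat sorted_wrt_nth_less)
      then show False unfolding word_less_def using ab less_fun_irrefl by metis
    qed
  qed (use i in auto)
qed (use assms in auto)

context base_n begin

definition replaces :: "(nat word \<Rightarrow> nat word) \<Rightarrow> nat list \<Rightarrow> nat list \<Rightarrow> bool" where
  "replaces f u v \<longleftrightarrow> u \<in> words n \<and> v \<in> words n \<and> (\<forall>\<eta>\<in>cantor n. f (u \<frown> \<eta>) = v \<frown> \<eta>)"

text \<open>A description without codes, which behaves well under composition and inversion. A
  finite code is recovered by compactness in \<open>locally_prefix_replacement\<close>.\<close>

definition locally_replacing :: "(nat word \<Rightarrow> nat word) \<Rightarrow> bool" where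
  "locally_replacing f \<longleftrightarrow> (\<forall>\<omega>\<in>cantor n. \<exists>k v. replaces f (prefix k \<omega>) v)"

lemma replaces_append: "replaces f u v \<Longrightarrow> w \<in> words n \<Longrightarrow> replaces f (u @ w) (v @ w)"
  unfolding replaces_def
proof (intro conjI ballI)
  assume h: "u \<in> words n \<and> v \<in> words n \<and> (\<forall>\<eta>\<in>cantor n. f (u \<frown> \<eta>) = v \<frown> \<eta>)" "w \<in> words n"
  fix \<eta> assume "\<eta> \<in> cantor n"
  then have "f (u \<frown> (w \<frown> \<eta>)) = v \<frown> (w \<frown> \<eta>)" using h by (simp del: conc_conc)
  then show "f ((u @ w) \<frown> \<eta>) = (v @ w) \<frown> \<eta>" by simp
qed auto

lemma locally_replacing_uniform:
  assumes "locally_replacing f" shows "\<exists>N. \<forall>u\<in>words n. N \<le> length u \<longrightarrow> (\<exists>v. replaces f u v)"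
proof (rule koenig)
  show "\<forall>\<omega>\<in>cantor n. \<exists>k. \<exists>v. replaces f (prefix k \<omega>) v" using assms by (auto simp: locally_replacing_def)
qed (use replaces_append in blast)

lemma uniform_locally_replacing:
  assumes "\<And>u. u\<in>words n \<Longrightarrow> N \<le> length u \<Longrightarrow> \<exists>v. replaces f u v" shows "locally_replacing f"
  unfolding locally_replacing_def
proof
  fix \<omega> assume "\<omega> \<in> cantor n"
  then show "\<exists>k v. replaces f (prefix k \<omega>) v" using assms[of "prefix N \<omega>"] by auto
qed

lemma replaces_comp:
  assumes "replaces g u v" "replaces f v w" "\<And>\<omega>. \<omega> \<in> cantor n \<Longrightarrow> h \<omega> = f (g \<omega>)"
  shows "replaces h u w"
  using assms unfolding replaces_def by auto

lemma locally_replacing_comp: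
  assumes f: "locally_replacing f" and g: "locally_replacing g" and h: "\<And>\<omega>. \<omega> \<in> cantor n \<Longrightarrow> h \<omega> = f (g \<omega>)"
  shows "locally_replacing h"
proof -
  obtain M N where M: "\<And>u. u\<in>words n \<Longrightarrow> M \<le> length u \<Longrightarrow> \<exists>v. replaces f u v"
    and N: "\<And>u. u\<in>words n \<Longrightarrow> N \<le> length u \<Longrightarrow> \<exists>v. replaces g u v"
    using locally_replacing_uniform[OF f] locally_replacing_uniform[OF g] by blast
  show ?thesis
  \<comment> \<open>\<open>N\<close> letters let \<open>g\<close> act; the remaining letters, at
    least \<open>M\<close> of them, are copied to its output, which is therefore long enough for
    \<open>f\<close>.\<close>
  proof (rule uniform_locally_replacing[of "N + M"])
    fix u assume u: "u \<in> words n" "N + M \<le> length u"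
    have t: "take N u \<in> words n" "drop N u \<in> words n" using u(1) by (auto dest: in_set_takeD in_set_dropD)
    obtain v where v: "replaces g (take N u) v" using N[OF t(1)] u by auto
    then have v': "replaces g u (v @ drop N u)" using replaces_append[OF v t(2)] by simp
    have "v @ drop N u \<in> words n" "M \<le> length (v @ drop N u)" using v' u unfolding replaces_def by auto
    then obtain w where "replaces f (v @ drop N u) w" using M by blast
    then show "\<exists>w. replaces h u w" using replaces_comp[OF v'] h by blast
  qed
qed

lemma replaces_inv:
  assumes "f \<in> carrier (HomeoC n)" "replaces f u v" shows "replaces (inv\<^bsub>HomeoC n\<^esub> f) v u"
  unfolding replaces_def
proof (intro conjI ballI)
  fix \<eta> assume e: "\<eta> \<in> cantor n"
  have "u \<frown> \<eta> \<in> cantor n" "f (u \<frown> \<eta>) = v \<frown> \<eta>" using assms(2) e by (auto simp: replaces_def)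
  then show "(inv\<^bsub>HomeoC n\<^esub> f) (v \<frown> \<eta>) = u \<frown> \<eta>" using homeo_inv_apply(2)[OF assms(1)] by metis
qed (use assms in \<open>auto simp: replaces_def\<close>)

lemma locally_replacing_inv:
  assumes p: "f \<in> carrier (HomeoC n)" and l: "locally_replacing f"
  shows "locally_replacing (inv\<^bsub>HomeoC n\<^esub> f)"
  unfolding locally_replacing_def
proof
  fix \<omega> assume w: "\<omega> \<in> cantor n"
  let ?q = "(inv\<^bsub>HomeoC n\<^esub> f) \<omega>"
  have q: "?q \<in> cantor n" using homeo_closed[OF homeo_inv_closed[OF p] w] .
  obtain k v where r: "replaces f (prefix k ?q) v" using l q unfolding locally_replacing_def by blast
  have "\<omega> = f (prefix k ?q \<frown> suffix k ?q)" using homeo_inv_apply(1)[OF p w] by simp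
  also have "\<dots> = v \<frown> suffix k ?q" using r suffix_in_cantor[OF q] unfolding replaces_def by blast
  finally have "prefix (length v) \<omega> = v" by (metis prefix_conc_length)
  then show "\<exists>k v. replaces (inv\<^bsub>HomeoC n\<^esub> f) (prefix k \<omega>) v" using replaces_inv[OF p r] by metis
qed

lemma prefix_replacement_locally: "prefix_replacement n f \<Longrightarrow> locally_replacing f"
  unfolding locally_replacing_def
proof
  assume "prefix_replacement n f"
  then obtain us vs where c: "complete_prefix_code n us" "complete_prefix_code n vs" "length us = length vs"
    "\<And>i \<omega>. i<length us \<Longrightarrow> \<omega>\<in>cantor n \<Longrightarrow> f (us ! i \<frown> \<omega>) = vs ! i \<frown> \<omega>" by (auto simp: prefix_replacement_def)
  fix \<omega> assume "\<omega> \<in> cantor n"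
  then obtain i where i: "i < length us" "\<omega> \<in> cylinder n (us ! i)" using c(1) unfolding complete_prefix_code_def by blast
  have w: "us ! i \<in> words n" "vs ! i \<in> words n"
    using c(1-3) i nth_mem[of i us] nth_mem[of i vs] unfolding complete_prefix_code_def by (metis subsetD)+
  then have "replaces f (us ! i) (vs ! i)" using c(4)[OF i(1)] unfolding replaces_def by blast
  moreover have "prefix (length (us ! i)) \<omega> = us ! i" using in_cylinder_iff[OF w(1)] i(2) by blast
  ultimately show "\<exists>k v. replaces f (prefix k \<omega>) v" by metis
qed

text \<open>The words of one sufficiently large length form the first code and their images the
  second. Order preservation sorts the images, and surjectivity makes their cylinders cover the
  space.\<close>

lemma locally_prefix_replacement:
  assumes p: "f \<in> carrier (HomeoC n)" and l: "locally_replacing f" and o: "order_preserving n f"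
  shows "prefix_replacement n f"
proof -
  obtain N where N: "\<And>u. u\<in>words n \<Longrightarrow> N \<le> length u \<Longrightarrow> \<exists>v. replaces f u v" using locally_replacing_uniform[OF l] by blast
  obtain h where h: "\<And>u. u\<in>words n \<Longrightarrow> N \<le> length u \<Longrightarrow> replaces f u (h u)" using N by metis
  let ?us = "all_words n N"
  have hu: "replaces f u (h u)" if "u \<in> set ?us" for u using that h by (auto simp: set_all_words)
  have inj: "inj_on f (cantor n)" using p by (simp add: homeo_group_carrier_iff bij_betw_def)
  have c1: "complete_prefix_code n ?us"
  proof (rule complete_prefix_codeI)
    fix \<omega> assume w: "\<omega> \<in> cantor n"
    then show "\<exists>u\<in>set ?us. \<omega> \<in> cylinder n u"
      by (intro bexI[of _ "prefix N \<omega>"]) (simp_all add: set_all_words in_cylinder_iff)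
  qed (auto simp: set_all_words sorted_all_words)
  have c2: "complete_prefix_code n (map h ?us)"
  proof (rule complete_prefix_codeI)
    show "set (map h ?us) \<subseteq> words n" using hu by (auto simp: replaces_def)
    have "word_less (h u) (h v)" if uv: "u \<in> set ?us" "v \<in> set ?us" "word_less u v" for u v
    proof -
      have *: "less_fun (h u \<frown> \<omega>) (h v \<frown> \<eta>)" if "\<omega> \<in> cantor n" "\<eta> \<in> cantor n" for \<omega> \<eta>
      proof -
        have "less_fun (f (u \<frown> \<omega>)) (f (v \<frown> \<eta>))"
          using o uv that unfolding order_preserving_def monotone_on_def word_less_def by (simp add: set_all_words)
        then show ?thesis using hu[OF uv(1)] hu[OF uv(2)] that unfolding replaces_def by simp
      qed
      have "(h u, h v) \<in> lexord less_than \<or> h u = h v \<or> (h v, h u) \<in> lexord less_than"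
        by (rule word_lexord_linear)
      moreover have w: "h u \<in> words n" "h v \<in> words n" using hu uv by (auto simp: replaces_def)
      \<comment> \<open>If one image were a prefix of the other, a point common to both cylinders
        would be strictly below itself.\<close>
      have np1: "h v \<noteq> h u @ x" for x
      proof
        assume e: "h v = h u @ x"
        then have "x \<in> words n" using w by auto
        then have "less_fun (h u \<frown> (x \<frown> (\<lambda>_. 0))) (h v \<frown> (\<lambda>_. 0))" by (intro *) auto
        then show False using e by (simp add: less_fun_irrefl)
      qed
      have np2: "h u \<noteq> h v @ x" for x
      proof
        assume e: "h u = h v @ x"
        then have "x \<in> words n" using w by auto
        then have "less_fun (h u \<frown> (\<lambda>_. 0)) (h v \<frown> (x \<frown> (\<lambda>_. 0)))" by (intro *) auto
        then show False using e by (simp add: less_fun_irrefl)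
      qed
      have "\<not> word_less (h v) (h u)" using *[OF zeros_cantor zeros_cantor] less_fun_asym unfolding word_less_def by blast
      then show ?thesis using calculation lexord_word_less[of "h u" "h v"] lexord_word_less[of "h v" "h u"] np1 np2[of "[]"] np2 by auto
    qed
    then show "sorted_wrt word_less (map h ?us)"
      unfolding sorted_wrt_map by (rule sorted_wrt_mono_rel[OF _ sorted_all_words]) 
    fix \<omega> assume w: "\<omega> \<in> cantor n"
    let ?q = "(inv\<^bsub>HomeoC n\<^esub> f) \<omega>"
    have q: "?q \<in> cantor n" using homeo_closed[OF homeo_inv_closed[OF p] w] .
    then have m: "prefix N ?q \<in> set ?us" by (simp add: set_all_words)
    have "\<omega> = f (prefix N ?q \<frown> suffix N ?q)" using homeo_inv_apply(1)[OF p w] by simp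
    also have "\<dots> = h (prefix N ?q) \<frown> suffix N ?q"
      using hu[OF m] suffix_in_cantor[OF q, of N] unfolding replaces_def by blast
    finally have "\<omega> \<in> cylinder n (h (prefix N ?q))" using q by (auto simp: cylinder_def)
    then show "\<exists>u\<in>set (map h ?us). \<omega> \<in> cylinder n u" using m by auto
  qed
  show ?thesis unfolding prefix_replacement_def
    using hu by (intro exI[of _ ?us] exI[of _ "map h ?us"] conjI c1 c2) (auto simp: replaces_def)
qed

lemma F_cantor_carrier:
  "f \<in> carrier (F_cantor n) \<longleftrightarrow> f \<in> carrier (HomeoC n) \<and> order_preserving n f \<and> locally_replacing f"
  unfolding F_cantor_def using prefix_replacement_locally locally_prefix_replacement by auto

lemma subgroup_F_cantor: "subgroup (carrier (F_cantor n)) (HomeoC n)"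
proof (rule group.subgroupI[OF group_homeo_group])
  show "carrier (F_cantor n) \<subseteq> carrier (HomeoC n)" by (auto simp: F_cantor_carrier)
  have one: "\<one>\<^bsub>HomeoC n\<^esub> \<in> carrier (HomeoC n)" by (rule monoid.one_closed[OF group.is_monoid[OF group_homeo_group]])
  have "locally_replacing (\<one>\<^bsub>HomeoC n\<^esub>)" unfolding locally_replacing_def homeo_one
    by (intro ballI exI[of _ 0] exI[of _ "[]"]) (auto simp: replaces_def)
  moreover have "order_preserving n (\<one>\<^bsub>HomeoC n\<^esub>)" by (auto simp: homeo_one order_preserving_def monotone_on_def)
  ultimately show "carrier (F_cantor n) \<noteq> {}" using one F_cantor_carrier by blast
next
  fix f assume f: "f \<in> carrier (F_cantor n)"
  then have p: "f \<in> carrier (HomeoC n)" and o: "order_preserving n f" by (auto simp: F_cantor_carrier)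
  have "order_preserving n (inv\<^bsub>HomeoC n\<^esub> f)"
    using monotone_inv(1)[OF _ o] p by (auto simp: homeo_inv homeo_group_carrier_iff order_preserving_def monotone_on_def)
  then show "inv\<^bsub>HomeoC n\<^esub> f \<in> carrier (F_cantor n)"
    using f locally_replacing_inv homeo_inv_closed[OF p] by (auto simp: F_cantor_carrier)
next
  fix f g assume f: "f \<in> carrier (F_cantor n)" and g: "g \<in> carrier (F_cantor n)"
  then have p: "f \<in> carrier (HomeoC n)" "g \<in> carrier (HomeoC n)" by (auto simp: F_cantor_carrier)
  have "locally_replacing (f \<otimes>\<^bsub>HomeoC n\<^esub> g)"
    by (rule locally_replacing_comp[of f g]) (use f g p in \<open>auto simp: F_cantor_carrier homeo_mult_apply\<close>)
  moreover have "order_preserving n (f \<otimes>\<^bsub>HomeoC n\<^esub> g)"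
    using f g p homeo_closed[OF p(2)] by (auto simp: F_cantor_carrier order_preserving_def monotone_on_def homeo_mult_apply)
  moreover have "f \<otimes>\<^bsub>HomeoC n\<^esub> g \<in> carrier (HomeoC n)"
    by (rule homeo_mult_closed[OF p])
  ultimately show "f \<otimes>\<^bsub>HomeoC n\<^esub> g \<in> carrier (F_cantor n)" by (simp add: F_cantor_carrier)
qed

lemma order_preserving_ends:
  assumes b: "bij_betw \<psi> (cantor n) (cantor n)" and o: "order_preserving n \<psi>"
  shows "\<psi> (\<lambda>_. 0) = (\<lambda>_. 0)" "\<psi> (\<lambda>_. n - 1) = (\<lambda>_. n - 1)"
proof -
  have inj: "inj_on \<psi> (cantor n)" and im: "\<psi> ` cantor n = cantor n" using b by (auto simp: bij_betw_def)
  note oi = order_preserving_iff[OF inj o]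
  obtain \<omega> where w: "\<omega> \<in> cantor n" "\<psi> \<omega> = (\<lambda>_. 0)" using im zeros_cantor by (metis imageE)
  have "\<not> less_fun (\<lambda>_. 0) \<omega>"
    using oi[OF zeros_cantor w(1)] w(2) not_less_zeros[OF bij_betwE[OF b, rule_format, OF zeros_cantor]] by simp
  then show "\<psi> (\<lambda>_. 0) = (\<lambda>_. 0)" using less_fun_total[of \<omega> "\<lambda>_. 0"] not_less_zeros[OF w(1)] w by metis
  obtain \<eta> where e: "\<eta> \<in> cantor n" "\<psi> \<eta> = (\<lambda>_. n - Suc 0)" using im tops_cantor by (metis imageE)
  have "\<not> less_fun \<eta> (\<lambda>_. n - Suc 0)"
    using oi[OF e(1) tops_cantor] e(2) not_less_tops[OF bij_betwE[OF b, rule_format, OF tops_cantor]] by simp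
  then show "\<psi> (\<lambda>_. n - 1) = (\<lambda>_. n - 1)" using less_fun_total[of \<eta> "\<lambda>_. n - Suc 0"] not_less_tops[OF e(1)] e by auto
qed

section \<open>n-adic numbers and affine pieces whose slopes are powers of n\<close>

lemma n_adic_mult: "x \<in> n_adic n \<Longrightarrow> y \<in> n_adic n \<Longrightarrow> x * y \<in> n_adic n"
proof -
  assume "x \<in> n_adic n" "y \<in> n_adic n"
  then obtain a b :: int and k l where "x = of_int a / real n ^ k" "y = of_int b / real n ^ l" by (auto simp: n_adic_def)
  then have "x * y = of_int (a * b) / real n ^ (k + l)" by (simp add: power_add)
  then show ?thesis unfolding n_adic_def by blast
qed

lemma n_adic_powi: "real n powi k \<in> n_adic n"
proof (cases "k \<ge> 0")
  case True
  then have "real n powi k = of_int (int n ^ nat k)" by (simp add: power_int_def)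
  then show ?thesis by (simp only: n_adic_of_int)
next
  case False
  then have "real n powi k = of_int 1 / real n ^ nat (- k)" by (simp add: power_int_def divide_simps)
  then show ?thesis unfolding n_adic_def by blast
qed

lemma powi_cancel: "real n powi (- k) * (real n powi k * x) = x"
proof -
  have "real n powi (- k) * real n powi k = 1" by (simp flip: power_int_add)
  then show ?thesis by (simp flip: mult.assoc)
qed

lemma n_adic_powi_mult_iff: "real n powi k * x \<in> n_adic n \<longleftrightarrow> x \<in> n_adic n"
proof
  assume "real n powi k * x \<in> n_adic n"
  then have "real n powi (- k) * (real n powi k * x) \<in> n_adic n" by (rule n_adic_mult[OF n_adic_powi])
  then show "x \<in> n_adic n" by (simp only: powi_cancel)
qed (intro n_adic_mult n_adic_powi)

lemma n_adic_powi_shift: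
  assumes "x \<in> n_adic n" shows "\<exists>d\<in>n_adic n. real n powi k * x = x + real (n - 1) * d"
proof -
  have pos: "\<exists>d\<in>n_adic n. real n ^ m * y = y + real (n - 1) * d" if "y \<in> n_adic n" for m y
  proof -
    have "real n ^ m - 1 = (real n - 1) * (\<Sum>j<m. real n ^ j)" by (rule power_diff_1_eq)
    moreover have "real n ^ m * y = y + (real n ^ m - 1) * y" by (simp add: algebra_simps)
    ultimately have e: "real n ^ m * y = y + real (n - 1) * ((\<Sum>j<m. real n ^ j) * y)"
      using n2 by (simp add: of_nat_diff mult.assoc)
    have "(\<Sum>j<m. real n ^ j) = of_int (\<Sum>j<m. int n ^ j)" by simp
    then have "(\<Sum>j<m. real n ^ j) * y \<in> n_adic n" using that by (metis n_adic_mult n_adic_of_int)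
    then show ?thesis using e by blast
  qed
  show ?thesis
  proof (cases "k \<ge> 0")
    case True
    then show ?thesis using pos[OF assms, of "nat k"] by (simp add: power_int_def)
  next
    case False
    \<comment> \<open>For a negative exponent x and its image exchange roles: x is obtained from
      \<open>?y\<close> by a positive power.\<close>
    let ?y = "real n powi k * x"
    have y: "?y \<in> n_adic n" using assms by (simp add: n_adic_powi_mult_iff)
    have "real n ^ nat (- k) = real n powi (- k)" using False by (simp add: power_int_def)
    then have "real n ^ nat (- k) * ?y = x" by (simp only: powi_cancel)
    then obtain d where "d\<in>n_adic n" "x = ?y + real (n - 1) * d" using pos[OF y, of "nat (-k)"] by metis
    then show ?thesis using n_adic_uminus[of d] by (intro bexI[of _ "- d"]) auto
  qed
qed

context
  fixes f :: "real \<Rightarrow> real" and B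
  assumes B: "finite B" "B \<subseteq> n_adic n \<inter> {0..1}" "{0, 1} \<subseteq> B"
    and aff: "\<forall>a b. 0 \<le> a \<and> a < b \<and> b \<le> 1 \<and> {a<..<b} \<inter> B = {} \<longrightarrow>
           (\<exists>(k::int) c. \<forall>x\<in>{a..b}. f x = of_nat n powi k * x + c)"
    and f0: "f 0 = 0"
begin

text \<open>\<open>b\<close> is the last breakpoint before x. This permits induction along the
  breakpoints, starting from \<open>f 0 = 0\<close>.\<close>

lemma PL_piece:
  assumes "0 < x" "x \<le> 1"
  shows "\<exists>b\<in>B. b < x \<and> (\<forall>y\<in>B. y < x \<longrightarrow> y \<le> b) \<and> (\<exists>k::int. f x = f b + real n powi k * (x - b))"
proof -
  let ?A = "{y \<in> B. y < x}"
  have fin: "finite ?A" "?A \<noteq> {}" using B assms by auto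
  define b where "b = Max ?A"
  have b: "b \<in> ?A" "\<And>y. y \<in> ?A \<Longrightarrow> y \<le> b" unfolding b_def using Max_in[OF fin] Max_ge[OF fin(1)] by blast+
  have "{b<..<x} \<inter> B = {}" using b(2) by fastforce
  moreover have "0 \<le> b" using b B by auto
  ultimately obtain k :: int and c where "\<forall>z\<in>{b..x}. f z = of_nat n powi k * z + c"
    using aff[rule_format, of b x] b assms by auto
  then have "f x = f b + real n powi k * (x - b)" using b by (simp add: algebra_simps)
  then show ?thesis using b by blast
qed

text \<open>Since \<open>n\<^sup>k - 1\<close> is divisible by \<open>n - 1\<close>, an affine piece of slope \<open>n\<^sup>k\<close> does not change differences of
  \<open>n\<close>-adic points modulo \<open>(n - 1)\<close> times the \<open>n\<close>-adic numbers. This is where the invariance of the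
  digit sum comes from.\<close>

lemma PL_shift: "x \<in> n_adic n \<Longrightarrow> 0 \<le> x \<Longrightarrow> x \<le> 1 \<Longrightarrow> \<exists>d\<in>n_adic n. f x = x + real (n - 1) * d"
proof (induction "card {y \<in> B. y < x}" arbitrary: x rule: less_induct)
  case less
  show ?case
  proof (cases "x = 0")
    case True
    then show ?thesis using f0 by (intro bexI[of _ 0]) auto
  next
    case False
    then obtain b k where b: "b \<in> B" "b < x" "\<And>y. y \<in> B \<Longrightarrow> y < x \<Longrightarrow> y \<le> b" "f x = f b + real n powi k * (x - b)"
      using PL_piece[of x] less.prems by auto
    have "{y \<in> B. y < b} \<subset> {y \<in> B. y < x}" using b by force
    then have "card {y \<in> B. y < b} < card {y \<in> B. y < x}" using B(1) by (intro psubset_card_mono) auto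
    moreover have "b \<in> n_adic n" "0 \<le> b" "b \<le> 1" using b(1) B(2) by auto
    ultimately obtain d where d: "d \<in> n_adic n" "f b = b + real (n - 1) * d" using less.hyps[of b] by blast
    have "x - b \<in> n_adic n" using b B less.prems by (intro n_adic_diff) auto
    then obtain e where "e \<in> n_adic n" "real n powi k * (x - b) = (x - b) + real (n - 1) * e" using n_adic_powi_shift by blast
    then have "f x = x + real (n - 1) * (d + e)" using b d by (simp add: algebra_simps)
    then show ?thesis using d \<open>e \<in> _\<close> n_adic_add by blast
  qed
qed

lemma PL_n_adic: "x \<in> n_adic n \<Longrightarrow> 0 \<le> x \<Longrightarrow> x \<le> 1 \<Longrightarrow> f x \<in> n_adic n"
proof -
  assume x: "x \<in> n_adic n" "0 \<le> x" "x \<le> 1"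
  obtain d where "d \<in> n_adic n" "f x = x + of_int (int (n - 1)) * d" using PL_shift[OF x] by auto
  then show ?thesis using x n_adic_add n_adic_mult[OF n_adic_of_int] by presburger
qed

text \<open>Relative to the last breakpoint, f multiplies by a power of n, and this is invertible on
  the n-adic numbers.\<close>

lemma PL_n_adic_iff: "0 < x \<Longrightarrow> x < 1 \<Longrightarrow> f x \<in> n_adic n \<longleftrightarrow> x \<in> n_adic n"
proof
  assume x: "0 < x" "x < 1" and fx: "f x \<in> n_adic n"
  obtain b k where b: "b \<in> B" "f x = f b + real n powi k * (x - b)" using PL_piece[of x] x by auto
  have "f b \<in> n_adic n" using b B by (intro PL_n_adic) auto
  then have "f x - f b \<in> n_adic n" using fx by (intro n_adic_diff)
  then have "real n powi k * (x - b) \<in> n_adic n" using b by simp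
  then have "x - b \<in> n_adic n" by (simp only: n_adic_powi_mult_iff)
  then have "(x - b) + b \<in> n_adic n" using b B by (intro n_adic_add) auto
  then show "x \<in> n_adic n" by simp
qed (use PL_n_adic in auto)

end

definition mono_homeos :: "(real \<Rightarrow> real) set" where
  "mono_homeos = {f \<in> carrier (homeo_group {0..1}). strict_mono_on {0..1} f}"

lemma mono_homeos_ends:
  assumes "f \<in> mono_homeos" shows "f 0 = 0" "f 1 = 1"
proof -
  have "f ` {0, 1} = {0, 1}" using homeo_Icc_interval(4) assms by (simp add: mono_homeos_def)
  moreover have "f 0 < f 1" using assms strict_mono_onD[of "{0..1}" f 0 1] by (auto simp: mono_homeos_def)
  ultimately have "f 0 \<in> {0,1}" "f 1 \<in> {0,1}" "f 0 < f 1" by auto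
  then show "f 0 = 0" "f 1 = 1" by auto
qed

text \<open>The lift is specified only over the open interval; monotonicity gives its values at the
  two constant words, so the equation holds everywhere.\<close>

lemma lift_rho:
  assumes f: "f \<in> mono_homeos" and a: "interval_action f \<in> adic_homeos" and w: "\<omega> \<in> cantor n"
  shows "rho n (cantor_action n f \<omega>) = f (rho n \<omega>)"
proof -
  have m: "strict_mono_on {0<..<1} (interval_action f)"
    using f by (auto simp: mono_homeos_def interval_action_def monotone_on_def)
  note L = cantor_lift[OF a]
  have b: "bij_betw (cantor_action n f) (cantor n) (cantor n)" using L(1) by (simp add: homeo_group_carrier_iff cantor_action_def)
  note E = order_preserving_ends[OF b] L(3)[OF m]
  consider "rho n \<omega> = 0" | "rho n \<omega> = 1" | "rho n \<omega> \<in> {0<..<1}" using rho_open_iff[OF w] by blast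
  then show ?thesis
  proof cases
    case 1
    then have "\<omega> = (\<lambda>_. 0)" using rho_eq_0_iff w by simp
    then show ?thesis using E 1 mono_homeos_ends[OF f] by (simp add: cantor_action_def)
  next
    case 2
    then have "\<omega> = (\<lambda>_. n - 1)" using rho_eq_1_iff w by simp
    then show ?thesis using E 2 mono_homeos_ends[OF f] by (simp add: cantor_action_def)
  next
    case 3
    then show ?thesis using L(2)[OF w 3] by (simp add: cantor_action_def interval_action_def)
  qed
qed

text \<open>Equal values give equal words only off the n-adic points; continuity and density extend
  the equality to the whole cylinder.\<close>

lemma replaces_from_rho:
  assumes p: "\<psi> \<in> carrier (HomeoC n)" and uv: "u \<in> words n" "v \<in> words n"
    and r: "\<And>\<eta>. \<eta> \<in> cantor n \<Longrightarrow> rho n (\<psi> (u \<frown> \<eta>)) = rho n (v \<frown> \<eta>)"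
  shows "replaces \<psi> u v"
  unfolding replaces_def
proof (intro conjI ballI uv)
  fix \<eta> assume e: "\<eta> \<in> cantor n"
  have cp: "continuous_on (cantor n) \<psi>" using p by (simp add: homeo_group_carrier_iff)
  have cv: "continuous_on (cantor n) (\<lambda>\<eta>. w \<frown> \<eta>)" for w
    unfolding continuous_on_discrete_word
  proof safe
    fix \<omega> j
    show "\<exists>k. \<forall>\<eta>\<in>cantor n. prefix k \<eta> = prefix k \<omega> \<longrightarrow> (w \<frown> \<eta>) j = (w \<frown> \<omega>) j"
    proof (intro exI[of _ "Suc j"] ballI impI)
      fix \<eta> assume h: "prefix (Suc j) \<eta> = prefix (Suc j) \<omega>"
      show "(w \<frown> \<eta>) j = (w \<frown> \<omega>) j"
        using arg_cong[OF h, of "\<lambda>l. l ! (j - length w)"] by (cases "j < length w") (simp_all del: subseq_to_Suc)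
    qed
  qed
  have cu: "continuous_on (cantor n) (\<psi> \<circ> (\<lambda>\<eta>. u \<frown> \<eta>))"
    by (rule continuous_on_compose[OF cv]) (rule continuous_on_subset[OF cp], use uv in auto)
  have "(\<psi> \<circ> (\<lambda>\<eta>. u \<frown> \<eta>)) \<eta> = v \<frown> \<eta>"
  proof (rule continuous_eq_off_n_adic[OF cu cv _ e])
    fix \<omega> assume w: "\<omega> \<in> cantor n" "rho n \<omega> \<notin> n_adic n"
    have vw: "v \<frown> \<omega> \<in> cantor n" using w uv by simp
    have uw: "\<psi> (u \<frown> \<omega>) \<in> cantor n" using w uv by (intro homeo_closed[OF p]) simp
    have "rho n (v \<frown> \<omega>) \<notin> n_adic n"
      using n_adic_evconst[OF vw] evconst_top_n_adic[OF w(1)] w(2) by auto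
    then show "(\<psi> \<circ> (\<lambda>\<eta>. u \<frown> \<eta>)) \<omega> = v \<frown> \<omega>"
      using rho_inj_non_adic[OF vw uw] r[OF w(1)] by simp
  qed
  then show "\<psi> (u \<frown> \<eta>) = v \<frown> \<eta>" by simp
qed

text \<open>A small enough n-adic interval [i, i+1] / n^p lies in one affine piece and is mapped
  onto an interval [J, J+1] / n^L' of the same kind. Such intervals are the images of cylinders, so
  the lift replaces a word of length p by a word of length L'.\<close>

lemma PL_lift:
  assumes f: "f \<in> mono_homeos" and PL: "n_adic_PL n f"
  shows "interval_action f \<in> adic_homeos" "cantor_action n f \<in> carrier (F_cantor n)"
proof -
  obtain B where B: "finite B" "B \<subseteq> n_adic n \<inter> {0..1}" "{0, 1} \<subseteq> B"
    and aff: "\<forall>a b. 0 \<le> a \<and> a < b \<and> b \<le> 1 \<and> {a<..<b} \<inter> B = {} \<longrightarrow>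
           (\<exists>(k::int) c. \<forall>x\<in>{a..b}. f x = of_nat n powi k * x + c)"
    using PL by (auto simp: n_adic_PL_def)
  note ends = mono_homeos_ends[OF f]
  note N = PL_n_adic_iff[OF B aff ends(1)]
  show a: "interval_action f \<in> adic_homeos"
    using homeo_Icc_interval(3)[of f] f N
    by (auto simp: adic_homeos_def adic_stable_def mono_homeos_def interval_action_def)
  have m: "strict_mono_on {0<..<1} (interval_action f)"
    using f by (auto simp: mono_homeos_def interval_action_def monotone_on_def)
  note L = cantor_lift[OF a] lift_rho[OF f a]
  \<comment> \<open>A common denominator: the finitely many breakpoints lie on one grid of mesh
    \<open>1 / n ^ M\<close>.\<close>
  have "\<exists>M. \<forall>b\<in>B. \<exists>j::int. b = of_int j / real n ^ M"
    using B(1,2)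
  proof (induction B rule: finite_induct)
    case (insert b B)
    then obtain M where M: "\<forall>b\<in>B. \<exists>j::int. b = of_int j / real n ^ M" by auto
    obtain j k where jk: "b = of_int j / real n ^ k" using insert by (auto simp: n_adic_def)
    have up: "\<exists>i::int. x = of_int i / real n ^ (p + q)" if "x = of_int j / real n ^ p" for x j p q
      using that by (intro exI[of _ "j * int n ^ q"]) (simp add: power_add)
    show ?case using M jk up[of _ _ M k] up[of b j k M] by (intro exI[of _ "M + k"]) (auto simp: add.commute)
  qed auto
  then obtain M where M: "\<And>b. b\<in>B \<Longrightarrow> \<exists>j::int. b = of_int j / real n ^ M" by blast
  have avoid: "{x / real n ^ M<..<(x + 1) / real n ^ M} \<inter> B = {}" if "x = of_int i" for x i
  proof (rule ccontr)
    assume "\<not> ?thesis"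
    then obtain j :: int where "x / real n ^ M < of_int j / real n ^ M" "of_int j / real n ^ M < (x + 1) / real n ^ M"
      using M by fastforce
    then have "x < of_int j" "of_int j < x + 1" by (simp_all add: divide_less_cancel)
    then have "i < j" "j < i + 1" unfolding that by linarith+
    then show False by simp
  qed
  have "locally_replacing (cantor_action n f)"
    unfolding locally_replacing_def
  proof
    fix \<omega> assume w: "\<omega> \<in> cantor n"
    define u0 where "u0 = prefix M \<omega>"
    define x0 where "x0 = real (word_num n u0) / real n ^ M"
    define y0 where "y0 = (real (word_num n u0) + 1) / real n ^ M"
    have u0: "u0 \<in> words n" "length u0 = M" using w by (auto simp: u0_def simp del: in_lists_conv_set)
    have xy: "0 \<le> x0" "x0 < y0" "y0 \<le> 1"
    proof -
      show "x0 < y0" by (simp add: x0_def y0_def divide_strict_right_mono)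
      have "word_num n u0 + 1 \<le> n ^ M" using word_num_less[OF u0(1)] u0(2) by simp
      then have "real (word_num n u0) + 1 \<le> real n ^ M" by (metis of_nat_1 of_nat_add of_nat_le_iff of_nat_power)
      then show "y0 \<le> 1" by (simp add: y0_def)
    qed (simp add: x0_def)
    obtain k :: int and c where kc: "\<And>x. x\<in>{x0..y0} \<Longrightarrow> f x = real n powi k * x + c"
    proof -
      have "{x0<..<y0} \<inter> B = {}"
        using avoid[of "real (word_num n u0)" "int (word_num n u0)"] unfolding x0_def y0_def by simp
      then have "\<exists>(k::int) c. \<forall>x\<in>{x0..y0}. f x = real n powi k * x + c" using aff xy by blast
      then show thesis using that by blast
    qed
    have x0: "x0 \<in> n_adic n"
      by (auto simp: x0_def n_adic_def intro!: exI[of _ "int (word_num n u0)"] exI[of _ M])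
    have "f x0 \<in> n_adic n" using xy by (intro PL_n_adic[OF B aff ends(1)] x0) linarith+
    then have "f x0 - real n powi k * x0 \<in> n_adic n" using x0
      by (intro n_adic_diff n_adic_mult n_adic_powi)
    then have "c \<in> n_adic n" using kc[of x0] xy by simp
    then obtain c' :: int and Q where c': "c = of_int c' / real n ^ Q" by (auto simp: n_adic_def)
    \<comment> \<open>\<open>M\<close> letters confine the cylinder to one affine piece. The other
      two summands ensure that the new length \<open>p - k\<close> is at least \<open>Q\<close>, so
      that \<open>c\<close> becomes a multiple of \<open>1 / n ^ L'\<close>.\<close>
    define p where "p = M + Q + nat \<bar>k\<bar>"
    define L' where "L' = nat (int p - k)"
    have L'1: "int L' = int p - k" "Q \<le> L'" unfolding L'_def p_def by auto
    have Lpow: "real n ^ L' * real n powi k = real n ^ p"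
    proof -
      have "real n powi int L' * real n powi k = real n powi int p"
        using L'1 by (simp flip: power_int_add)
      then show ?thesis by simp
    qed
    define u where "u = prefix p \<omega>"
    have u: "u \<in> words n" "length u = p" using w by (auto simp: u_def simp del: in_lists_conv_set)
    have inpiece: "rho n (u \<frown> \<eta>) \<in> {x0..y0}" if e: "\<eta> \<in> cantor n" for \<eta>
    proof -
      have "take M u = u0" unfolding u_def u0_def p_def by simp
      then have dec: "u = u0 @ drop M u" by (metis append_take_drop_id)
      have "drop M u \<in> words n" using u(1) by (auto dest: in_set_dropD)
      then have z: "drop M u \<frown> \<eta> \<in> cantor n" using e by simp
      have "rho n (u \<frown> \<eta>) = rho n (u0 \<frown> (drop M u \<frown> \<eta>))" using dec by simp
      also have "\<dots> = (real (word_num n u0) + rho n (drop M u \<frown> \<eta>)) / real n ^ M"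
        using rho_conc[OF u0(1) z] u0(2) by simp
      finally show ?thesis using rho_nonneg[OF z] rho_le_1[OF z]
        by (auto simp: x0_def y0_def divide_right_mono)
    qed
    define J where "J = int (word_num n u) + c' * int n ^ (L' - Q)"
    have img: "f (rho n (u \<frown> \<eta>)) = (of_int J + rho n \<eta>) / real n ^ L'" if e: "\<eta> \<in> cantor n" for \<eta>
    proof -
      have "f (rho n (u \<frown> \<eta>)) = real n powi k * ((real (word_num n u) + rho n \<eta>) / real n ^ p) + of_int c' / real n ^ Q"
        using kc[OF inpiece[OF e]] rho_conc[OF u(1) e] u(2) c' by simp
      also have "\<dots> = (real (word_num n u) + rho n \<eta>) / real n ^ L' + of_int c' * real n ^ (L' - Q) / real n ^ L'"
      proof -
        have "real n ^ L' = real n ^ Q * real n ^ (L' - Q)" using L'1 by (simp flip: power_add)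
        then have 1: "of_int c' / real n ^ Q = of_int c' * real n ^ (L' - Q) / real n ^ L'" by simp
        have 2: "real n powi k * (y / real n ^ p) = y / real n ^ L'" for y
          unfolding Lpow[symmetric] by simp
        show ?thesis unfolding 1 2 ..
      qed
      finally show ?thesis by (simp add: J_def add_divide_distrib)
    qed
    have fr: "f x \<in> {0..1}" if "x \<in> {0..1}" for x using f homeo_closed[of f "{0..1}" x] that by (simp add: mono_homeos_def)
    \<comment> \<open>Both ends of the image interval lie in [0,1]; this bounds J so that it is the
      numeral of a word of length \<open>L'\<close>.\<close>
    have "f (rho n (u \<frown> (\<lambda>_. 0))) \<in> {0..1}" "f (rho n (u \<frown> (\<lambda>_. n - 1))) \<in> {0..1}"
      by (rule fr, use u(1) in \<open>simp add: rho_nonneg rho_le_1\<close>)+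
    then have "0 \<le> real_of_int J" "real_of_int J + 1 \<le> real n ^ L'"
      using img[OF zeros_cantor] img[OF tops_cantor] zero_less_power[OF n_pos(3), of L'] by (auto simp: zero_le_divide_iff)
    moreover have "real_of_int (J + 1) \<le> real_of_int (int n ^ L')" using calculation by simp
    ultimately have "0 \<le> J" "J + 1 \<le> int n ^ L'" by (simp_all only: of_int_le_iff of_int_0_le_iff)
    then have "nat J < n ^ L'" by (simp add: nat_less_iff)
    then obtain v where v: "v \<in> words n" "length v = L'" "word_num n v = nat J" using word_num_surj by blast
    have "replaces (cantor_action n f) u v"
    proof (rule replaces_from_rho[OF _ u(1) v(1)])
      show "cantor_action n f \<in> carrier (HomeoC n)" using L(1) by (simp add: cantor_action_def)
      fix \<eta> assume e: "\<eta> \<in> cantor n"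
      have "rho n (cantor_action n f (u \<frown> \<eta>)) = f (rho n (u \<frown> \<eta>))" using L(5)[of "u \<frown> \<eta>"] u(1) e by simp
      also have "\<dots> = rho n (v \<frown> \<eta>)" using img[OF e] rho_conc[OF v(1) e] v \<open>0 \<le> J\<close> by simp
      finally show "rho n (cantor_action n f (u \<frown> \<eta>)) = rho n (v \<frown> \<eta>)" .
    qed
    then show "\<exists>k v. replaces (cantor_action n f) (prefix k \<omega>) v" unfolding u_def by blast
  qed
  then show "cantor_action n f \<in> carrier (F_cantor n)" using L(1) L(3)[OF m] by (simp add: F_cantor_carrier cantor_action_def)
qed

text \<open>If every word of length N is replaced, the multiples of 1 / n^N can serve as
  breakpoints: replacing u by v is affine, of slope n to the power N - length v.\<close>

lemma lift_PL:
  assumes f: "f \<in> mono_homeos" and a: "interval_action f \<in> adic_homeos" and F: "cantor_action n f \<in> carrier (F_cantor n)"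
  shows "n_adic_PL n f"
proof -
  obtain N where N: "\<And>u. u\<in>words n \<Longrightarrow> N \<le> length u \<Longrightarrow> \<exists>v. replaces (cantor_action n f) u v"
    using locally_replacing_uniform F unfolding F_cantor_carrier by blast
  define B where "B = (\<lambda>j. real j / real n ^ N) ` {..n ^ N}"
  have pN: "real n ^ N > 0" by simp
  have aff: "\<exists>(k::int) c. \<forall>x\<in>{a..b}. f x = of_nat n powi k * x + c"
    if ab: "0 \<le> a" "a < b" "b \<le> 1" "{a<..<b} \<inter> B = {}" for a b
  proof -
    \<comment> \<open>The grid interval starting at \<open>j / n ^ N\<close> contains a, and it
      contains b as well since no grid point lies strictly between them.\<close>
    define j where "j = nat \<lfloor>real n ^ N * a\<rfloor>"
    have j: "real j \<le> real n ^ N * a" "real n ^ N * a < real j + 1"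
      using ab by (simp_all add: j_def)
    have "real n ^ N * a < real n ^ N * 1" using ab pN by (intro mult_strict_left_mono) linarith+
    then have jn: "j < n ^ N" using j by (metis le_less_trans mult.right_neutral of_nat_less_iff of_nat_power)
    have ja: "real j / real n ^ N \<le> a" using j(1) pN by (simp add: divide_le_eq mult.commute)
    have aj: "a < (real j + 1) / real n ^ N" using j(2) pN by (simp add: less_divide_eq mult.commute)
    have "b \<le> (real j + 1) / real n ^ N"
    proof (rule ccontr)
      assume "\<not> ?thesis"
      moreover have "(real j + 1) / real n ^ N \<in> B" unfolding B_def using jn by (intro image_eqI[of _ _ "Suc j"]) auto
      moreover have "(real j + 1) / real n ^ N \<in> {a<..<b}" using \<open>\<not> b \<le> _\<close> aj by simp
      ultimately show False using ab(4) by blast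
    qed
    obtain u where u: "u \<in> words n" "length u = N" "word_num n u = j" using word_num_surj[OF jn] by blast
    obtain v where v: "replaces (cantor_action n f) u v" using N[OF u(1)] u by auto
    have "f x = of_nat n powi (int N - int (length v)) * x + (real (word_num n v) - real j) / real n ^ length v" if x: "x \<in> {a..b}" for x
    proof -
      have "real n ^ N * a \<le> real n ^ N * x" using x by (intro mult_left_mono) auto
      then have "0 \<le> real n ^ N * x - real j" using j(1) by linarith
      moreover have "x \<le> (real j + 1) / real n ^ N" using x \<open>b \<le> (real j + 1) / real n ^ N\<close> by simp
      then have "real n ^ N * x - real j \<le> 1" using pN by (simp only: pos_le_divide_eq) (simp add: mult.commute)
      ultimately obtain \<eta> where e: "\<eta> \<in> cantor n" "rho n \<eta> = real n ^ N * x - real j" using rho_surj by blast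
      have "rho n (u \<frown> \<eta>) = x" using rho_conc[OF u(1) e(1)] u e by simp
      then have "f x = rho n (v \<frown> \<eta>)" using lift_rho[OF f a, of "u \<frown> \<eta>"] u(1) e(1) v by (simp add: replaces_def)
      also have "\<dots> = (real (word_num n v) + (real n ^ N * x - real j)) / real n ^ length v"
        using rho_conc[of v \<eta>] v e by (simp add: replaces_def)
      also have "\<dots> = real n ^ N / real n ^ length v * x + (real (word_num n v) - real j) / real n ^ length v"
        by (simp add: add_divide_distrib diff_divide_distrib)
      also have "real n ^ N / real n ^ length v = real n powi (int N - int (length v))"
        by (simp add: power_int_diff)
      finally show ?thesis .
    qed
    then show ?thesis by blast
  qed
  have "finite B" by (simp add: B_def)
  moreover have "B \<subseteq> n_adic n \<inter> {0..1}"
  proof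
    fix x assume "x \<in> B"
    then obtain j where j: "j \<le> n ^ N" "x = real j / real n ^ N" by (auto simp: B_def)
    then have "real j \<le> real n ^ N" by (metis of_nat_le_iff of_nat_power)
    then have "x \<le> 1" using j by simp
    have "x = of_int (int j) / real n ^ N" using j by simp
    then have "x \<in> n_adic n" unfolding n_adic_def by blast
    moreover have "0 \<le> x" using j by simp
    ultimately show "x \<in> n_adic n \<inter> {0..1}" using \<open>x \<le> 1\<close> by simp
  qed
  moreover have "{0, 1} \<subseteq> B" unfolding B_def by (auto intro: image_eqI[of _ _ 0] image_eqI[of _ _ "n ^ N"])
  ultimately show ?thesis unfolding n_adic_PL_def by (intro exI[of _ B] conjI allI impI aff) blast+
qed

text \<open>Membership in F_n, expressed on the Cantor space. Closure under products and inverses is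
  thereby inherited from prefix replacements, without composing piecewise linear maps.\<close>

lemma thompson_F_iff:
  "f \<in> carrier (thompson_F n) \<longleftrightarrow> f \<in> mono_homeos \<and> interval_action f \<in> adic_homeos \<and> cantor_action n f \<in> carrier (F_cantor n)"
  using PL_lift[of f] lift_PL[of f] by (auto simp: thompson_F_def mono_homeos_def)

end

section \<open>F_n as a group and its two actions\<close>

lemma hom_inv_subgroup:
  assumes "group G" "group H" "subgroup K G" "\<And>x y. x \<in> K \<Longrightarrow> y \<in> K \<Longrightarrow> h (x \<otimes>\<^bsub>G\<^esub> y) = h x \<otimes>\<^bsub>H\<^esub> h y"
    "\<And>x. x \<in> K \<Longrightarrow> h x \<in> carrier H" "x \<in> K"
  shows "h (inv\<^bsub>G\<^esub> x) = inv\<^bsub>H\<^esub> (h x)"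
proof -
  interpret G: group G by fact
  interpret H: group H by fact
  have ix: "inv\<^bsub>G\<^esub> x \<in> K" "\<one>\<^bsub>G\<^esub> \<in> K" "x \<in> carrier G" using assms(3,6) by (auto simp: subgroup.m_inv_closed subgroup.one_closed subgroup.mem_carrier)
  have "h \<one>\<^bsub>G\<^esub> \<otimes>\<^bsub>H\<^esub> h \<one>\<^bsub>G\<^esub> = h \<one>\<^bsub>G\<^esub>" using assms(4)[OF ix(2,2)] by simp
  then have h1: "h \<one>\<^bsub>G\<^esub> = \<one>\<^bsub>H\<^esub>" using assms(5)[OF ix(2)] H.l_cancel_one by blast
  have "h (inv\<^bsub>G\<^esub> x) \<otimes>\<^bsub>H\<^esub> h x = \<one>\<^bsub>H\<^esub>" using assms(4)[OF ix(1) assms(6)] h1 ix by simp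
  then show ?thesis using H.inv_equality assms(5) ix(1) assms(6) by metis
qed

lemma interval_action_mult:
  assumes "f \<in> carrier (homeo_group {0..1})" "g \<in> carrier (homeo_group {0..1})"
  shows "interval_action (f \<otimes>\<^bsub>homeo_group {0..1}\<^esub> g) = interval_action f \<otimes>\<^bsub>Homeo01\<^esub> interval_action g"
proof -
  have "g x \<in> {0<..<1}" if "x \<in> {0<..<1}" for x using homeo_Icc_interval(2)[OF assms(2)] that by (auto simp: bij_betw_def)
  then show ?thesis
    unfolding homeo_mult[OF assms] homeo_mult[OF homeo_Icc_interval(3)[OF assms(1)] homeo_Icc_interval(3)[OF assms(2)]]
    by (auto simp: interval_action_def compose_def fun_eq_iff)
qed

context base_n begin

lemma interval_action_inj: "inj_on interval_action mono_homeos"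
proof (rule inj_onI)
  fix f g assume f: "f \<in> mono_homeos" and g: "g \<in> mono_homeos" and e: "interval_action f = interval_action g"
  have c: "f \<in> carrier (homeo_group {0..1})" "g \<in> carrier (homeo_group {0..1})" using f g by (auto simp: mono_homeos_def)
  show "f = g"
  proof (rule homeo_group_ext[OF c])
    fix x :: real assume "x \<in> {0..1}"
    then consider "x = 0" | "x = 1" | "x \<in> {0<..<1}" by fastforce
    then show "f x = g x"
    proof cases
      case 3
      then show ?thesis using fun_cong[OF e, of x] by (simp add: interval_action_def)
    qed (use mono_homeos_ends[OF f] mono_homeos_ends[OF g] in auto)
  qed
qed

lemma subgroup_mono_homeos: "subgroup mono_homeos (homeo_group {0..1})"
proof (rule group.subgroupI[OF group_homeo_group])
  show "mono_homeos \<subseteq> carrier (homeo_group {0..1})" by (auto simp: mono_homeos_def)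
  have "\<one>\<^bsub>homeo_group {0..1}\<^esub> \<in> mono_homeos" 
    using monoid.one_closed[OF group.is_monoid[OF group_homeo_group, of "{0..1::real}"]]
    by (auto simp: mono_homeos_def homeo_one monotone_on_def)
  then show "mono_homeos \<noteq> {}" by blast
next
  fix f assume f: "f \<in> mono_homeos"
  then have c: "f \<in> carrier (homeo_group {0..1})" and m: "strict_mono_on {0..1} f" by (auto simp: mono_homeos_def)
  have "bij_betw f {0..1} {0..1}" using c by (simp add: homeo_group_carrier_iff)
  from strict_mono_on_inv_into[OF this m] have "strict_mono_on {0..1} (inv\<^bsub>homeo_group {0..1}\<^esub> f)"
    by (auto simp: homeo_inv[OF c] monotone_on_def)
  then show "inv\<^bsub>homeo_group {0..1}\<^esub> f \<in> mono_homeos" using homeo_inv_closed[OF c] by (simp add: mono_homeos_def)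
next
  fix f g assume f: "f \<in> mono_homeos" and g: "g \<in> mono_homeos"
  then have c: "f \<in> carrier (homeo_group {0..1})" "g \<in> carrier (homeo_group {0..1})" 
    and m: "strict_mono_on {0..1} f" "strict_mono_on {0..1} g" by (auto simp: mono_homeos_def)
  have "strict_mono_on {0..1} (f \<otimes>\<^bsub>homeo_group {0..1}\<^esub> g)"
    using m homeo_closed[OF c(2)] by (auto simp: homeo_mult_apply[OF c] monotone_on_def)
  then show "f \<otimes>\<^bsub>homeo_group {0..1}\<^esub> g \<in> mono_homeos"
    using homeo_mult_closed[OF c] by (simp add: mono_homeos_def)
qed

lemma cantor_lift_inv: "a \<in> adic_homeos \<Longrightarrow> cantor_lift n (inv\<^bsub>Homeo01\<^esub> a) = inv\<^bsub>HomeoC n\<^esub> (cantor_lift n a)"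
  by (rule hom_inv_subgroup[OF group_homeo_group group_homeo_group subgroup_adic_homeos])
    (auto simp: cantor_lift_mult cantor_lift)

lemma interval_action_inv:
  "f \<in> carrier (homeo_group {0..1}) \<Longrightarrow> interval_action (inv\<^bsub>homeo_group {0..1}\<^esub> f) = inv\<^bsub>Homeo01\<^esub> (interval_action f)"
  by (rule hom_inv_subgroup[OF group_homeo_group group_homeo_group group.subgroup_self[OF group_homeo_group]])
    (auto simp: interval_action_mult homeo_Icc_interval(3))

lemma subgroup_thompson_F: "subgroup (carrier (thompson_F n)) (homeo_group {0..1})"
proof (rule group.subgroupI[OF group_homeo_group])
  show "carrier (thompson_F n) \<subseteq> carrier (homeo_group {0..1})" by (auto simp: thompson_F_iff mono_homeos_def)
  let ?i = "\<one>\<^bsub>homeo_group {0..1}\<^esub> :: real \<Rightarrow> real"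
  have i: "?i \<in> mono_homeos" using subgroup.one_closed[OF subgroup_mono_homeos] .
  have "n_adic_PL n ?i" unfolding n_adic_PL_def homeo_one
    by (rule exI[of _ "{0, 1}"]) (auto intro!: exI[of _ "0::int"] exI[of _ "0::real"])
  then have "?i \<in> carrier (thompson_F n)" using i by (auto simp: thompson_F_def mono_homeos_def)
  then show "carrier (thompson_F n) \<noteq> {}" by blast
next
  fix f assume f: "f \<in> carrier (thompson_F n)"
  then have c: "f \<in> carrier (homeo_group {0..1})" by (auto simp: thompson_F_iff mono_homeos_def)
  have "cantor_action n (inv\<^bsub>homeo_group {0..1}\<^esub> f) = inv\<^bsub>HomeoC n\<^esub> (cantor_action n f)"
    using f by (simp add: cantor_action_def interval_action_inv[OF c] cantor_lift_inv thompson_F_iff)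
  then show "inv\<^bsub>homeo_group {0..1}\<^esub> f \<in> carrier (thompson_F n)"
    using f subgroup.m_inv_closed[OF subgroup_F_cantor] subgroup.m_inv_closed[OF subgroup_mono_homeos]
      subgroup.m_inv_closed[OF subgroup_adic_homeos] by (simp add: thompson_F_iff interval_action_inv[OF c])
next
  fix f g assume f: "f \<in> carrier (thompson_F n)" and g: "g \<in> carrier (thompson_F n)"
  then have c: "f \<in> carrier (homeo_group {0..1})" "g \<in> carrier (homeo_group {0..1})" by (auto simp: thompson_F_iff mono_homeos_def)
  have "cantor_action n (f \<otimes>\<^bsub>homeo_group {0..1}\<^esub> g) = cantor_action n f \<otimes>\<^bsub>HomeoC n\<^esub> cantor_action n g"
    using f g by (simp add: cantor_action_def interval_action_mult[OF c] cantor_lift_mult thompson_F_iff)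
  then show "f \<otimes>\<^bsub>homeo_group {0..1}\<^esub> g \<in> carrier (thompson_F n)"
    using f g subgroup.m_closed[OF subgroup_F_cantor] subgroup.m_closed[OF subgroup_mono_homeos]
      subgroup.m_closed[OF subgroup_adic_homeos] by (simp add: thompson_F_iff interval_action_mult[OF c])
qed

lemma thompson_F_mult: "x \<otimes>\<^bsub>thompson_F n\<^esub> y = x \<otimes>\<^bsub>homeo_group {0..1}\<^esub> y"
  by (simp add: thompson_F_def)

lemma group_thompson_F: "group (thompson_F n)"
proof -
  have "thompson_F n = homeo_group {0..1}\<lparr>carrier := carrier (thompson_F n)\<rparr>" by (simp add: thompson_F_def)
  then show ?thesis using subgroup.subgroup_is_group[OF subgroup_thompson_F group_homeo_group] by metis
qed

lemma thompson_F_homeo: "f \<in> carrier (thompson_F n) \<Longrightarrow> f \<in> carrier (homeo_group {0..1})"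
  by (auto simp: thompson_F_iff mono_homeos_def)

lemma interval_action_hom: "interval_action \<in> hom (thompson_F n) Homeo01"
  by (rule homI) (auto simp: thompson_F_homeo homeo_Icc_interval(3) thompson_F_mult interval_action_mult)

lemma interval_action_inj_F: "inj_on interval_action (carrier (thompson_F n))"
  by (rule inj_on_subset[OF interval_action_inj]) (auto simp: thompson_F_iff)

lemma cantor_action_hom: "cantor_action n \<in> hom (thompson_F n) (HomeoC n)"
proof (rule homI)
  fix f g assume f: "f \<in> carrier (thompson_F n)" and g: "g \<in> carrier (thompson_F n)"
  show "cantor_action n (f \<otimes>\<^bsub>thompson_F n\<^esub> g) = cantor_action n f \<otimes>\<^bsub>HomeoC n\<^esub> cantor_action n g"
    using f g thompson_F_homeo
    by (simp add: cantor_action_def thompson_F_mult interval_action_mult cantor_lift_mult thompson_F_iff)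
qed (auto simp: thompson_F_iff F_cantor_carrier)

lemma cantor_action_inj: "inj_on (cantor_action n) (carrier (thompson_F n))"
proof (rule inj_onI)
  fix f g assume f: "f \<in> carrier (thompson_F n)" and g: "g \<in> carrier (thompson_F n)" and e: "cantor_action n f = cantor_action n g"
  then have "interval_action f = interval_action g"
    using inj_onD[OF cantor_lift_inj] by (auto simp: cantor_action_def thompson_F_iff)
  then show "f = g" using inj_onD[OF interval_action_inj_F] f g by blast
qed

text \<open>An order-preserving homeomorphism respects the fibres of \<open>rho\<close> and descends
  to [0,1]. It fixes both constant words, so the descended map fixes 0 and 1 and is
  increasing.\<close>

lemma cantor_action_surj:
  assumes p: "\<psi> \<in> carrier (F_cantor n)" shows "\<exists>f\<in>carrier (thompson_F n). cantor_action n f = \<psi>"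
proof -
  have c: "\<psi> \<in> carrier (HomeoC n)" "order_preserving n \<psi>" using p by (auto simp: F_cantor_carrier)
  then have b: "bij_betw \<psi> (cantor n) (cantor n)" by (simp add: homeo_group_carrier_iff)
  have r: "preserves_rho_relation n \<psi>" by (rule monotone_preserves_rho[OF b]) (use c in blast)
  obtain f where f: "f\<in>carrier (homeo_group {0..1})" "\<forall>\<omega>\<in>cantor n. rho n (\<psi> \<omega>) = f (rho n \<omega>)" using descend[OF c(1) r] by blast
  note D = descend_adic_stable[OF c(1) r f]
  have "f 0 = 0" "f 1 = 1" using f(2)[rule_format, OF zeros_cantor] f(2)[rule_format, OF tops_cantor] order_preserving_ends[OF b c(2)] by simp_all
  then have "\<not> strict_antimono_on {0..1} f" using monotone_onD[of "{0..1}" "(<)" "(>)" f 0 1] by auto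
  then have "f \<in> mono_homeos" using homeo_Icc_interval(1)[OF f(1)] f(1) by (auto simp: mono_homeos_def)
  then have "f \<in> carrier (thompson_F n)" using D p by (simp add: thompson_F_iff cantor_action_def)
  then show ?thesis using D(2) by (auto simp: cantor_action_def)
qed

lemma cantor_action_image: "cantor_action n ` carrier (thompson_F n) = carrier (F_cantor n)"
  using cantor_action_surj by (auto simp: thompson_F_iff)

lemma cantor_action_iso: "cantor_action n \<in> iso (thompson_F n) (F_cantor n)"
proof -
  have "cantor_action n \<in> hom (thompson_F n) (F_cantor n)"
    using cantor_action_hom by (auto simp: hom_def thompson_F_iff F_cantor_def)
  then show ?thesis using cantor_action_inj cantor_action_image by (simp add: iso_def bij_betw_def)
qed

text \<open>Compare the first point of the cylinder of u with its image. By \<open>PL_shift\<close>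
  their values differ by n - 1 times an n-adic number; after clearing denominators the powers of n
  disappear modulo n - 1, and numerals may be replaced by digit sums.\<close>

lemma F_cantor_sum_list:
  assumes f: "f \<in> carrier (F_cantor n)" and r: "replaces f u v"
  shows "int (n - 1) dvd int (sum_list u) - int (sum_list v)"
proof -
  obtain g where g: "g \<in> carrier (thompson_F n)" "cantor_action n g = f" using cantor_action_surj[OF f] by blast
  then have gm: "g \<in> mono_homeos" "interval_action g \<in> adic_homeos" by (auto simp: thompson_F_iff)
  have gPL: "n_adic_PL n g" using g(1) by (simp add: thompson_F_def)
  have uv: "u \<in> words n" "v \<in> words n" using r by (auto simp: replaces_def)
  let ?x = "rho n (u \<frown> (\<lambda>_. 0))" let ?p = "length u" and ?q = "length v"
  have c: "u \<frown> (\<lambda>_. 0) \<in> cantor n" using uv by simp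
  have "g ?x = rho n (v \<frown> (\<lambda>_. 0))" using lift_rho[OF gm(1,2) c] g r by (simp add: replaces_def)
  then have gx: "g ?x = real (word_num n v) / real n ^ ?q" using rho_conc[OF uv(2) zeros_cantor] by simp
  have x: "?x = real (word_num n u) / real n ^ ?p" using rho_conc[OF uv(1) zeros_cantor] by simp
  have "?x \<in> n_adic n" by (rule evconst_top_n_adic[OF c]) simp
  then obtain d where d: "d \<in> n_adic n" "g ?x = ?x + real (n - 1) * d"
  proof -
    obtain B where B: "finite B" "B \<subseteq> n_adic n \<inter> {0..1}" "{0, 1} \<subseteq> B"
      and aff: "\<forall>a b. 0 \<le> a \<and> a < b \<and> b \<le> 1 \<and> {a<..<b} \<inter> B = {} \<longrightarrow>
           (\<exists>(k::int) c. \<forall>x\<in>{a..b}. g x = of_nat n powi k * x + c)"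
      using gPL unfolding n_adic_PL_def by (elim exE conjE)
    from PL_shift[OF B aff mono_homeos_ends(1)[OF gm(1)] \<open>?x \<in> _\<close> rho_nonneg[OF c] rho_le_1[OF c]] that
    show thesis by blast
  qed
  then obtain a :: int and k where a: "d = of_int a / real n ^ k" by (auto simp: n_adic_def)
  have "real (word_num n v) / real n ^ ?q = real (word_num n u) / real n ^ ?p + real (n - 1) * (of_int a / real n ^ k)"
    using d gx x a by simp
  then have "real (word_num n v) * real n ^ (?p + k) = real (word_num n u) * real n ^ (?q + k) + real (n - 1) * of_int a * real n ^ (?p + ?q)"
    by (simp add: field_simps power_add)
  then have "real_of_int (int (word_num n v) * int n ^ (?p + k)) = real_of_int (int (word_num n u) * int n ^ (?q + k) + int (n - 1) * a * int n ^ (?p + ?q))"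
    by simp
  then have e: "int (word_num n v) * int n ^ (?p + k) = int (word_num n u) * int n ^ (?q + k) + int (n - 1) * a * int n ^ (?p + ?q)"
    by (simp only: of_int_eq_iff)
  have np: "int (n - 1) dvd int n ^ m - 1" for m
    using power_diff_1_eq[of "int n" m] n2 by (simp add: of_nat_diff)
  have "int (word_num n u) - int (word_num n v) = 
      int (word_num n v) * (int n ^ (?p + k) - 1) - int (word_num n u) * (int n ^ (?q + k) - 1) - int (n - 1) * (a * int n ^ (?p + ?q))"
    using e by (simp add: algebra_simps)
  also have "int (n - 1) dvd \<dots>" by (intro dvd_diff dvd_mult np dvd_triv_left)
  finally have 1: "int (n - 1) dvd int (word_num n u) - int (word_num n v)" .
  have 2: "int (n - 1) dvd int (word_num n w) - int (sum_list w)" for w by (rule word_num_cong_sum_list) (use n2 in simp)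
  have "int (sum_list u) - int (sum_list v) = (int (word_num n u) - int (word_num n v)) - (int (word_num n u) - int (sum_list u)) + (int (word_num n v) - int (sum_list v))"
    by simp
  also have "int (n - 1) dvd \<dots>" by (intro dvd_add dvd_diff 1 2)
  finally show ?thesis .
qed

section \<open>Prefix codes and bumps\<close>

definition is_code :: "nat list list \<Rightarrow> bool" where
  "is_code us \<longleftrightarrow> set us \<subseteq> words n \<and> sorted_wrt word_less us \<and> (\<forall>\<omega>\<in>cantor n. \<exists>u\<in>set us. \<omega> \<in> cylinder n u)"

lemma is_code_words: "is_code us \<Longrightarrow> i < length us \<Longrightarrow> us ! i \<in> words n"
  by (meson is_code_def nth_mem subsetD)

lemma is_code_Nil: "is_code [[]]"
  by (auto simp: is_code_def cylinder_def)

lemma is_code_split: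
  assumes "is_code (xs @ x # ys)"
  shows "is_code (xs @ map (\<lambda>i. x @ [i]) [0..<n] @ ys)"
  unfolding is_code_def
proof (intro conjI ballI)
  have x: "x \<in> words n" "set xs \<subseteq> words n" "set ys \<subseteq> words n" using assms by (auto simp: is_code_def)
  then show "set (xs @ map (\<lambda>i. x @ [i]) [0..<n] @ ys) \<subseteq> words n" by auto
  have s: "sorted_wrt word_less (xs @ x # ys)" using assms by (simp add: is_code_def)
  have 1: "word_less a (x @ [i])" if "word_less a x" for a i using word_less_append[OF that, of "[]"] by simp
  have 2: "word_less (x @ [i]) a" if "word_less x a" for a i using word_less_append[OF that, of _ "[]"] by simp
  have 3: "sorted_wrt word_less (map (\<lambda>i. x @ [i]) [0..<n])"
    unfolding sorted_wrt_map
    by (rule sorted_wrt_mono_rel[OF _ sorted_wrt_upt]) (use less_fun_diff in \<open>auto simp: word_less_def\<close>)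
  show "sorted_wrt word_less (xs @ map (\<lambda>i. x @ [i]) [0..<n] @ ys)"
    using s 3 by (auto simp: sorted_wrt_append 1 2)
  fix \<omega> assume w: "\<omega> \<in> cantor n"
  then obtain u where u: "u \<in> set (xs @ x # ys)" "\<omega> \<in> cylinder n u" using assms unfolding is_code_def by blast
  show "\<exists>u\<in>set (xs @ map (\<lambda>i. x @ [i]) [0..<n] @ ys). \<omega> \<in> cylinder n u"
  proof (cases "u = x")
    case True
    then obtain \<eta> where e: "\<eta> \<in> cantor n" "\<omega> = x \<frown> \<eta>" using u by (auto simp: cylinder_def)
    have "\<eta> = [\<eta> 0] \<frown> suffix 1 \<eta>" using build_split[of \<eta>] by simp
    then have "\<omega> = (x @ [\<eta> 0]) \<frown> suffix 1 \<eta>" using e(2) by (metis conc_conc)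
    then have "\<omega> \<in> cylinder n (x @ [\<eta> 0])" using e by (auto simp: cylinder_def)
    then show ?thesis using cantorD[OF e(1), of 0] by auto
  qed (use u in auto)
qed

text \<open>Start from the one-word code and split along the letters of u: a letter i leaves i
  siblings on the left and n - 1 - i on the right. Thus the digit sum counts the words to the left
  of u.\<close>

lemma is_code_path:
  "u \<in> words n \<Longrightarrow> \<exists>xs ys. is_code (xs @ u # ys) \<and> length xs = sum_list u \<and> length xs + length ys = (n - 1) * length u"
proof (induction u rule: rev_induct)
  case Nil
  then show ?case using is_code_Nil by (intro exI[of _ "[]"]) auto
next
  case (snoc i u)
  then obtain xs ys where c: "is_code (xs @ u # ys)" "length xs = sum_list u" "length xs + length ys = (n - 1) * length u" by auto
  have i: "i < n" using snoc by auto
  then have "[0..<n] = [0..<i] @ i # [Suc i..<n]"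
    using upt_add_eq_append[of 0 i "n - i"] upt_conv_Cons[of i n] by simp
  then have "is_code ((xs @ map (\<lambda>i. u @ [i]) [0..<i]) @ (u @ [i]) # (map (\<lambda>i. u @ [i]) [Suc i..<n] @ ys))"
    using is_code_split[OF c(1)] by simp
  then show ?case using c i
    by (intro exI[of _ "xs @ map (\<lambda>i. u @ [i]) [0..<i]"] exI[of _ "map (\<lambda>i. u @ [i]) [Suc i..<n] @ ys"] conjI) auto
qed

text \<open>Each split of the first word adds n - 1 words on the left and leaves the rest alone; an
  empty left part cannot grow.\<close>

lemma is_code_expand_left:
  "is_code (xs @ zs) \<Longrightarrow> xs \<noteq> [] \<or> m = 0 \<Longrightarrow> \<exists>xs'. is_code (xs' @ zs) \<and> length xs' = length xs + m * (n - 1)"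
proof (induction m)
  case (Suc m)
  then obtain xs' where x: "is_code (xs' @ zs)" "length xs' = length xs + m * (n - 1)" by auto
  then obtain y ys where ys: "xs' = y # ys" using Suc.prems by (cases xs') auto
  have "is_code ((map (\<lambda>i. y @ [i]) [0..<n] @ ys) @ zs)" using is_code_split[of "[]" y "ys @ zs"] x ys by simp
  moreover have "length (map (\<lambda>i. y @ [i]) [0..<n] @ ys) = length xs + Suc m * (n - 1)" using x ys n2 by simp
  ultimately show ?case by blast
qed auto

lemma is_code_expand_right:
  "is_code (zs @ xs) \<Longrightarrow> xs \<noteq> [] \<or> m = 0 \<Longrightarrow> \<exists>xs'. is_code (zs @ xs') \<and> length xs' = length xs + m * (n - 1)"
proof (induction m)
  case (Suc m)
  then obtain xs' where x: "is_code (zs @ xs')" "length xs' = length xs + m * (n - 1)" by auto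
  then obtain y ys where ys: "xs' = y # ys" using Suc.prems by (cases xs') auto
  have "is_code (zs @ (map (\<lambda>i. y @ [i]) [0..<n] @ ys))" using is_code_split[of zs y ys] x ys by simp
  moreover have "length (map (\<lambda>i. y @ [i]) [0..<n] @ ys) = length xs + Suc m * (n - 1)" using x ys n2 by simp
  ultimately show ?case by blast
qed auto

lemma is_code_align:
  assumes "is_code (xs @ u # ys)" and p: "length xs \<le> p" "int (n - 1) dvd int p - int (length xs)" "xs = [] \<Longrightarrow> p = 0"
    and q: "length ys \<le> q" "int (n - 1) dvd int q - int (length ys)" "ys = [] \<Longrightarrow> q = 0"
  shows "\<exists>xs' ys'. is_code (xs' @ u # ys') \<and> length xs' = p \<and> length ys' = q"
proof -
  have ex: "\<exists>m. p = l + m * (n - 1)" if "l \<le> p" "int (n - 1) dvd int p - int l" for p l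
  proof -
    have "(n - 1) dvd (p - l)" using that by (metis of_nat_diff of_nat_dvd_iff)
    then show ?thesis using that by (metis dvdE le_add_diff_inverse mult.commute)
  qed
  obtain m where m: "p = length xs + m * (n - 1)" using ex[OF p(1,2)] by blast
  obtain k where k: "q = length ys + k * (n - 1)" using ex[OF q(1,2)] by blast
  have "xs \<noteq> [] \<or> m = 0" using p(3) m n2 by auto
  then obtain xs' where x: "is_code (xs' @ u # ys)" "length xs' = p" using is_code_expand_left[OF assms(1)] m by metis
  have "ys \<noteq> [] \<or> k = 0" using q(3) k n2 by auto
  then obtain ys' where "is_code ((xs' @ [u]) @ ys')" "length ys' = q" using is_code_expand_right[of "xs' @ [u]" ys] x k by auto
  then show ?thesis using x by auto
qed

definition code_map :: "nat list list \<Rightarrow> nat list list \<Rightarrow> nat word \<Rightarrow> nat word" where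
  "code_map us vs = (\<lambda>\<omega>\<in>cantor n. let i = (THE i. i < length us \<and> \<omega> \<in> cylinder n (us ! i)) in vs ! i \<frown> suffix (length (us ! i)) \<omega>)"

lemma is_code_unique:
  assumes "is_code us" "i < length us" "j < length us" "us ! i \<frown> \<omega> = us ! j \<frown> \<eta>"
  shows "i = j"
proof (rule ccontr)
  assume "i \<noteq> j"
  then have "word_less (us ! i) (us ! j) \<or> word_less (us ! j) (us ! i)"
    using assms by (metis is_code_def linorder_neqE_nat sorted_wrt_nth_less)
  then show False unfolding word_less_def using assms(4) less_fun_irrefl by metis
qed

lemma is_code_decompose:
  assumes "is_code us" "\<omega> \<in> cantor n" obtains i \<eta> where "i < length us" "\<eta> \<in> cantor n" "\<omega> = us ! i \<frown> \<eta>"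
  using assms unfolding is_code_def cylinder_def by (metis imageE in_set_conv_nth)

lemma code_map_apply:
  assumes "is_code us" "i < length us" "\<eta> \<in> cantor n"
  shows "code_map us vs (us ! i \<frown> \<eta>) = vs ! i \<frown> \<eta>"
proof -
  have u: "us ! i \<in> words n" by (rule is_code_words[OF assms(1,2)])
  have "(THE j. j < length us \<and> us ! i \<frown> \<eta> \<in> cylinder n (us ! j)) = i"
    using assms is_code_unique[OF assms(1)] by (intro the_equality) (auto simp: cylinder_def)
  then show ?thesis using u assms by (simp add: code_map_def)
qed

lemma code_map_F_cantor:
  assumes u: "is_code us" and v: "is_code vs" and l: "length us = length vs"
  shows "code_map us vs \<in> carrier (F_cantor n)"
proof -
  have uw: "us ! i \<in> words n" "vs ! i \<in> words n" if "i < length us" for i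
    using u v l that is_code_words by auto
  have 1: "code_map us vs \<omega> \<in> cantor n" "code_map vs us (code_map us vs \<omega>) = \<omega>"
    if c: "is_code us" "is_code vs" "length us = length vs" and w: "\<omega> \<in> cantor n" for us vs \<omega>
  proof -
    obtain i \<eta> where i: "i < length us" "\<eta> \<in> cantor n" "\<omega> = us ! i \<frown> \<eta>" using is_code_decompose[OF c(1) w] .
    have "vs ! i \<in> words n" using c i is_code_words by simp
    then show "code_map us vs \<omega> \<in> cantor n" "code_map vs us (code_map us vs \<omega>) = \<omega>"
      using code_map_apply[OF c(1) i(1,2)] code_map_apply[OF c(2), of i \<eta>] i c(3) by auto
  qed
  have b: "bij_betw (code_map us vs) (cantor n) (cantor n)"
    by (rule bij_betwI[of _ _ _ "code_map vs us"]) (use 1 u v l in auto)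
  have o: "order_preserving n (code_map us vs)"
    unfolding order_preserving_def monotone_on_def
  proof safe
    fix \<omega> \<eta> assume w: "\<omega> \<in> cantor n" "\<eta> \<in> cantor n" and le: "less_fun \<omega> \<eta>"
    obtain i \<alpha> where i: "i < length us" "\<alpha> \<in> cantor n" "\<omega> = us ! i \<frown> \<alpha>" using is_code_decompose[OF u w(1)] .
    obtain j \<beta> where j: "j < length us" "\<beta> \<in> cantor n" "\<eta> = us ! j \<frown> \<beta>" using is_code_decompose[OF u w(2)] .
    have "\<not> j < i"
    proof
      assume "j < i"
      then have "word_less (us ! j) (us ! i)" using u i by (metis is_code_def sorted_wrt_nth_less)
      then show False using le i j less_fun_asym unfolding word_less_def by metis
    qed
    then consider "i = j" | "i < j" by linarith
    then have "less_fun (vs ! i \<frown> \<alpha>) (vs ! j \<frown> \<beta>)"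
    proof cases
      case 1
      then show ?thesis using le i j by simp
    next
      case 2
      then have "word_less (vs ! i) (vs ! j)" using v j l by (metis is_code_def sorted_wrt_nth_less)
      then show ?thesis by (simp add: word_less_def)
    qed
    then show "less_fun (code_map us vs \<omega>) (code_map us vs \<eta>)" using code_map_apply[OF u] i j by simp
  qed
  have "code_map us vs \<in> carrier (HomeoC n)" by (rule monotone_HomeoC[OF b]) (use o in \<open>auto simp: code_map_def\<close>)
  moreover have "locally_replacing (code_map us vs)"
    unfolding locally_replacing_def
  proof
    fix \<omega> assume w: "\<omega> \<in> cantor n"
    obtain i \<eta> where i: "i < length us" "\<eta> \<in> cantor n" "\<omega> = us ! i \<frown> \<eta>" using is_code_decompose[OF u w] .
    have "replaces (code_map us vs) (us ! i) (vs ! i)" using uw[OF i(1)] code_map_apply[OF u i(1)] by (simp add: replaces_def)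
    then show "\<exists>k v. replaces (code_map us vs) (prefix k \<omega>) v" using i(3) by (metis prefix_conc_length)
  qed
  ultimately show ?thesis using o by (simp add: F_cantor_carrier)
qed

text \<open>Complete u and v to codes. The numbers of words on either side are congruent modulo n -
  1, so splitting words other than u and v makes them equal, and matching the two codes in order
  takes u to v. By \<open>l\<close> and \<open>r\<close> a side is empty for both words or for
  neither.\<close>

lemma F_cantor_moves:
  assumes u: "u \<in> words n" and v: "v \<in> words n" and d: "int (n - 1) dvd int (sum_list u) - int (sum_list v)"
    and l: "sum_list u = 0 \<longleftrightarrow> sum_list v = 0"
    and r: "sum_list u = (n - 1) * length u \<longleftrightarrow> sum_list v = (n - 1) * length v"
  shows "\<exists>f\<in>carrier (F_cantor n). replaces f u v"
proof -
  obtain xs ys where c: "is_code (xs @ u # ys)" "length xs = sum_list u" "length xs + length ys = (n - 1) * length u" using is_code_path[OF u] by blast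
  obtain xs' ys' where c': "is_code (xs' @ v # ys')" "length xs' = sum_list v" "length xs' + length ys' = (n - 1) * length v" using is_code_path[OF v] by blast
  have dx: "int (n - 1) dvd int (length xs) - int (length xs')" using d c c' by simp
  have "int (length ys) - int (length ys') = int (n - 1) * (int (length u) - int (length v)) - (int (length xs) - int (length xs'))"
  proof -
    have "int (length xs) + int (length ys) = int (n - 1) * int (length u)" using c(3) by (metis of_nat_add of_nat_mult)
    moreover have "int (length xs') + int (length ys') = int (n - 1) * int (length v)" using c'(3) by (metis of_nat_add of_nat_mult)
    ultimately show ?thesis by (simp add: right_diff_distrib)
  qed
  also have "int (n - 1) dvd \<dots>" by (rule dvd_diff[OF dvd_triv_left dx])
  finally have dy: "int (n - 1) dvd int (length ys) - int (length ys')" .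
  have e: "xs = [] \<longleftrightarrow> xs' = []" "ys = [] \<longleftrightarrow> ys' = []"
    using l r c c' by (metis length_0_conv, metis add_cancel_left_right length_0_conv)
  define p where "p = max (length xs) (length xs')"
  define q where "q = max (length ys) (length ys')"
  have dsym: "int (n - 1) dvd b - a" if "int (n - 1) dvd a - b" for a b using that by (simp add: dvd_diff_commute)
  have "\<exists>xs' ys'. is_code (xs' @ u # ys') \<and> length xs' = p \<and> length ys' = q"
    using dx dy dsym e by (intro is_code_align[OF c(1)]) (auto simp: p_def q_def max_def)
  then obtain as bs where A: "is_code (as @ u # bs)" "length as = p" "length bs = q" by blast
  have "\<exists>xs' ys'. is_code (xs' @ v # ys') \<and> length xs' = p \<and> length ys' = q"
    using dx dy dsym e by (intro is_code_align[OF c'(1)]) (auto simp: p_def q_def max_def)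
  then obtain as' bs' where B: "is_code (as' @ v # bs')" "length as' = p" "length bs' = q" by blast
  let ?f = "code_map (as @ u # bs) (as' @ v # bs')"
  have "?f \<in> carrier (F_cantor n)" by (rule code_map_F_cantor[OF A(1) B(1)]) (use A B in simp)
  moreover have "replaces ?f u v"
    unfolding replaces_def using u v code_map_apply[OF A(1), of p _ "as' @ v # bs'"] A B by (auto simp: nth_append)
  ultimately show ?thesis by blast
qed

text \<open>Adds (n - 1) g to the identity, where g rises with slope 1, stays constant and falls
  with slope -1/n. The resulting slopes are n, 1 and 1/n.\<close>

lemma bump_exists:
  assumes pq: "p \<in> n_adic n" "q \<in> n_adic n" "0 \<le> p" "p < q" "q \<le> 1"
  shows "\<exists>f\<in>carrier (thompson_F n). (\<forall>x\<in>{p<..<q}. x < f x) \<and> (\<forall>x\<in>{0..1} - {p<..<q}. f x = x)"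
proof -
  \<comment> \<open>The height e = n^-k of g must leave room for its three pieces: the rise takes
    length e and the fall n e, hence the factor n + 1.\<close>
  obtain k where k: "(1 / real n) ^ k < (q - p) / (real n + 1)"
    using real_arch_pow_inv[of "(q - p) / (real n + 1)" "1 / real n"] pq n2 by auto
  define e where "e = (1 / real n) ^ k"
  have e: "0 < e" "(real n + 1) * e < q - p" using k by (simp_all add: e_def pos_less_divide_eq mult.commute)
  have en: "e \<in> n_adic n" using n_adic_powi[of "- int k"] by (simp add: e_def power_int_minus power_one_over field_simps)
  define g where "g x = max 0 (min (x - p) (min e ((q - x) / real n)))" for x
  define f0 where "f0 x = x + (real n - 1) * g x" for x
  define f where "f = restrict f0 {0..1}"
  have n1: "real n - 1 > 0" using n2 by simp
  have gpos: "g x > 0" if "x \<in> {p<..<q}" for x using that e(1) by (auto simp: g_def)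
  have g0: "g x = 0" if "x \<notin> {p<..<q}" for x
  proof (cases "x \<le> p")
    case False
    then have "(q - x) / real n \<le> 0" using that by (simp add: divide_nonpos_pos)
    then show ?thesis by (auto simp: g_def)
  qed (auto simp: g_def)
  \<comment> \<open>The steepest descent of g has slope -1/n, so \<open>f0\<close> keeps slope at
    least 1/n and is strictly increasing.\<close>
  have gsl: "g x - g y \<le> (y - x) / real n" if "x \<le> y" for x y
  proof -
    have "(q - x) / real n = (q - y) / real n + (y - x) / real n" by (simp flip: add_divide_distrib)
    moreover have "(y - x) / real n \<ge> 0" using that by simp
    ultimately show ?thesis using that unfolding g_def by linarith
  qed
  have sm: "f0 x < f0 y" if "x < y" for x y
  proof -
    have "(real n - 1) * (g x - g y) \<le> (real n - 1) * ((y - x) / real n)"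
      using gsl[of x y] that n2 by (intro mult_left_mono) auto
    also have "\<dots> = (y - x) - (y - x) / real n" by (simp add: field_simps)
    also have "\<dots> < y - x" using that by simp
    finally show ?thesis by (simp add: f0_def algebra_simps)
  qed
  have f01: "f0 0 = 0" "f0 1 = 1" using g0[of 0] g0[of 1] pq by (auto simp: f0_def)
  have c: "continuous_on {0..1} f0" unfolding f0_def g_def by (intro continuous_intros) auto
  have im: "f ` {0..1} = {0..1}"
  proof -
    have 1: "f0 x \<in> {0..1}" if "x \<in> {0..1}" for x
      using that sm[of 0 x] sm[of x 1] f01 by (cases "x = 0"; cases "x = 1") auto
    have 2: "\<exists>x\<in>{0..1}. f0 x = y" if "y \<in> {0..1}" for y
      using IVT'[of f0 0 y 1] that f01 c by auto
    have "f0 ` {0..1} = {0..1}"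
    proof (intro equalityI subsetI)
      show "y \<in> {0..1}" if "y \<in> f0 ` {0..1}" for y using that 1 by blast
      show "y \<in> f0 ` {0..1}" if "y \<in> {0..1}" for y using 2[OF that] by blast
    qed
    then show ?thesis by (simp add: f_def)
  qed
  have smf: "strict_mono_on {0..1} f" using sm by (auto simp: f_def monotone_on_def)
  have inj: "inj_on f {0..1}" using smf by (rule strict_mono_on_imp_inj_on)
  have cf: "continuous_on {0..1} f" using c continuous_on_cong[of "{0..1}" "{0..1}" f f0] by (auto simp: f_def)
  obtain h where "homeomorphism {0..1} {0..1} f h" using homeomorphism_compact[OF _ cf im inj] by auto
  then have fc: "f \<in> carrier (homeo_group {0..1})"
    using inj im by (auto simp: homeo_group_def Bij_def bij_betw_def f_def)
  have "n_adic_PL n f"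
    unfolding n_adic_PL_def
  proof (intro exI[of _ "{0, 1, p, p + e, q - real n * e, q}"] conjI allI impI)
    have ne: "real n * e \<in> n_adic n" using n_adic_mult[OF n_adic_of_int[of "int n"] en] by simp
    have o: "p + e < q - real n * e" using e by (simp add: algebra_simps)
    have ne0: "real n * e > 0" using e by simp
    show "{0, 1, p, p + e, q - real n * e, q} \<subseteq> n_adic n \<inter> {0..1}"
    proof -
      have "p \<le> 1" "p + e \<le> 1" "0 \<le> p + e" "0 \<le> q - real n * e" "q - real n * e \<le> 1" "0 \<le> q"
        using pq e(1) o ne0 by linarith+
      then show ?thesis using pq en ne by (simp add: n_adic_add n_adic_diff)
    qed
    fix a b assume ab: "0 \<le> a \<and> a < b \<and> b \<le> 1 \<and> {a<..<b} \<inter> {0, 1, p, p + e, q - real n * e, q} = {}"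
    have av: "c \<le> a \<or> b \<le> c" if "c \<in> {p, p + e, q - real n * e, q}" for c using ab that by force
    have fe: "f x = x + (real n - 1) * g x" if "x \<in> {a..b}" for x using that ab by (auto simp: f_def f0_def)
    consider "b \<le> p \<or> q \<le> a" | "p \<le> a" "b \<le> p + e" | "p + e \<le> a" "b \<le> q - real n * e" | "q - real n * e \<le> a" "b \<le> q"
      using av[of p] av[of "p + e"] av[of "q - real n * e"] av[of q] o by fastforce
    then show "\<exists>(k::int) c. \<forall>x\<in>{a..b}. f x = real n powi k * x + c"
    proof cases
      case 1
      then have "f x = real n powi 0 * x + 0" if "x \<in> {a..b}" for x using fe[OF that] g0[of x] that by auto
      then show ?thesis by blast
    next
      case 2
      have "f x = real n powi 1 * x + (- (real n - 1) * p)" if x: "x \<in> {a..b}" for x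
      proof -
        have "e \<le> (q - x) / real n" using x 2 o by (simp add: pos_le_divide_eq mult.commute)
        then have gx: "g x = x - p" using x 2 by (auto simp: g_def)
        show ?thesis using fe[OF x] unfolding gx by (simp add: algebra_simps)
      qed
      then show ?thesis by blast
    next
      case 3
      have "f x = real n powi 0 * x + ((real n - 1) * e)" if x: "x \<in> {a..b}" for x
      proof -
        have "e \<le> (q - x) / real n" using x 3 by (simp add: pos_le_divide_eq mult.commute)
        then have "g x = e" using x 3 e by (auto simp: g_def)
        then show ?thesis using fe[OF x] by simp
      qed
      then show ?thesis by blast
    next
      case 4
      have "f x = real n powi (- 1) * x + ((real n - 1) * (q / real n))" if x: "x \<in> {a..b}" for x
      proof -
        have "(q - x) / real n \<le> e" using x 4 by (simp add: pos_divide_le_eq mult.commute)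
        moreover have "e \<le> x - p" using x 4 o by simp
        moreover have "0 \<le> (q - x) / real n" using x 4 by simp
        ultimately have gx: "g x = (q - x) / real n" using e by (auto simp: g_def)
        have "x + (real n - 1) * ((q - x) / real n) = inverse (real n) * x + (real n - 1) * (q / real n)"
          by (simp add: field_simps)
        then show ?thesis using fe[OF x] unfolding gx by (simp add: power_int_minus)
      qed
      then show ?thesis by blast
    qed
  qed auto
  then have "f \<in> carrier (thompson_F n)" using fc smf by (simp add: thompson_F_def)
  moreover have "\<forall>x\<in>{p<..<q}. x < f x" using gpos n1 pq by (auto simp: f_def f0_def)
  moreover have "\<forall>x\<in>{0..1} - {p<..<q}. f x = x" using g0 by (auto simp: f_def f0_def)
  ultimately show ?thesis by blast
qed

end

section \<open>Reconstruction of the interval from the group\<close>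

text \<open>If x were moved, a fixed point would lie strictly between x and its image, but an
  increasing map keeps points on their side of a fixed point.\<close>

lemma strict_mono_fixed_dense:
  fixes c :: "real \<Rightarrow> real"
  assumes c: "\<And>x. x \<in> I \<Longrightarrow> c x \<in> I" "strict_mono_on I c" and e: "\<And>e. e \<in> E \<Longrightarrow> c e = e" "E \<subseteq> I"
    and dense: "\<And>x y. x \<in> I \<Longrightarrow> y \<in> I \<Longrightarrow> x < y \<Longrightarrow> \<exists>e\<in>E. x < e \<and> e < y" and x: "x \<in> I"
  shows "c x = x"
proof (rule ccontr)
  assume "c x \<noteq> x"
  then consider "c x < x" | "x < c x" by linarith
  then show False
  proof cases
    case 1
    then obtain d where d: "d \<in> E" "c x < d" "d < x" using dense c(1) x by blast
    then show False using strict_mono_onD[OF c(2), of d x] e x by fastforce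
  next
    case 2
    then obtain d where d: "d \<in> E" "x < d" "d < c x" using dense c(1) x by blast
    then show False using strict_mono_onD[OF c(2), of x d] e x by fastforce
  qed
qed

text \<open>Suprema extend \<phi> and its inverse to increasing maps of the interval. Both
  composites are increasing and fix a dense set, so they are identities; bijectivity follows without
  any continuity argument.\<close>

lemma dense_order_iso_extension:
  fixes \<phi> :: "real \<Rightarrow> real"
  assumes D: "D1 \<subseteq> {0<..<1}" "D2 \<subseteq> {0<..<1}"
    and d1: "\<And>x y. 0 \<le> x \<Longrightarrow> x < y \<Longrightarrow> y \<le> 1 \<Longrightarrow> \<exists>d\<in>D1. x < d \<and> d < y"
    and d2: "\<And>x y. 0 \<le> x \<Longrightarrow> x < y \<Longrightarrow> y \<le> 1 \<Longrightarrow> \<exists>d\<in>D2. x < d \<and> d < y"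
    and b: "bij_betw \<phi> D1 D2" and m: "strict_mono_on D1 \<phi>"
  shows "\<exists>a. bij_betw a {0<..<1} {0<..<1} \<and> strict_mono_on {0<..<1} a \<and> (\<forall>d\<in>D1. a d = \<phi> d)"
proof -
  have ext: "\<exists>a. (\<forall>x\<in>{0<..<1}. a x \<in> {0<..<1}) \<and> strict_mono_on {0<..<1} a \<and> (\<forall>d\<in>D1. a d = \<phi> d)"
    if D: "D1 \<subseteq> {0<..<1}" "D2 \<subseteq> {0<..<1}"
    and d1: "\<And>x y. 0 \<le> x \<Longrightarrow> x < y \<Longrightarrow> y \<le> 1 \<Longrightarrow> \<exists>d\<in>D1. x < d \<and> d < y"
    and b: "bij_betw \<phi> D1 D2" and m: "strict_mono_on D1 \<phi>" for D1 D2 and \<phi> :: "real \<Rightarrow> real"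
  proof -
    define a where "a x = Sup (\<phi> ` {d \<in> D1. d \<le> x})" for x
    have r: "\<phi> d \<in> {0<..<1}" if "d \<in> D1" for d using b that D by (auto simp: bij_betw_def)
    have mle: "\<phi> d \<le> \<phi> d'" if "d \<in> D1" "d' \<in> D1" "d \<le> d'" for d d' using strict_mono_on_leD[OF m] that by blast
    have bdd: "bdd_above (\<phi> ` {d \<in> D1. d \<le> x})" for x
      by (rule bdd_aboveI2[of _ _ 1]) (use r in fastforce)
    have lo: "\<phi> d \<le> a x" if "d \<in> D1" "d \<le> x" for d x
      unfolding a_def by (rule cSup_upper[OF _ bdd]) (use that in auto)
    have hi: "a x \<le> \<phi> d" if "d \<in> D1" "x \<le> d" "0 < x" "x < 1" for d x
      unfolding a_def
    proof (rule cSup_least)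
      have "\<exists>d\<in>D1. 0 < d \<and> d < x" using that by (intro d1) auto
      then obtain d' where "d' \<in> D1" "d' < x" by blast
      then show "\<phi> ` {d \<in> D1. d \<le> x} \<noteq> {}" by force
      fix y assume "y \<in> \<phi> ` {d \<in> D1. d \<le> x}"
      then show "y \<le> \<phi> d" using mle that by auto
    qed
    have "a x \<in> {0<..<1}" if x: "x \<in> {0<..<1}" for x
    proof -
      obtain d where d: "d \<in> D1" "d < x" using d1[of 0 x] x by auto
      obtain d' where d': "d' \<in> D1" "x < d'" using d1[of x 1] x by auto
      show ?thesis using lo[of d x] hi[of d' x] d d' x r[of d] r[of d'] by auto
    qed
    moreover have "strict_mono_on {0<..<1} a"
    proof (rule strict_mono_onI)
      fix x y :: real assume xy: "x \<in> {0<..<1}" "y \<in> {0<..<1}" "x < y"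
      obtain d where d: "d \<in> D1" "x < d" "d < y" using d1[of x y] xy by auto
      obtain d' where d': "d' \<in> D1" "d < d'" "d' < y" using d1[of d y] xy d by auto
      have "a x \<le> \<phi> d" "\<phi> d' \<le> a y" using hi[of d x] lo[of d' y] d d' xy by auto
      then show "a x < a y" using strict_mono_onD[OF m d(1) d'(1) d'(2)] by linarith
    qed
    moreover have "a d = \<phi> d" if "d \<in> D1" for d using lo[of d d] hi[of d d] that D by force
    ultimately show ?thesis by blast
  qed
  obtain a where a: "\<And>x. x\<in>{0<..<1} \<Longrightarrow> a x \<in> {0<..<1}" "strict_mono_on {0<..<1} a" "\<And>d. d\<in>D1 \<Longrightarrow> a d = \<phi> d"
    using ext[OF D d1 b m] by blast
  obtain c where c: "\<And>x. x\<in>{0<..<1} \<Longrightarrow> c x \<in> {0<..<1}" "strict_mono_on {0<..<1} c" "\<And>d. d\<in>D2 \<Longrightarrow> c d = inv_into D1 \<phi> d"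
    using ext[OF D(2,1) d2 bij_betw_inv_into[OF b] strict_mono_on_inv_into[OF b m]] by blast
  have 1: "a (c x) = x" if x: "x \<in> {0<..<1}" for x
  proof (rule strict_mono_fixed_dense[of "{0<..<1}" "\<lambda>x. a (c x)" D2])
    show "strict_mono_on {0<..<1} (\<lambda>x. a (c x))" using a c by (auto simp: monotone_on_def)
    show "a (c e) = e" if "e \<in> D2" for e
      using c(3)[OF that] a(3)[of "inv_into D1 \<phi> e"] b that by (auto simp: bij_betw_def inv_into_into f_inv_into_f)
  qed (use a c D d2 x in auto)
  have 2: "c (a x) = x" if x: "x \<in> {0<..<1}" for x
  proof (rule strict_mono_fixed_dense[of "{0<..<1}" "\<lambda>x. c (a x)" D1])
    show "strict_mono_on {0<..<1} (\<lambda>x. c (a x))" using a c by (auto simp: monotone_on_def)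
    show "c (a e) = e" if "e \<in> D1" for e
      using a(3)[OF that] c(3)[of "\<phi> e"] b that by (auto simp: bij_betw_def)
  qed (use a c D d1 x in auto)
  have "bij_betw a {0<..<1} {0<..<1}" by (rule bij_betwI[of _ _ _ c]) (use a c 1 2 in auto)
  then show ?thesis using a by blast
qed

text \<open>What the reconstruction uses of F_n. D plays the part of the n-adic points of [0,1];
  \<open>bump\<close> allows the action to be localized to small intervals, and \<open>edge\<close>
  ties the boundaries of fixed sets to D.\<close>

locale interval_group = group G for G (structure) +
  fixes act :: "'a \<Rightarrow> real \<Rightarrow> real" and D :: "real set"
  assumes act_bij: "g \<in> carrier G \<Longrightarrow> bij_betw (act g) {0<..<1} {0<..<1}"
    and act_mono: "g \<in> carrier G \<Longrightarrow> strict_mono_on {0<..<1} (act g)"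
    and act_mult: "g \<in> carrier G \<Longrightarrow> h \<in> carrier G \<Longrightarrow> x \<in> {0<..<1} \<Longrightarrow> act (g \<otimes> h) x = act g (act h x)"
    and faithful: "g \<in> carrier G \<Longrightarrow> h \<in> carrier G \<Longrightarrow> (\<And>x. x \<in> {0<..<1} \<Longrightarrow> act g x = act h x) \<Longrightarrow> g = h"
    and D_dense: "0 \<le> x \<Longrightarrow> x < y \<Longrightarrow> y \<le> 1 \<Longrightarrow> \<exists>d\<in>D. x < d \<and> d < y"
    and D_ends: "0 \<in> D" "1 \<in> D" "D \<subseteq> {0..1}"
    and D_act: "g \<in> carrier G \<Longrightarrow> x \<in> {0<..<1} \<Longrightarrow> act g x \<in> D \<longleftrightarrow> x \<in> D"
    and bump: "p \<in> D \<Longrightarrow> q \<in> D \<Longrightarrow> p < q \<Longrightarrow>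
       \<exists>g\<in>carrier G. (\<forall>x\<in>{p<..<q}. x < act g x) \<and> (\<forall>x\<in>{0<..<1} - {p<..<q}. act g x = x)"
    and edge: "g \<in> carrier G \<Longrightarrow> x \<in> {0<..<1} \<Longrightarrow> x \<in> frontier (interior {y \<in> {0<..<1}. act g y = y}) \<Longrightarrow> x \<in> D"
begin

text \<open>The set of moved points, without closure, hence open; \<open>fixint\<close> is the
  interior of its complement in (0,1).\<close>

definition supp :: "'a \<Rightarrow> real set" where "supp g = {x \<in> {0<..<1}. act g x \<noteq> x}"
definition fixint :: "'a \<Rightarrow> real set" where "fixint g = interior {x \<in> {0<..<1}. act g x = x}"

lemma act_in: "g \<in> carrier G \<Longrightarrow> x \<in> {0<..<1} \<Longrightarrow> act g x \<in> {0<..<1}"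
  using act_bij[of g] by (auto simp: bij_betw_def)

lemma act_one: "x \<in> {0<..<1} \<Longrightarrow> act \<one> x = x"
proof -
  assume x: "x \<in> {0<..<1}"
  have "act \<one> (act \<one> x) = act \<one> x" using act_mult[of \<one> \<one> x] x by simp
  then show ?thesis using act_bij[of \<one>] act_in[of \<one> x] x by (auto simp: bij_betw_def inj_on_def)
qed

lemma act_inv: "g \<in> carrier G \<Longrightarrow> x \<in> {0<..<1} \<Longrightarrow> act g (act (inv g) x) = x"
  "g \<in> carrier G \<Longrightarrow> x \<in> {0<..<1} \<Longrightarrow> act (inv g) (act g x) = x"
  using act_mult[of g "inv g" x] act_mult[of "inv g" g x] act_one[of x] by simp_all

lemma act_less: "g \<in> carrier G \<Longrightarrow> x \<in> {0<..<1} \<Longrightarrow> y \<in> {0<..<1} \<Longrightarrow> act g x < act g y \<longleftrightarrow> x < y"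
  using strict_mono_on_less[OF act_mono] by blast

lemma act_eq: "g \<in> carrier G \<Longrightarrow> x \<in> {0<..<1} \<Longrightarrow> y \<in> {0<..<1} \<Longrightarrow> act g x = act g y \<longleftrightarrow> x = y"
  using act_bij[of g] by (auto simp: bij_betw_def inj_on_def)

lemma act_continuous: "g \<in> carrier G \<Longrightarrow> continuous_on {0<..<1} (act g)"
  by (rule strict_mono_on_bij_continuous[OF act_bij act_mono])

lemma act_open: "g \<in> carrier G \<Longrightarrow> open U \<Longrightarrow> open ({0<..<1} \<inter> act g -` U)"
  by (rule continuous_open_preimage[OF act_continuous]) auto

lemma act_image: "g \<in> carrier G \<Longrightarrow> U \<subseteq> {0<..<1} \<Longrightarrow> act g ` U = {0<..<1} \<inter> act (inv g) -` U"
proof (intro equalityI subsetI)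
  assume g: "g \<in> carrier G" "U \<subseteq> {0<..<1}"
  show "y \<in> {0<..<1} \<inter> act (inv g) -` U" if "y \<in> act g ` U" for y
  proof -
    from that obtain x where x: "x \<in> U" "y = act g x" by blast
    then have "x \<in> {0<..<1}" using g by blast
    then show ?thesis using x act_in[OF g(1)] act_inv(2)[OF g(1)] by simp
  qed
  show "y \<in> act g ` U" if "y \<in> {0<..<1} \<inter> act (inv g) -` U" for y using that g act_inv(1) by (intro image_eqI[of _ _ "act (inv g) y"]) auto
qed

lemma act_image_open: "g \<in> carrier G \<Longrightarrow> U \<subseteq> {0<..<1} \<Longrightarrow> open U \<Longrightarrow> open (act g ` U)"
  using act_open[of "inv g" U] by (simp add: act_image)

lemma D_interval:
  assumes "open W" "x \<in> W" "W \<subseteq> {0<..<1}" shows "\<exists>p\<in>D. \<exists>q\<in>D. p < x \<and> x < q \<and> {p<..<q} \<subseteq> W"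
proof -
  obtain e where e: "e > 0" "ball x e \<subseteq> W" using assms by (meson openE)
  have x: "0 < x" "x < 1" using assms by auto
  obtain p where p: "p \<in> D" "max 0 (x - e) < p" "p < x" using D_dense[of "max 0 (x - e)" x] e x by auto
  obtain q where q: "q \<in> D" "x < q" "q < min 1 (x + e)" using D_dense[of x "min 1 (x + e)"] e x by auto
  have "{p<..<q} \<subseteq> ball x e" using p q by (auto simp: dist_real_def)
  then show ?thesis using p q e by blast
qed

lemma D_sub: "p \<in> D \<Longrightarrow> q \<in> D \<Longrightarrow> {p<..<q} \<subseteq> {0<..<1}"
  using D_ends(3) by fastforce

lemma supp_open: "g \<in> carrier G \<Longrightarrow> open (supp g)"
proof -
  assume g: "g \<in> carrier G"
  have "open ({0<..<1} \<inter> (\<lambda>x. act g x - x) -` (- {0}))"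
    by (intro continuous_open_preimage continuous_intros act_continuous g)
  also have "{0<..<1} \<inter> (\<lambda>x. act g x - x) -` (- {0}) = supp g" by (auto simp: supp_def)
  finally show ?thesis .
qed

lemma supp_sub: "supp g \<subseteq> {0<..<1}" by (auto simp: supp_def)

lemma supp_act: "g \<in> carrier G \<Longrightarrow> x \<in> supp g \<Longrightarrow> act g x \<in> supp g"
  using act_in[of g x] act_eq[of g x "act g x"] by (auto simp: supp_def)

lemma supp_disjoint_commute:
  assumes g: "g \<in> carrier G" "h \<in> carrier G" and d: "supp g \<inter> supp h = {}"
  shows "g \<otimes> h = h \<otimes> g"
proof (rule faithful)
  fix x :: real assume x: "x \<in> {0<..<1}"
  note gx = act_in[OF g(1) x] and hx = act_in[OF g(2) x]
  show "act (g \<otimes> h) x = act (h \<otimes> g) x"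
  proof (cases "x \<in> supp g")
    case True
    then have "act g x \<in> supp g" using supp_act g by blast
    then have "act h (act g x) = act g x" "act h x = x" using d True x gx by (auto simp: supp_def)
    then show ?thesis using act_mult[OF g x] act_mult[OF g(2,1) x] by simp
  next
    case False
    show ?thesis
    proof (cases "x \<in> supp h")
      case T: True
      then have "act h x \<in> supp h" using supp_act g by blast
      then have "act g (act h x) = act h x" "act g x = x" using d False T x hx by (auto simp: supp_def)
      then show ?thesis using act_mult[OF g x] act_mult[OF g(2,1) x] by simp
    next
      case F: False
      then have "act g x = x" "act h x = x" using False x by (auto simp: supp_def)
      then show ?thesis using act_mult[OF g x] act_mult[OF g(2,1) x] by simp
    qed
  qed
qed (use g in auto)

lemma commute_supp:
  assumes g: "g \<in> carrier G" "h \<in> carrier G" "g \<otimes> h = h \<otimes> g" and x: "x \<in> supp h"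
  shows "act g x \<in> supp h"
proof -
  have xi: "x \<in> {0<..<1}" using x supp_sub by blast
  have "act h (act g x) = act g (act h x)" using act_mult[OF g(1,2) xi] act_mult[OF g(2,1) xi] g(3) by simp
  then show ?thesis using x act_eq[OF g(1), of "act h x" x] act_in[OF g(1) xi] act_in[OF g(2) xi] xi by (auto simp: supp_def)
qed

text \<open>Otherwise the images of v under elements supported in (p,q) have a supremum s below q. A
  bump on (p,q) moves everything there to the right, so it carries an image close to s beyond
  s.\<close>

lemma reach:
  assumes pq: "p \<in> D" "q \<in> D" "p < v" "v < q" "c < q"
  shows "\<exists>g\<in>carrier G. supp g \<subseteq> {p<..<q} \<and> c < act g v"
proof (rule ccontr)
  assume no: "\<not> ?thesis"
  have v: "v \<in> {0<..<1}" using pq D_ends(3) by force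
  define A where "A = {act g v | g. g \<in> carrier G \<and> supp g \<subseteq> {p<..<q}}"
  have le: "y \<le> c" if "y \<in> A" for y using no that by (auto simp: A_def not_less)
  have "supp \<one> = {}" using act_one by (auto simp: supp_def)
  then have vA: "v \<in> A" using act_one[OF v] unfolding A_def by (intro CollectI exI[of _ \<one>]) auto
  have bdd: "bdd_above A" using le by (rule bdd_aboveI)
  define s where "s = Sup A"
  have s: "v \<le> s" "s \<le> c" unfolding s_def using cSup_upper[OF vA bdd] cSup_least[of A c] vA le by auto
  obtain b where b: "b\<in>carrier G" "\<And>x. x\<in>{p<..<q} \<Longrightarrow> x < act b x" "\<And>x. x\<in>{0<..<1} - {p<..<q} \<Longrightarrow> act b x = x" using bump[of p q] pq by auto
  have si: "s \<in> {p<..<q}" using s pq by simp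
  then have si: "s \<in> {p<..<q}" "s \<in> {0<..<1}" using D_sub[OF pq(1,2)] by blast+
  \<comment> \<open>The preimage of s under the bump: an image of v beyond t is carried beyond
    s.\<close>
  define t where "t = act (inv b) s"
  have t: "t \<in> {0<..<1}" "act b t = s" using act_in[of "inv b" s] act_inv[of b s] b si by (auto simp: t_def)
  have "t < s" using act_less[OF b(1) t(1) si(2)] t(2) b(2)[OF si(1)] by simp
  then obtain y where "y \<in> A" "t < y" unfolding s_def using less_cSup_iff[OF _ bdd] vA by blast
  then obtain g where g: "g \<in> carrier G" "supp g \<subseteq> {p<..<q}" "t < act g v" by (auto simp: A_def)
  have gv: "act g v \<in> {0<..<1}" using act_in[OF g(1) v] .
  have "act b t < act b (act g v)" using act_less[OF b(1) t(1) gv] g(3) by simp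
  then have "s < act (b \<otimes> g) v" using t act_mult[OF b(1) g(1) v] by simp
  moreover have "supp (b \<otimes> g) \<subseteq> {p<..<q}"
  proof
    fix x assume x: "x \<in> supp (b \<otimes> g)"
    then have xi: "x \<in> {0<..<1}" using supp_sub by blast
    show "x \<in> {p<..<q}"
    proof (rule ccontr)
      assume n: "x \<notin> {p<..<q}"
      then have "act g x = x" using g(2) xi by (auto simp: supp_def)
      then have "act (b \<otimes> g) x = x" using b(3)[of x] n xi act_mult[OF b(1) g(1) xi] by simp
      then show False using x by (simp add: supp_def)
    qed
  qed
  then have "act (b \<otimes> g) v \<in> A" using b g by (auto simp: A_def)
  then have "act (b \<otimes> g) v \<le> s" unfolding s_def by (rule cSup_upper[OF _ bdd])
  ultimately show False by simp
qed

lemma supp_inv: "g \<in> carrier G \<Longrightarrow> supp (inv g) = supp g"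
proof -
  assume g: "g \<in> carrier G"
  have "act (inv g) x = x \<longleftrightarrow> act g x = x" if "x \<in> {0<..<1}" for x
    using act_inv[OF g that] by metis
  then show ?thesis by (auto simp: supp_def)
qed

lemma supp_interval_act:
  assumes "g \<in> carrier G" "supp g \<subseteq> {p<..<q}" "x \<in> {p<..<q}" "p \<in> D" "q \<in> D"
  shows "act g x \<in> {p<..<q}"
  using assms supp_act[of g x] by (cases "x \<in> supp g") (use D_sub[of p q] in \<open>auto simp: supp_def\<close>)

text \<open>Local transitivity up to neighbourhoods: \<open>reach\<close> pushes z to the right, and
  the inverse of such an element pushes to the left. The support ends at a point of D close to w, so
  that z does not overshoot.\<close>

lemma push:
  assumes pq: "p \<in> D" "q \<in> D" and z: "z \<in> {p<..<q}" and W: "open W" "W \<subseteq> {p<..<q}" "w \<in> W"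
  shows "\<exists>g\<in>carrier G. supp g \<subseteq> {p<..<q} \<and> act g z \<in> W"
proof -
  have Wi: "W \<subseteq> {0<..<1}" using W D_sub[OF pq] by blast
  obtain c d where cd: "c \<in> D" "d \<in> D" "c < w" "w < d" "{c<..<d} \<subseteq> W" using D_interval[OF W(1) W(3) Wi] by blast
  consider "z = w" | "z < w" | "w < z" by linarith
  then show ?thesis
  proof cases
    case 1
    then show ?thesis using W(3) z D_sub[OF pq] act_one[of w] by (intro bexI[of _ \<one>]) (auto simp: supp_def act_one)
  next
    case 2
    have zi: "z \<in> {0<..<1}" using z D_sub[OF pq] by blast
    have wi: "w \<in> {0<..<1}" using W(3) Wi by blast
    have "\<exists>d\<in>D. max c z < d \<and> d < w" using 2 cd(3) wi zi by (intro D_dense) auto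
    then obtain q' where q': "q' \<in> D" "max c z < q'" "q' < w" by blast
    obtain p' where p': "p' \<in> D" "p < p'" "p' < z" using D_dense[of p z] z zi pq D_ends by force
    obtain g where g: "g \<in> carrier G" "supp g \<subseteq> {p'<..<q'}" "max c z < act g z" using reach[of p' q' z "max c z"] p' q' by auto
    have "act g z \<in> {p'<..<q'}" using supp_interval_act[OF g(1,2)] p' q' by auto
    then have "act g z \<in> {c<..<d}" using g q' cd by auto
    moreover have "supp g \<subseteq> {p<..<q}" using g(2) p' q' W by fastforce
    ultimately show ?thesis using g cd by blast
  next
    case 3
    have zi: "z \<in> {0<..<1}" using z D_sub[OF pq] by blast
    have wi: "w \<in> {0<..<1}" using W(3) Wi by blast
    obtain q' where q': "q' \<in> D" "z < q'" "q' < q" using D_dense[of z q] z zi pq D_ends by force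
    obtain p' where p': "p' \<in> D" "c < p'" "p' < w" using D_dense[of c w] cd wi D_ends by force
    obtain g where g: "g \<in> carrier G" "supp g \<subseteq> {p'<..<q'}" "z < act g w" using reach[of p' q' w z] p' q' 3 by auto
    have a: "act (inv g) z \<in> {p'<..<q'}" using supp_interval_act[of "inv g" p' q' z] p' q' g 3 by (auto simp: supp_inv)
    have "act (inv g) z < w" using act_less[OF g(1), of "act (inv g) z" w] act_inv(1)[OF g(1) zi] act_in[of "inv g" z] g zi wi by simp
    then have "act (inv g) z \<in> {c<..<d}" using a p' cd by auto
    moreover have "w \<in> {p<..<q}" using W by blast
    then have "supp (inv g) \<subseteq> {p<..<q}" using g p' q' cd W 
    proof -
      have "c \<ge> p"
      proof (rule ccontr)
        assume "\<not> c \<ge> p"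
        then have "p \<in> {c<..<d}" using \<open>w \<in> {p<..<q}\<close> cd by auto
        then have "p \<in> {p<..<q}" using cd(5) W(2) by blast
        then show False by simp
      qed
      then show ?thesis using supp_inv[OF g(1)] g(2) p' q' by fastforce
    qed
    ultimately show ?thesis using g cd by (intro bexI[of _ "inv g"]) auto
  qed
qed

section \<open>Commutators and disjoint supports\<close>

definition comm :: "'a \<Rightarrow> 'a \<Rightarrow> 'a" where "comm a b = a \<otimes> b \<otimes> inv a \<otimes> inv b"

lemma comm_closed [simp]: "a \<in> carrier G \<Longrightarrow> b \<in> carrier G \<Longrightarrow> comm a b \<in> carrier G"
  by (simp add: comm_def)

lemma comm_eq_one_iff: "a \<in> carrier G \<Longrightarrow> b \<in> carrier G \<Longrightarrow> comm a b = \<one> \<longleftrightarrow> a \<otimes> b = b \<otimes> a"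
proof -
  assume ab: "a \<in> carrier G" "b \<in> carrier G"
  have "comm a b = (a \<otimes> b) \<otimes> inv (b \<otimes> a)" using ab by (simp add: comm_def inv_mult_group m_assoc)
  then have "comm a b = \<one> \<longleftrightarrow> a \<otimes> b = \<one> \<otimes> (b \<otimes> a)" using ab inv_solve_right[of \<one> "a \<otimes> b" "b \<otimes> a"] by (metis m_closed one_closed)
  then show ?thesis using ab by simp
qed

lemma comm_act:
  "a \<in> carrier G \<Longrightarrow> b \<in> carrier G \<Longrightarrow> x \<in> {0<..<1} \<Longrightarrow> act (comm a b) x = act a (act b (act (inv a) (act (inv b) x)))"
proof -
  assume a: "a \<in> carrier G" "b \<in> carrier G" and x: "x \<in> {0<..<1}"
  have 1: "act (inv b) x \<in> {0<..<1}" using act_in a x by blast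
  have 2: "act (inv a) (act (inv b) x) \<in> {0<..<1}" using act_in a 1 by blast
  show "act (comm a b) x = act a (act b (act (inv a) (act (inv b) x)))"
    using a act_mult[of "a \<otimes> b \<otimes> inv a" "inv b" x] act_mult[of "a \<otimes> b" "inv a" "act (inv b) x"]
      act_mult[of a b "act (inv a) (act (inv b) x)"] x 1 2 by (simp add: comm_def)
qed

text \<open>A first-order condition in the group that characterizes disjointness of supports; it is a variant
  of the formula of Rubin's reconstruction theorem.\<close>

definition separated :: "'a \<Rightarrow> 'a \<Rightarrow> bool" where
  "separated f g \<longleftrightarrow> (\<forall>h\<in>carrier G. h \<otimes> f \<noteq> f \<otimes> h \<longrightarrow>
     (\<exists>a\<in>carrier G. \<exists>b\<in>carrier G. a \<otimes> g = g \<otimes> a \<and> b \<otimes> g = g \<otimes> b \<and>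
        comm (comm h a) b \<noteq> \<one> \<and> comm (comm h a) b \<otimes> g = g \<otimes> comm (comm h a) b))"

lemma displaced_interval:
  assumes h: "h \<in> carrier G" and U: "open U" "x \<in> U" "U \<subseteq> {0<..<1}" and hx: "act h x \<noteq> x"
  shows "\<exists>p\<in>D. \<exists>q\<in>D. p < x \<and> x < q \<and> {p<..<q} \<subseteq> U \<and> (\<forall>y\<in>{p<..<q}. act h y \<notin> {p<..<q})"
proof -
  obtain A B where AB: "open A" "open B" "act h x \<in> A" "x \<in> B" "A \<inter> B = {}" using hausdorff[OF hx] by blast
  let ?W = "U \<inter> B \<inter> ({0<..<1} \<inter> act h -` A)"
  have "open ?W" using U AB act_open[OF h AB(1)] by blast
  moreover have "x \<in> ?W" using U AB by auto
  ultimately obtain p q where "p\<in>D" "q\<in>D" "p < x" "x < q" "{p<..<q} \<subseteq> ?W" using D_interval[of ?W x] by blast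
  then show ?thesis using AB by blast
qed

text \<open>Let h displace an interval V inside the support of f. For a supported in V, the
  commutator [h,a] acts on V like the inverse of a. Hence for a and b in V the element [[h,a],b] is
  again supported in V, off the support of g, and it is nontrivial if a and b do not
  commute.\<close>

lemma disjoint_imp_separated:
  assumes f: "f \<in> carrier G" and g: "g \<in> carrier G" and d: "supp f \<inter> supp g = {}"
  shows "separated f g"
  unfolding separated_def
proof (intro ballI impI)
  fix h assume h: "h \<in> carrier G" and nc: "h \<otimes> f \<noteq> f \<otimes> h"
  obtain x where x: "x \<in> supp f" "act h x \<noteq> x"
  proof -
    have "supp h \<inter> supp f \<noteq> {}" using supp_disjoint_commute[OF h f] nc by blast
    then show thesis using that by (auto simp: supp_def)
  qed
  obtain p q where pq: "p\<in>D" "q\<in>D" "p < x" "x < q" "{p<..<q} \<subseteq> supp f" "\<And>y. y\<in>{p<..<q} \<Longrightarrow> act h y \<notin> {p<..<q}"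
    using displaced_interval[OF h supp_open[OF f] x(1) supp_sub x(2)] by blast
  note Vi = D_sub[OF pq(1,2)]
  obtain a where a: "a\<in>carrier G" "\<And>x. x\<in>{p<..<q} \<Longrightarrow> x < act a x" "\<And>x. x\<in>{0<..<1} - {p<..<q} \<Longrightarrow> act a x = x"
    using bump[OF pq(1,2)] pq by auto
  have px: "0 \<le> p" "x \<le> 1" using pq D_ends(3) by auto
  \<comment> \<open>b will live on the smaller interval (p,r): it fixes r but moves the preimage of
    r under a, which lies between p and r. This keeps a and b from commuting.\<close>
  obtain r where r: "r \<in> D" "p < r" "r < x" using D_dense[OF px(1) pq(3) px(2)] by blast
  obtain b where b: "b\<in>carrier G" "\<And>x. x\<in>{p<..<r} \<Longrightarrow> x < act b x" "\<And>x. x\<in>{0<..<1} - {p<..<r} \<Longrightarrow> act b x = x"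
    using bump[OF pq(1) r(1) r(2)] by auto
  have sa: "supp a \<subseteq> {p<..<q}" using a(3) unfolding supp_def by blast
  have sb: "supp b \<subseteq> {p<..<q}" using b(3) r pq(4) by (force simp: supp_def)
  have ia: "inv a \<in> carrier G" "inv h \<in> carrier G" using a h by auto
  define k where "k = comm h a"
  have k: "k \<in> carrier G" using h a by (simp add: k_def)
  \<comment> \<open>V is disjoint from its image under h, so the conjugate of a by h is the identity
    on V and only \<open>inv a\<close> remains of k.\<close>
  have kV: "act k y = act (inv a) y" "act (inv a) y \<in> {p<..<q}" if y: "y \<in> {p<..<q}" for y
  proof -
    have yi: "y \<in> {0<..<1}" using y Vi by blast
    show z: "act (inv a) y \<in> {p<..<q}" using supp_interval_act[OF ia(1) _ y pq(1,2)] sa supp_inv[OF a(1)] by simp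
    then have zi: "act (inv a) y \<in> {0<..<1}" using Vi by blast
    have "act (inv h) (act (inv a) y) \<notin> {p<..<q}" using pq(6)[of "act (inv h) (act (inv a) y)"] act_inv(1)[OF h zi] z by auto
    then have "act a (act (inv h) (act (inv a) y)) = act (inv h) (act (inv a) y)" using a(3) act_in[OF ia(2) zi] by blast
    then show "act k y = act (inv a) y" using comm_act[OF h a(1) yi] act_inv(1)[OF h zi] by (simp add: k_def)
  qed
  have kb: "comm k b \<noteq> \<one>"
  proof
    assume "comm k b = \<one>"
    then have e: "k \<otimes> b = b \<otimes> k" using comm_eq_one_iff k b(1) by blast
    have "r \<in> {p<..<q}" using r pq by simp
    then have ri: "r \<in> {p<..<q}" "r \<in> {0<..<1}" using Vi by blast+
    define s where "s = act (inv a) r"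
    have s: "s \<in> {p<..<q}" "s \<in> {0<..<1}" using kV(2)[OF ri(1)] Vi by (auto simp: s_def)
    have "act a s = r" using act_inv(1)[OF a(1) ri(2)] by (simp add: s_def)
    then have "s < r" using a(2)[OF s(1)] by simp
    then have "act b s \<noteq> s" using b(2)[of s] s by auto
    moreover have "act b r = r" using b(3)[of r] ri by simp
    moreover have "act k (act b r) = act b (act k r)" using act_mult[OF k b(1) ri(2)] act_mult[OF b(1) k ri(2)] e by simp
    ultimately show False using kV(1)[OF ri(1)] by (simp add: s_def)
  qed
  have "supp (comm k b) \<subseteq> {p<..<q}"
  proof
    fix y assume y: "y \<in> supp (comm k b)"
    then have yi: "y \<in> {0<..<1}" using supp_sub by blast
    show "y \<in> {p<..<q}"
    proof (rule ccontr)
      assume n: "y \<notin> {p<..<q}"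
      then have "y \<notin> supp (inv b)" using sb supp_inv[OF b(1)] by blast
      then have 1: "act (inv b) y = y" using yi by (simp add: supp_def)
      have kyi: "act (inv k) y \<in> {0<..<1}" using act_in[of "inv k" y] k yi by simp
      have "act (inv k) y \<notin> {p<..<q}" using kV[of "act (inv k) y"] act_inv(1)[OF k yi] n by auto
      then have "act (inv k) y \<notin> supp b" using sb by blast
      then have "act b (act (inv k) y) = act (inv k) y" using kyi by (simp add: supp_def)
      then have "act (comm k b) y = y" using comm_act[OF k b(1) yi] 1 act_inv(1)[OF k yi] by simp
      then show False using y by (simp add: supp_def)
    qed
  qed
  then have "supp (comm k b) \<inter> supp g = {}" using pq(5) d by blast
  moreover have "supp a \<inter> supp g = {}" "supp b \<inter> supp g = {}" using sa sb pq(5) d by blast+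
  ultimately have "a \<otimes> g = g \<otimes> a" "b \<otimes> g = g \<otimes> b" "comm k b \<otimes> g = g \<otimes> comm k b"
    using supp_disjoint_commute a(1) b(1) g k by auto
  then show "\<exists>a\<in>carrier G. \<exists>b\<in>carrier G. a \<otimes> g = g \<otimes> a \<and> b \<otimes> g = g \<otimes> b \<and>
        comm (comm h a) b \<noteq> \<one> \<and> comm (comm h a) b \<otimes> g = g \<otimes> comm (comm h a) b"
    using a(1) b(1) kb unfolding k_def by blast
qed

lemma act_funpow_in: "g \<in> carrier G \<Longrightarrow> x \<in> {0<..<1} \<Longrightarrow> (act g ^^ i) x \<in> {0<..<1}"
  by (induction i) (auto dest: act_in)

lemma act_funpow_commute:
  "g \<in> carrier G \<Longrightarrow> a \<in> carrier G \<Longrightarrow> a \<otimes> g = g \<otimes> a \<Longrightarrow> x \<in> {0<..<1} \<Longrightarrow> (act g ^^ i) (act a x) = act a ((act g ^^ i) x)"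
proof (induction i)
  case (Suc i)
  then have "act g ((act g ^^ i) (act a x)) = act g (act a ((act g ^^ i) x))" by simp
  also have "\<dots> = act a (act g ((act g ^^ i) x))"
    using act_mult[of g a "(act g ^^ i) x"] act_mult[of a g "(act g ^^ i) x"] Suc.prems act_funpow_in by simp
  finally show ?case by simp
qed simp

text \<open>Once an increasing map has thrown a point of the interval to one side, all later
  iterates stay on that side.\<close>

lemma funpow_displaced:
  assumes g: "g \<in> carrier G" and V: "\<And>y. y\<in>{p<..<q} \<Longrightarrow> act g y \<notin> {p<..<q}" "{p<..<q} \<subseteq> {0<..<1}"
    and v: "v \<in> {p<..<q}" and i: "i > 0"
  shows "(act g ^^ i) v \<notin> {p<..<q}"
proof -
  have gv: "act g v \<notin> {p<..<q}" using V v by blast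
  have vi: "v \<in> {0<..<1}" using V v by blast
  note gi = act_funpow_in[OF g vi]
  show ?thesis
  proof (cases "act g v \<le> p")
    case True
    have "(act g ^^ Suc j) v \<le> p" for j
    proof (induction j)
      case (Suc j)
      then have "(act g ^^ Suc j) v < v" using v by auto
      then have "act g ((act g ^^ Suc j) v) < act g v" using act_less[OF g gi vi] by blast
      then show ?case using True by simp
    qed (use True in simp)
    then show ?thesis using i by (cases i) (auto simp: not_less)
  next
    case False
    then have F: "q \<le> act g v" using gv by auto
    have "q \<le> (act g ^^ Suc j) v" for j
    proof (induction j)
      case (Suc j)
      then have "v < (act g ^^ Suc j) v" using v by auto
      then have "act g v < act g ((act g ^^ Suc j) v)" using act_less[OF g vi gi] by blast
      then show ?case using F by simp
    qed (use F in simp)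
    then show ?thesis using i by (cases i) (auto simp: not_less)
  qed
qed

text \<open>[a,b] is the product of a and the conjugate of \<open>inv a\<close> by b.\<close>

lemma comm_supp:
  assumes "a \<in> carrier G" "b \<in> carrier G" "y \<in> supp (comm a b)"
  shows "y \<in> supp a \<or> (\<exists>z\<in>supp a. y = act b z)"
proof (rule ccontr)
  assume n: "\<not> ?thesis"
  have yi: "y \<in> {0<..<1}" using assms supp_sub by blast
  let ?z = "act (inv b) y"
  have zi: "?z \<in> {0<..<1}" using act_in[of "inv b" y] assms yi by simp
  have bz: "act b ?z = y" using act_inv assms yi by simp
  then have "?z \<notin> supp a" using n by metis
  then have "act (inv a) ?z = ?z" using supp_inv[OF assms(1)] zi by (auto simp: supp_def)
  moreover have "act a y = y" using n yi by (auto simp: supp_def)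
  ultimately have "act (comm a b) y = y" using comm_act[OF assms(1,2) yi] bz by simp
  then show False using assms(3) by (simp add: supp_def)
qed

text \<open>If \<open>f\<close> and \<open>g\<close> both move a point of a small interval \<open>V\<close>, take \<open>h\<close> supported in \<open>V\<close>. The support of
  \<open>[[h,a],b]\<close> is covered by four translates of \<open>V\<close> under the centralizer of \<open>g\<close>, so it contains no
  five points of one \<open>g\<close>-orbit and is not \<open>g\<close>-invariant unless empty.\<close>

lemma separated_imp_disjoint:
  assumes f: "f \<in> carrier G" and g: "g \<in> carrier G" and s: "separated f g"
  shows "supp f \<inter> supp g = {}"
proof (rule ccontr)
  assume "supp f \<inter> supp g \<noteq> {}"
  then obtain x where x: "x \<in> supp f \<inter> supp g" by blast
  have op: "open (supp f \<inter> supp g)" using supp_open f g by blast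
  have sub: "supp f \<inter> supp g \<subseteq> {0<..<1}" using supp_sub by blast
  have fx: "act f x \<noteq> x" "act g x \<noteq> x" using x by (auto simp: supp_def)
  obtain p1 q1 where 1: "p1\<in>D" "q1\<in>D" "p1 < x" "x < q1" "{p1<..<q1} \<subseteq> supp f \<inter> supp g" "\<And>y. y\<in>{p1<..<q1} \<Longrightarrow> act f y \<notin> {p1<..<q1}"
    using displaced_interval[OF f op x sub fx(1)] by blast
  have sub1: "{p1<..<q1} \<subseteq> {0<..<1}" using 1(5) sub by blast
  obtain p q where pq: "p\<in>D" "q\<in>D" "p < x" "x < q" "{p<..<q} \<subseteq> {p1<..<q1}" "\<And>y. y\<in>{p<..<q} \<Longrightarrow> act g y \<notin> {p<..<q}"
    using displaced_interval[OF g _ _ sub1 fx(2)] 1(3,4) by auto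
  have Vi: "{p<..<q} \<subseteq> {0<..<1}" using pq(5) sub1 by blast
  obtain h where h: "h\<in>carrier G" "\<And>x. x\<in>{p<..<q} \<Longrightarrow> x < act h x" "\<And>x. x\<in>{0<..<1} - {p<..<q} \<Longrightarrow> act h x = x"
    using bump[OF pq(1,2)] pq by auto
  have sh: "supp h = {p<..<q}"
  proof
    show "supp h \<subseteq> {p<..<q}" using h(3) unfolding supp_def by blast
    show "{p<..<q} \<subseteq> supp h" using h(2) Vi by (force simp: supp_def)
  qed
  \<comment> \<open>If f commuted with h it would preserve the support of h, but f displaces the
    larger interval that contains this support.\<close>
  have "h \<otimes> f \<noteq> f \<otimes> h"
  proof
    assume "h \<otimes> f = f \<otimes> h"
    then have "act f x \<in> {p<..<q}" using commute_supp[OF f h(1), of x] sh pq by auto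
    then have "act f x \<in> {p1<..<q1}" using pq(5) by blast
    then show False using 1(6)[of x] 1(3,4) by auto
  qed
  then obtain a b where ab: "a\<in>carrier G" "b\<in>carrier G" "a \<otimes> g = g \<otimes> a" "b \<otimes> g = g \<otimes> b"
     "comm (comm h a) b \<noteq> \<one>" "comm (comm h a) b \<otimes> g = g \<otimes> comm (comm h a) b"
    using s h(1) unfolding separated_def by blast
  let ?c = "comm (comm h a) b"
  have c: "?c \<in> carrier G" using h ab by simp
  define S where "S = {\<one>, a, b, b \<otimes> a}"
  have Sc: "e \<in> carrier G" "e \<otimes> g = g \<otimes> e" if "e \<in> S" for e
    using that ab g by (auto simp: S_def) (metis m_assoc)
  have cS: "\<exists>e\<in>S. \<exists>v\<in>{p<..<q}. y = act e v" if y: "y \<in> supp ?c" for y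
  proof -
    have yi: "y \<in> {0<..<1}" using y supp_sub by blast
    have ha: "\<exists>e\<in>{\<one>, a}. \<exists>v\<in>{p<..<q}. z = act e v" if z: "z \<in> supp (comm h a)" for z
    proof -
      consider "z \<in> {p<..<q}" | v where "v \<in> {p<..<q}" "z = act a v" using comm_supp[OF h(1) ab(1) z] sh by blast
      then show ?thesis
      proof cases
        case 1
        then have "z = act \<one> z" using act_one[of z] Vi by (metis subsetD)
        then show ?thesis using 1 by blast
      qed blast
    qed
    from comm_supp[OF _ ab(2) y] h ab consider "y \<in> supp (comm h a)" | z where "z \<in> supp (comm h a)" "y = act b z" by auto
    then show ?thesis
    proof cases
      case 1
      then show ?thesis using ha unfolding S_def by blast
    next
      case 2
      then obtain e v where ev: "e \<in> {\<one>, a}" "v \<in> {p<..<q}" "z = act e v" using ha by blast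
      have "y = act (b \<otimes> e) v" using 2 ev act_mult[OF ab(2), of e v] ab Vi by auto
      moreover have "b \<otimes> e \<in> S" using ev ab by (auto simp: S_def)
      ultimately show ?thesis using ev by blast
    qed
  qed
  obtain z where z: "z \<in> supp ?c"
  proof -
    have "\<exists>z\<in>{0<..<1}. act ?c z \<noteq> z" using faithful[OF c one_closed] act_one ab(5) by metis
    then show thesis using that by (auto simp: supp_def)
  qed
  have zi: "z \<in> {0<..<1}" using z supp_sub by blast
  have orb: "(act g ^^ i) z \<in> supp ?c" for i
    by (induction i) (use z commute_supp[OF g c ab(6)[symmetric]] in auto)
  then have "\<forall>i. \<exists>e v. e \<in> S \<and> v \<in> {p<..<q} \<and> (act g ^^ i) z = act e v" using cS by blast
  then obtain e v where ev: "\<And>i. e i \<in> S" "\<And>i. v i \<in> {p<..<q}" "\<And>i. (act g ^^ i) z = act (e i) (v i)" by metis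
  \<comment> \<open>Five points of the g-orbit of z lie in four translates of V, so two of them lie
    in the same one. The translating element commutes with g, so two points of V would lie on one
    g-orbit, although g displaces V.\<close>
  have "card (e ` {..4::nat}) \<le> card S" by (rule card_mono) (use ev in \<open>auto simp: S_def\<close>)
  also have "card S \<le> 4" unfolding S_def by (simp add: card_insert_if)
  finally have "\<not> inj_on e {..4}" by (intro pigeonhole) simp
  then obtain i j where ij: "i < j" "e i = e j" unfolding inj_on_def by (metis linorder_neqE_nat)
  let ?a = "e i"
  have vi: "v i \<in> {0<..<1}" "v j \<in> {0<..<1}" using ev(2) Vi by blast+
  have "act ?a (v j) = (act g ^^ j) z" using ev(3)[of j] ij by simp
  also have "\<dots> = (act g ^^ (j - i)) ((act g ^^ i) z)"
    using ij funpow_add[of "j - i" i "act g"] by simp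
  also have "\<dots> = act ?a ((act g ^^ (j - i)) (v i))"
    using ev(3)[of i] act_funpow_commute[OF g Sc[OF ev(1)] vi(1)] by simp
  finally have "v j = (act g ^^ (j - i)) (v i)"
    using act_eq[OF Sc(1)[OF ev(1)] vi(2) act_funpow_in[OF g vi(1)]] by simp
  then show False using funpow_displaced[OF g pq(6) Vi ev(2), of "j - i" i] ij ev(2)[of j] by simp
qed

section \<open>Elements whose fixed set is a ray\<close>

lemma separated_iff: "f \<in> carrier G \<Longrightarrow> g \<in> carrier G \<Longrightarrow> separated f g \<longleftrightarrow> supp f \<inter> supp g = {}"
  using separated_imp_disjoint[of f g] disjoint_imp_separated[of f g] by (rule_tac iffI)

text \<open>By \<open>separated_iff\<close> these are the elements supported inside
  \<open>fixint f\<close>, so that inclusions between the sets \<open>fixint\<close> become visible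
  in the group.\<close>

definition perp :: "'a \<Rightarrow> 'a set" where "perp f = {k \<in> carrier G. separated f k}"

lemma fixint_props: "fixint f \<subseteq> {0<..<1}" "open (fixint f)" "x \<in> fixint f \<Longrightarrow> act f x = x"
  using interior_subset[of "{x \<in> {0<..<1}. act f x = x}"] by (auto simp: fixint_def)

lemma fixintI: "open U \<Longrightarrow> U \<subseteq> {0<..<1} \<Longrightarrow> (\<And>x. x \<in> U \<Longrightarrow> act f x = x) \<Longrightarrow> U \<subseteq> fixint f"
  unfolding fixint_def by (rule interior_maximal) auto

text \<open>Bumps detect points: a bump on a small interval inside \<open>fixint f\<close> is
  disjoint from f, and if it is disjoint from f' as well, then f' is the identity on that
  interval.\<close>

lemma perp_subset_iff:
  assumes f: "f \<in> carrier G" and f': "f' \<in> carrier G"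
  shows "perp f \<subseteq> perp f' \<longleftrightarrow> fixint f \<subseteq> fixint f'"
proof
  assume h: "perp f \<subseteq> perp f'"
  show "fixint f \<subseteq> fixint f'"
  proof
    fix x assume x: "x \<in> fixint f"
    obtain p q where pq: "p\<in>D" "q\<in>D" "p < x" "x < q" "{p<..<q} \<subseteq> fixint f" using D_interval[OF fixint_props(2) x fixint_props(1)] by blast
    obtain b where b: "b\<in>carrier G" "\<And>x. x\<in>{p<..<q} \<Longrightarrow> x < act b x" "\<And>x. x\<in>{0<..<1} - {p<..<q} \<Longrightarrow> act b x = x"
      using bump[OF pq(1,2)] pq by auto
    have sb: "supp b \<subseteq> {p<..<q}" using b(3) unfolding supp_def by blast
    have "supp f \<inter> supp b = {}" using sb pq(5) fixint_props(3) by (auto simp: supp_def)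
    then have "b \<in> perp f" using b(1) f by (simp add: perp_def separated_iff)
    then have "b \<in> perp f'" using h by blast
    then have "supp f' \<inter> supp b = {}" using b(1) f' by (simp add: perp_def separated_iff)
    moreover have "{p<..<q} \<subseteq> supp b" using b(2) D_sub[OF pq(1,2)] by (force simp: supp_def)
    ultimately have "{p<..<q} \<subseteq> fixint f'" using D_sub[OF pq(1,2)] by (intro fixintI) (auto simp: supp_def)
    then show "x \<in> fixint f'" using pq by auto
  qed
next
  assume h: "fixint f \<subseteq> fixint f'"
  show "perp f \<subseteq> perp f'"
  proof
    fix k assume "k \<in> perp f"
    then have k: "k \<in> carrier G" "supp f \<inter> supp k = {}" using f by (auto simp: perp_def separated_iff)
    then have "supp k \<subseteq> fixint f" using supp_sub by (intro fixintI supp_open) (auto simp: supp_def)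
    then have "supp f' \<inter> supp k = {}" using h fixint_props(3)[of _ f'] by (auto simp: supp_def)
    then show "k \<in> perp f'" using k f' by (simp add: perp_def separated_iff)
  qed
qed

lemma fixint_conj:
  assumes g: "g \<in> carrier G" and f: "f \<in> carrier G"
  shows "fixint (g \<otimes> f \<otimes> inv g) = act g ` fixint f"
proof -
  have main: "act g ` fixint f \<subseteq> fixint (g \<otimes> f \<otimes> inv g)" if g: "g \<in> carrier G" and f: "f \<in> carrier G" for g f
  proof (rule fixintI)
    show "open (act g ` fixint f)" by (rule act_image_open[OF g fixint_props(1,2)])
    show "act g ` fixint f \<subseteq> {0<..<1}" using fixint_props(1)[of f] act_in[OF g] by blast
    fix x assume "x \<in> act g ` fixint f"
    then obtain y where y: "y \<in> fixint f" "x = act g y" by blast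
    have yi: "y \<in> {0<..<1}" using y fixint_props(1) by blast
    have xi: "x \<in> {0<..<1}" using act_in[OF g yi] y by simp
    have "act (inv g) x = y" using act_inv[OF g yi] y by simp
    then show "act (g \<otimes> f \<otimes> inv g) x = x" using act_mult[of "g \<otimes> f" "inv g" x] act_mult[of g f y] g f xi yi y fixint_props(3)[of y f] by simp
  qed
  have "fixint (g \<otimes> f \<otimes> inv g) \<subseteq> act g ` fixint f"
  proof
    fix x assume x: "x \<in> fixint (g \<otimes> f \<otimes> inv g)"
    have xi: "x \<in> {0<..<1}" using x fixint_props(1) by blast
    have "act (inv g) x \<in> fixint (inv g \<otimes> (g \<otimes> f \<otimes> inv g) \<otimes> inv (inv g))"
      using main[of "inv g" "g \<otimes> f \<otimes> inv g"] g f x by auto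
    also have "inv g \<otimes> (g \<otimes> f \<otimes> inv g) \<otimes> inv (inv g) = f" using g f by (simp add: m_assoc) (simp add: m_assoc[symmetric])
    finally show "x \<in> act g ` fixint f" using act_inv(1)[OF g xi] by (metis imageI)
  qed
  then show ?thesis using main[OF g f] by blast
qed

text \<open>Stated through \<open>perp\<close> alone, so that automorphisms respect it. By
  \<open>cutI\<close> and \<open>cutE\<close> these are the elements whose \<open>fixint\<close> is
  a ray.\<close>

definition cut :: "'a \<Rightarrow> bool" where
  "cut f \<longleftrightarrow> f \<in> carrier G \<and> f \<noteq> \<one> \<and> perp f \<noteq> {\<one>} \<and>
     (\<forall>g\<in>carrier G. perp f \<subseteq> perp (g \<otimes> f \<otimes> inv g) \<or> perp (g \<otimes> f \<otimes> inv g) \<subseteq> perp f)"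

lemma perp_trivial_iff:
  assumes f: "f \<in> carrier G" shows "perp f = {\<one>} \<longleftrightarrow> fixint f = {}"
proof
  assume h: "perp f = {\<one>}"
  show "fixint f = {}"
  proof (rule ccontr)
    assume "fixint f \<noteq> {}"
    then obtain x where x: "x \<in> fixint f" by blast
    obtain p q where pq: "p\<in>D" "q\<in>D" "p < x" "x < q" "{p<..<q} \<subseteq> fixint f" using D_interval[OF fixint_props(2) x fixint_props(1)] by blast
    obtain b where b: "b\<in>carrier G" "\<And>x. x\<in>{p<..<q} \<Longrightarrow> x < act b x" "\<And>x. x\<in>{0<..<1} - {p<..<q} \<Longrightarrow> act b x = x"
      using bump[OF pq(1,2)] pq by auto
    have "supp b \<subseteq> {p<..<q}" using b(3) unfolding supp_def by blast
    then have "supp f \<inter> supp b = {}" using pq(5) fixint_props(3) by (auto simp: supp_def)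
    then have "b = \<one>" using h b(1) f by (auto simp: perp_def separated_iff)
    moreover have "x \<in> {0<..<1}" using x fixint_props(1) by blast
    ultimately show False using b(2)[of x] pq act_one by force
  qed
next
  assume h: "fixint f = {}"
  have "k = \<one>" if "k \<in> perp f" for k
  proof (rule faithful)
    show k: "k \<in> carrier G" using that by (simp add: perp_def)
    have "supp f \<inter> supp k = {}" using that f k by (simp add: perp_def separated_iff)
    then have "supp k \<subseteq> fixint f" using supp_sub supp_open[OF k] by (intro fixintI) (auto simp: supp_def)
    then have "supp k = {}" using h by blast
    then show "act k x = act \<one> x" if "x \<in> {0<..<1}" for x using that act_one by (auto simp: supp_def)
  qed simp
  moreover have "\<one> \<in> perp f" using f act_one by (auto simp: perp_def separated_iff supp_def)
  ultimately show "perp f = {\<one>}" by blast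
qed

lemma fixint_one: "fixint \<one> = {0<..<1}"
proof
  show "{0<..<1} \<subseteq> fixint \<one>" by (rule fixintI) (simp_all add: act_one)
qed (rule fixint_props(1))

lemma act_image_rays:
  assumes g: "g \<in> carrier G" and x: "x \<in> {0<..<1}"
  shows "act g ` {0<..<x} = {0<..<act g x}" "act g ` {x<..<1} = {act g x<..<1}"
proof -
  have *: "act g x \<in> {0<..<1}" using act_in[OF g x] .
  have surj: "\<exists>y\<in>{0<..<1}. z = act g y" if "z \<in> {0<..<1}" for z using act_inv(1)[OF g that] act_in[of "inv g" z] g that by force
  show "act g ` {0<..<x} = {0<..<act g x}"
  proof (intro equalityI subsetI)
    fix z assume "z \<in> act g ` {0<..<x}"
    then obtain y where "y \<in> {0<..<x}" "z = act g y" by blast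
    then show "z \<in> {0<..<act g x}" using act_less[OF g, of y x] act_in[OF g, of y] x by auto
  next
    fix z assume z: "z \<in> {0<..<act g x}"
    then obtain y where "y \<in> {0<..<1}" "z = act g y" using surj[of z] * by auto
    then show "z \<in> act g ` {0<..<x}" using act_less[OF g, of y x] x z by auto
  qed
  show "act g ` {x<..<1} = {act g x<..<1}"
  proof (intro equalityI subsetI)
    fix z assume "z \<in> act g ` {x<..<1}"
    then obtain y where "y \<in> {x<..<1}" "z = act g y" by blast
    then show "z \<in> {act g x<..<1}" using act_less[OF g, of x y] act_in[OF g, of y] x by auto
  next
    fix z assume z: "z \<in> {act g x<..<1}"
    then obtain y where "y \<in> {0<..<1}" "z = act g y" using surj[of z] * by auto
    then show "z \<in> act g ` {x<..<1}" using act_less[OF g, of x y] x z by auto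
  qed
qed

lemma cutI:
  assumes f: "f \<in> carrier G" and x: "x \<in> {0<..<1}" and Z: "fixint f = {0<..<x} \<or> fixint f = {x<..<1}"
  shows "cut f"
  unfolding cut_def
proof (intro conjI f ballI)
  have "x / 2 \<in> {0<..<x}" "(x + 1) / 2 \<in> {x<..<1}" using x by auto
  then show "perp f \<noteq> {\<one>}" unfolding perp_trivial_iff[OF f] using Z by blast
  show "f \<noteq> \<one>" using Z x fixint_one by auto
  fix g assume g: "g \<in> carrier G"
  note im = act_image_rays[OF g x]
  have "fixint f \<subseteq> act g ` fixint f \<or> act g ` fixint f \<subseteq> fixint f"
    using Z
  proof
    assume "fixint f = {0<..<x}"
    then have "act g ` fixint f = {0<..<act g x}" using im by simp
    then show ?thesis unfolding \<open>fixint f = _\<close> by (cases "act g x \<le> x") auto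
  next
    assume "fixint f = {x<..<1}"
    then have "act g ` fixint f = {act g x<..<1}" using im by simp
    then show ?thesis unfolding \<open>fixint f = _\<close> by (cases "act g x \<le> x") auto
  qed
  then show "perp f \<subseteq> perp (g \<otimes> f \<otimes> inv g) \<or> perp (g \<otimes> f \<otimes> inv g) \<subseteq> perp f"
    using f g by (simp add: perp_subset_iff fixint_conj)
qed

lemma frontier_fixint:
  assumes f: "f \<in> carrier G" and x: "x \<in> {0<..<1}" "x \<in> frontier (fixint f)" and p: "p < x" "x < q" "{p<..<q} \<subseteq> {0<..<1}"
  shows "(\<exists>z\<in>{p<..<q}. z \<in> fixint f) \<and> (\<exists>W w. open W \<and> w \<in> W \<and> W \<subseteq> {p<..<q} \<and> W \<inter> fixint f = {})"
proof
  have xc: "x \<in> closure (fixint f)" and xn: "x \<notin> fixint f" using x(2) fixint_props(2)[of f] by (auto simp: frontier_def interior_open)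
  show "\<exists>z\<in>{p<..<q}. z \<in> fixint f"
    using xc p open_Int_closure_eq_empty[of "{p<..<q}" "fixint f"] by (metis disjoint_iff greaterThanLessThan_iff open_greaterThanLessThan)
  have "\<not> {p<..<q} \<subseteq> fixint f" using xn p by auto
  then obtain y where y: "y \<in> {p<..<q}" "act f y \<noteq> y" using fixintI[of "{p<..<q}" f] p by auto
  let ?W = "supp f \<inter> {p<..<q}"
  have "open ?W" using supp_open[OF f] by auto
  moreover have "y \<in> ?W" using y p by (auto simp: supp_def)
  moreover have "?W \<inter> fixint f = {}" using fixint_props(3) by (auto simp: supp_def)
  ultimately show "\<exists>W w. open W \<and> w \<in> W \<and> W \<subseteq> {p<..<q} \<and> W \<inter> fixint f = {}" by blast
qed

text \<open>Separate two frontier points by m in D. One element supported left of m moves a point of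
  the fixed set out of it, another supported right of m moves an outside point into it. The fixed
  set and its image under the product are then incomparable.\<close>

lemma cut_frontier_unique:
  assumes c: "cut f" and x: "x1 \<in> {0<..<1}" "x2 \<in> {0<..<1}" "x1 \<in> frontier (fixint f)" "x2 \<in> frontier (fixint f)"
  shows "\<not> x1 < x2"
proof
  assume lt: "x1 < x2"
  have f: "f \<in> carrier G" using c by (simp add: cut_def)
  obtain m where m: "m \<in> D" "x1 < m" "m < x2" using D_dense[of x1 x2] lt x by auto
  note s1 = D_sub[OF D_ends(1) m(1)] and s2 = D_sub[OF m(1) D_ends(2)]
  obtain z W w where 1: "z \<in> {0<..<m}" "z \<in> fixint f" "open W" "w \<in> W" "W \<subseteq> {0<..<m}" "W \<inter> fixint f = {}"
    using frontier_fixint[OF f x(1,3) _ m(2) s1] x by auto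
  obtain z2 V v where 2: "z2 \<in> {m<..<1}" "z2 \<in> fixint f" "open V" "v \<in> V" "V \<subseteq> {m<..<1}" "V \<inter> fixint f = {}"
    using frontier_fixint[OF f x(2,4) m(3) _ s2] x by auto
  obtain g1 where g1: "g1\<in>carrier G" "supp g1 \<subseteq> {0<..<m}" "act g1 z \<in> W" using push[OF D_ends(1) m(1) 1(1) 1(3,5,4)] by blast
  have "open (fixint f \<inter> {m<..<1})" by (intro open_Int fixint_props(2)) simp
  moreover have "v \<in> {m<..<1}" "z2 \<in> fixint f \<inter> {m<..<1}" using 2 by auto
  ultimately obtain g2 where g2: "g2\<in>carrier G" "supp g2 \<subseteq> {m<..<1}" "act g2 v \<in> fixint f \<inter> {m<..<1}"
    using push[OF m(1) D_ends(2), of v "fixint f \<inter> {m<..<1}" z2] by blast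
  define g where "g = g1 \<otimes> g2"
  have g: "g \<in> carrier G" using g1 g2 by (simp add: g_def)
  have zi: "z \<in> {0<..<1}" using 1 s1 by blast
  have vi: "v \<in> {0<..<1}" using 2 s2 by blast
  have "act g2 z = z" using g2(2) 1(1) zi by (force simp: supp_def)
  then have gz: "act g z = act g1 z" using act_mult[OF g1(1) g2(1) zi] by (simp add: g_def)
  have "act g1 (act g2 v) = act g2 v" using g1(2) g2(3) act_in[OF g2(1) vi] by (force simp: supp_def)
  then have gv: "act g v \<in> fixint f" using act_mult[OF g1(1) g2(1) vi] g2(3) by (simp add: g_def)
  have "act g z \<in> act g ` fixint f" using 1(2) by (rule imageI)
  moreover have "act g z \<notin> fixint f" using gz g1(3) 1(6) by auto
  ultimately have "\<not> act g ` fixint f \<subseteq> fixint f" by blast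
  moreover have "\<not> fixint f \<subseteq> act g ` fixint f"
  proof
    assume "fixint f \<subseteq> act g ` fixint f"
    then obtain y where "y \<in> fixint f" "act g v = act g y" using gv by blast
    then have "v \<in> fixint f" using act_eq[OF g vi, of y] fixint_props(1) by blast
    then show False using 2 by blast
  qed
  moreover have "perp f \<subseteq> perp (g \<otimes> f \<otimes> inv g) \<or> perp (g \<otimes> f \<otimes> inv g) \<subseteq> perp f" using c g unfolding cut_def by blast
  ultimately show False using g f by (simp add: perp_subset_iff fixint_conj)
qed

text \<open>Connectedness of (0,1) yields a frontier point, which is unique by
  \<open>cut_frontier_unique\<close> and lies in D by \<open>edge\<close>. Both sides of it are
  connected and miss the frontier, so each lies inside or outside the fixed set, and exactly one
  lies inside.\<close>

lemma cutE:
  assumes c: "cut f"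
  shows "\<exists>x\<in>D \<inter> {0<..<1}. fixint f = {0<..<x} \<or> fixint f = {x<..<1}"
proof -
  have f: "f \<in> carrier G" "f \<noteq> \<one>" "fixint f \<noteq> {}" using c perp_trivial_iff[of f] by (auto simp: cut_def)
  have nI: "\<exists>y\<in>{0<..<1}. act f y \<noteq> y" using faithful[OF f(1) one_closed] f(2) act_one by metis
  have "{0<..<1} \<inter> fixint f \<noteq> {}" "{0<..<1} - fixint f \<noteq> {}"
    using f(3) fixint_props(3)[of _ f] fixint_props(1)[of f] nI by blast+
  then have "{0<..<1} \<inter> frontier (fixint f) \<noteq> {}" by (intro connected_Int_frontier) auto
  then obtain x where x: "x \<in> {0<..<1}" "x \<in> frontier (fixint f)" by blast
  have xD: "x \<in> D" using edge[OF f(1) x(1)] x(2) by (simp add: fixint_def)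
  have uniq: "y = x" if "y \<in> {0<..<1}" "y \<in> frontier (fixint f)" for y
    using cut_frontier_unique[OF c that(1) x(1) that(2) x(2)] cut_frontier_unique[OF c x(1) that(1) x(2) that(2)] by linarith
  have xn: "x \<notin> fixint f" using x(2) fixint_props(2)[of f] by (auto simp: frontier_def interior_open)
  have half: "S \<subseteq> fixint f \<or> S \<inter> fixint f = {}" if "connected S" "S \<subseteq> {0<..<1} - {x}" for S
    using connected_Int_frontier[OF that(1), of "fixint f"] uniq that(2) by blast
  have l: "{0<..<x} \<subseteq> fixint f \<or> {0<..<x} \<inter> fixint f = {}" by (rule half) (use x in auto)
  have r: "{x<..<1} \<subseteq> fixint f \<or> {x<..<1} \<inter> fixint f = {}" by (rule half) (use x in auto)
  have split: "{0<..<1} = {0<..<x} \<union> {x} \<union> {x<..<1}" using x by auto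
  \<comment> \<open>If both sides were fixed, injectivity would force x to be fixed too, and f would
    be the identity.\<close>
  have nb: "\<not> ({0<..<x} \<subseteq> fixint f \<and> {x<..<1} \<subseteq> fixint f)"
  proof
    assume h: "{0<..<x} \<subseteq> fixint f \<and> {x<..<1} \<subseteq> fixint f"
    then have fx: "act f y = y" if "y \<in> {0<..<1}" "y \<noteq> x" for y using that split fixint_props(3)[of y f] by blast
    have "act f x = x"
    proof (rule ccontr)
      assume n: "act f x \<noteq> x"
      then have "act f (act f x) = act f x" using fx act_in[OF f(1) x(1)] by blast
      then show False using act_eq[OF f(1) act_in[OF f(1) x(1)] x(1)] n by blast
    qed
    then show False using nI fx by metis
  qed
  show ?thesis
    using l r nb xn split f(3) fixint_props(1)[of f] x xD by blast
qed

text \<open>If c moved x, a small bump around x would fix c x but not x, against commutation and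
  injectivity.\<close>

lemma centralizer_trivial:
  assumes c: "\<And>x. x \<in> {0<..<1} \<Longrightarrow> c x \<in> {0<..<1}" "\<And>g x. g \<in> carrier G \<Longrightarrow> x \<in> {0<..<1} \<Longrightarrow> c (act g x) = act g (c x)"
    and i: "inj_on c {0<..<1}" and x: "x \<in> {0<..<1}"
  shows "c x = x"
proof (rule ccontr)
  assume n: "c x \<noteq> x"
  have "open ({0<..<1} - {c x})" "x \<in> {0<..<1} - {c x}" using x n by auto
  then obtain p q where pq: "p\<in>D" "q\<in>D" "p < x" "x < q" "{p<..<q} \<subseteq> {0<..<1} - {c x}" using D_interval by blast
  obtain b where b: "b\<in>carrier G" "\<And>x. x\<in>{p<..<q} \<Longrightarrow> x < act b x" "\<And>x. x\<in>{0<..<1} - {p<..<q} \<Longrightarrow> act b x = x"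
    using bump[OF pq(1,2)] pq by auto
  have "act b (c x) = c x" using b(3) c(1)[OF x] pq(5) by blast
  then have "c (act b x) = c x" using c(2)[OF b(1) x] by simp
  then have "act b x = x" using i act_in[OF b(1) x] x by (auto simp: inj_on_def)
  then show False using b(2)[of x] pq by simp
qed

lemma left_cut_exists: "x \<in> D \<inter> {0<..<1} \<Longrightarrow> \<exists>l\<in>carrier G. fixint l = {0<..<x}"
proof -
  assume x: "x \<in> D \<inter> {0<..<1}"
  obtain b where b: "b\<in>carrier G" "\<And>y. y\<in>{x<..<1} \<Longrightarrow> y < act b y" "\<And>y. y\<in>{0<..<1} - {x<..<1} \<Longrightarrow> act b y = y"
  proof -
    have "x \<in> D" "x < 1" using x by auto
    from bump[OF this(1) D_ends(2) this(2)] that show thesis by blast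
  qed
  have "fixint b = {0<..<x}"
  proof
    show "{0<..<x} \<subseteq> fixint b" by (rule fixintI) (use b(3) x in auto)
    have "{y\<in>{0<..<1}. act b y = y} \<subseteq> {0<..x}" using b(2) by force
    then have "fixint b \<subseteq> interior {0<..x}" unfolding fixint_def by (rule interior_mono)
    then show "fixint b \<subseteq> {0<..<x}" by simp
  qed
  then show ?thesis using b(1) by blast
qed

text \<open>\<open>separated\<close> quantifies over group elements only and uses nothing but the
  group operations, so every bound variable may be replaced by its image under \<alpha>.\<close>

lemma auto_separated:
  assumes a: "\<alpha> \<in> auto G" and f: "f \<in> carrier G" "g \<in> carrier G"
  shows "separated (\<alpha> f) (\<alpha> g) \<longleftrightarrow> separated f g"
proof -
  have hom: "\<alpha> \<in> hom G G" and b: "bij_betw \<alpha> (carrier G) (carrier G)" using a by (auto simp: auto_def Bij_def)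
  interpret H: group_hom G G \<alpha> by unfold_locales (rule hom)
  have im: "\<alpha> ` carrier G = carrier G" and inj: "inj_on \<alpha> (carrier G)" using b by (auto simp: bij_betw_def)
  have eq: "\<alpha> x = \<alpha> y \<longleftrightarrow> x = y" if "x \<in> carrier G" "y \<in> carrier G" for x y using inj that by (auto simp: inj_on_def)
  have m: "\<alpha> x \<otimes> \<alpha> y = \<alpha> (x \<otimes> y)" if "x \<in> carrier G" "y \<in> carrier G" for x y using that by simp
  have cm: "comm (\<alpha> x) (\<alpha> y) = \<alpha> (comm x y)" if "x \<in> carrier G" "y \<in> carrier G" for x y
    using that by (simp add: comm_def)
  have o: "\<alpha> x = \<one> \<longleftrightarrow> x = \<one>" if "x \<in> carrier G" for x using eq[OF that one_closed] by simp
  have ball: "(\<forall>h\<in>carrier G. P h) \<longleftrightarrow> (\<forall>h\<in>carrier G. P (\<alpha> h))" for P using im by (metis imageE imageI)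
  have bex: "(\<exists>h\<in>carrier G. P h) \<longleftrightarrow> (\<exists>h\<in>carrier G. P (\<alpha> h))" for P using im by (metis imageE imageI)
  have "separated (\<alpha> f) (\<alpha> g) \<longleftrightarrow> (\<forall>h\<in>carrier G. \<alpha> h \<otimes> \<alpha> f \<noteq> \<alpha> f \<otimes> \<alpha> h \<longrightarrow>
     (\<exists>a\<in>carrier G. \<exists>b\<in>carrier G. \<alpha> a \<otimes> \<alpha> g = \<alpha> g \<otimes> \<alpha> a \<and> \<alpha> b \<otimes> \<alpha> g = \<alpha> g \<otimes> \<alpha> b \<and>
        comm (comm (\<alpha> h) (\<alpha> a)) (\<alpha> b) \<noteq> \<one> \<and> comm (comm (\<alpha> h) (\<alpha> a)) (\<alpha> b) \<otimes> \<alpha> g = \<alpha> g \<otimes> comm (comm (\<alpha> h) (\<alpha> a)) (\<alpha> b)))"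
    unfolding separated_def by (subst ball, subst bex, subst (2) bex) (rule refl)
  also have "\<dots> \<longleftrightarrow> separated f g" unfolding separated_def
    using f by (intro ball_cong bex_cong refl imp_cong conj_cong) (simp_all add: m cm eq o del: H.hom_mult)
  finally show ?thesis .
qed

lemma auto_perp:
  assumes a: "\<alpha> \<in> auto G" and f: "f \<in> carrier G" shows "perp (\<alpha> f) = \<alpha> ` perp f"
proof -
  have im: "\<alpha> ` carrier G = carrier G" using a by (auto simp: auto_def Bij_def bij_betw_def)
  have "perp (\<alpha> f) = {k \<in> \<alpha> ` carrier G. separated (\<alpha> f) k}" by (simp add: perp_def im)
  also have "\<dots> = \<alpha> ` perp f" using auto_separated[OF a f] by (auto simp: perp_def)
  finally show ?thesis .
qed

lemma auto_fixint_subset: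
  assumes a: "\<alpha> \<in> auto G" and f: "f \<in> carrier G" "f' \<in> carrier G"
  shows "fixint (\<alpha> f) \<subseteq> fixint (\<alpha> f') \<longleftrightarrow> fixint f \<subseteq> fixint f'"
proof -
  have b: "inj_on \<alpha> (carrier G)" "\<alpha> ` carrier G = carrier G" using a by (auto simp: auto_def Bij_def bij_betw_def)
  have "\<alpha> f \<in> carrier G" "\<alpha> f' \<in> carrier G" using b f by blast+
  moreover have "perp f \<subseteq> carrier G" "perp f' \<subseteq> carrier G" by (auto simp: perp_def)
  ultimately show ?thesis using inj_on_image_subset_iff[OF b(1)] a f
    by (simp add: perp_subset_iff[symmetric] auto_perp)
qed

lemma auto_cut:
  assumes a: "\<alpha> \<in> auto G" and f: "f \<in> carrier G" shows "cut (\<alpha> f) \<longleftrightarrow> cut f"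
proof -
  have hom: "\<alpha> \<in> hom G G" and b: "inj_on \<alpha> (carrier G)" "\<alpha> ` carrier G = carrier G" using a by (auto simp: auto_def Bij_def bij_betw_def)
  interpret H: group_hom G G \<alpha> by unfold_locales (rule hom)
  have ball: "(\<forall>h\<in>carrier G. P h) \<longleftrightarrow> (\<forall>h\<in>carrier G. P (\<alpha> h))" for P using b(2) by (metis imageE imageI)
  have af: "\<alpha> f \<in> carrier G" using f by simp
  have o: "\<alpha> f = \<one> \<longleftrightarrow> f = \<one>" using inj_onD[OF b(1), of f \<one>] f by auto
  have "perp (\<alpha> f) = {\<one>} \<longleftrightarrow> perp f = {\<one>}"
  proof -
    have "perp f \<subseteq> carrier G" by (auto simp: perp_def)
    then have "\<alpha> ` perp f = \<alpha> ` {\<one>} \<longleftrightarrow> perp f = {\<one>}" using inj_on_image_eq_iff[OF b(1), of "perp f" "{\<one>}"] by simp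
    then show ?thesis by (simp add: auto_perp[OF a f])
  qed
  moreover have "perp (\<alpha> f) \<subseteq> perp (\<alpha> g \<otimes> \<alpha> f \<otimes> inv (\<alpha> g)) \<longleftrightarrow> perp f \<subseteq> perp (g \<otimes> f \<otimes> inv g)"
    "perp (\<alpha> g \<otimes> \<alpha> f \<otimes> inv (\<alpha> g)) \<subseteq> perp (\<alpha> f) \<longleftrightarrow> perp (g \<otimes> f \<otimes> inv g) \<subseteq> perp f" if g: "g \<in> carrier G" for g
  proof -
    have e: "\<alpha> g \<otimes> \<alpha> f \<otimes> inv (\<alpha> g) = \<alpha> (g \<otimes> f \<otimes> inv g)" using f g by simp
    show "perp (\<alpha> f) \<subseteq> perp (\<alpha> g \<otimes> \<alpha> f \<otimes> inv (\<alpha> g)) \<longleftrightarrow> perp f \<subseteq> perp (g \<otimes> f \<otimes> inv g)"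
      "perp (\<alpha> g \<otimes> \<alpha> f \<otimes> inv (\<alpha> g)) \<subseteq> perp (\<alpha> f) \<longleftrightarrow> perp (g \<otimes> f \<otimes> inv g) \<subseteq> perp f"
      unfolding e using auto_fixint_subset[OF a, of f "g \<otimes> f \<otimes> inv g"] auto_fixint_subset[OF a, of "g \<otimes> f \<otimes> inv g" f] f g
      by (simp_all add: perp_subset_iff del: H.hom_mult)
  qed
  ultimately show ?thesis unfolding cut_def using o af f by (subst ball) simp
qed

end

lemma bij_betw_one_minus: "bij_betw (\<lambda>x. 1 - x) {0<..<1} {0<..<1::real}"
  by (rule bij_betwI[of _ _ _ "\<lambda>x. 1 - x"]) auto

text \<open>The reflection x -> 1 - x reduces decreasing bijections to increasing ones.\<close>

lemma monotone_bij_Homeo01: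
  assumes b: "bij_betw a {0<..<1} {0<..<1}" and m: "strict_mono_on {0<..<1} a \<or> strict_antimono_on {0<..<1} a"
    and e: "a \<in> extensional {0<..<1}"
  shows "a \<in> carrier Homeo01"
  using m
proof
  assume "strict_mono_on {0<..<1} a"
  then show ?thesis using strict_mono_on_bij_Homeo01 b e by blast
next
  assume anti: "strict_antimono_on {0<..<1} a"
  let ?r = "restrict (\<lambda>x. 1 - x) {0<..<1::real}" and ?b = "restrict (\<lambda>x. 1 - a x) {0<..<1}"
  have ar: "a x \<in> {0<..<1}" if "x \<in> {0<..<1}" for x using b that by (auto simp: bij_betw_def)
  have bb: "bij_betw ?b {0<..<1} {0<..<1}"
    using bij_betw_trans[OF b bij_betw_one_minus] bij_betw_cong[of "{0<..<1}" ?b "(\<lambda>x. 1 - x) \<circ> a"] by simp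
  have bh: "?b \<in> carrier Homeo01"
    by (rule strict_mono_on_bij_Homeo01[OF bb]) (use anti in \<open>auto simp: monotone_on_def\<close>)
  have cr: "continuous_on {0<..<1} ?r"
    using continuous_on_cong[of "{0<..<1}" "{0<..<1}" ?r "\<lambda>x. 1 - x"] by (simp add: continuous_intros)
  have "homeomorphism {0<..<1} {0<..<1} ?r ?r"
    using cr by (auto simp: homeomorphism_def image_iff intro!: bexI[of _ "1 - _"])
  moreover have "bij_betw ?r {0<..<1} {0<..<1}"
    using bij_betw_one_minus bij_betw_cong[of "{0<..<1}" ?r "\<lambda>x. 1 - x"] by simp
  ultimately have rh: "?r \<in> carrier Homeo01" by (auto simp: homeo_group_def Bij_def)
  have rb: "?r \<otimes>\<^bsub>Homeo01\<^esub> ?b \<in> carrier Homeo01"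
    by (rule homeo_mult_closed[OF rh bh])
  have "?r \<otimes>\<^bsub>Homeo01\<^esub> ?b = a"
    unfolding homeo_mult[OF rh bh] using ar e by (auto simp: compose_def extensional_def)
  then show ?thesis using rb by simp
qed

section \<open>The homeomorphism induced by an automorphism\<close>

context interval_group
begin

text \<open>\<open>b\<close> is the type of the ray: initial if true, final if false. Rays of
  different types are never comparable, so the type can be read off from inclusions.\<close>

definition ray :: "bool \<Rightarrow> real \<Rightarrow> real set" where
  "ray b x = (if b then {0<..<x} else {x<..<1})"

lemma ray_subset:
  assumes "x \<in> {0<..<1}" "y \<in> {0<..<1}"
  shows "ray b x \<subseteq> ray c y \<longleftrightarrow> b = c \<and> (if b then x \<le> y else y \<le> x)"
proof (cases "b = c")
  case True
  then show ?thesis using assms by (auto simp: ray_def subset_iff not_le dest: dense)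
next
  case False
  have "\<exists>z. z \<in> ray b x \<and> z \<notin> ray c y"
  proof (cases b)
    case True
    have "min x y / 2 \<in> {0<..<x}" "min x y / 2 \<notin> {y<..<1}" using assms by (auto simp: min_def)
    then show ?thesis using True False unfolding ray_def by metis
  next
    case b: False
    have "(1 + max x y) / 2 \<in> {x<..<1}" "(1 + max x y) / 2 \<notin> {0<..<y}" using assms by (auto simp: max_def)
    then show ?thesis using b False unfolding ray_def by metis
  qed
  then show ?thesis using False by blast
qed

lemma ray_eq: "x \<in> {0<..<1} \<Longrightarrow> y \<in> {0<..<1} \<Longrightarrow> ray b x = ray b y \<longleftrightarrow> x = y"
proof
  assume x: "x \<in> {0<..<1}" "y \<in> {0<..<1}" and "ray b x = ray b y"
  then have "ray b x \<subseteq> ray b y" "ray b y \<subseteq> ray b x" by auto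
  then show "x = y" unfolding ray_subset[OF x] ray_subset[OF x(2,1)] by (simp split: if_splits)
qed simp

lemma act_ray: "g \<in> carrier G \<Longrightarrow> x \<in> {0<..<1} \<Longrightarrow> act g ` ray b x = ray b (act g x)"
  by (simp add: ray_def act_image_rays)

theorem auto_conjugation:
  assumes \<alpha>: "\<alpha> \<in> auto G"
  shows "\<exists>a. bij_betw a {0<..<1} {0<..<1} \<and> (strict_mono_on {0<..<1} a \<or> strict_antimono_on {0<..<1} a) \<and>
    (\<forall>x\<in>{0<..<1}. a x \<in> D \<longleftrightarrow> x \<in> D) \<and> (\<forall>g\<in>carrier G. \<forall>x\<in>{0<..<1}. act (\<alpha> g) (a x) = a (act g x))"
proof -
  have hom: "\<alpha> \<in> hom G G" and b: "inj_on \<alpha> (carrier G)" "\<alpha> ` carrier G = carrier G" using \<alpha> by (auto simp: auto_def Bij_def bij_betw_def)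
  interpret H: group_hom G G \<alpha> by unfold_locales (rule hom)
  note sub = auto_fixint_subset[OF \<alpha>]
  define E where "E = D \<inter> {0<..<1}"
  have EI: "x \<in> E \<Longrightarrow> x \<in> {0<..<1}" for x by (simp add: E_def)
  have "\<exists>l. \<forall>x\<in>E. l x \<in> carrier G \<and> fixint (l x) = ray True x"
  proof (intro bchoice ballI)
    fix x assume "x \<in> E"
    then show "\<exists>l. l \<in> carrier G \<and> fixint l = ray True x"
      using left_cut_exists[of x] unfolding E_def ray_def by auto
  qed
  then obtain l where l: "\<And>x. x \<in> E \<Longrightarrow> l x \<in> carrier G" "\<And>x. x \<in> E \<Longrightarrow> fixint (l x) = ray True x" by blast
  have cutray: "\<exists>b. \<exists>x\<in>E. fixint f = ray b x" if "cut f" for f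
    using cutE[OF that] unfolding E_def ray_def by (metis (full_types))
  have raycut: "cut f" if "f \<in> carrier G" "x \<in> E" "fixint f = ray b x" for f b x
    using cutI[OF that(1) EI[OF that(2)]] that(3) by (auto simp: ray_def split: if_splits)
  have "\<exists>b. \<exists>y\<in>E. fixint (\<alpha> (l x)) = ray b y" if "x \<in> E" for x
    using cutray[of "\<alpha> (l x)"] auto_cut[OF \<alpha> l(1)[OF that]] raycut[OF l(1)[OF that] that l(2)[OF that]] by blast
  then obtain t \<phi> where t\<phi>: "\<And>x. x \<in> E \<Longrightarrow> \<phi> x \<in> E" "\<And>x. x \<in> E \<Longrightarrow> fixint (\<alpha> (l x)) = ray (t x) (\<phi> x)" by metis
  \<comment> \<open>Initial rays are nested, so their images are comparable, and comparable rays
    have the same type. The common type \<open>B\<close> decides whether the homeomorphism is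
    increasing or decreasing.\<close>
  have tc: "t x = t y" if "x \<in> E" "y \<in> E" for x y
  proof -
    have "fixint (l x) \<subseteq> fixint (l y) \<or> fixint (l y) \<subseteq> fixint (l x)"
      unfolding l(2)[OF that(1)] l(2)[OF that(2)] ray_def by auto
    then have "ray (t x) (\<phi> x) \<subseteq> ray (t y) (\<phi> y) \<or> ray (t y) (\<phi> y) \<subseteq> ray (t x) (\<phi> x)"
      using sub[OF l(1)[OF that(1)] l(1)[OF that(2)]] sub[OF l(1)[OF that(2)] l(1)[OF that(1)]] t\<phi>(2)[OF that(1)] t\<phi>(2)[OF that(2)] by simp
    then show ?thesis using ray_subset EI t\<phi>(1) that by metis
  qed
  obtain x0 where x0: "x0 \<in> E" using D_dense[of 0 1] by (auto simp: E_def)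
  define B where "B = t x0"
  have \<phi>: "\<phi> x \<in> E" "fixint (\<alpha> (l x)) = ray B (\<phi> x)" if "x \<in> E" for x
    using t\<phi>[OF that] tc[OF that x0] by (auto simp: B_def)
  have ord: "x \<le> y \<longleftrightarrow> (if B then \<phi> x \<le> \<phi> y else \<phi> y \<le> \<phi> x)" if "x \<in> E" "y \<in> E" for x y
  proof -
    have "x \<le> y \<longleftrightarrow> fixint (l x) \<subseteq> fixint (l y)" using ray_subset[OF EI[OF that(1)] EI[OF that(2)], of True True] l that by simp
    also have "\<dots> \<longleftrightarrow> fixint (\<alpha> (l x)) \<subseteq> fixint (\<alpha> (l y))" using sub l that by simp
    also have "\<dots> \<longleftrightarrow> (if B then \<phi> x \<le> \<phi> y else \<phi> y \<le> \<phi> x)"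
      using ray_subset[OF EI[OF \<phi>(1)[OF that(1)]] EI[OF \<phi>(1)[OF that(2)]], of B B] \<phi> that by simp
    finally show ?thesis .
  qed
  have inj: "inj_on \<phi> E"
  proof (rule inj_onI)
    fix x y assume "x \<in> E" "y \<in> E" "\<phi> x = \<phi> y"
    then show "x = y" using ord[of x y] ord[of y x] by (cases B) auto
  qed
  have rays: "\<exists>f\<in>carrier G. fixint f = ray b y" if "y \<in> E" for b y
  proof (cases b)
    case True
    then show ?thesis using l(1)[OF that] l(2)[OF that] by auto
  next
    case False
    have y: "y \<in> D" "0 < y" using that by (auto simp: E_def)
    obtain c where c: "c\<in>carrier G" "\<And>z. z\<in>{0<..<y} \<Longrightarrow> z < act c z" "\<And>z. z\<in>{0<..<1} - {0<..<y} \<Longrightarrow> act c z = z"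
      using bump[OF D_ends(1) y] by blast
    have "fixint c = {y<..<1}"
    proof
      show "{y<..<1} \<subseteq> fixint c" by (rule fixintI) (use c(3) EI[OF that] in auto)
      have "{z\<in>{0<..<1}. act c z = z} \<subseteq> {y..<1}" using c(2) by force
      then have "fixint c \<subseteq> interior {y..<1}" unfolding fixint_def by (rule interior_mono)
      then show "fixint c \<subseteq> {y<..<1}" by simp
    qed
    then show ?thesis using c(1) False by (auto simp: ray_def)
  qed
  have surj: "\<exists>x\<in>E. \<phi> x = y" if y: "y \<in> E" for y
  proof -
    obtain f0 where f0: "f0 \<in> carrier G" "fixint f0 = ray B y" using rays[OF y] by blast
    have "f0 \<in> \<alpha> ` carrier G" using b(2) f0(1) by simp
    then obtain f where f: "f \<in> carrier G" "\<alpha> f = f0" by (metis imageE)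
    have "cut f" using raycut[OF f0(1) y f0(2)] auto_cut[OF \<alpha> f(1)] f(2) by simp
    then obtain c x where x: "x \<in> E" "fixint f = ray c x" using cutray by blast
    \<comment> \<open>Comparison with \<open>l x\<close> at the same point x excludes that f has a
      final ray.\<close>
    have "ray B y \<subseteq> ray B (\<phi> x) \<or> ray B (\<phi> x) \<subseteq> ray B y" unfolding ray_def by auto
    then have "fixint f \<subseteq> fixint (l x) \<or> fixint (l x) \<subseteq> fixint f"
      using sub[OF f(1) l(1)[OF x(1)]] sub[OF l(1)[OF x(1)] f(1)] f(2) f0(2) \<phi>(2)[OF x(1)] by simp
    then have "c = True" using ray_subset[OF EI[OF x(1)] EI[OF x(1)]] x(2) l(2)[OF x(1)] by metis
    then have "fixint f = fixint (l x)" using x(2) l(2)[OF x(1)] by simp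
    then have "ray B y = ray B (\<phi> x)"
      using sub[OF f(1) l(1)[OF x(1)]] sub[OF l(1)[OF x(1)] f(1)] f(2) f0(2) \<phi>(2)[OF x(1)] by auto
    then show ?thesis using ray_eq EI y \<phi>(1)[OF x(1)] x(1) by metis
  qed
  have bE: "bij_betw \<phi> E E" unfolding bij_betw_def using inj \<phi>(1) surj by blast
  \<comment> \<open>Conjugation by g moves the ray at x to the ray at g x, and \<alpha> turns it
    into conjugation by \<alpha> g.\<close>
  have equiE: "\<phi> (act g x) = act (\<alpha> g) (\<phi> x)" if g: "g \<in> carrier G" and x: "x \<in> E" for g x
  proof -
    have gx: "act g x \<in> E" using x D_act[OF g] act_in[OF g] by (auto simp: E_def)
    have "fixint (l (act g x)) = fixint (g \<otimes> l x \<otimes> inv g)"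
      using l gx x fixint_conj[OF g l(1)[OF x]] act_ray[OF g EI[OF x]] by simp
    then have "fixint (\<alpha> (l (act g x))) = fixint (\<alpha> (g \<otimes> l x \<otimes> inv g))"
      using sub[OF l(1)[OF gx], of "g \<otimes> l x \<otimes> inv g"] sub[OF _ l(1)[OF gx], of "g \<otimes> l x \<otimes> inv g"] g l(1)[OF x]
      by (simp del: H.hom_mult)
    also have "\<alpha> (g \<otimes> l x \<otimes> inv g) = \<alpha> g \<otimes> \<alpha> (l x) \<otimes> inv (\<alpha> g)" using g l(1)[OF x] by simp
    also have "fixint \<dots> = ray B (act (\<alpha> g) (\<phi> x))"
      using fixint_conj[of "\<alpha> g" "\<alpha> (l x)"] g l(1)[OF x] \<phi>[OF x] act_ray[of "\<alpha> g" "\<phi> x" B] EI by simp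
    finally have "ray B (\<phi> (act g x)) = ray B (act (\<alpha> g) (\<phi> x))" using \<phi>(2)[OF gx] by simp
    then show ?thesis using ray_eq[of "\<phi> (act g x)" "act (\<alpha> g) (\<phi> x)" B] EI \<phi>(1) gx x act_in[of "\<alpha> g" "\<phi> x"] g by simp
  qed
  have dE: "\<exists>d\<in>E. x < d \<and> d < y" if "0 \<le> x" "x < y" "y \<le> 1" for x y
    using D_dense[OF that] that by (force simp: E_def)
  have "\<exists>a. bij_betw a {0<..<1} {0<..<1} \<and> (strict_mono_on {0<..<1} a \<or> strict_antimono_on {0<..<1} a) \<and> (\<forall>d\<in>E. a d = \<phi> d)"
  proof (cases B)
    case True
    have "strict_mono_on E \<phi>"
    proof (rule strict_mono_onI)
      fix x y assume "x \<in> E" "y \<in> E" "x < y"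
      then show "\<phi> x < \<phi> y" using ord[of y x] True by auto
    qed
    then show ?thesis using dense_order_iso_extension[of E E \<phi>] dE bE E_def by blast
  next
    case False
    \<comment> \<open>In the decreasing case \<phi> is composed with x -> 1 - x, extended as an
      increasing map, and reflected back.\<close>
    define E' where "E' = (\<lambda>x. 1 - x) ` E"
    have bE': "bij_betw (\<lambda>x. 1 - \<phi> x) E E'"
    proof -
      have "bij_betw (\<lambda>x. 1 - x) E E'" by (simp add: bij_betw_def inj_on_def E'_def)
      from bij_betw_trans[OF bE this] show ?thesis by (simp add: comp_def)
    qed
    have sE': "E' \<subseteq> {0<..<1}" using EI by (auto simp: E'_def)
    have dE': "\<exists>d\<in>E'. x < d \<and> d < y" if "0 \<le> x" "x < y" "y \<le> 1" for x y
    proof -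
      have "\<exists>d\<in>E. 1 - y < d \<and> d < 1 - x" using that by (intro dE) auto
      then obtain d where "d \<in> E" "1 - y < d" "d < 1 - x" by blast
      then show ?thesis by (intro bexI[of _ "1 - d"]) (auto simp: E'_def)
    qed
    have "strict_mono_on E (\<lambda>x. 1 - \<phi> x)"
    proof (rule strict_mono_onI)
      fix x y assume "x \<in> E" "y \<in> E" "x < y"
      then show "1 - \<phi> x < 1 - \<phi> y" using ord[of y x] False by auto
    qed
    then obtain a' where a': "bij_betw a' {0<..<1} {0<..<1}" "strict_mono_on {0<..<1} a'" "\<forall>d\<in>E. a' d = 1 - \<phi> d"
      using dense_order_iso_extension[of E E' "\<lambda>x. 1 - \<phi> x"] dE dE' bE' sE' E_def by blast
    have "bij_betw ((\<lambda>x. 1 - x) \<circ> a') {0<..<1} {0<..<1}" using a'(1) bij_betw_one_minus by (rule bij_betw_trans)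
    moreover have "strict_antimono_on {0<..<1} ((\<lambda>x. 1 - x) \<circ> a')" using a'(2) by (auto simp: monotone_on_def)
    moreover have "\<forall>d\<in>E. ((\<lambda>x. 1 - x) \<circ> a') d = \<phi> d" using a'(3) by simp
    ultimately show ?thesis by blast
  qed
  then obtain a where ab: "bij_betw a {0<..<1} {0<..<1}" and am: "strict_mono_on {0<..<1} a \<or> strict_antimono_on {0<..<1} a"
    and aE: "\<And>d. d \<in> E \<Longrightarrow> a d = \<phi> d" by blast
  have ar: "a x \<in> {0<..<1}" if "x \<in> {0<..<1}" for x using ab that by (auto simp: bij_betw_def)
  have ainj: "a x = a y \<longleftrightarrow> x = y" if "x \<in> {0<..<1}" "y \<in> {0<..<1}" for x y using ab that by (auto simp: bij_betw_def inj_on_def)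
  define ia where "ia = inv_into {0<..<1} a"
  have ia: "ia y \<in> {0<..<1}" "a (ia y) = y" if "y \<in> {0<..<1}" for y
    using bij_betwE[OF bij_betw_inv_into[OF ab]] bij_betw_inv_into_right[OF ab] that unfolding ia_def by blast+
  have mono_conj: "strict_mono_on {0<..<1} (\<lambda>x. ia (act h (a x)))" if h: "h \<in> carrier G" for h
  proof (rule strict_mono_onI)
    fix x y :: real assume xy: "x \<in> {0<..<1}" "y \<in> {0<..<1}" "x < y"
    let ?u = "ia (act h (a x))" and ?v = "ia (act h (a y))"
    have u: "?u \<in> {0<..<1}" "a ?u = act h (a x)" and v: "?v \<in> {0<..<1}" "a ?v = act h (a y)"
      using ia[OF act_in[OF h ar]] xy by auto
    from am show "?u < ?v"
    proof
      assume m: "strict_mono_on {0<..<1} a"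
      have "a x < a y" using strict_mono_onD[OF m] xy by blast
      then have "a ?u < a ?v" using u v act_less[OF h ar ar] xy by simp
      then show ?thesis using strict_mono_on_less[OF m u(1) v(1)] by simp
    next
      assume m: "strict_antimono_on {0<..<1} a"
      have "a y < a x" using monotone_onD[OF m] xy by blast
      then have lt: "a ?v < a ?u" using u v act_less[OF h ar ar] xy by simp
      show ?thesis
      proof (rule ccontr)
        assume "\<not> ?u < ?v"
        then have "?v < ?u \<or> ?v = ?u" by auto
        then show False using monotone_onD[OF m v(1) u(1)] lt by auto
      qed
    qed
  qed
  have "act (\<alpha> g) (a x) = a (act g x)" if g: "g \<in> carrier G" and x: "x \<in> {0<..<1}" for g x
  proof -
    have ag: "\<alpha> g \<in> carrier G" "inv g \<in> carrier G" using g by auto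
    \<comment> \<open>This map fixes E by \<open>equiE\<close>. It is increasing even for decreasing
      a, because conjugation by a monotone bijection keeps increasing maps increasing. Hence it is
      the identity.\<close>
    let ?c = "\<lambda>x. act (inv g) (ia (act (\<alpha> g) (a x)))"
    have "?c x = x"
    proof (rule strict_mono_fixed_dense[of "{0<..<1}" ?c E])
      show "?c x \<in> {0<..<1}" if "x \<in> {0<..<1}" for x
        by (rule act_in[OF ag(2) ia(1)[OF act_in[OF ag(1) ar[OF that]]]])
      show "strict_mono_on {0<..<1} ?c"
      proof (rule strict_mono_onI)
        fix x y :: real assume xy: "x \<in> {0<..<1}" "y \<in> {0<..<1}" "x < y"
        have "ia (act (\<alpha> g) (a x)) < ia (act (\<alpha> g) (a y))" using strict_mono_onD[OF mono_conj[OF ag(1)] xy] .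
        then show "?c x < ?c y"
          using act_less[OF ag(2) ia(1)[OF act_in[OF ag(1) ar]] ia(1)[OF act_in[OF ag(1) ar]]] xy by blast
      qed
      show "?c e = e" if e: "e \<in> E" for e
      proof -
        have ge: "act g e \<in> E" using e D_act[OF g] act_in[OF g] by (auto simp: E_def)
        have "act (\<alpha> g) (a e) = a (act g e)" using equiE[OF g e] aE e ge by simp
        moreover have "ia (a (act g e)) = act g e" using ainj ia EI[OF ge] ar by metis
        ultimately show ?thesis using act_inv(2)[OF g EI[OF e]] by simp
      qed
      show "\<exists>e\<in>E. x < e \<and> e < y" if "x \<in> {0<..<1}" "y \<in> {0<..<1}" "x < y" for x y
        using dE[of x y] that by auto
    qed (use x EI in auto)
    then have "ia (act (\<alpha> g) (a x)) = act g x"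
      using act_inv(1)[OF g ia(1)[OF act_in[OF ag(1) ar[OF x]]]] by simp
    then show ?thesis using ia(2)[OF act_in[OF ag(1) ar[OF x]]] by simp
  qed
  moreover have "a x \<in> D \<longleftrightarrow> x \<in> D" if x: "x \<in> {0<..<1}" for x
  proof
    assume "x \<in> D"
    then have "x \<in> E" using x by (simp add: E_def)
    then show "a x \<in> D" using aE \<phi>(1) by (simp add: E_def)
  next
    assume "a x \<in> D"
    then have "a x \<in> E" using ar[OF x] by (simp add: E_def)
    then obtain y where "y \<in> E" "a y = a x" using surj aE by metis
    then show "x \<in> D" using ainj[OF _ x] EI by (auto simp: E_def)
  qed
  ultimately show ?thesis using ab am by blast
qed

end

section \<open>Automorphisms and normalizers\<close>

text \<open>The normalizer is a stabilizer under conjugation of subsets; the equality of sets is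
  split into invariance under a and under its inverse, which can be checked elementwise.\<close>

lemma (in group) normalizer_iff:
  assumes K: "K \<subseteq> carrier G"
  shows "a \<in> normalizer G K \<longleftrightarrow> a \<in> carrier G \<and> (\<forall>k\<in>K. a \<otimes> k \<otimes> inv a \<in> K) \<and> (\<forall>k\<in>K. inv a \<otimes> k \<otimes> a \<in> K)"
proof -
  have e: "a <# K #> inv a = (\<lambda>k. a \<otimes> k \<otimes> inv a) ` K" by (auto simp: l_coset_def r_coset_def)
  have "a \<in> normalizer G K \<longleftrightarrow> a \<in> carrier G \<and> (\<lambda>k. a \<otimes> k \<otimes> inv a) ` K = K"
    using K by (simp add: normalizer_def stabilizer_def e)
  also have "\<dots> \<longleftrightarrow> a \<in> carrier G \<and> (\<forall>k\<in>K. a \<otimes> k \<otimes> inv a \<in> K) \<and> (\<forall>k\<in>K. inv a \<otimes> k \<otimes> a \<in> K)"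
  proof (cases "a \<in> carrier G")
    case a: True
    have 1: "inv a \<otimes> (a \<otimes> k \<otimes> inv a) \<otimes> a = k" if "k \<in> K" for k
      using a K that by (simp add: m_assoc subsetD) (simp add: m_assoc[symmetric] subsetD)
    have 2: "a \<otimes> (inv a \<otimes> k \<otimes> a) \<otimes> inv a = k" if "k \<in> K" for k
      using a K that by (simp add: m_assoc subsetD) (simp add: m_assoc[symmetric] subsetD)
    have "(\<lambda>k. a \<otimes> k \<otimes> inv a) ` K = K \<longleftrightarrow> (\<forall>k\<in>K. a \<otimes> k \<otimes> inv a \<in> K) \<and> (\<forall>k\<in>K. inv a \<otimes> k \<otimes> a \<in> K)"
    proof (intro iffI conjI ballI)
      assume h: "(\<lambda>k. a \<otimes> k \<otimes> inv a) ` K = K"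
      show "a \<otimes> k \<otimes> inv a \<in> K" if "k \<in> K" for k using h that by blast
      show "inv a \<otimes> k \<otimes> a \<in> K" if "k \<in> K" for k
      proof -
        have "k \<in> (\<lambda>k. a \<otimes> k \<otimes> inv a) ` K" using h that by simp
        then obtain k' where "k' \<in> K" "k = a \<otimes> k' \<otimes> inv a" by blast
        then show ?thesis using 1 by simp
      qed
    next
      assume h: "(\<forall>k\<in>K. a \<otimes> k \<otimes> inv a \<in> K) \<and> (\<forall>k\<in>K. inv a \<otimes> k \<otimes> a \<in> K)"
      show "(\<lambda>k. a \<otimes> k \<otimes> inv a) ` K = K"
      proof (intro equalityI subsetI)
        fix k assume "k \<in> K"
        then show "k \<in> (\<lambda>k. a \<otimes> k \<otimes> inv a) ` K" using h 2[of k] by (intro image_eqI[of _ _ "inv a \<otimes> k \<otimes> a"]) auto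
      qed (use h in auto)
    qed
    then show ?thesis using a by simp
  qed simp
  finally show ?thesis .
qed

text \<open>A faithful representation of G in H. It is instantiated twice, with the homeomorphisms
  of (0,1) and with those of the Cantor space as H.\<close>

locale conj_setup = G: group G + H: group H for G :: "('a, 'c) monoid_scheme" and H :: "('b, 'd) monoid_scheme" +
  fixes \<phi> :: "'a \<Rightarrow> 'b"
  assumes hom: "\<phi> \<in> hom G H" and inj: "inj_on \<phi> (carrier G)"
begin

sublocale P: group_hom G H \<phi> by unfold_locales (rule hom)

abbreviation N where "N \<equiv> normalizer H (\<phi> ` carrier G)"

lemma image_sub: "\<phi> ` carrier G \<subseteq> carrier H" by auto

lemma N_iff: "a \<in> N \<longleftrightarrow> a \<in> carrier H \<and> (\<forall>g\<in>carrier G. a \<otimes>\<^bsub>H\<^esub> \<phi> g \<otimes>\<^bsub>H\<^esub> inv\<^bsub>H\<^esub> a \<in> \<phi> ` carrier G) \<and>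
    (\<forall>g\<in>carrier G. inv\<^bsub>H\<^esub> a \<otimes>\<^bsub>H\<^esub> \<phi> g \<otimes>\<^bsub>H\<^esub> a \<in> \<phi> ` carrier G)"
  unfolding H.normalizer_iff[OF image_sub] by blast

lemma conj_aut:
  assumes "a \<in> N" "g \<in> carrier G"
  shows "conj_aut G H \<phi> a g \<in> carrier G" "\<phi> (conj_aut G H \<phi> a g) = a \<otimes>\<^bsub>H\<^esub> \<phi> g \<otimes>\<^bsub>H\<^esub> inv\<^bsub>H\<^esub> a"
  using assms unfolding N_iff by (auto simp: conj_aut_def inv_into_into f_inv_into_f)

lemma conj_aut_eqI:
  "a \<in> N \<Longrightarrow> g \<in> carrier G \<Longrightarrow> g' \<in> carrier G \<Longrightarrow> \<phi> g' = a \<otimes>\<^bsub>H\<^esub> \<phi> g \<otimes>\<^bsub>H\<^esub> inv\<^bsub>H\<^esub> a \<Longrightarrow> conj_aut G H \<phi> a g = g'"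
  using conj_aut[of a g] inj by (auto simp: inj_on_def)

lemma subgroup_N: "subgroup N H" by (rule H.normalizer_imp_subgroup[OF image_sub])

lemma N_carrier: "a \<in> N \<Longrightarrow> a \<in> carrier H" unfolding N_iff by blast

lemma conj_aut_mult:
  assumes a: "a \<in> N" "b \<in> N" and g: "g \<in> carrier G"
  shows "conj_aut G H \<phi> (a \<otimes>\<^bsub>H\<^esub> b) g = conj_aut G H \<phi> a (conj_aut G H \<phi> b g)"
proof (rule conj_aut_eqI[OF _ g])
  show "a \<otimes>\<^bsub>H\<^esub> b \<in> N" using subgroup.m_closed[OF subgroup_N a] .
  note bg = conj_aut[OF a(2) g]
  show "conj_aut G H \<phi> a (conj_aut G H \<phi> b g) \<in> carrier G" using conj_aut(1)[OF a(1) bg(1)] .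
  show "\<phi> (conj_aut G H \<phi> a (conj_aut G H \<phi> b g)) = a \<otimes>\<^bsub>H\<^esub> b \<otimes>\<^bsub>H\<^esub> \<phi> g \<otimes>\<^bsub>H\<^esub> inv\<^bsub>H\<^esub> (a \<otimes>\<^bsub>H\<^esub> b)"
    unfolding conj_aut(2)[OF a(1) bg(1)] bg(2) using a[THEN N_carrier] g
    by (simp add: H.m_assoc H.inv_mult_group)
qed

lemma conj_aut_auto:
  assumes a: "a \<in> N" shows "conj_aut G H \<phi> a \<in> auto G"
proof -
  have ia: "inv\<^bsub>H\<^esub> a \<in> N" using subgroup.m_inv_closed[OF subgroup_N a] .
  have ac: "a \<in> carrier H" using N_carrier[OF a] .
  have one: "conj_aut G H \<phi> \<one>\<^bsub>H\<^esub> g = g" if "g \<in> carrier G" for g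
    by (rule conj_aut_eqI[OF subgroup.one_closed[OF subgroup_N] that that]) (use that in simp)
  have "conj_aut G H \<phi> a \<in> hom G G"
  proof (rule homI)
    fix g h assume g: "g \<in> carrier G" "h \<in> carrier G"
    note ag = conj_aut[OF a g(1)] and ah = conj_aut[OF a g(2)]
    show "conj_aut G H \<phi> a (g \<otimes>\<^bsub>G\<^esub> h) = conj_aut G H \<phi> a g \<otimes>\<^bsub>G\<^esub> conj_aut G H \<phi> a h"
    proof (rule conj_aut_eqI[OF a])
      show "\<phi> (conj_aut G H \<phi> a g \<otimes>\<^bsub>G\<^esub> conj_aut G H \<phi> a h) = a \<otimes>\<^bsub>H\<^esub> \<phi> (g \<otimes>\<^bsub>G\<^esub> h) \<otimes>\<^bsub>H\<^esub> inv\<^bsub>H\<^esub> a"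
        using ag ah ac g by (simp add: H.m_assoc) (simp add: H.m_assoc[symmetric])
    qed (use g ag ah in auto)
  qed (rule conj_aut(1)[OF a])
  moreover have "bij_betw (conj_aut G H \<phi> a) (carrier G) (carrier G)"
    by (rule bij_betwI[of _ _ _ "conj_aut G H \<phi> (inv\<^bsub>H\<^esub> a)"])
      (use conj_aut(1)[OF a] conj_aut(1)[OF ia] conj_aut_mult[OF a ia] conj_aut_mult[OF ia a] one ac in auto)
  moreover have "conj_aut G H \<phi> a \<in> extensional (carrier G)" by (simp add: conj_aut_def)
  ultimately show ?thesis by (simp add: auto_def Bij_def)
qed

lemma conj_aut_hom: "conj_aut G H \<phi> \<in> hom (H\<lparr>carrier := N\<rparr>) (AutoGroup G)"
proof (rule homI)
  show "conj_aut G H \<phi> a \<in> carrier (AutoGroup G)" if "a \<in> carrier (H\<lparr>carrier := N\<rparr>)" for a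
    using conj_aut_auto that by (simp add: AutoGroup_def)
  fix a b assume "a \<in> carrier (H\<lparr>carrier := N\<rparr>)" "b \<in> carrier (H\<lparr>carrier := N\<rparr>)"
  then have a: "a \<in> N" "b \<in> N" by auto
  have B: "conj_aut G H \<phi> a \<in> Bij (carrier G)" "conj_aut G H \<phi> b \<in> Bij (carrier G)"
    using conj_aut_auto[OF a(1)] conj_aut_auto[OF a(2)] by (auto simp: auto_def)
  have "conj_aut G H \<phi> (a \<otimes>\<^bsub>H\<^esub> b) = compose (carrier G) (conj_aut G H \<phi> a) (conj_aut G H \<phi> b)"
  proof
    fix g show "conj_aut G H \<phi> (a \<otimes>\<^bsub>H\<^esub> b) g = compose (carrier G) (conj_aut G H \<phi> a) (conj_aut G H \<phi> b) g"
      using conj_aut_mult[OF a, of g] by (cases "g \<in> carrier G") (auto simp: compose_def conj_aut_def)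
  qed
  then show "conj_aut G H \<phi> (a \<otimes>\<^bsub>H\<lparr>carrier := N\<rparr>\<^esub> b) = conj_aut G H \<phi> a \<otimes>\<^bsub>AutoGroup G\<^esub> conj_aut G H \<phi> b"
    using B by (simp add: AutoGroup_def BijGroup_def)
qed

text \<open>\<open>cent\<close> makes conjugation by different elements different. An element of H
  provided by \<open>surj\<close> normalizes the image because \<alpha> maps G onto G, so it induces
  \<alpha>.\<close>

lemma conj_aut_iso:
  assumes cent: "\<And>a. a \<in> carrier H \<Longrightarrow> (\<And>g. g \<in> carrier G \<Longrightarrow> a \<otimes>\<^bsub>H\<^esub> \<phi> g = \<phi> g \<otimes>\<^bsub>H\<^esub> a) \<Longrightarrow> a = \<one>\<^bsub>H\<^esub>"
    and surj: "\<And>\<alpha>. \<alpha> \<in> auto G \<Longrightarrow> \<exists>a\<in>carrier H. \<forall>g\<in>carrier G. \<phi> (\<alpha> g) \<otimes>\<^bsub>H\<^esub> a = a \<otimes>\<^bsub>H\<^esub> \<phi> g"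
  shows "conj_aut G H \<phi> \<in> iso (H\<lparr>carrier := N\<rparr>) (AutoGroup G)"
proof -
  have "inj_on (conj_aut G H \<phi>) N"
  proof (rule inj_onI)
    fix a b assume a: "a \<in> N" "b \<in> N" and e: "conj_aut G H \<phi> a = conj_aut G H \<phi> b"
    note c = a[THEN N_carrier]
    have "inv\<^bsub>H\<^esub> b \<otimes>\<^bsub>H\<^esub> a = \<one>\<^bsub>H\<^esub>"
    proof (rule cent)
      fix g assume g: "g \<in> carrier G"
      have "a \<otimes>\<^bsub>H\<^esub> \<phi> g \<otimes>\<^bsub>H\<^esub> inv\<^bsub>H\<^esub> a = b \<otimes>\<^bsub>H\<^esub> \<phi> g \<otimes>\<^bsub>H\<^esub> inv\<^bsub>H\<^esub> b" using conj_aut(2)[OF a(1) g] conj_aut(2)[OF a(2) g] e by simp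
      then have "inv\<^bsub>H\<^esub> b \<otimes>\<^bsub>H\<^esub> (a \<otimes>\<^bsub>H\<^esub> \<phi> g \<otimes>\<^bsub>H\<^esub> inv\<^bsub>H\<^esub> a) \<otimes>\<^bsub>H\<^esub> a = inv\<^bsub>H\<^esub> b \<otimes>\<^bsub>H\<^esub> (b \<otimes>\<^bsub>H\<^esub> \<phi> g \<otimes>\<^bsub>H\<^esub> inv\<^bsub>H\<^esub> b) \<otimes>\<^bsub>H\<^esub> a" by simp
      moreover have "inv\<^bsub>H\<^esub> b \<otimes>\<^bsub>H\<^esub> (a \<otimes>\<^bsub>H\<^esub> \<phi> g \<otimes>\<^bsub>H\<^esub> inv\<^bsub>H\<^esub> a) \<otimes>\<^bsub>H\<^esub> a = inv\<^bsub>H\<^esub> b \<otimes>\<^bsub>H\<^esub> a \<otimes>\<^bsub>H\<^esub> \<phi> g"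
        using c g by (simp add: H.m_assoc)
      moreover have "inv\<^bsub>H\<^esub> b \<otimes>\<^bsub>H\<^esub> (b \<otimes>\<^bsub>H\<^esub> \<phi> g \<otimes>\<^bsub>H\<^esub> inv\<^bsub>H\<^esub> b) \<otimes>\<^bsub>H\<^esub> a = \<phi> g \<otimes>\<^bsub>H\<^esub> (inv\<^bsub>H\<^esub> b \<otimes>\<^bsub>H\<^esub> a)"
        using c g by (simp add: H.m_assoc) (simp add: H.m_assoc[symmetric])
      ultimately show "inv\<^bsub>H\<^esub> b \<otimes>\<^bsub>H\<^esub> a \<otimes>\<^bsub>H\<^esub> \<phi> g = \<phi> g \<otimes>\<^bsub>H\<^esub> (inv\<^bsub>H\<^esub> b \<otimes>\<^bsub>H\<^esub> a)" by simp
    qed (use c in simp)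
    then have "b \<otimes>\<^bsub>H\<^esub> (inv\<^bsub>H\<^esub> b \<otimes>\<^bsub>H\<^esub> a) = b \<otimes>\<^bsub>H\<^esub> \<one>\<^bsub>H\<^esub>" by simp
    then show "a = b" using c by (simp add: H.m_assoc[symmetric])
  qed
  moreover have "conj_aut G H \<phi> ` N = auto G"
  proof (intro equalityI subsetI)
    fix \<alpha> assume \<alpha>: "\<alpha> \<in> auto G"
    then obtain a where a: "a\<in>carrier H" "\<And>g. g\<in>carrier G \<Longrightarrow> \<phi> (\<alpha> g) \<otimes>\<^bsub>H\<^esub> a = a \<otimes>\<^bsub>H\<^esub> \<phi> g" using surj by blast
    have bij: "bij_betw \<alpha> (carrier G) (carrier G)" and ext: "\<alpha> \<in> extensional (carrier G)" using \<alpha> by (auto simp: auto_def Bij_def)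
    have \<alpha>c: "\<alpha> g \<in> carrier G" if "g \<in> carrier G" for g using bij that by (auto simp: bij_betw_def)
    have 1: "a \<otimes>\<^bsub>H\<^esub> \<phi> g \<otimes>\<^bsub>H\<^esub> inv\<^bsub>H\<^esub> a = \<phi> (\<alpha> g)" if "g \<in> carrier G" for g
      using a(2)[OF that, symmetric] a(1) \<alpha>c[OF that] by (simp add: H.m_assoc)
    have 2: "inv\<^bsub>H\<^esub> a \<otimes>\<^bsub>H\<^esub> \<phi> (\<alpha> g) \<otimes>\<^bsub>H\<^esub> a = \<phi> g" if "g \<in> carrier G" for g
      using a(2)[OF that] a(1) \<alpha>c[OF that] that by (simp add: H.m_assoc) (simp add: H.m_assoc[symmetric])
    have N: "a \<in> N" unfolding N_iff
    proof (intro conjI ballI a(1))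
      fix g assume g: "g \<in> carrier G"
      then show "a \<otimes>\<^bsub>H\<^esub> \<phi> g \<otimes>\<^bsub>H\<^esub> inv\<^bsub>H\<^esub> a \<in> \<phi> ` carrier G" using 1 \<alpha>c by simp
      obtain g' where "g' \<in> carrier G" "\<alpha> g' = g" using bij g unfolding bij_betw_def by (metis imageE)
      then show "inv\<^bsub>H\<^esub> a \<otimes>\<^bsub>H\<^esub> \<phi> g \<otimes>\<^bsub>H\<^esub> a \<in> \<phi> ` carrier G" using 2[of g'] by auto
    qed
    have "\<alpha> = conj_aut G H \<phi> a"
    proof (rule extensionalityI[OF ext])
      show "conj_aut G H \<phi> a \<in> extensional (carrier G)" by (simp add: conj_aut_def)
      show "\<alpha> g = conj_aut G H \<phi> a g" if "g \<in> carrier G" for g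
        by (rule conj_aut_eqI[OF N that, symmetric]) (use 1 \<alpha>c that in auto)
    qed
    then show "\<alpha> \<in> conj_aut G H \<phi> ` N" using N by blast
  qed (use conj_aut_auto in auto)
  ultimately show ?thesis using conj_aut_hom by (simp add: iso_def bij_betw_def AutoGroup_def)
qed

end

section \<open>The action of F_n as an instance, and its normalizers\<close>

context base_n begin

text \<open>Off the breakpoints g is affine near x. If x is a frontier point, this affine piece
  contains two fixed points, so it is the identity; then x would be interior to the fixed
  set.\<close>

lemma edge_n_adic:
  assumes g: "g \<in> carrier (thompson_F n)" and x: "x \<in> {0<..<1}"
    and fr: "x \<in> frontier (interior {y \<in> {0<..<1}. interval_action g y = y})"
  shows "x \<in> n_adic n"
proof (rule ccontr)
  assume nx: "x \<notin> n_adic n"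
  let ?F = "{y \<in> {0<..<1}. interval_action g y = y}"
  have "n_adic_PL n g" using g by (simp add: thompson_F_def)
  then obtain B where B: "finite B" "B \<subseteq> n_adic n \<inter> {0..1}" "{0, 1} \<subseteq> B"
      and aff: "\<forall>a b. 0 \<le> a \<and> a < b \<and> b \<le> 1 \<and> {a<..<b} \<inter> B = {} \<longrightarrow>
           (\<exists>(k::int) c. \<forall>x\<in>{a..b}. g x = of_nat n powi k * x + c)"
    unfolding n_adic_PL_def by (elim exE conjE)
  have "open ({0<..<1} - B)" using B(1) by (intro open_Diff finite_imp_closed) auto
  moreover have "x \<in> {0<..<1} - B" using nx x B by auto
  ultimately obtain e where e: "e > 0" "cball x e \<subseteq> {0<..<1} - B" by (meson open_contains_cball)
  define a b where "a = x - e" and "b = x + e"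
  have ab: "a < x" "x < b" "{a..b} \<subseteq> {0<..<1} - B" using e by (auto simp: a_def b_def cball_eq_atLeastAtMost)
  have "{a<..<b} \<subseteq> {a..b}" by auto
  then have "{a<..<b} \<inter> B = {}" using ab(3) by blast
  moreover have "a \<in> {a..b}" "b \<in> {a..b}" using ab by auto
  then have "a \<in> {0<..<1}" "b \<in> {0<..<1}" using ab(3) by blast+
  ultimately obtain k :: int and c where kc: "\<And>y. y\<in>{a..b} \<Longrightarrow> g y = real n powi k * y + c"
    using aff[rule_format, of a b] ab by auto
  have xc: "x \<in> closure (interior ?F)" "x \<notin> interior ?F" using fr by (auto simp: frontier_def)
  then have "{a<..<b} \<inter> interior ?F \<noteq> {}"
    using open_Int_closure_eq_empty[of "{a<..<b}" "interior ?F"] ab by auto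
  then obtain y where y: "y \<in> {a<..<b} \<inter> interior ?F" by blast
  moreover have "open ({a<..<b} \<inter> interior ?F)" by auto
  ultimately obtain d where d: "d > 0" "ball y d \<subseteq> {a<..<b} \<inter> interior ?F" by (meson openE)
  let ?z = "y + d / 2"
  have "?z \<in> ball y d" using d by (simp add: dist_real_def)
  then have z: "?z \<in> {a<..<b}" "?z \<in> ?F" "y \<in> {a<..<b}" "y \<in> ?F" using d y interior_subset[of ?F] by blast+
  have "g ?z = ?z" "g y = y" using z by (auto simp: interval_action_def)
  then have eq: "real n powi k * ?z + c = ?z" "real n powi k * y + c = y" using kc[of ?z] kc[of y] z by auto
  then have "real n powi k * (y + d / 2) - real n powi k * y = d / 2" by linarith
  then have "real n powi k * (d / 2) = d / 2" by (simp add: distrib_left)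
  then have k1: "real n powi k = 1" using d by simp
  then have "c = 0" using eq by simp
  then have "g w = w" if "w \<in> {a<..<b}" for w using kc[of w] that k1 by auto
  moreover have "w \<in> {0<..<1}" if "w \<in> {a<..<b}" for w using that ab(3) \<open>{a<..<b} \<subseteq> {a..b}\<close> by blast
  ultimately have "w \<in> ?F" if "w \<in> {a<..<b}" for w using that by (simp add: interval_action_def)
  then have "{a<..<b} \<subseteq> ?F" by blast
  then have "{a<..<b} \<subseteq> interior ?F" by (intro interior_maximal) auto
  then show False using ab xc(2) by auto
qed

lemma n_adic_dense:
  assumes "0 \<le> x" "x < y" "y \<le> 1" shows "\<exists>d\<in>n_adic n \<inter> {0..1}. x < d \<and> d < y"
proof -
  obtain k where k: "(1 / real n) ^ k < y - x" using real_arch_pow_inv[of "y - x" "1 / real n"] assms n2 by auto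
  have p: "real n ^ k > 0" by simp
  define j where "j = \<lfloor>real n ^ k * x\<rfloor> + 1"
  have "real n ^ k * x < of_int j" by (simp add: j_def)
  then have 1: "x < of_int j / real n ^ k" using p by (simp add: pos_less_divide_eq mult.commute)
  have "of_int j \<le> real n ^ k * x + 1" by (simp add: j_def)
  also have "\<dots> < real n ^ k * x + real n ^ k * (y - x)"
    using k p by (simp add: power_one_over pos_divide_less_eq mult.commute)
  finally have "of_int j < real n ^ k * y" by (simp add: algebra_simps)
  then have 2: "of_int j / real n ^ k < y" using p by (simp add: pos_divide_less_eq mult.commute)
  obtain d where d: "d = of_int j / real n ^ k" by blast
  then have "d \<in> n_adic n" by (auto simp: n_adic_def)
  then show ?thesis using 1 2 assms unfolding d[symmetric] by (intro bexI[of _ d]) auto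
qed

sublocale T: interval_group "thompson_F n" interval_action "n_adic n \<inter> {0..1}"
proof (intro interval_group.intro group_thompson_F interval_group_axioms.intro)
  fix g assume g: "g \<in> carrier (thompson_F n)"
  then have h: "g \<in> carrier (homeo_group {0..1})" "strict_mono_on {0..1} g" "interval_action g \<in> adic_homeos"
    by (auto simp: thompson_F_iff mono_homeos_def)
  show "bij_betw (interval_action g) {0<..<1} {0<..<1}"
    using homeo_Icc_interval(3)[OF h(1)] by (simp add: homeo_group_carrier_iff)
  show "strict_mono_on {0<..<1} (interval_action g)"
    using h(2) by (auto simp: interval_action_def monotone_on_def)
  show "interval_action g x \<in> n_adic n \<inter> {0..1} \<longleftrightarrow> x \<in> n_adic n \<inter> {0..1}" if "x \<in> {0<..<1}" for x
  proof -
    have "interval_action g x \<in> {0<..<1}" using homeo_closed[OF homeo_Icc_interval(3)[OF h(1)] that] .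
    then show ?thesis using h(3) that by (auto simp: adic_homeos_def adic_stable_def)
  qed
  show "x \<in> n_adic n \<inter> {0..1}" if "x \<in> {0<..<1}" "x \<in> frontier (interior {y \<in> {0<..<1}. interval_action g y = y})" for x
    using edge_n_adic[OF g that] that(1) by auto
  fix h assume h': "h \<in> carrier (thompson_F n)"
  show "interval_action (g \<otimes>\<^bsub>thompson_F n\<^esub> h) x = interval_action g (interval_action h x)" if "x \<in> {0<..<1}" for x
    using g h' that thompson_F_homeo homeo_Icc_interval(3)
    by (simp add: thompson_F_mult interval_action_mult homeo_mult_apply)
  show "g = h" if "\<And>x. x \<in> {0<..<1} \<Longrightarrow> interval_action g x = interval_action h x"
  proof -
    have "interval_action g = interval_action h"
      by (rule homeo_group_ext[of _ "{0<..<1}"]) (use that g h' thompson_F_homeo homeo_Icc_interval(3) in auto)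
    then show ?thesis using interval_action_inj_F g h' by (auto simp: inj_on_def)
  qed
next
  show "\<exists>d\<in>n_adic n \<inter> {0..1}. x < d \<and> d < y" if "0 \<le> x" "x < y" "y \<le> 1" for x y by (rule n_adic_dense[OF that])
  fix p q assume pq: "p \<in> n_adic n \<inter> {0..1}" "q \<in> n_adic n \<inter> {0..1}" "p < q"
  then obtain f where f: "f\<in>carrier (thompson_F n)" "\<forall>x\<in>{p<..<q}. x < f x" "\<forall>x\<in>{0..1} - {p<..<q}. f x = x"
    using bump_exists[of p q] by auto
  then show "\<exists>g\<in>carrier (thompson_F n). (\<forall>x\<in>{p<..<q}. x < interval_action g x) \<and> (\<forall>x\<in>{0<..<1} - {p<..<q}. interval_action g x = x)"
    using pq by (intro bexI[OF _ f(1)]) (auto simp: interval_action_def)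
qed auto

sublocale I: conj_setup "thompson_F n" Homeo01 interval_action
  by (intro conj_setup.intro conj_setup_axioms.intro group_thompson_F group_homeo_group interval_action_hom interval_action_inj_F)

sublocale K: conj_setup "thompson_F n" "HomeoC n" "cantor_action n"
  by (intro conj_setup.intro conj_setup_axioms.intro group_thompson_F group_homeo_group cantor_action_hom cantor_action_inj)

lemma interval_normalizer_iso:
  "conj_aut (thompson_F n) Homeo01 interval_action \<in> iso (interval_normalizer n) (AutoGroup (thompson_F n))"
  unfolding interval_normalizer_def
proof (rule I.conj_aut_iso)
  fix a assume a: "a \<in> carrier Homeo01" and c: "\<And>g. g \<in> carrier (thompson_F n) \<Longrightarrow> a \<otimes>\<^bsub>Homeo01\<^esub> interval_action g = interval_action g \<otimes>\<^bsub>Homeo01\<^esub> a"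
  have ga: "interval_action g \<in> carrier Homeo01" if "g \<in> carrier (thompson_F n)" for g
    using that thompson_F_homeo homeo_Icc_interval(3) by blast
  have "a x = x" if x: "x \<in> {0<..<1}" for x
  proof (rule T.centralizer_trivial[OF _ _ _ x])
    show "a x \<in> {0<..<1}" if "x \<in> {0<..<1}" for x using homeo_closed[OF a that] .
    show "inj_on a {0<..<1}" using a by (simp add: homeo_group_carrier_iff bij_betw_def)
    show "a (interval_action g x) = interval_action g (a x)" if "g \<in> carrier (thompson_F n)" "x \<in> {0<..<1}" for g x
      using homeo_mult_apply[OF a ga[OF that(1)] that(2)] homeo_mult_apply[OF ga[OF that(1)] a that(2)] c[OF that(1)] by simp
  qed
  then show "a = \<one>\<^bsub>Homeo01\<^esub>"
    by (intro homeo_group_ext[OF a monoid.one_closed[OF group.is_monoid[OF group_homeo_group]]]) (simp add: homeo_one)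
next
  fix \<alpha> assume \<alpha>a: "\<alpha> \<in> auto (thompson_F n)"
  from T.auto_conjugation[OF \<alpha>a] obtain a where
    A: "bij_betw a {0<..<1} {0<..<1} \<and> (strict_mono_on {0<..<1} a \<or> strict_antimono_on {0<..<1} a) \<and>
    (\<forall>x\<in>{0<..<1}. a x \<in> n_adic n \<inter> {0..1} \<longleftrightarrow> x \<in> n_adic n \<inter> {0..1}) \<and>
    (\<forall>g\<in>carrier (thompson_F n). \<forall>x\<in>{0<..<1}. interval_action (\<alpha> g) (a x) = a (interval_action g x))"
    by (rule exE)
  note a = A[THEN conjunct1] A[THEN conjunct2, THEN conjunct1]
    A[THEN conjunct2, THEN conjunct2, THEN conjunct2, rule_format]
  let ?a = "restrict a {0<..<1}"
  have "bij_betw ?a {0<..<1} {0<..<1}" using a(1) bij_betw_cong[of "{0<..<1}" ?a a] by simp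
  moreover have "strict_mono_on {0<..<1} ?a \<or> strict_antimono_on {0<..<1} ?a" using a(2) by (auto simp: monotone_on_def)
  ultimately have ac: "?a \<in> carrier Homeo01" by (rule monotone_bij_Homeo01) simp
  have ga: "interval_action g \<in> carrier Homeo01" if "g \<in> carrier (thompson_F n)" for g
    using that thompson_F_homeo homeo_Icc_interval(3) by blast
  have \<alpha>c: "\<alpha> g \<in> carrier (thompson_F n)" if "g \<in> carrier (thompson_F n)" for g
    using \<alpha>a that by (auto simp: auto_def Bij_def bij_betw_def)
  have "interval_action (\<alpha> g) \<otimes>\<^bsub>Homeo01\<^esub> ?a = ?a \<otimes>\<^bsub>Homeo01\<^esub> interval_action g" if g: "g \<in> carrier (thompson_F n)" for g
  proof (rule homeo_group_ext[of _ "{0<..<1}"])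
    fix x :: real assume x: "x \<in> {0<..<1}"
    show "(interval_action (\<alpha> g) \<otimes>\<^bsub>Homeo01\<^esub> ?a) x = (?a \<otimes>\<^bsub>Homeo01\<^esub> interval_action g) x"
      using homeo_mult_apply[OF ga[OF \<alpha>c[OF g]] ac x] homeo_mult_apply[OF ac ga[OF g] x] a(3)[OF g x] x homeo_closed[OF ga[OF g] x] by simp
  qed (use homeo_mult_closed ga \<alpha>c g ac in auto)
  then show "\<exists>a\<in>carrier Homeo01. \<forall>g\<in>carrier (thompson_F n). interval_action (\<alpha> g) \<otimes>\<^bsub>Homeo01\<^esub> a = a \<otimes>\<^bsub>Homeo01\<^esub> interval_action g"
    using ac by blast
qed

text \<open>The normalizer is formed among all homeomorphisms of (0,1). The automorphism induced by
  a is also induced by some b that preserves the n-adic points, and \<open>inv a\<close> composed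
  with b commutes with the action of F_n, so a = b.\<close>

lemma interval_normalizer_adic:
  assumes a: "a \<in> I.N" shows "a \<in> adic_homeos"
proof -
  have ac: "a \<in> carrier Homeo01" using I.N_carrier[OF a] .
  let ?\<alpha> = "conj_aut (thompson_F n) Homeo01 interval_action a"
  have ga: "interval_action g \<in> carrier Homeo01" if "g \<in> carrier (thompson_F n)" for g
    using that thompson_F_homeo homeo_Icc_interval(3) by blast
  from T.auto_conjugation[OF I.conj_aut_auto[OF a]] obtain b where
    A: "bij_betw b {0<..<1} {0<..<1} \<and> (strict_mono_on {0<..<1} b \<or> strict_antimono_on {0<..<1} b) \<and>
    (\<forall>x\<in>{0<..<1}. b x \<in> n_adic n \<inter> {0..1} \<longleftrightarrow> x \<in> n_adic n \<inter> {0..1}) \<and>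
    (\<forall>g\<in>carrier (thompson_F n). \<forall>x\<in>{0<..<1}. interval_action (?\<alpha> g) (b x) = b (interval_action g x))"
    by (rule exE)
  note b = A[THEN conjunct1] A[THEN conjunct2, THEN conjunct2, THEN conjunct1, rule_format]
    A[THEN conjunct2, THEN conjunct2, THEN conjunct2, rule_format]
  have ia: "inv\<^bsub>Homeo01\<^esub> a \<in> carrier Homeo01" using homeo_inv_closed[OF ac] .
  have br: "b x \<in> {0<..<1}" if "x \<in> {0<..<1}" for x using b(1) that by (auto simp: bij_betw_def)
  let ?c = "\<lambda>x. (inv\<^bsub>Homeo01\<^esub> a) (b x)"
  have "?c x = x" if x: "x \<in> {0<..<1}" for x
  proof (rule T.centralizer_trivial[OF _ _ _ x])
    show "?c x \<in> {0<..<1}" if "x \<in> {0<..<1}" for x using homeo_closed[OF ia br[OF that]] .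
    show "inj_on ?c {0<..<1}"
    proof (rule inj_onI)
      fix x y :: real assume "x \<in> {0<..<1}" "y \<in> {0<..<1}" "?c x = ?c y"
      then show "x = y" using homeo_inv_apply(1)[OF ac br] b(1) unfolding bij_betw_def inj_on_def by metis
    qed
    fix g and x :: real assume g: "g \<in> carrier (thompson_F n)" and x: "x \<in> {0<..<1}"
    note \<alpha>g = I.conj_aut[OF a g]
    let ?u = "(inv\<^bsub>Homeo01\<^esub> a) (b x)"
    have u: "?u \<in> {0<..<1}" using homeo_closed[OF ia br[OF x]] .
    have agc: "a \<otimes>\<^bsub>Homeo01\<^esub> interval_action g \<in> carrier Homeo01"
      by (rule homeo_mult_closed[OF ac ga[OF g]])
    have "b (interval_action g x) = interval_action (?\<alpha> g) (b x)" using b(3)[OF g x] by simp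
    also have "\<dots> = a (interval_action g ?u)"
      unfolding \<alpha>g(2) homeo_mult_apply[OF agc ia br[OF x]] homeo_mult_apply[OF ac ga[OF g] u] ..
    finally show "?c (interval_action g x) = interval_action g (?c x)"
      using homeo_inv_apply(2)[OF ac homeo_closed[OF ga[OF g] u]] by simp
  qed
  then have e: "a x = b x" if "x \<in> {0<..<1}" for x using homeo_inv_apply(1)[OF ac br[OF that]] that by metis
  have "a x \<in> n_adic n \<longleftrightarrow> x \<in> n_adic n" if x: "x \<in> {0<..<1}" for x
    using e[OF x] b(2)[OF x] br[OF x] x by auto
  then show ?thesis using ac by (simp add: adic_homeos_def adic_stable_def)
qed

lemma cantor_action_lift: "cantor_action n g = cantor_lift n (interval_action g)"
  by (simp add: cantor_action_def)

lemma interval_action_image_iff: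
  assumes k: "k \<in> adic_homeos"
  shows "k \<in> interval_action ` carrier (thompson_F n) \<longleftrightarrow> cantor_lift n k \<in> carrier (F_cantor n)"
proof
  assume "k \<in> interval_action ` carrier (thompson_F n)"
  then show "cantor_lift n k \<in> carrier (F_cantor n)" by (auto simp: thompson_F_iff cantor_action_lift)
next
  assume "cantor_lift n k \<in> carrier (F_cantor n)"
  then obtain f where f: "f\<in>carrier (thompson_F n)" "cantor_lift n (interval_action f) = cantor_lift n k"
    using cantor_action_surj unfolding cantor_action_lift by blast
  then have "interval_action f = k" using inj_onD[OF cantor_lift_inj _ _ k] by (auto simp: thompson_F_iff)
  then show "k \<in> interval_action ` carrier (thompson_F n)" using f by blast
qed

lemma lift_normalizer_iff:
  assumes a: "a \<in> adic_homeos"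
  shows "cantor_lift n a \<in> normalizer (HomeoC n) (carrier (F_cantor n)) \<longleftrightarrow> a \<in> I.N"
proof -
  have ac: "a \<in> carrier Homeo01" using a by (simp add: adic_homeos_def)
  have ia: "inv\<^bsub>Homeo01\<^esub> a \<in> adic_homeos" using subgroup.m_inv_closed[OF subgroup_adic_homeos a] .
  have ga: "interval_action g \<in> adic_homeos" if "g \<in> carrier (thompson_F n)" for g using that by (simp add: thompson_F_iff)
  note mc = subgroup.m_closed[OF subgroup_adic_homeos]
  have 1: "a \<otimes>\<^bsub>Homeo01\<^esub> interval_action g \<otimes>\<^bsub>Homeo01\<^esub> inv\<^bsub>Homeo01\<^esub> a \<in> interval_action ` carrier (thompson_F n) \<longleftrightarrow>
     cantor_lift n a \<otimes>\<^bsub>HomeoC n\<^esub> cantor_action n g \<otimes>\<^bsub>HomeoC n\<^esub> inv\<^bsub>HomeoC n\<^esub> (cantor_lift n a) \<in> carrier (F_cantor n)"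
    if g: "g \<in> carrier (thompson_F n)" for g
    using interval_action_image_iff[OF mc[OF mc[OF a ga[OF g]] ia]] a ia ga[OF g] mc[OF a ga[OF g]]
    by (simp add: cantor_lift_mult cantor_lift_inv cantor_action_lift)
  have 2: "inv\<^bsub>Homeo01\<^esub> a \<otimes>\<^bsub>Homeo01\<^esub> interval_action g \<otimes>\<^bsub>Homeo01\<^esub> a \<in> interval_action ` carrier (thompson_F n) \<longleftrightarrow>
     inv\<^bsub>HomeoC n\<^esub> (cantor_lift n a) \<otimes>\<^bsub>HomeoC n\<^esub> cantor_action n g \<otimes>\<^bsub>HomeoC n\<^esub> cantor_lift n a \<in> carrier (F_cantor n)"
    if g: "g \<in> carrier (thompson_F n)" for g
    using interval_action_image_iff[OF mc[OF mc[OF ia ga[OF g]] a]] a ia ga[OF g] mc[OF ia ga[OF g]]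
    by (simp add: cantor_lift_mult cantor_lift_inv cantor_action_lift)
  show ?thesis
    unfolding I.N_iff cantor_action_image[symmetric] K.N_iff
    using 1 2 ac cantor_lift(1)[OF a] by (simp add: cantor_action_image)
qed

text \<open>Homeomorphisms preserving the relation are lifts, and lifting is compatible with
  conjugation, so the two normalizers correspond.\<close>

lemma cantor_lift_normalizer_image: "cantor_lift n ` I.N = carrier (cantor_normalizer n)"
proof (intro equalityI subsetI)
  fix \<psi> assume "\<psi> \<in> cantor_lift n ` I.N"
  then obtain a where a: "a \<in> I.N" "\<psi> = cantor_lift n a" by blast
  then show "\<psi> \<in> carrier (cantor_normalizer n)"
    using lift_normalizer_iff cantor_lift_preserves_rho interval_normalizer_adic by (simp add: cantor_normalizer_def)
next
  fix \<psi> assume p: "\<psi> \<in> carrier (cantor_normalizer n)"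
  then have "\<psi> \<in> carrier (HomeoC n)" "preserves_rho_relation n \<psi>"
    unfolding cantor_normalizer_def cantor_action_image[symmetric] by (auto dest: K.N_carrier)
  then obtain a where "a \<in> adic_homeos" "\<psi> = cantor_lift n a" using cantor_lift_image by blast
  then show "\<psi> \<in> cantor_lift n ` I.N" using lift_normalizer_iff p by (auto simp: cantor_normalizer_def)
qed

lemma cantor_lift_bij: "bij_betw (cantor_lift n) I.N (carrier (cantor_normalizer n))"
  unfolding bij_betw_def using cantor_lift_normalizer_image inj_on_subset[OF cantor_lift_inj] interval_normalizer_adic by blast

lemma cantor_lift_iso: "cantor_lift n \<in> iso (interval_normalizer n) (cantor_normalizer n)"
proof -
  have "cantor_lift n \<in> hom (interval_normalizer n) (cantor_normalizer n)"
  proof (rule homI)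
    fix a b assume "a \<in> carrier (interval_normalizer n)" "b \<in> carrier (interval_normalizer n)"
    then have "a \<in> adic_homeos" "b \<in> adic_homeos" using interval_normalizer_adic by (auto simp: interval_normalizer_def)
    then show "cantor_lift n (a \<otimes>\<^bsub>interval_normalizer n\<^esub> b) = cantor_lift n a \<otimes>\<^bsub>cantor_normalizer n\<^esub> cantor_lift n b"
      using cantor_lift_mult by (simp add: interval_normalizer_def cantor_normalizer_def)
  qed (use cantor_lift_normalizer_image in \<open>auto simp: interval_normalizer_def\<close>)
  then show ?thesis using cantor_lift_bij by (simp add: iso_def interval_normalizer_def)
qed

lemma cantor_normalizer_sub: "carrier (cantor_normalizer n) \<subseteq> K.N"
  by (auto simp: cantor_normalizer_def cantor_action_image)

lemma conj_aut_cantor_lift: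
  assumes a: "a \<in> I.N"
  shows "conj_aut (thompson_F n) (HomeoC n) (cantor_action n) (cantor_lift n a) = conj_aut (thompson_F n) Homeo01 interval_action a"
proof
  fix g
  show "conj_aut (thompson_F n) (HomeoC n) (cantor_action n) (cantor_lift n a) g = conj_aut (thompson_F n) Homeo01 interval_action a g"
  proof (cases "g \<in> carrier (thompson_F n)")
    case g: True
    have aa: "a \<in> adic_homeos" using interval_normalizer_adic[OF a] .
    have ia: "inv\<^bsub>Homeo01\<^esub> a \<in> adic_homeos" using subgroup.m_inv_closed[OF subgroup_adic_homeos aa] .
    have ga: "interval_action g \<in> adic_homeos" using g by (simp add: thompson_F_iff)
    note mc = subgroup.m_closed[OF subgroup_adic_homeos]
    have L: "cantor_lift n a \<in> K.N" using cantor_normalizer_sub cantor_lift_normalizer_image a by blast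
    show ?thesis
    proof (rule K.conj_aut_eqI[OF L g I.conj_aut(1)[OF a g]])
      show "cantor_action n (conj_aut (thompson_F n) Homeo01 interval_action a g) =
        cantor_lift n a \<otimes>\<^bsub>HomeoC n\<^esub> cantor_action n g \<otimes>\<^bsub>HomeoC n\<^esub> inv\<^bsub>HomeoC n\<^esub> (cantor_lift n a)"
        unfolding cantor_action_lift I.conj_aut(2)[OF a g]
        using aa ia ga mc[OF aa ga] by (simp add: cantor_lift_mult cantor_lift_inv)
    qed
  qed (simp add: conj_aut_def)
qed

text \<open>Transported from the interval: composed with the bijection \<open>cantor_lift\<close>,
  the map becomes the isomorphism known there. No centralizer among the homeomorphisms of the Cantor
  space has to be computed.\<close>

lemma cantor_normalizer_iso:
  "conj_aut (thompson_F n) (HomeoC n) (cantor_action n) \<in> iso (cantor_normalizer n) (AutoGroup (thompson_F n))"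
proof -
  let ?c = "conj_aut (thompson_F n) (HomeoC n) (cantor_action n)" and ?i = "conj_aut (thompson_F n) Homeo01 interval_action"
  have hom: "?c \<in> hom (cantor_normalizer n) (AutoGroup (thompson_F n))"
    using K.conj_aut_hom cantor_normalizer_sub by (auto simp: hom_def cantor_normalizer_def)
  have "bij_betw ?i I.N (carrier (AutoGroup (thompson_F n)))"
    using interval_normalizer_iso by (simp add: iso_def interval_normalizer_def)
  then have "bij_betw (?c \<circ> cantor_lift n) I.N (carrier (AutoGroup (thompson_F n)))"
    using bij_betw_cong[of I.N "?c \<circ> cantor_lift n" ?i] conj_aut_cantor_lift by simp
  then have "bij_betw ?c (carrier (cantor_normalizer n)) (carrier (AutoGroup (thompson_F n)))"
    using bij_betw_comp_iff[OF cantor_lift_bij] by blast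
  then show ?thesis using hom by (simp add: iso_def)
qed

end

section \<open>Transducers and residuals\<close>

lemma trans_word_append: "trans_word T s (u @ w) = trans_word T (trans_word T s u) w"
  by (simp add: trans_word_def)

lemma trans_word_Cons: "trans_word T s (i # w) = trans_word T (step T s i) w"
  by (simp add: trans_word_def)

lemma trans_word_Nil [simp]: "trans_word T s [] = s"
  by (simp add: trans_word_def)

lemma out_word_append: "out_word T s (u @ w) = out_word T s u @ out_word T (trans_word T s u) w"
  by (induction u arbitrary: s) (auto simp: trans_word_Cons)

lemma word_prefix_iff: "word_prefix w \<omega> \<longleftrightarrow> prefix (length w) \<omega> = w"
  by (simp add: word_prefix_def subsequence_def)

lemma word_prefix_nth: "word_prefix w \<omega> \<Longrightarrow> j < length w \<Longrightarrow> w ! j = \<omega> j"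
  unfolding word_prefix_iff by (metis add_0 diff_zero subsequence_nth)

lemma word_prefix_conc [simp]: "word_prefix w (w \<frown> \<omega>)"
  by (simp add: word_prefix_iff)

lemma out_word_prefix_mono:
  "k \<le> l \<Longrightarrow> \<exists>w. out_word T s (prefix l \<omega>) = out_word T s (prefix k \<omega>) @ w"
proof -
  assume "k \<le> l"
  then have "prefix l \<omega> = prefix k \<omega> @ subsequence \<omega> k l" using subsequence_append[of \<omega> k "l - k"] by simp
  then show ?thesis by (simp only: out_word_append) blast
qed

lemma induced_alt: "induced T s \<omega> j = out_word T s (prefix (LEAST k. j < length (out_word T s (prefix k \<omega>))) \<omega>) ! j"
  by (simp add: induced_def subsequence_def)

lemma induced_nth:
  assumes "j < length (out_word T s (prefix k \<omega>))"
  shows "induced T s \<omega> j = out_word T s (prefix k \<omega>) ! j"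
proof -
  let ?K = "LEAST k. j < length (out_word T s (prefix k \<omega>))"
  have "j < length (out_word T s (prefix ?K \<omega>))" using assms by (rule LeastI)
  moreover have "?K \<le> k" using assms by (rule Least_le)
  from out_word_prefix_mono[OF this] obtain w where "out_word T s (prefix k \<omega>) = out_word T s (prefix ?K \<omega>) @ w" by (rule exE)
  ultimately show ?thesis unfolding induced_alt by (simp add: nth_append)
qed

lemma induced_eqI:
  assumes "\<And>j. \<exists>k. j < length (out_word T s (prefix k \<omega>)) \<and> word_prefix (out_word T s (prefix k \<omega>)) \<eta>"
  shows "induced T s \<omega> = \<eta>"
proof
  fix j
  obtain k where "j < length (out_word T s (prefix k \<omega>))" "word_prefix (out_word T s (prefix k \<omega>)) \<eta>" using assms by blast
  then show "induced T s \<omega> j = \<eta> j" using induced_nth word_prefix_nth by metis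
qed

lemma induced_word_prefix: "word_prefix (out_word T s (prefix k \<omega>)) (induced T s \<omega>)"
  unfolding word_prefix_iff by (rule nth_equalityI) (auto simp: induced_nth)

lemma trans_word_state:
  "is_transducer n m T \<Longrightarrow> s \<in> states T \<Longrightarrow> u \<in> words n \<Longrightarrow> trans_word T s u \<in> states T"
  by (induction u arbitrary: s) (auto simp: trans_word_Cons is_transducer_def)

lemma out_word_words:
  "is_transducer n m T \<Longrightarrow> s \<in> states T \<Longrightarrow> u \<in> words n \<Longrightarrow> out_word T s u \<in> words m"
proof (induction u arbitrary: s)
  case (Cons i u)
  then have "step T s i \<in> states T" "emit T s i \<in> words m" by (auto simp: is_transducer_def)
  then show ?case using Cons.IH[of "step T s i"] Cons.prems by auto
qed simp

lemma induced_conc: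
  assumes T: "is_transducer n m T" "s \<in> states T" and u: "u \<in> words n" and w: "\<omega> \<in> cantor n"
  shows "induced T s (u \<frown> \<omega>) = out_word T s u \<frown> induced T (trans_word T s u) \<omega>"
proof (rule induced_eqI)
  fix j
  let ?s = "trans_word T s u"
  have "?s \<in> states T" by (rule trans_word_state[OF T u])
  then obtain k where k: "j < length (out_word T ?s (prefix k \<omega>))" using T w unfolding is_transducer_def subsequence_def by blast
  have "word_prefix (out_word T s u @ out_word T ?s (prefix k \<omega>)) (out_word T s u \<frown> induced T ?s \<omega>)"
    using induced_word_prefix[of T ?s \<omega> k] by (simp add: word_prefix_iff)
  then show "\<exists>k. j < length (out_word T s (prefix k (u \<frown> \<omega>))) \<and>
      word_prefix (out_word T s (prefix k (u \<frown> \<omega>))) (out_word T s u \<frown> induced T ?s \<omega>)"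
    using k by (intro exI[of _ "length u + k"]) (simp add: out_word_append)
qed

section \<open>Residuals of a map\<close>

context base_n begin

text \<open>Residuals of homeomorphisms need not be surjective; this class is closed under taking
  residuals.\<close>

definition admissible :: "(nat word \<Rightarrow> nat word) \<Rightarrow> bool" where
  "admissible h \<longleftrightarrow> (\<forall>\<omega>\<in>cantor n. h \<omega> \<in> cantor n) \<and> inj_on h (cantor n) \<and> continuous_on (cantor n) h"

lemma HomeoC_admissible: "\<psi> \<in> carrier (HomeoC n) \<Longrightarrow> admissible \<psi>"
  unfolding admissible_def homeo_group_carrier_iff bij_betw_def by blast

text \<open>The length of the greatest common prefix of the image of a cylinder, found as the first
  position at which two outputs differ. For injective maps there is one.\<close>

definition common_length :: "(nat word \<Rightarrow> nat word) \<Rightarrow> nat list \<Rightarrow> nat" where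
  "common_length h u = (LEAST k. \<exists>\<omega>\<in>cantor n. \<exists>\<eta>\<in>cantor n. h (u \<frown> \<omega>) k \<noteq> h (u \<frown> \<eta>) k)"

definition common_prefix :: "(nat word \<Rightarrow> nat word) \<Rightarrow> nat list \<Rightarrow> nat list" where
  "common_prefix h u = prefix (common_length h u) (h (u \<frown> (\<lambda>_. 0)))"

text \<open>Restricted to the Cantor space so that residuals agreeing there are equal as functions;
  equality of functions is then the criterion for equality of states.\<close>

definition residual :: "(nat word \<Rightarrow> nat word) \<Rightarrow> nat list \<Rightarrow> nat word \<Rightarrow> nat word" where
  "residual h u = (\<lambda>\<omega>\<in>cantor n. suffix (common_length h u) (h (u \<frown> \<omega>)))"

lemma common_length_props:
  assumes h: "admissible h" and u: "u \<in> words n"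
  shows "\<exists>\<omega>\<in>cantor n. \<exists>\<eta>\<in>cantor n. h (u \<frown> \<omega>) (common_length h u) \<noteq> h (u \<frown> \<eta>) (common_length h u)"
    "\<And>k \<omega> \<eta>. k < common_length h u \<Longrightarrow> \<omega> \<in> cantor n \<Longrightarrow> \<eta> \<in> cantor n \<Longrightarrow> h (u \<frown> \<omega>) k = h (u \<frown> \<eta>) k"
proof -
  have ne: "(\<lambda>_. 0) \<noteq> (\<lambda>_. n - 1 :: nat)" using n2 by (metis One_nat_def diff_is_0_eq not_less_eq_eq numeral_2_eq_2)
  then have "h (u \<frown> (\<lambda>_. 0)) \<noteq> h (u \<frown> (\<lambda>_. n - 1))"
    using h u unfolding admissible_def inj_on_def by (metis cantor_conc One_nat_def same_concat_eq tops_cantor zeros_cantor)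
  then obtain k where "h (u \<frown> (\<lambda>_. 0)) k \<noteq> h (u \<frown> (\<lambda>_. n - 1)) k" by blast
  then have ex: "\<exists>k. \<exists>\<omega>\<in>cantor n. \<exists>\<eta>\<in>cantor n. h (u \<frown> \<omega>) k \<noteq> h (u \<frown> \<eta>) k"
    by (intro exI[of _ k] bexI[of _ "\<lambda>_. 0"] bexI[of _ "\<lambda>_. n - 1"]) auto
  show "\<exists>\<omega>\<in>cantor n. \<exists>\<eta>\<in>cantor n. h (u \<frown> \<omega>) (common_length h u) \<noteq> h (u \<frown> \<eta>) (common_length h u)"
    unfolding common_length_def using ex by (rule LeastI_ex)
  show "\<And>k \<omega> \<eta>. k < common_length h u \<Longrightarrow> \<omega> \<in> cantor n \<Longrightarrow> \<eta> \<in> cantor n \<Longrightarrow> h (u \<frown> \<omega>) k = h (u \<frown> \<eta>) k"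
    unfolding common_length_def using not_less_Least by blast
qed

lemma length_common_prefix [simp]: "length (common_prefix h u) = common_length h u"
  by (simp add: common_prefix_def)

lemma restrict_residual [simp]: "restrict (residual h u) (cantor n) = residual h u"
  by (simp add: residual_def)

lemma residual_extensional [simp]: "residual h u \<in> extensional (cantor n)"
  by (simp add: residual_def)

lemma residual_decomp:
  assumes h: "admissible h" and u: "u \<in> words n" and w: "\<omega> \<in> cantor n"
  shows "h (u \<frown> \<omega>) = common_prefix h u \<frown> residual h u \<omega>"
proof -
  have "prefix (common_length h u) (h (u \<frown> \<omega>)) = common_prefix h u"
    unfolding common_prefix_def using common_length_props(2)[OF h u _ w zeros_cantor] by (auto simp: subsequence_def)
  then show ?thesis using prefix_suffix[of "h (u \<frown> \<omega>)" "common_length h u"] w by (simp add: residual_def)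
qed

lemma residual_differ:
  assumes h: "admissible h" and u: "u \<in> words n"
  shows "\<exists>\<omega>\<in>cantor n. \<exists>\<eta>\<in>cantor n. residual h u \<omega> 0 \<noteq> residual h u \<eta> 0"
  using common_length_props(1)[OF h u] by (simp add: residual_def)

text \<open>The common part of the outputs is exhausted as soon as the first letter of the rest
  varies, so residuals can be computed by exhibiting any such splitting.\<close>

lemma residual_unique:
  assumes e: "\<And>\<omega>. \<omega> \<in> cantor n \<Longrightarrow> h (u \<frown> \<omega>) = x \<frown> g \<omega>"
    and d: "\<exists>\<omega>\<in>cantor n. \<exists>\<eta>\<in>cantor n. g \<omega> 0 \<noteq> g \<eta> 0"
  shows "common_prefix h u = x" "residual h u = restrict g (cantor n)"
proof -
  have cl: "common_length h u = length x"
    unfolding common_length_def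
  proof (rule Least_equality)
    show "\<exists>\<omega>\<in>cantor n. \<exists>\<eta>\<in>cantor n. h (u \<frown> \<omega>) (length x) \<noteq> h (u \<frown> \<eta>) (length x)" using d e by simp
    fix k assume "\<exists>\<omega>\<in>cantor n. \<exists>\<eta>\<in>cantor n. h (u \<frown> \<omega>) k \<noteq> h (u \<frown> \<eta>) k"
    then show "length x \<le> k" using e by (metis conc_fst not_le)
  qed
  show "common_prefix h u = x" unfolding common_prefix_def cl using e[OF zeros_cantor] by simp
  show "residual h u = restrict g (cantor n)" unfolding residual_def cl using e by (auto simp: restrict_def fun_eq_iff)
qed

lemma common_prefix_words: "admissible h \<Longrightarrow> u \<in> words n \<Longrightarrow> common_prefix h u \<in> words n"
  unfolding common_prefix_def by (rule prefix_in_words) (auto simp: admissible_def)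

lemma residual_admissible:
  assumes h: "admissible h" and u: "u \<in> words n" shows "admissible (residual h u)"
  unfolding admissible_def
proof (intro conjI ballI)
  fix \<omega> assume w: "\<omega> \<in> cantor n"
  then have "h (u \<frown> \<omega>) \<in> cantor n" using h u by (simp add: admissible_def)
  then show "residual h u \<omega> \<in> cantor n" using w by (simp add: residual_def)
next
  show "inj_on (residual h u) (cantor n)"
  proof (rule inj_onI)
    fix \<omega> \<eta> assume w: "\<omega> \<in> cantor n" "\<eta> \<in> cantor n" "residual h u \<omega> = residual h u \<eta>"
    then have "h (u \<frown> \<omega>) = h (u \<frown> \<eta>)" using residual_decomp[OF h u] by simp
    moreover have "u \<frown> \<omega> \<in> cantor n" "u \<frown> \<eta> \<in> cantor n" using u w by auto
    moreover have "inj_on h (cantor n)" using h by (simp add: admissible_def)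
    ultimately have "u \<frown> \<omega> = u \<frown> \<eta>" by (meson inj_onD)
    then show "\<omega> = \<eta>" by simp
  qed
next
  show "continuous_on (cantor n) (residual h u)"
    unfolding continuous_on_discrete_word
  proof safe
    fix \<omega> j assume w: "\<omega> \<in> cantor n"
    have "u \<frown> \<omega> \<in> cantor n" using u w by simp
    then obtain k where k: "\<forall>\<eta>\<in>cantor n. prefix k \<eta> = prefix k (u \<frown> \<omega>) \<longrightarrow> h \<eta> (common_length h u + j) = h (u \<frown> \<omega>) (common_length h u + j)"
      using h unfolding admissible_def continuous_on_discrete_word by blast
    show "\<exists>k. \<forall>\<eta>\<in>cantor n. prefix k \<eta> = prefix k \<omega> \<longrightarrow> residual h u \<eta> j = residual h u \<omega> j"
    proof (intro exI[of _ k] ballI impI)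
      fix \<eta> assume e: "\<eta> \<in> cantor n" "prefix k \<eta> = prefix k \<omega>"
      have "prefix k (u \<frown> \<eta>) = prefix k (u \<frown> \<omega>)"
      proof (cases "k \<le> length u")
        case False
        have "prefix (k - length u) \<eta> = prefix (k - length u) \<omega>" using arg_cong[OF e(2), of "take (k - length u)"] by (simp add: min_def)
        then show ?thesis using False by simp
      qed simp
      then have "h (u \<frown> \<eta>) (common_length h u + j) = h (u \<frown> \<omega>) (common_length h u + j)" using k e u by simp
      then show "residual h u \<eta> j = residual h u \<omega> j" using e w by (simp add: residual_def)
    qed
  qed
qed

lemma residual_append:
  assumes h: "admissible h" and u: "u \<in> words n" and w: "w \<in> words n"
  shows "common_prefix h (u @ w) = common_prefix h u @ common_prefix (residual h u) w"
    "residual h (u @ w) = residual (residual h u) w"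
proof -
  note g = residual_admissible[OF h u]
  have "h ((u @ w) \<frown> \<omega>) = (common_prefix h u @ common_prefix (residual h u) w) \<frown> residual (residual h u) w \<omega>" if "\<omega> \<in> cantor n" for \<omega>
  proof -
    have "w \<frown> \<omega> \<in> cantor n" using w that by simp
    then have "h (u \<frown> (w \<frown> \<omega>)) = common_prefix h u \<frown> residual h u (w \<frown> \<omega>)" by (rule residual_decomp[OF h u])
    then show ?thesis using residual_decomp[OF g w that] by simp
  qed
  from residual_unique[OF this residual_differ[OF g w]]
  show "common_prefix h (u @ w) = common_prefix h u @ common_prefix (residual h u) w"
    "residual h (u @ w) = residual (residual h u) w" by simp_all
qed

lemma residual_Nil:
  assumes "\<exists>\<omega>\<in>cantor n. \<exists>\<eta>\<in>cantor n. h \<omega> 0 \<noteq> h \<eta> 0" "h \<in> extensional (cantor n)"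
  shows "common_prefix h [] = []" "residual h [] = h"
  using residual_unique[of h "[]" "[]" h] assms by (simp_all add: extensional_restrict)

lemma HomeoC_differ: "\<psi> \<in> carrier (HomeoC n) \<Longrightarrow> \<exists>\<omega>\<in>cantor n. \<exists>\<eta>\<in>cantor n. \<psi> \<omega> 0 \<noteq> \<psi> \<eta> 0"
proof -
  assume p: "\<psi> \<in> carrier (HomeoC n)"
  then have im: "\<psi> ` cantor n = cantor n" by (simp add: homeo_group_carrier_iff bij_betw_def)
  have "(\<lambda>_. 0) \<in> \<psi> ` cantor n" "(\<lambda>_. n - Suc 0) \<in> \<psi> ` cantor n" by (simp_all add: im)
  then obtain \<omega> \<eta> where "\<omega> \<in> cantor n" "\<psi> \<omega> = (\<lambda>_. 0)" "\<eta> \<in> cantor n" "\<psi> \<eta> = (\<lambda>_. n - Suc 0)"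
    by (elim imageE) simp
  then show ?thesis using n2 by (intro bexI[of _ \<omega>] bexI[of _ \<eta>]) auto
qed

lemma continuous_prefix:
  fixes h :: "nat word \<Rightarrow> nat word"
  assumes "continuous_on (cantor n) h" "\<omega> \<in> cantor n"
  shows "\<exists>k. \<forall>\<eta>\<in>cantor n. prefix k \<eta> = prefix k \<omega> \<longrightarrow> prefix j (h \<eta>) = prefix j (h \<omega>)"
proof (induction j)
  case (Suc j)
  then obtain k where k: "\<forall>\<eta>\<in>cantor n. prefix k \<eta> = prefix k \<omega> \<longrightarrow> prefix j (h \<eta>) = prefix j (h \<omega>)" by blast
  obtain l where l: "\<forall>\<eta>\<in>cantor n. prefix l \<eta> = prefix l \<omega> \<longrightarrow> h \<eta> j = h \<omega> j"
    using assms unfolding continuous_on_discrete_word by blast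
  show ?case
  proof (intro exI[of _ "max k l"] ballI impI)
    fix \<eta> assume e: "\<eta> \<in> cantor n" "prefix (max k l) \<eta> = prefix (max k l) \<omega>"
    have "prefix k \<eta> = prefix k \<omega>" "prefix l \<eta> = prefix l \<omega>"
      using arg_cong[OF e(2), of "take k"] arg_cong[OF e(2), of "take l"] by (auto simp: min_def max_def split: if_splits)
    then show "prefix (Suc j) (h \<eta>) = prefix (Suc j) (h \<omega>)" using k l e(1) by simp
  qed
qed simp

text \<open>By continuity a long input prefix determines the first j output letters, so no two
  outputs differ before position j.\<close>

lemma common_length_unbounded:
  assumes h: "admissible h" and w: "\<omega> \<in> cantor n"
  shows "\<exists>k. j \<le> common_length h (prefix k \<omega>)"
proof -
  obtain k where k: "\<forall>\<eta>\<in>cantor n. prefix k \<eta> = prefix k \<omega> \<longrightarrow> prefix j (h \<eta>) = prefix j (h \<omega>)"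
    using continuous_prefix[of h \<omega> j] h w by (auto simp: admissible_def)
  let ?u = "prefix k \<omega>"
  have u: "?u \<in> words n" by (rule prefix_in_words[OF w])
  have "j \<le> common_length h ?u"
  proof (rule ccontr)
    assume "\<not> ?thesis"
    then have l: "common_length h ?u < j" by simp
    have e: "h (?u \<frown> \<eta>) (common_length h ?u) = h \<omega> (common_length h ?u)" if "\<eta> \<in> cantor n" for \<eta>
    proof -
      have "?u \<frown> \<eta> \<in> cantor n" using u that by simp
      moreover have "prefix k (?u \<frown> \<eta>) = ?u" by simp
      ultimately have "prefix j (h (?u \<frown> \<eta>)) = prefix j (h \<omega>)" using k by blast
      from arg_cong[OF this, of "\<lambda>l. l ! common_length h ?u"] show ?thesis using l by simp
    qed
    show False using common_length_props(1)[OF h u] e by metis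
  qed
  then show ?thesis ..
qed

lemma common_length_mono:
  "admissible h \<Longrightarrow> u \<in> words n \<Longrightarrow> w \<in> words n \<Longrightarrow> common_length h u \<le> common_length h (u @ w)"
  using arg_cong[OF residual_append(1), of h u w length] by simp

lemma common_length_uniform:
  assumes h: "admissible h" shows "\<exists>N. \<forall>u\<in>words n. N \<le> length u \<longrightarrow> j \<le> common_length h u"
proof -
  have "\<exists>N. \<forall>u\<in>words n. N \<le> length u \<longrightarrow> (u \<in> words n \<longrightarrow> j \<le> common_length h u)"
  proof (rule koenig)
    show "\<forall>\<omega>\<in>cantor n. \<exists>k. prefix k \<omega> \<in> words n \<longrightarrow> j \<le> common_length h (prefix k \<omega>)"
      using common_length_unbounded[OF h] by blast
    show "u @ w \<in> words n \<longrightarrow> j \<le> common_length h (u @ w)" if a: "u \<in> words n \<longrightarrow> j \<le> common_length h u" "w \<in> words n" for u w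
    proof
      assume "u @ w \<in> words n"
      then have u: "u \<in> words n" by simp
      show "j \<le> common_length h (u @ w)" using common_length_mono[OF h u a(2)] a(1) u by linarith
    qed
  qed
  then show ?thesis by blast
qed

section \<open>The transducer of residuals\<close>

definition residual_rep :: "(nat word \<Rightarrow> nat word) \<Rightarrow> nat list \<Rightarrow> nat list" where
  "residual_rep h u = (SOME v. v \<in> words n \<and> residual h v = residual h u)"

text \<open>States have to be natural numbers, so a residual is encoded by the number of a chosen
  word representing it. The choice depends only on the residual, hence equal residuals get equal
  numbers.\<close>

definition residual_state :: "(nat word \<Rightarrow> nat word) \<Rightarrow> nat list \<Rightarrow> nat" where
  "residual_state h u = to_nat (residual_rep h u)"

definition residual_transducer :: "(nat word \<Rightarrow> nat word) \<Rightarrow> nat transducer" where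
  "residual_transducer h = \<lparr>states = residual_state h ` words n,
     step = (\<lambda>s i. residual_state h (from_nat s @ [i])),
     emit = (\<lambda>s i. common_prefix (residual h (from_nat s)) [i]),
     start = residual_state h []\<rparr>"

lemma residual_rep:
  assumes "u \<in> words n" shows "residual_rep h u \<in> words n" "residual h (residual_rep h u) = residual h u"
  using someI[of "\<lambda>v. v \<in> words n \<and> residual h v = residual h u" u] assms by (auto simp: residual_rep_def)

lemma residual_state_eq_iff:
  assumes "u \<in> words n" "v \<in> words n"
  shows "residual_state h u = residual_state h v \<longleftrightarrow> residual h u = residual h v"
proof
  assume "residual_state h u = residual_state h v"
  then have "residual_rep h u = residual_rep h v" by (simp add: residual_state_def)
  then show "residual h u = residual h v" using residual_rep(2) assms by metis
next
  assume "residual h u = residual h v"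
  then show "residual_state h u = residual_state h v" by (simp add: residual_state_def residual_rep_def)
qed

context
  fixes h :: "nat word \<Rightarrow> nat word"
  assumes h: "admissible h"
begin

lemma residual_cong_append:
  "u \<in> words n \<Longrightarrow> v \<in> words n \<Longrightarrow> w \<in> words n \<Longrightarrow> residual h u = residual h v \<Longrightarrow> residual h (u @ w) = residual h (v @ w)"
  using residual_append(2)[OF h] by metis

lemma residual_step:
  assumes u: "u \<in> words n" and i: "i < n"
  shows "step (residual_transducer h) (residual_state h u) i = residual_state h (u @ [i])"
proof -
  have "residual h (residual_rep h u @ [i]) = residual h (u @ [i])"
    by (rule residual_cong_append) (use u i residual_rep in auto)
  then show ?thesis using residual_state_eq_iff[of "residual_rep h u @ [i]" "u @ [i]" h] residual_rep(1)[OF u] u i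
    by (simp add: residual_transducer_def) (simp add: residual_state_def)
qed

lemma residual_emit:
  "u \<in> words n \<Longrightarrow> emit (residual_transducer h) (residual_state h u) i = common_prefix (residual h u) [i]"
  using residual_rep(2)[of u h] by (simp add: residual_transducer_def residual_state_def)

lemma residual_trans_word:
  "u \<in> words n \<Longrightarrow> w \<in> words n \<Longrightarrow> trans_word (residual_transducer h) (residual_state h u) w = residual_state h (u @ w)"
proof (induction w arbitrary: u)
  case (Cons i w)
  then show ?case using Cons.IH[of "u @ [i]"] by (simp add: trans_word_Cons residual_step)
qed simp

text \<open>Common prefixes concatenate along \<open>residual_append\<close>, so the letters emitted
  step by step make up the common prefix for the whole word.\<close>

lemma residual_out_word:
  "u \<in> words n \<Longrightarrow> w \<in> words n \<Longrightarrow> out_word (residual_transducer h) (residual_state h u) w = common_prefix (residual h u) w"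
proof (induction w arbitrary: u)
  case Nil
  show ?case using residual_Nil(1)[of "residual h u"] residual_differ[OF h Nil(1)] by simp
next
  case (Cons i w)
  have ui: "u @ [i] \<in> words n" "i < n" "[i] \<in> words n" "w \<in> words n" using Cons.prems by auto
  have "common_prefix (residual h u) ([i] @ w) = common_prefix (residual h u) [i] @ common_prefix (residual (residual h u) [i]) w"
    by (rule residual_append(1)[OF residual_admissible[OF h Cons.prems(1)] ui(3,4)])
  also have "residual (residual h u) [i] = residual h (u @ [i])" using residual_append(2)[OF h Cons.prems(1) ui(3)] by simp
  finally show ?case using Cons.IH[OF ui(1) ui(4)] by (simp add: residual_step residual_emit Cons.prems(1) ui)
qed

lemma residual_out_unbounded:
  assumes u: "u \<in> words n" and w: "\<omega> \<in> cantor n"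
  shows "\<exists>k. j < length (out_word (residual_transducer h) (residual_state h u) (prefix k \<omega>))"
proof -
  obtain k where "Suc j \<le> common_length (residual h u) (prefix k \<omega>)"
    using common_length_unbounded[OF residual_admissible[OF h u] w] by blast
  then show ?thesis using residual_out_word[OF u prefix_in_words[OF w], of 0 k] by (intro exI[of _ k]) simp
qed

lemma residual_is_transducer: "is_transducer n n (residual_transducer h)"
  unfolding is_transducer_def
proof (intro conjI ballI allI impI)
  show "start (residual_transducer h) \<in> states (residual_transducer h)" by (simp add: residual_transducer_def)
  fix s assume "s \<in> states (residual_transducer h)"
  then obtain u where u: "u \<in> words n" "s = residual_state h u" by (auto simp: residual_transducer_def)
  show "step (residual_transducer h) s i \<in> states (residual_transducer h)" if "i < n" for i
    unfolding u(2) residual_step[OF u(1) that] using u(1) that by (auto simp: residual_transducer_def)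
  show "emit (residual_transducer h) s i \<in> words n" if "i < n" for i
    unfolding u(2) residual_emit[OF u(1)] by (rule common_prefix_words[OF residual_admissible[OF h u(1)]]) (use that in simp)
  show "\<exists>k. j < length (out_word (residual_transducer h) s (map \<omega> [0..<k]))" if "\<omega> \<in> cantor n" for \<omega> j
    using residual_out_unbounded[OF u(1) that] u(2) by (simp add: subsequence_def)
qed

lemma residual_induced:
  assumes u: "u \<in> words n" and w: "\<omega> \<in> cantor n"
  shows "induced (residual_transducer h) (residual_state h u) \<omega> = residual h u \<omega>"
proof (rule induced_eqI)
  fix j
  obtain k where k: "j < length (out_word (residual_transducer h) (residual_state h u) (prefix k \<omega>))"
    using residual_out_unbounded[OF u w] by blast
  have p: "prefix k \<omega> \<in> words n" by (rule prefix_in_words[OF w])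
  have "residual h u (prefix k \<omega> \<frown> suffix k \<omega>) = common_prefix (residual h u) (prefix k \<omega>) \<frown> residual (residual h u) (prefix k \<omega>) (suffix k \<omega>)"
    by (rule residual_decomp[OF residual_admissible[OF h u] p suffix_in_cantor[OF w]])
  then have "word_prefix (common_prefix (residual h u) (prefix k \<omega>)) (residual h u \<omega>)" by simp
  then show "\<exists>k. j < length (out_word (residual_transducer h) (residual_state h u) (prefix k \<omega>)) \<and>
      word_prefix (out_word (residual_transducer h) (residual_state h u) (prefix k \<omega>)) (residual h u \<omega>)"
    using k residual_out_word[OF u p] by (intro exI[of _ k]) simp
qed

end

lemma residual_minimal:
  assumes p: "\<psi> \<in> carrier (HomeoC n)"
  shows "minimal_transducer n n \<psi> (residual_transducer \<psi>)"
proof -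
  let ?T = "residual_transducer \<psi>"
  note h = HomeoC_admissible[OF p]
  have nil: "residual \<psi> [] = \<psi>" using residual_Nil(2)[of \<psi>] HomeoC_differ[OF p] p by (simp add: homeo_group_carrier_iff)
  have st: "start ?T = residual_state \<psi> []" by (simp add: residual_transducer_def)
  have states: "\<exists>u\<in>words n. s = residual_state \<psi> u" if "s \<in> states ?T" for s using that by (auto simp: residual_transducer_def)
  show ?thesis unfolding minimal_transducer_def
  proof (intro conjI ballI allI impI)
    show "represents n n ?T \<psi>" unfolding represents_def
      using residual_is_transducer[OF h] residual_induced[OF h, of "[]"] nil by (simp add: st)
    fix s assume "s \<in> states ?T"
    then obtain u where u: "u \<in> words n" "s = residual_state \<psi> u" using states by blast
    show "\<exists>u\<in>words n. trans_word ?T (start ?T) u = s" using residual_trans_word[OF h, of "[]" u] u st by auto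
    show "s = s'" if s': "s' \<in> states ?T" and e: "\<forall>\<omega>\<in>cantor n. induced ?T s \<omega> = induced ?T s' \<omega>" for s'
    proof -
      obtain v where v: "v \<in> words n" "s' = residual_state \<psi> v" using states[OF s'] by blast
      have "residual \<psi> u \<omega> = residual \<psi> v \<omega>" if "\<omega> \<in> cantor n" for \<omega>
        using e that residual_induced[OF h u(1) that] residual_induced[OF h v(1) that] u v by simp
      then have "residual \<psi> u = residual \<psi> v" by (intro extensionalityI[of _ "cantor n"]) (auto simp: residual_def)
      then show ?thesis using residual_state_eq_iff[OF u(1) v(1)] u v by simp
    qed
    fix i assume i: "i < n"
    let ?g = "residual \<psi> u"
    note g = residual_admissible[OF h u(1)]
    have iw: "[i] \<in> words n" using i by simp
    have im: "induced ?T s ` cylinder n [i] = {?g ([i] \<frown> \<eta>) | \<eta>. \<eta> \<in> cantor n}"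
    proof -
      have "induced ?T s ([i] \<frown> \<eta>) = ?g ([i] \<frown> \<eta>)" if "\<eta> \<in> cantor n" for \<eta>
        using residual_induced[OF h u(1), of "[i] \<frown> \<eta>"] u(2) i that by simp
      then show ?thesis unfolding cylinder_def by (auto simp: image_image image_iff simp del: build_cons)
    qed
    have em: "emit ?T s i = common_prefix ?g [i]" using residual_emit[OF h u(1)] u(2) by simp
    show "is_greatest_common_prefix (emit ?T s i) (induced ?T s ` cylinder n [i])"
      unfolding is_greatest_common_prefix_def im em
    proof (intro conjI allI impI ballI)
      show "word_prefix (common_prefix ?g [i]) \<omega>" if "\<omega> \<in> {?g ([i] \<frown> \<eta>) | \<eta>. \<eta> \<in> cantor n}" for \<omega>
        using that residual_decomp[OF g iw] by auto
      fix v assume v: "\<forall>\<omega>\<in>{?g ([i] \<frown> \<eta>) | \<eta>. \<eta> \<in> cantor n}. word_prefix v \<omega>"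
      show "length v \<le> length (common_prefix ?g [i])"
      proof (rule ccontr)
        assume "\<not> ?thesis"
        then have l: "common_length ?g [i] < length v" by simp
        have "?g ([i] \<frown> \<eta>) (common_length ?g [i]) = v ! common_length ?g [i]" if "\<eta> \<in> cantor n" for \<eta>
          using word_prefix_nth[OF _ l] v that by (metis (mono_tags, lifting) mem_Collect_eq)
        then show False using common_length_props(1)[OF g iw] by metis
      qed
    qed
  qed
qed

section \<open>Synchronization\<close>

lemma inner_word_iff: "inner_word n u \<longleftrightarrow> u \<in> words n \<and> (\<exists>x\<in>set u. x \<noteq> 0) \<and> (\<exists>x\<in>set u. x \<noteq> n - 1)"
proof -
  have r: "(\<exists>k. u = replicate k c) \<longleftrightarrow> (\<forall>x\<in>set u. x = c)" for c
  proof
    assume "\<forall>x\<in>set u. x = c"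
    then have "u = replicate (length u) c" by (intro replicate_eqI) auto
    then show "\<exists>k. u = replicate k c" ..
  qed auto
  show ?thesis unfolding inner_word_def r by auto
qed

lemma sum_list_top:
  assumes "u \<in> words n" shows "sum_list u \<le> (n - 1) * length u \<and> (sum_list u = (n - 1) * length u \<longleftrightarrow> (\<forall>x\<in>set u. x = n - 1))"
  using assms
proof (induction u)
  case (Cons i u)
  then have "i \<le> n - 1" by auto
  with Cons show ?case by auto
qed simp

lemma inner_word_sum: "inner_word n u \<Longrightarrow> sum_list u \<noteq> 0 \<and> sum_list u \<noteq> (n - 1) * length u"
  using sum_list_top[of u] by (auto simp: inner_word_iff)

lemma finite_short_words: "finite {u \<in> words n. length u \<le> m}"
proof -
  have "{u \<in> words n. length u \<le> m} = {u. set u \<subseteq> {..<n} \<and> length u \<le> m}" by auto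
  then show ?thesis by (simp add: finite_lists_length_le)
qed

lemma sigma_eq_iff: "sigma n u = sigma n v \<longleftrightarrow> int (n - 1) dvd int (sum_list u) - int (sum_list v)"
proof -
  have "sigma n u = sigma n v \<longleftrightarrow> int (sum_list u) mod int (n - 1) = int (sum_list v) mod int (n - 1)"
    by (simp add: sigma_def flip: of_nat_mod)
  then show ?thesis by (simp add: mod_eq_dvd_iff)
qed

text \<open>For long w the common prefix of \<psi> on the cylinder of \<open>u @ w\<close> is long
  enough to be replaced by the conjugate of f, say by y. On the cylinder of \<open>v @ w\<close> the
  map \<psi> is then y followed by \<open>residual \<psi> (u @ w)\<close>, and uniqueness of such a
  splitting identifies the residuals.\<close>

lemma normalizes_residual:
  assumes p: "\<psi> \<in> carrier (HomeoC n)" and f: "f \<in> carrier (F_cantor n)" and r: "replaces f u v"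
    and g: "\<psi> \<otimes>\<^bsub>HomeoC n\<^esub> f \<otimes>\<^bsub>HomeoC n\<^esub> inv\<^bsub>HomeoC n\<^esub> \<psi> \<in> carrier (F_cantor n)"
  shows "\<exists>k. \<forall>w\<in>words n. k \<le> length w \<longrightarrow> residual \<psi> (u @ w) = residual \<psi> (v @ w)"
proof -
  let ?g = "\<psi> \<otimes>\<^bsub>HomeoC n\<^esub> f \<otimes>\<^bsub>HomeoC n\<^esub> inv\<^bsub>HomeoC n\<^esub> \<psi>"
  note h = HomeoC_admissible[OF p]
  have fc: "f \<in> carrier (HomeoC n)" using f by (simp add: F_cantor_carrier)
  have pf: "\<psi> \<otimes>\<^bsub>HomeoC n\<^esub> f \<in> carrier (HomeoC n)" by (rule homeo_mult_closed[OF p fc])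
  have uv: "u \<in> words n" "v \<in> words n" using r by (auto simp: replaces_def)
  have ge: "?g (\<psi> \<omega>) = \<psi> (f \<omega>)" if "\<omega> \<in> cantor n" for \<omega>
    using homeo_mult_apply[OF pf homeo_inv_closed[OF p] homeo_closed[OF p that]] homeo_mult_apply[OF p fc that] homeo_inv_apply(2)[OF p that] by simp
  obtain N where N: "\<And>x. x\<in>words n \<Longrightarrow> N \<le> length x \<Longrightarrow> \<exists>y. replaces ?g x y"
    using g locally_replacing_uniform unfolding F_cantor_carrier by blast
  obtain k where k: "\<And>x. x\<in>words n \<Longrightarrow> k \<le> length x \<Longrightarrow> N \<le> common_length \<psi> x" using common_length_uniform[OF h] by blast
  have "residual \<psi> (u @ w) = residual \<psi> (v @ w)" if w: "w \<in> words n" "k \<le> length w" for w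
  proof -
    have uw: "u @ w \<in> words n" "v @ w \<in> words n" using uv w by auto
    obtain y where y: "replaces ?g (common_prefix \<psi> (u @ w)) y"
      using N[OF common_prefix_words[OF h uw(1)]] k[OF uw(1)] w(2) by auto
    have "\<psi> ((v @ w) \<frown> \<omega>) = y \<frown> residual \<psi> (u @ w) \<omega>" if e: "\<omega> \<in> cantor n" for \<omega>
    proof -
      have "u \<frown> (w \<frown> \<omega>) \<in> cantor n" "w \<frown> \<omega> \<in> cantor n" using uv w e by auto
      then have "\<psi> (v \<frown> (w \<frown> \<omega>)) = ?g (\<psi> (u \<frown> (w \<frown> \<omega>)))" using ge r unfolding replaces_def by metis
      also have "\<psi> (u \<frown> (w \<frown> \<omega>)) = common_prefix \<psi> (u @ w) \<frown> residual \<psi> (u @ w) \<omega>"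
        using residual_decomp[OF h uw(1) e] by simp
      also have "?g \<dots> = y \<frown> residual \<psi> (u @ w) \<omega>"
        using y residual_admissible[OF h uw(1)] e unfolding replaces_def admissible_def by blast
      finally show ?thesis by simp
    qed
    from residual_unique(2)[OF this residual_differ[OF h uw(1)]]
    show ?thesis by simp
  qed
  then show ?thesis by blast
qed

text \<open>A standard inner word for each class. Class 0 uses the letter n - 1, which is 0 modulo n
  - 1, because the word 00 is not inner.\<close>

definition class_rep :: "nat \<Rightarrow> nat list" where
  "class_rep c = [0, if c = 0 then n - 1 else c]"

lemma class_rep:
  assumes "c < n - 1 \<or> c = 0"
  shows "inner_word n (class_rep c)" "sigma n (class_rep c) = c" "length (class_rep c) = 2"
  using assms n2 by (auto simp: inner_word_iff class_rep_def sigma_def)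

lemma sigma_less: "sigma n u < n - 1 \<or> sigma n u = 0"
  using n2 by (auto simp: sigma_def)

lemma sigma_append: "sigma n (u @ w) = (sigma n u + sum_list w) mod (n - 1)"
  by (simp add: sigma_def mod_add_left_eq)

lemma inner_word_append: "inner_word n u \<Longrightarrow> w \<in> words n \<Longrightarrow> inner_word n (u @ w)"
  by (auto simp: inner_word_iff)

text \<open>The finitely many inner words of bounded length are synchronized by a common \<open>k\<close>. A long inner word
  is shortened one letter at a time: its initial constant block can be cut down to length \<open>r\<close>, and
  a shorter inner word can be replaced by the standard representative of its class.\<close>

lemma uniform_synchronization:
  fixes F :: "nat list \<Rightarrow> 'x"
  assumes cong: "\<And>u v w. u \<in> words n \<Longrightarrow> v \<in> words n \<Longrightarrow> w \<in> words n \<Longrightarrow> F u = F v \<Longrightarrow> F (u @ w) = F (v @ w)"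
    and pairs: "\<And>u v. inner_word n u \<Longrightarrow> inner_word n v \<Longrightarrow> sigma n u = sigma n v \<Longrightarrow>
       \<exists>k. \<forall>w\<in>words n. k \<le> length w \<longrightarrow> F (u @ w) = F (v @ w)"
    and r: "r \<ge> 1" "\<And>m. m \<ge> r \<Longrightarrow> F (replicate m 0) = F (replicate r 0)"
      "\<And>m. m \<ge> r \<Longrightarrow> F (replicate m (n - 1)) = F (replicate r (n - 1))"
  shows "\<exists>k. (\<forall>u w. inner_word n u \<longrightarrow> w \<in> words n \<longrightarrow> k \<le> length w \<longrightarrow> F (u @ w) = F (class_rep (sigma n u) @ w))"
proof -
  \<comment> \<open>The bound covers the words compared below: a constant block of length at most r
    followed by one letter, and a representative of length 2 followed by one letter.\<close>
  define S where "S = {u \<in> words n. length u \<le> r + 3}"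
  have "finite S" unfolding S_def by (rule finite_short_words)
  define Q where "Q = {(u, v). u \<in> S \<and> v \<in> S \<and> inner_word n u \<and> inner_word n v \<and> sigma n u = sigma n v}"
  have "Q \<subseteq> S \<times> S" by (auto simp: Q_def)
  then have finQ: "finite Q" using \<open>finite S\<close> by (meson finite_SigmaI finite_subset)
  have "\<forall>q\<in>Q. \<exists>k. \<forall>w\<in>words n. k \<le> length w \<longrightarrow> F (fst q @ w) = F (snd q @ w)"
    using pairs by (auto simp: Q_def)
  then obtain kk where kk: "\<And>q w. q\<in>Q \<Longrightarrow> w\<in>words n \<Longrightarrow> kk q \<le> length w \<Longrightarrow> F (fst q @ w) = F (snd q @ w)" by metis
  define k where "k = Max (insert 0 (kk ` Q))"
  have short: "F (u @ w) = F (v @ w)"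
    if "inner_word n u" "inner_word n v" "sigma n u = sigma n v" "length u \<le> r + 3" "length v \<le> r + 3" "w \<in> words n" "k \<le> length w" for u v w
  proof -
    have "(u, v) \<in> Q" using that by (auto simp: Q_def S_def inner_word_iff)
    moreover have "kk (u, v) \<le> k" unfolding k_def using finQ calculation by (intro Max_ge) auto
    ultimately show ?thesis using kk[of "(u, v)" w] that by simp
  qed
  have block: "F (u @ w) = F (class_rep (sigma n u) @ w)"
    if c: "c = 0 \<or> c = n - 1" and u: "u = replicate m c @ [i]" "inner_word n u" and w: "w \<in> words n" "k \<le> length w" for c u m i w
  proof -
    have cn: "c < n" using c n2 by auto
    have ic: "i \<noteq> c" "i < n" using u c by (auto simp: inner_word_iff)
    \<comment> \<open>The block is cut down to length at most r. A nonempty block stays nonempty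
      because r is at least 1, so the word stays inner.\<close>
    define m' where "m' = min m r"
    define u' where "u' = replicate m' c @ [i]"
    have "F (replicate m c) = F (replicate m' c)"
      using r(2)[of m] r(3)[of m] c by (cases "m \<le> r") (auto simp: m'_def min_def)
    then have "F (replicate m c @ ([i] @ w)) = F (replicate m' c @ ([i] @ w))"
      using cn ic w by (intro cong) auto
    then have 1: "F (u @ w) = F (u' @ w)" using u by (simp add: u'_def)
    have inner: "inner_word n u'"
    proof (cases "m = 0")
      case False
      then have "m' \<ge> 1" using r(1) by (simp add: m'_def)
      then have "set u' = {c, i}" by (auto simp: u'_def)
      then show ?thesis using c ic cn n2 by (auto simp: inner_word_iff)
    qed (use u in \<open>simp add: u'_def m'_def\<close>)
    have "sigma n u' = i mod (n - 1)" "sigma n u = i mod (n - 1)"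
      using c u by (auto simp: sigma_def u'_def sum_list_replicate)
    then have sg: "sigma n u' = sigma n u" by simp
    have "length u' \<le> r + 3" by (simp add: u'_def m'_def)
    then have "F (u' @ w) = F (class_rep (sigma n u) @ w)"
      using short[OF inner class_rep(1)[OF sigma_less[of u]] _ _ _ w] class_rep(2,3)[OF sigma_less[of u]] sg by simp
    then show ?thesis using 1 by simp
  qed
  have "inner_word n u \<Longrightarrow> \<forall>w\<in>words n. k \<le> length w \<longrightarrow> F (u @ w) = F (class_rep (sigma n u) @ w)" for u
  proof (induction u rule: rev_induct)
    case Nil then show ?case by (simp add: inner_word_def)
  next
    case (snoc i u)
    have ui: "u \<in> words n" "i < n" using snoc.prems by (auto simp: inner_word_iff)
    show ?case
    proof (cases "inner_word n u")
      case True
      let ?c = "class_rep (sigma n u)"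
      note cr = class_rep[OF sigma_less[of u]]
      show ?thesis
      proof (intro ballI impI)
        fix w assume w: "w \<in> words n" "k \<le> length w"
        \<comment> \<open>The last letter is moved into the suffix, so that the induction hypothesis
          applies to u.\<close>
        have "F (u @ ([i] @ w)) = F (?c @ ([i] @ w))" using snoc.IH[OF True] w ui by auto
        then have "F ((u @ [i]) @ w) = F ((?c @ [i]) @ w)" by simp
        also have "\<dots> = F (class_rep (sigma n (u @ [i])) @ w)"
        proof (rule short[OF _ _ _ _ _ w])
          show "inner_word n (?c @ [i])" by (rule inner_word_append[OF cr(1)]) (use ui in simp)
          show "sigma n (?c @ [i]) = sigma n (class_rep (sigma n (u @ [i])))"
            using class_rep(2)[OF sigma_less[of "u @ [i]"]] cr(2) by (simp add: sigma_append)
        qed (use class_rep[OF sigma_less[of "u @ [i]"]] cr(3) in auto)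
        finally show "F ((u @ [i]) @ w) = F (class_rep (sigma n (u @ [i])) @ w)" .
      qed
    next
      case False
      then obtain c where c: "c = 0 \<or> c = n - 1" "\<forall>x\<in>set u. x = c" using ui by (auto simp: inner_word_iff)
      then have "u = replicate (length u) c" by (intro replicate_eqI) auto
      then have "u @ [i] = replicate (length u) c @ [i]" by simp
      then show ?thesis using block[OF c(1) _ snoc.prems] by blast
    qed
  qed
  then show ?thesis by blast
qed

text \<open>F_n contains an element replacing c by cc. So two long powers of c whose lengths differ
  by one have the same residual, and appending further letters c propagates this.\<close>

lemma residual_constant_stable:
  assumes p: "\<psi> \<in> carrier (cantor_normalizer n)" and c: "c = 0 \<or> c = n - 1"
  shows "\<exists>r. \<forall>m\<ge>r. residual \<psi> (replicate m c) = residual \<psi> (replicate r c)"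
proof -
  have N: "\<psi> \<in> K.N" using p cantor_normalizer_sub by blast
  have ph: "\<psi> \<in> carrier (HomeoC n)" using K.N_carrier[OF N] .
  note h = HomeoC_admissible[OF ph]
  have cn: "c < n" using c n2 by auto
  have "\<exists>f\<in>carrier (F_cantor n). replaces f [c] [c, c]"
    by (rule F_cantor_moves) (use c cn n2 in auto)
  then obtain f where f: "f\<in>carrier (F_cantor n)" "replaces f [c] [c, c]" by blast
  have "\<psi> \<otimes>\<^bsub>HomeoC n\<^esub> f \<otimes>\<^bsub>HomeoC n\<^esub> inv\<^bsub>HomeoC n\<^esub> \<psi> \<in> carrier (F_cantor n)"
    using N f(1) unfolding K.N_iff using cantor_action_image by (metis imageE)
  then obtain k where k: "\<forall>w\<in>words n. k \<le> length w \<longrightarrow> residual \<psi> ([c] @ w) = residual \<psi> ([c, c] @ w)"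
    using normalizes_residual[OF ph f] by blast
  have rep: "replicate m c \<in> words n" for m using cn by auto
  have step: "residual \<psi> (replicate (Suc k) c) = residual \<psi> (replicate (Suc (Suc k)) c)"
    using k[rule_format, OF rep[of k]] by simp
  have "residual \<psi> (replicate (Suc k + j) c) = residual \<psi> (replicate (Suc k) c)" for j
  proof (induction j)
    case (Suc j)
    have "residual \<psi> (replicate (Suc k + j) c @ [c]) = residual \<psi> (replicate (Suc k) c @ [c])"
      by (rule residual_cong_append[OF h rep rep _ Suc]) (use cn in simp)
    then show ?case using step by (simp add: replicate_append_same)
  qed simp
  then have "\<forall>m\<ge>Suc k. residual \<psi> (replicate m c) = residual \<psi> (replicate (Suc k) c)"
    by (metis le_add_diff_inverse)
  then show ?thesis ..
qed

text \<open>The stable residuals of the constant words provide the states at the ends, and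
  \<open>uniform_synchronization\<close> the common k. Together they also bound the number of
  states: every residual is that of a word of bounded length.\<close>

lemma cantor_normalizer_synchronizing:
  assumes p: "\<psi> \<in> carrier (cantor_normalizer n)"
  shows "monotone_rational_semi_synchronizing n \<psi>"
proof -
  have N: "\<psi> \<in> K.N" using p cantor_normalizer_sub by blast
  have ph: "\<psi> \<in> carrier (HomeoC n)" using K.N_carrier[OF N] .
  note h = HomeoC_admissible[OF ph]
  let ?T = "residual_transducer \<psi>" and ?F = "residual \<psi>"
  obtain a where a: "a \<in> I.N" "\<psi> = cantor_lift n a" using p cantor_lift_normalizer_image by blast
  have mono: "order_preserving n \<psi> \<or> order_reversing n \<psi>"
    using cantor_lift(4)[OF interval_normalizer_adic[OF a(1)]] a(2) by simp
  obtain r1 where r1: "\<And>m. m\<ge>r1 \<Longrightarrow> ?F (replicate m 0) = ?F (replicate r1 0)" using residual_constant_stable[OF p, of 0] by blast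
  obtain r2 where r2: "\<And>m. m\<ge>r2 \<Longrightarrow> ?F (replicate m (n - 1)) = ?F (replicate r2 (n - 1))" using residual_constant_stable[OF p, of "n - 1"] by blast
  define r where "r = Suc (max r1 r2)"
  have rr: "r \<ge> 1" "\<And>m. m\<ge>r \<Longrightarrow> ?F (replicate m 0) = ?F (replicate r 0)" "\<And>m. m\<ge>r \<Longrightarrow> ?F (replicate m (n - 1)) = ?F (replicate r (n - 1))"
  proof -
    have r: "r1 \<le> r" "r2 \<le> r" by (auto simp: r_def)
    show "?F (replicate m 0) = ?F (replicate r 0)" if "m\<ge>r" for m using r1[of m] r1[of r] r that by simp
    show "?F (replicate m (n - 1)) = ?F (replicate r (n - 1))" if "m\<ge>r" for m using r2[of m] r2[of r] r that by simp
  qed (simp add: r_def)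
  have pairs: "\<exists>k. \<forall>w\<in>words n. k \<le> length w \<longrightarrow> ?F (u @ w) = ?F (v @ w)"
    if uv: "inner_word n u" "inner_word n v" "sigma n u = sigma n v" for u v
  proof -
    have "\<exists>f\<in>carrier (F_cantor n). replaces f u v"
      using uv inner_word_sum[OF uv(1)] inner_word_sum[OF uv(2)] sigma_eq_iff[of u v] 
      by (intro F_cantor_moves) (auto simp: inner_word_iff)
    then obtain f where f: "f\<in>carrier (F_cantor n)" "replaces f u v" by blast
    have "\<psi> \<otimes>\<^bsub>HomeoC n\<^esub> f \<otimes>\<^bsub>HomeoC n\<^esub> inv\<^bsub>HomeoC n\<^esub> \<psi> \<in> carrier (F_cantor n)"
      using N f(1) unfolding K.N_iff using cantor_action_image by (metis imageE)
    then show ?thesis by (rule normalizes_residual[OF ph f])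
  qed
  obtain k where k: "\<And>u w. inner_word n u \<Longrightarrow> w \<in> words n \<Longrightarrow> k \<le> length w \<Longrightarrow> ?F (u @ w) = ?F (class_rep (sigma n u) @ w)"
    using uniform_synchronization[of ?F r, OF residual_cong_append[OF h] pairs rr] by blast
  have tw: "trans_word ?T (start ?T) u = residual_state \<psi> u" if "u \<in> words n" for u
    using residual_trans_word[OF h, of "[]" u] that by (simp add: residual_transducer_def)
  have repw: "replicate m c \<in> words n" if "c = 0 \<or> c = n - 1" for m c using that n2 by auto
  have ends: "\<exists>s\<in>states ?T. step ?T s c = s \<and> (\<exists>r. trans_word ?T (start ?T) (replicate r c) = s)"
    if c: "c = 0 \<or> c = n - 1" for c
  proof (intro bexI[of _ "residual_state \<psi> (replicate r c)"] conjI exI[of _ r])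
    have cn: "c < n" using c n2 by auto
    have "step ?T (residual_state \<psi> (replicate r c)) c = residual_state \<psi> (replicate (Suc r) c)"
      using residual_step[OF h repw[OF c] cn] by (simp add: replicate_append_same)
    also have "\<dots> = residual_state \<psi> (replicate r c)"
    proof -
      have "?F (replicate (Suc r) c) = ?F (replicate r c)"
        using rr(2)[of "Suc r"] rr(3)[of "Suc r"] c by (metis le_SucI order_refl)
      then show ?thesis using residual_state_eq_iff[OF repw[OF c] repw[OF c]] by blast
    qed
    finally show "step ?T (residual_state \<psi> (replicate r c)) c = residual_state \<psi> (replicate r c)" .
    show "trans_word ?T (start ?T) (replicate r c) = residual_state \<psi> (replicate r c)" by (rule tw[OF repw[OF c]])
    show "residual_state \<psi> (replicate r c) \<in> states ?T" using repw[OF c] by (auto simp: residual_transducer_def)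
  qed
  have sync: "trans_word ?T (start ?T) (u @ w) = trans_word ?T (start ?T) (v @ w)"
    if uv: "inner_word n u" "inner_word n v" "sigma n u = sigma n v" and w: "w \<in> words n" "length w = k" for u v w
  proof -
    have "u @ w \<in> words n" "v @ w \<in> words n" using uv w by (auto simp: inner_word_iff)
    then show ?thesis using tw residual_state_eq_iff k[OF uv(1) w(1)] k[OF uv(2) w(1)] w(2) uv(3) by simp
  qed
  have semi: "semi_synchronizing n ?T"
    unfolding semi_synchronizing_def using ends[of 0] ends[of "n - 1"] sync by blast
  \<comment> \<open>Words of length at most k + r represent themselves. In a longer word the part
    before the last k letters is replaced by a representative of length 2 or by a constant block of
    length r.\<close>
  define S where "S = {u \<in> words n. length u \<le> k + r + 2}"
  have "finite S" unfolding S_def by (rule finite_short_words)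
  have short: "\<exists>u'\<in>S. ?F u = ?F u'" if u: "u \<in> words n" for u
  proof (cases "length u \<le> k + r")
    case True
    then show ?thesis using u by (intro bexI[of _ u]) (auto simp: S_def)
  next
    case False
    let ?x = "take (length u - k) u" and ?w = "drop (length u - k) u"
    have xw: "?x \<in> words n" "?w \<in> words n" "length ?w = k" "length ?x \<ge> r"
      using u False by (auto dest: in_set_takeD in_set_dropD)
    show ?thesis
    proof (cases "inner_word n ?x")
      case True
      note cr = class_rep[OF sigma_less[of ?x]]
      have "?F u = ?F (class_rep (sigma n ?x) @ ?w)" using k[OF True xw(2)] xw(3) by simp
      moreover have "class_rep (sigma n ?x) @ ?w \<in> S" using cr xw by (auto simp: S_def inner_word_iff)
      ultimately show ?thesis by blast
    next
      case False
      then obtain c where c: "c = 0 \<or> c = n - 1" "\<forall>x\<in>set ?x. x = c" using xw(1) by (auto simp: inner_word_iff)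
      then have e: "?x = replicate (length ?x) c" by (intro replicate_eqI) auto
      have "?F ?x = ?F (replicate r c)" using rr(2,3)[OF xw(4)] c(1) e by metis
      then have "?F (?x @ ?w) = ?F (replicate r c @ ?w)" by (rule residual_cong_append[OF h xw(1) repw[OF c(1)] xw(2)])
      moreover have "replicate r c @ ?w \<in> S" using repw[OF c(1), of r] xw by (auto simp: S_def)
      ultimately show ?thesis by (metis append_take_drop_id)
    qed
  qed
  have "states ?T \<subseteq> residual_state \<psi> ` S"
  proof
    fix s assume "s \<in> states ?T"
    then obtain u where u: "u \<in> words n" "s = residual_state \<psi> u" by (auto simp: residual_transducer_def)
    obtain u' where u': "u' \<in> S" "?F u = ?F u'" using short[OF u(1)] by blast
    then have "s = residual_state \<psi> u'" using residual_state_eq_iff[OF u(1)] u(2) by (simp add: S_def)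
    then show "s \<in> residual_state \<psi> ` S" using u'(1) by blast
  qed
  then have "finite (states ?T)" using \<open>finite S\<close> finite_subset by blast
  moreover have min: "minimal_transducer n n \<psi> ?T" by (rule residual_minimal[OF ph])
  ultimately have "rational n n \<psi>" unfolding rational_def minimal_transducer_def by blast
  moreover have "minimal_semi_synchronizing n \<psi>" unfolding minimal_semi_synchronizing_def using min semi by blast
  ultimately show ?thesis using mono by (simp add: monotone_rational_semi_synchronizing_def)
qed

section \<open>From synchronizing maps back to the normalizer\<close>

lemma prefix_inner:
  assumes w: "\<omega> \<in> cantor n" and ne: "\<omega> \<noteq> (\<lambda>_. 0)" "\<omega> \<noteq> (\<lambda>_. n - 1)"
  shows "\<exists>M. \<forall>m\<ge>M. inner_word n (prefix m \<omega>)"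
proof -
  obtain i j where ij: "\<omega> i \<noteq> 0" "\<omega> j \<noteq> n - 1" using ne by blast
  have "inner_word n (prefix m \<omega>)" if "m \<ge> Suc (max i j)" for m
  proof -
    have "\<omega> i \<in> set (prefix m \<omega>)" "\<omega> j \<in> set (prefix m \<omega>)" using that by auto
    then show ?thesis unfolding inner_word_iff using ij prefix_in_words[OF w] by blast
  qed
  then show ?thesis by blast
qed

text \<open>Every point q has a prefix u that f replaces by some v such that the transducer reaches
  the same state after u and after v. Then \<psi>(u\<eta>) = x h(\<eta>) and \<psi>(v\<eta>) = y
  h(\<eta>) with the same h, so the conjugate exchanges x for y near \<psi>(q).\<close>

lemma synchronizing_conjugate:
  assumes p: "\<psi> \<in> carrier (HomeoC n)" and s: "monotone_rational_semi_synchronizing n \<psi>" and f: "f \<in> carrier (F_cantor n)"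
  shows "\<psi> \<otimes>\<^bsub>HomeoC n\<^esub> f \<otimes>\<^bsub>HomeoC n\<^esub> inv\<^bsub>HomeoC n\<^esub> \<psi> \<in> carrier (F_cantor n)"
proof -
  let ?g = "\<psi> \<otimes>\<^bsub>HomeoC n\<^esub> f \<otimes>\<^bsub>HomeoC n\<^esub> inv\<^bsub>HomeoC n\<^esub> \<psi>" and ?i = "inv\<^bsub>HomeoC n\<^esub> \<psi>"
  have fc: "f \<in> carrier (HomeoC n)" "order_preserving n f" "locally_replacing f" using f by (auto simp: F_cantor_carrier)
  have ip: "?i \<in> carrier (HomeoC n)" using homeo_inv_closed[OF p] .
  have pf: "\<psi> \<otimes>\<^bsub>HomeoC n\<^esub> f \<in> carrier (HomeoC n)" by (rule homeo_mult_closed[OF p fc(1)])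
  have gc: "?g \<in> carrier (HomeoC n)" by (rule homeo_mult_closed[OF pf ip])
  have ga: "?g \<omega> = \<psi> (f (?i \<omega>))" if "\<omega> \<in> cantor n" for \<omega>
    using homeo_mult_apply[OF pf ip that] homeo_mult_apply[OF p fc(1) homeo_closed[OF ip that]] by simp
  have bp: "bij_betw \<psi> (cantor n) (cantor n)" using p by (simp add: homeo_group_carrier_iff)
  have bf: "bij_betw f (cantor n) (cantor n)" using fc by (simp add: homeo_group_carrier_iff)
  have ii: "?i \<omega> = inv_into (cantor n) \<psi> \<omega>" if "\<omega> \<in> cantor n" for \<omega> using that by (simp add: homeo_inv[OF p])
  have mono: "order_preserving n \<psi> \<or> order_reversing n \<psi>" using s by (simp add: monotone_rational_semi_synchronizing_def)
  have op: "order_preserving n ?g"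
    using mono
  proof
    assume o: "order_preserving n \<psi>"
    then have "order_preserving n ?i" using monotone_inv(1)[OF bp o] ii by (auto simp: order_preserving_def monotone_on_def)
    then show ?thesis using o fc(2) homeo_closed[OF ip] homeo_closed[OF fc(1)]
      unfolding order_preserving_def monotone_on_def by (auto simp: ga)
  next
    assume o: "order_reversing n \<psi>"
    then have "order_reversing n ?i" using monotone_inv(2)[OF bp o] ii by (auto simp: order_reversing_def monotone_on_def)
    then show ?thesis using o fc(2) homeo_closed[OF ip] homeo_closed[OF fc(1)]
      unfolding order_preserving_def order_reversing_def monotone_on_def by (auto simp: ga)
  qed
  obtain T :: "nat transducer" where T: "minimal_transducer n n \<psi> T" "semi_synchronizing n T"
    using s by (auto simp: monotone_rational_semi_synchronizing_def minimal_semi_synchronizing_def)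
  have Tt: "is_transducer n n T" and Ti: "\<And>\<omega>. \<omega>\<in>cantor n \<Longrightarrow> induced T (start T) \<omega> = \<psi> \<omega>"
    using T(1) by (auto simp: minimal_transducer_def represents_def)
  have st: "start T \<in> states T" using Tt by (simp add: is_transducer_def)
  let ?t = "trans_word T (start T)"
  have ends: "\<exists>r. \<forall>m\<ge>r. ?t (replicate m c) = ?t (replicate r c)" if c: "c = 0 \<or> c = n - 1" for c
  proof -
    obtain s r where sr: "step T s c = s" "?t (replicate r c) = s" using T(2) c unfolding semi_synchronizing_def by blast
    have "?t (replicate (r + j) c) = s" for j
    proof (induction j)
      case (Suc j)
      have "replicate (r + Suc j) c = replicate (r + j) c @ [c]" by (simp add: replicate_append_same)
      then show ?case using Suc sr(1) by (simp only: trans_word_append) (simp add: trans_word_Cons)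
    qed (simp add: sr)
    then have "\<forall>m\<ge>r. ?t (replicate m c) = ?t (replicate r c)" using sr(2) by (metis le_add_diff_inverse)
    then show ?thesis ..
  qed
  obtain k where k: "\<And>u v w. inner_word n u \<Longrightarrow> inner_word n v \<Longrightarrow> sigma n u = sigma n v \<Longrightarrow> w\<in>words n \<Longrightarrow> length w = k \<Longrightarrow> ?t (u @ w) = ?t (v @ w)"
    using T(2) unfolding semi_synchronizing_def by blast
  have find: "\<exists>m v. replaces f (prefix m q) v \<and> ?t (prefix m q) = ?t v" if q: "q \<in> cantor n" for q
  proof -
    obtain k0 v0 where k0: "replaces f (prefix k0 q) v0" using fc(3) q unfolding locally_replacing_def by blast
    have fq: "f q = v0 \<frown> suffix k0 q"
    proof -
      have "f (prefix k0 q \<frown> suffix k0 q) = v0 \<frown> suffix k0 q"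
        using k0 suffix_in_cantor[OF q] unfolding replaces_def by blast
      then show ?thesis by simp
    qed
    have fqc: "f q \<in> cantor n" using homeo_closed[OF fc(1) q] .
    have ext: "replaces f (prefix (k0 + m) q) (prefix (length v0 + m) (f q))" for m
    proof -
      have "replaces f (prefix k0 q @ prefix m (suffix k0 q)) (v0 @ prefix m (suffix k0 q))"
        by (rule replaces_append[OF k0 prefix_in_words[OF suffix_in_cantor[OF q]]])
      moreover have "prefix k0 q @ prefix m (suffix k0 q) = prefix (k0 + m) q" using subsequence_append[of q k0 m] by simp
      moreover have "v0 @ prefix m (suffix k0 q) = prefix (length v0 + m) (f q)" unfolding fq by simp
      ultimately show ?thesis by metis
    qed
    \<comment> \<open>The constant words 00... and (n-1)(n-1)... have no inner prefixes. They are
      fixed by f, and the state reached along them is eventually constant, so prefixes of different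
      lengths lead to the same state.\<close>
    have const: ?thesis if c: "c = 0 \<or> c = n - 1" and qc: "q = (\<lambda>_. c)" and fqc: "f q = q" for c
    proof -
      obtain r where r: "\<And>m. m\<ge>r \<Longrightarrow> ?t (replicate m c) = ?t (replicate r c)" using ends[OF c] by blast
      have pc: "prefix m q = replicate m c" for m unfolding qc subsequence_def by (simp add: map_replicate_const)
      have "?t (prefix (k0 + r) q) = ?t (prefix (length v0 + r) (f q))"
        unfolding fqc pc using r[of "k0 + r"] r[of "length v0 + r"] by simp
      then show ?thesis using ext by blast
    qed
    note E = order_preserving_ends[OF bf fc(2)]
    consider "q = (\<lambda>_. 0)" | "q = (\<lambda>_. n - 1)" | "q \<noteq> (\<lambda>_. 0)" "q \<noteq> (\<lambda>_. n - 1)" by blast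
    then show ?thesis
    proof cases
      case 1 then show ?thesis using const[of 0] E by simp
    next
      case 2 then show ?thesis using const[of "n - 1"] E by simp
    next
      case 3
      have inj: "inj_on f (cantor n)" using bf by (simp add: bij_betw_def)
      have "f q \<noteq> (\<lambda>_. 0)" "f q \<noteq> (\<lambda>_. n - 1)"
        using 3 E inj_onD[OF inj _ q zeros_cantor] inj_onD[OF inj _ q tops_cantor] by auto
      then obtain M2 where M2: "\<And>m. m\<ge>M2 \<Longrightarrow> inner_word n (prefix m (f q))" using prefix_inner[OF fqc] by blast
      obtain M1 where M1: "\<And>m. m\<ge>M1 \<Longrightarrow> inner_word n (prefix m q)" using prefix_inner[OF q 3] by blast
      define m where "m = max M1 M2"
      let ?u = "prefix (k0 + m) q" and ?v = "prefix (length v0 + m) (f q)"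
      have inn: "inner_word n ?u" "inner_word n ?v" using M1[of "k0 + m"] M2[of "length v0 + m"] by (auto simp: m_def)
      \<comment> \<open>Elements of F_n preserve digit sums modulo n - 1, so both prefixes are in
        the same class, and k further letters synchronize them.\<close>
      have "sigma n ?u = sigma n ?v" unfolding sigma_eq_iff by (rule F_cantor_sum_list[OF f ext])
      then have te: "?t (?u @ w) = ?t (?v @ w)" if "w \<in> words n" "length w = k" for w using k[OF inn _ that] by blast
      let ?w = "prefix k (suffix (k0 + m) q)"
      have w: "?w \<in> words n" "length ?w = k" by (rule prefix_in_words[OF suffix_in_cantor[OF q]]) simp
      have "?u @ ?w = prefix (k0 + m + k) q" using subsequence_append[of q "k0 + m" k] by simp
      moreover have "replaces f (?u @ ?w) (?v @ ?w)" by (rule replaces_append[OF ext w(1)])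
      ultimately show ?thesis using te[OF w] by metis
    qed
  qed
  have "locally_replacing ?g"
    unfolding locally_replacing_def
  proof
    fix \<omega> assume w: "\<omega> \<in> cantor n"
    let ?q = "?i \<omega>"
    have q: "?q \<in> cantor n" using homeo_closed[OF ip w] .
    obtain m v where mv: "replaces f (prefix m ?q) v" "?t (prefix m ?q) = ?t v" using find[OF q] by blast
    let ?u = "prefix m ?q" let ?x = "out_word T (start T) ?u" and ?y = "out_word T (start T) v" and ?h = "induced T (?t v)"
    have uv: "?u \<in> words n" "v \<in> words n" using mv(1) by (auto simp: replaces_def)
    have pu: "\<psi> (?u \<frown> \<eta>) = ?x \<frown> ?h \<eta>" and pv: "\<psi> (v \<frown> \<eta>) = ?y \<frown> ?h \<eta>" if "\<eta> \<in> cantor n" for \<eta>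
      using induced_conc[OF Tt st uv(1) that] induced_conc[OF Tt st uv(2) that] Ti[of "?u \<frown> \<eta>"] Ti[of "v \<frown> \<eta>"] uv that mv(2) by auto
    have wx: "\<omega> = ?x \<frown> ?h (suffix m ?q)"
    proof -
      have "\<psi> (?u \<frown> suffix m ?q) = ?x \<frown> ?h (suffix m ?q)" by (rule pu[OF suffix_in_cantor[OF q]])
      then show ?thesis using homeo_inv_apply(1)[OF p w] by simp
    qed
    have ci: "continuous_on (cantor n) ?i" using ip by (simp add: homeo_group_carrier_iff)
    \<comment> \<open>The image of \<open>?h\<close> need not be everything, so the conjugate is not
      yet known on the whole cylinder of \<open>?x\<close>. Continuity of the inverse gives an
      extension of \<open>?x\<close> whose cylinder comes from inputs with prefix
      \<open>?u\<close>.\<close>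
    obtain l where l: "\<forall>\<zeta>\<in>cantor n. prefix l \<zeta> = prefix l \<omega> \<longrightarrow> prefix m (?i \<zeta>) = ?u"
      using continuous_prefix[OF ci w, of m] by blast
    define z where "z = prefix l (suffix (length ?x) \<omega>)"
    have "prefix (length ?x) \<omega> = ?x" using wx by (metis prefix_conc_length)
    then have xz: "prefix (length ?x + l) \<omega> = ?x @ z" using subsequence_append[of \<omega> "length ?x" l] by (simp add: z_def)
    have zw: "z \<in> words n" unfolding z_def by (rule prefix_in_words[OF suffix_in_cantor[OF w]])
    have xw: "?x \<in> words n" "?y \<in> words n" using out_word_words[OF Tt st] uv by auto
    have "replaces ?g (?x @ z) (?y @ z)"
      unfolding replaces_def
    proof (intro conjI ballI)
      fix \<xi> assume xi: "\<xi> \<in> cantor n"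
      let ?z = "(?x @ z) \<frown> \<xi>"
      have zc: "?z \<in> cantor n" using xw zw xi by simp
      have "prefix l ?z = prefix l \<omega>"
      proof -
        have "prefix l ?z = take l (?x @ z)" by (rule prefix_conc_fst) (simp add: z_def)
        also have "\<dots> = take l (prefix (length ?x + l) \<omega>)" by (simp only: xz)
        also have "\<dots> = prefix l \<omega>" by simp
        finally show ?thesis .
      qed
      then have "prefix m (?i ?z) = ?u" using l zc by blast
      then have iz: "?i ?z = ?u \<frown> suffix m (?i ?z)" using prefix_suffix[of "?i ?z" m] by simp
      let ?e = "suffix m (?i ?z)"
      have e: "?e \<in> cantor n" by (rule suffix_in_cantor[OF homeo_closed[OF ip zc]])
      have "?z = \<psi> (?u \<frown> ?e)" using homeo_inv_apply(1)[OF p zc] iz by simp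
      also have "\<dots> = ?x \<frown> ?h ?e" by (rule pu[OF e])
      finally have "?x \<frown> (z \<frown> \<xi>) = ?x \<frown> ?h ?e" by simp
      then have he: "?h ?e = z \<frown> \<xi>" by (metis same_concat_eq)
      have "?g ?z = \<psi> (f (?u \<frown> ?e))" using ga[OF zc] iz by simp
      also have "f (?u \<frown> ?e) = v \<frown> ?e" using mv(1) e unfolding replaces_def by blast
      also have "\<psi> \<dots> = ?y \<frown> (z \<frown> \<xi>)" using pv[OF e] he by simp
      finally show "?g ?z = (?y @ z) \<frown> \<xi>" by simp
    qed (use xw zw in auto)
    then show "\<exists>k v. replaces ?g (prefix k \<omega>) v" using xz by metis
  qed
  then show ?thesis using gc op by (simp add: F_cantor_carrier)
qed

lemma cantor_normalizer_inv:
  assumes "\<psi> \<in> carrier (cantor_normalizer n)" shows "inv\<^bsub>HomeoC n\<^esub> \<psi> \<in> carrier (cantor_normalizer n)"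
proof -
  obtain a where a: "a \<in> I.N" "\<psi> = cantor_lift n a" using assms cantor_lift_normalizer_image by blast
  have "inv\<^bsub>HomeoC n\<^esub> \<psi> = cantor_lift n (inv\<^bsub>Homeo01\<^esub> a)" using cantor_lift_inv[OF interval_normalizer_adic[OF a(1)]] a(2) by simp
  then show ?thesis using subgroup.m_inv_closed[OF I.subgroup_N a(1)] cantor_lift_normalizer_image by blast
qed

text \<open>\<open>synchronizing_conjugate\<close>, applied to \<psi> and to its inverse, gives the
  two inclusions that make up normalization, while monotonicity takes care of the relation. In the
  other direction the inverse is covered because it lies in the normalizer again.\<close>

lemma cantor_normalizer_characterization:
  "carrier (cantor_normalizer n) =
       {\<psi> \<in> carrier (HomeoC n).
          monotone_rational_semi_synchronizing n \<psi> \<and>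
          monotone_rational_semi_synchronizing n (inv\<^bsub>HomeoC n\<^esub> \<psi>)}"
proof (intro equalityI subsetI)
  fix \<psi> assume p: "\<psi> \<in> carrier (cantor_normalizer n)"
  then have "\<psi> \<in> carrier (HomeoC n)" using cantor_normalizer_sub K.N_carrier by blast
  then show "\<psi> \<in> {\<psi> \<in> carrier (HomeoC n). monotone_rational_semi_synchronizing n \<psi> \<and>
          monotone_rational_semi_synchronizing n (inv\<^bsub>HomeoC n\<^esub> \<psi>)}"
    using cantor_normalizer_synchronizing p cantor_normalizer_inv by simp
next
  fix \<psi> assume "\<psi> \<in> {\<psi> \<in> carrier (HomeoC n). monotone_rational_semi_synchronizing n \<psi> \<and>
          monotone_rational_semi_synchronizing n (inv\<^bsub>HomeoC n\<^esub> \<psi>)}"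
  then have p: "\<psi> \<in> carrier (HomeoC n)" and s: "monotone_rational_semi_synchronizing n \<psi>"
    "monotone_rational_semi_synchronizing n (inv\<^bsub>HomeoC n\<^esub> \<psi>)" by auto

  have "inv\<^bsub>HomeoC n\<^esub> \<psi> \<otimes>\<^bsub>HomeoC n\<^esub> f \<otimes>\<^bsub>HomeoC n\<^esub> \<psi> \<in> carrier (F_cantor n)" if "f \<in> carrier (F_cantor n)" for f
    using synchronizing_conjugate[OF homeo_inv_closed[OF p] s(2) that] group.inv_inv[OF group_homeo_group p] by simp
  then have "\<psi> \<in> normalizer (HomeoC n) (carrier (F_cantor n))"
    using group.normalizer_iff[OF group_homeo_group subgroup.subset[OF subgroup_F_cantor]] p synchronizing_conjugate[OF p s(1)] by blast
  moreover have "preserves_rho_relation n \<psi>"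
    using p s(1) by (intro monotone_preserves_rho) (auto simp: homeo_group_carrier_iff monotone_rational_semi_synchronizing_def)
  ultimately show "\<psi> \<in> carrier (cantor_normalizer n)" by (simp add: cantor_normalizer_def)
qed

end

theorem corollary4p12:
  fixes n :: nat
  assumes "n \<ge> 2"
  shows
    "conj_aut (thompson_F n) Homeo01 interval_action
       \<in> iso (interval_normalizer n) (AutoGroup (thompson_F n)) \<and>
     cantor_action n \<in> iso (thompson_F n) (F_cantor n) \<and>
     cantor_lift n \<in> iso (interval_normalizer n) (cantor_normalizer n) \<and>
     conj_aut (thompson_F n) (HomeoC n) (cantor_action n)
       \<in> iso (cantor_normalizer n) (AutoGroup (thompson_F n)) \<and>
     (\<forall>a\<in>carrier (interval_normalizer n).
        conj_aut (thompson_F n) (HomeoC n) (cantor_action n) (cantor_lift n a) =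
        conj_aut (thompson_F n) Homeo01 interval_action a) \<and>
     carrier (cantor_normalizer n) =
       {\<psi> \<in> carrier (HomeoC n).
          monotone_rational_semi_synchronizing n \<psi> \<and>
          monotone_rational_semi_synchronizing n (inv\<^bsub>HomeoC n\<^esub> \<psi>)}"
proof -
  interpret base_n n by unfold_locales (rule assms)
  show ?thesis
    using interval_normalizer_iso cantor_action_iso cantor_lift_iso cantor_normalizer_iso
      conj_aut_cantor_lift cantor_normalizer_characterization
    by (simp add: interval_normalizer_def)
qed

end
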